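(* Let $d\ge1$, $\delta>1$ and $1/\delta<1/\gamma-1<\infty$, and set $$\beta_0:=\frac{1}{2^{d\delta+3}+1}\cdot\frac{\delta-1}{\omega_d\,\delta}\Big(1-\gamma\,\frac{\delta+1}{\delta}\Big)>0,$$ where $\omega_d$ is the volume of the $d$-dimensional Euclidean unit ball. Then, for all $\beta<\beta_0$, there exist constants $c_1,C_2,c_3,C_4,c_5,C_6\in(0,\infty)$, depending on $\beta$, $\gamma$ and $\delta$, such that for all $m>1$ the following holds for the $d$-th power $\mathscr{D}_\beta^d$ of the Euclidean diameter of the component of the origin in the soft Boolean model. (i) If $\delta<1/\gamma-1$, then $$c_1m^{1-\delta}\le\mathbb{P}_o(\mathscr{D}_\beta^d>m)\le C_2m^{1-\delta}.$$ (ii) If $\delta=1/\gamma-1$, then $$c_3m^{1-\delta}\le\mathbb{P}_o(\mathscr{D}_\beta^d>m)\le C_4\log(m)\,m^{1-\delta}.$$ (iii) If $1/\delta<1/\gamma-1<\delta$, then $$c_5\,m^{-\frac{\delta-1}{\delta}(\frac1\gamma-1)}\le\mathbb{P}_o(\mathscr{D}_\beta^d>m)\le C_6\,\log(m)^{1\vee d(\delta-1)}\,m^{-\frac{\delta-1}{\delta}(\frac1\gamma-1)}.$$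
   Context: Soft Boolean model with parameters $\beta>0$, $\gamma\in(0,1)$, $\delta>1$ in $\mathbb{R}^d$: the vertex locations form a unit-intensity Poisson point process $X$ on $\mathbb{R}^d$. Each location $x\in X$ carries an independent mark $u_x$, uniform on $(0,1)$; a vertex is a pair $\boldsymbol{x}=(x,u_x)$. Each unordered pair of distinct vertices $\{\boldsymbol{x},\boldsymbol{y}\}$ carries an independent edge mark $V_{\boldsymbol{x},\boldsymbol{y}}$, uniform on $(0,1)$, independent of everything else. With $\rho(t)=1\wedge t^{-\delta}$, the pair is joined by an edge if and only if $$V_{\boldsymbol{x},\boldsymbol{y}}\le\rho\big(\beta^{-1}(u_x\wedge u_y)^\gamma|x-y|^d\big),$$ where $|\cdot|$ is the Euclidean norm. (Equivalently: independent radii $R_x$ with $\mathbb{P}(R_x>r)=1\wedge r^{-d/\gamma}$, independent edge weights $W(x,y)$ with $\mathbb{P}(W(x,y)>w)=1\wedge w^{-d\delta}$, and an edge iff $|x-y|\le\beta^{1/d}W(x,y)(R_x\vee R_y)$.) $\mathbb{P}_o$ denotes the law of the model after adding a vertex $\mathbf{o}=(o,U_o)$ at the origin, with independent uniform mark $U_o$ and independent uniform edge marks to all other vertices, connected by the same rule. Let $\mathscr{C}_\beta$ be the set of vertices connected to $\mathbf{o}$ by a finite path; its Euclidean diameter is $\mathscr{D}_\beta:=\sup\{|x|:\boldsymbol{x}\in\mathscr{C}_\beta\}$ (equal to $0$ if $\mathbf{o}$ is isolated).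
   Formalization: The upper bounds in (ii) and (iii) are claimed for all m ≥ m₀, for any fixed m₀ > 1 with constants that may depend on m₀, instead of all m > 1: as m → 1 the factor log(m) tends to 0 while the probability stays bounded below, so the printed bounds fail. *)

theory Defs
  imports "HOL-Probability.Probability"
begin

section \<open>Poisson point process\<close>

text \<open>
  A point process is given by the law of a sequence \<open>x\<close> enumerating its points. Only the
  unordered collection of points matters, and no particular enumeration is singled out.
  The total intensity is infinite, so there are almost surely infinitely many points.
\<close>

definition point_count :: "'a set \<Rightarrow> (nat \<Rightarrow> 'a) \<Rightarrow> ennreal" where
  "point_count B x = emeasure (count_space UNIV) {i. x i \<in> B}"

locale unit_poisson_process = prob_space N
  for N :: "(nat \<Rightarrow> 'a::euclidean_space) measure" +
  assumes sets_N: "sets N = sets (PiM UNIV (\<lambda>_. borel))"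
  and poisson: "\<And>B k. B \<in> sets borel \<Longrightarrow> emeasure lborel B < \<infinity> \<Longrightarrow>
    prob {x \<in> space N. point_count B x = of_nat k} =
      measure lborel B ^ k / fact k * exp (- measure lborel B)"
  and independent: "\<And>B :: nat \<Rightarrow> 'a set. range B \<subseteq> sets borel \<Longrightarrow> disjoint_family B \<Longrightarrow>
    indep_vars (\<lambda>_. borel) (\<lambda>n. point_count (B n)) UNIV"


section \<open>Soft Boolean model with a vertex added at the origin\<close>

text \<open>
  A configuration \<open>(x, u, v)\<close> consists of the Poisson points \<open>x\<close>, the vertex marks \<open>u\<close> and the
  edge marks \<open>v\<close>. Vertices are named by natural numbers: \<open>0\<close> is the added vertex at the origin,
  \<open>Suc i\<close> is the vertex at \<open>x i\<close>. Edge marks are indexed by unordered pairs, i.e. by two-element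
  sets of vertex names.
\<close>

type_synonym 'a config = "(nat \<Rightarrow> 'a) \<times> (nat \<Rightarrow> real) \<times> (nat set \<Rightarrow> real)"

definition uniform01 :: "real measure" where
  "uniform01 = uniform_measure lborel {0<..<1}"

definition palm_law :: "(nat \<Rightarrow> 'a::euclidean_space) measure \<Rightarrow> 'a config measure" where
  "palm_law N = N \<Otimes>\<^sub>M (PiM UNIV (\<lambda>_. uniform01) \<Otimes>\<^sub>M PiM {e. card e = 2} (\<lambda>_. uniform01))"

text \<open>
  The case distinction accounts for \<open>0 powr (- \<delta>) = 0\<close> in HOL, where the intended value
  is \<open>\<infinity>\<close>, so that the profile function equals 1 at 0.
\<close>

definition rho :: "real \<Rightarrow> real \<Rightarrow> real" where
  "rho \<delta> t = (if t = 0 then 1 else min 1 (t powr (- \<delta>)))"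

fun location :: "(nat \<Rightarrow> 'a::euclidean_space) \<Rightarrow> nat \<Rightarrow> 'a" where
  "location x 0 = 0"
| "location x (Suc i) = x i"

fun adjacent :: "real \<Rightarrow> real \<Rightarrow> real \<Rightarrow> 'a::euclidean_space config \<Rightarrow> nat \<Rightarrow> nat \<Rightarrow> bool" where
  "adjacent \<beta> \<gamma> \<delta> (x, u, v) i j \<longleftrightarrow> i \<noteq> j \<and>
     v {i, j} \<le> rho \<delta> (inverse \<beta> * min (u i) (u j) powr \<gamma>
                        * norm (location x i - location x j) ^ DIM('a))"

definition cluster :: "real \<Rightarrow> real \<Rightarrow> real \<Rightarrow> 'a::euclidean_space config \<Rightarrow> nat set" where
  "cluster \<beta> \<gamma> \<delta> \<omega> = {j. (adjacent \<beta> \<gamma> \<delta> \<omega>)\<^sup>*\<^sup>* 0 j}"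

definition diameter_o :: "real \<Rightarrow> real \<Rightarrow> real \<Rightarrow> 'a::euclidean_space config \<Rightarrow> ennreal" where
  "diameter_o \<beta> \<gamma> \<delta> \<omega> = (SUP j \<in> cluster \<beta> \<gamma> \<delta> \<omega>. ennreal (norm (location (fst \<omega>) j)))"

definition diameter_tail ::
    "(nat \<Rightarrow> 'a::euclidean_space) measure \<Rightarrow> real \<Rightarrow> real \<Rightarrow> real \<Rightarrow> real \<Rightarrow> real" where
  "diameter_tail N \<beta> \<gamma> \<delta> m =
     measure (palm_law N)
       {\<omega> \<in> space (palm_law N). diameter_o \<beta> \<gamma> \<delta> \<omega> ^ DIM('a) > ennreal m}"

definition beta0 :: "'a::euclidean_space itself \<Rightarrow> real \<Rightarrow> real \<Rightarrow> real" where
  "beta0 _ \<gamma> \<delta> =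
     1 / (2 powr (real DIM('a) * \<delta> + 3) + 1)
     * ((\<delta> - 1) / (measure lborel (ball (0::'a) 1) * \<delta>))
     * (1 - \<gamma> * ((\<delta> + 1) / \<delta>))"

end

theory Submission
  imports Defs "HOL-Real_Asymp.Real_Asymp"
begin

text \<open>
  Upper bounds. Join two vertices outright when \<open>soft\<close>, in which both marks enter, is at most 1. This
  only enlarges the graph, and in a shortest path of the enlarged graph vertices that are not
  consecutive have \<open>soft > 1\<close>. Factorial moments of the Poisson process turn expected numbers of such
  paths into integrals. Cutting a path at its vertex of smallest mark, recursively, bounds these
  integrals by Catalan-type sequences, whose ratio of growth is below 1 when \<open>\<beta> < \<beta>\<^sub>0\<close>. If the
  component reaches far, then either a shortest path meets a mark below \<open>u\<^sub>* = m powr -((\<delta> - 1) / (\<gamma>\<delta>))\<close>,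
  or a path all of whose marks exceed \<open>u\<^sub>*\<close> makes a jump that is long compared to \<open>m\<close>.

  Lower bounds. The region \<open>2m \<le> |x|^d < 3m\<close> contains at least of order \<open>m\<close> points with probability
  bounded below. Either one of them is joined to the origin directly, at cost \<open>m powr (1 - \<delta>)\<close>, or the
  origin has a neighbour of mark at most \<open>u\<^sub>*\<close>, at cost \<open>u\<^sub>* powr (1 - \<gamma>)\<close>, and that neighbour is
  joined to one of them with probability of order one.
\<close>

section \<open>Factorial moments of the Poisson process\<close>

text \<open>Summing expected path numbers meets one obstacle: joining two ends of small mark through
  a vertex of larger mark w costs an integral that the connection probability of the ends must pay
  for. For close ends that probability is capped at 1, while the integral is unbounded as their
  marks tend to 0. On a shortest path the ends of a cut piece are not adjacent, so
  \<open>1 < soft\<close>, and there the kernel is a pure power law. One of the distances to the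
  middle vertex is at least half the distance of the ends, which costs
  \<open>2 powr (d * \<delta>)\<close> on either side. The exponent \<gamma>/\<delta> of the larger
  mark in \<open>soft\<close> gives that mark the power -\<gamma> in the power law; in a convolution
  the marks then trade places, the kernel of the ends reappears, and w keeps the factor
  \<open>w powr - th\<close>. Its integrability on (0,1) is the condition 1/\<delta> < 1/\<gamma> -
  1, and its integral together with the halving cost is the source of
  \<open>\<beta>\<^sub>0\<close>. The mark \<open>u\<^sub>*\<close> balances
  \<open>us powr (1 - \<gamma>)\<close>, the cost of a weak vertex, against \<open>m powr (1 -
  \<delta>) * us powr (1 - \<gamma> - \<gamma> * \<delta>)\<close>, the order of the long jump term
  when \<gamma> + \<gamma>\<delta> > 1.\<close>

definition injections :: "'i set \<Rightarrow> ('i \<Rightarrow> nat) set" where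
  "injections I = {\<tau> \<in> I \<rightarrow>\<^sub>E UNIV. inj_on \<tau> I}"

lemma countable_injections [simp, intro]: "finite I \<Longrightarrow> countable (injections I)"
  unfolding injections_def by (rule countable_subset[OF _ countable_PiE[of I "\<lambda>_. UNIV"]]) auto

lemma ennreal_of_nat_minus: "(of_nat a :: ennreal) - of_nat b = of_nat (a - b)"
  by (simp add: ennreal_of_nat_eq_real_of_nat ennreal_minus of_nat_diff ennreal_neg not_le
      ) (metis diff_is_0_eq' ennreal_eq_0_iff linorder_le_cases of_nat_0 of_nat_diff diff_le_0_iff_le of_nat_le_iff)

text \<open>Summation over the last coordinate: once the earlier indices are placed, those with the same
  label occupy that many elements of the last set, and the others are disjoint from it.\<close>

lemma card_injections_labelled:
  assumes "finite I" "finite L" "c ` I \<subseteq> L"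
    and fin: "\<And>s. s \<in> L \<Longrightarrow> finite (S s)" and disj: "disjoint_family_on S L"
  shows "finite {\<tau> \<in> injections I. \<forall>i\<in>I. \<tau> i \<in> S (c i)} \<and>
    card {\<tau> \<in> injections I. \<forall>i\<in>I. \<tau> i \<in> S (c i)} =
      (\<Prod>s\<in>L. \<Prod>j<card {i\<in>I. c i = s}. card (S s) - j)"
  using assms(1,3)
proof (induction I rule: finite_induct)
  case empty
  have "{\<tau> \<in> injections {}. \<forall>i\<in>{}. \<tau> i \<in> S (c i)} = {\<lambda>_. undefined}"
    by (auto simp: injections_def)
  then show ?case by simp
next
  case (insert i I)
  let ?T = "{\<tau> \<in> injections I. \<forall>i\<in>I. \<tau> i \<in> S (c i)}"
  let ?T' = "{\<tau> \<in> injections (insert i I). \<forall>i\<in>insert i I. \<tau> i \<in> S (c i)}"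
  define B where "B \<tau> = S (c i) - \<tau> ` I" for \<tau> :: "'a \<Rightarrow> nat"
  have IH: "finite ?T" "card ?T = (\<Prod>s\<in>L. \<Prod>j<card {i\<in>I. c i = s}. card (S s) - j)"
    using insert by auto
  have ci: "c i \<in> L" using insert by auto
  have "bij_betw (\<lambda>(\<tau>, y). \<tau>(i := y)) (SIGMA \<tau>:?T. B \<tau>) ?T'"
  proof (rule bij_betwI[where g = "\<lambda>\<tau>. (\<tau>(i := undefined), \<tau> i)"])
    show "(\<lambda>(\<tau>, y). \<tau>(i := y)) \<in> (SIGMA \<tau>:?T. B \<tau>) \<rightarrow> ?T'"
    proof (rule funcsetI, clarify)
      fix \<tau> y assume \<tau>: "\<tau> \<in> injections I" "\<forall>i\<in>I. \<tau> i \<in> S (c i)" and y: "y \<in> B \<tau>"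
      have eq: "(\<tau>(i := y)) j = \<tau> j" if "j \<in> I" for j using that insert(2) by auto
      have "inj_on (\<tau>(i := y)) I"
        using \<tau>(1) by (subst inj_on_cong[OF eq]) (auto simp: injections_def)
      moreover have "(\<tau>(i := y)) ` I = \<tau> ` I" using eq by (rule image_cong[OF refl])
      ultimately have "inj_on (\<tau>(i := y)) (insert i I)"
        using y insert(2) by (simp add: inj_on_insert B_def)
      moreover have "\<tau>(i := y) \<in> insert i I \<rightarrow>\<^sub>E UNIV"
        using \<tau>(1) by (auto simp: injections_def PiE_def extensional_def)
      ultimately show "\<tau>(i := y) \<in> injections (insert i I) \<and> (\<forall>i'\<in>insert i I. (\<tau>(i := y)) i' \<in> S (c i'))"
        using \<tau>(2) y insert(2) by (auto simp: injections_def B_def)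
    qed
    show "(\<lambda>\<tau>. (\<tau>(i := undefined), \<tau> i)) \<in> ?T' \<rightarrow> (SIGMA \<tau>:?T. B \<tau>)"
    proof (rule funcsetI)
      fix \<tau> assume \<tau>: "\<tau> \<in> ?T'"
      let ?\<sigma> = "\<tau>(i := undefined)"
      have eq: "?\<sigma> j = \<tau> j" if "j \<in> I" for j using that insert(2) by auto
      have im: "?\<sigma> ` I = \<tau> ` I" using eq by (rule image_cong[OF refl])
      have "inj_on \<tau> I" "\<tau> i \<notin> \<tau> ` I"
        using \<tau> insert(2) by (auto simp: injections_def)
      then have "inj_on ?\<sigma> I" by (subst inj_on_cong[OF eq]) auto
      moreover have "?\<sigma> \<in> I \<rightarrow>\<^sub>E UNIV"
        using \<tau> by (auto simp: injections_def PiE_def extensional_def)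
      ultimately have "?\<sigma> \<in> ?T" using \<tau> eq by (simp add: injections_def)
      then show "(?\<sigma>, \<tau> i) \<in> (SIGMA \<tau>:?T. B \<tau>)"
        using \<tau> \<open>\<tau> i \<notin> \<tau> ` I\<close> im by (simp add: B_def)
    qed
    show "\<And>x. x \<in> (SIGMA \<tau>:?T. B \<tau>) \<Longrightarrow> ((case x of (\<tau>, y) \<Rightarrow> \<tau>(i := y))(i := undefined), (case x of (\<tau>, y) \<Rightarrow> \<tau>(i := y)) i) = x"
      using insert(2) by (force simp: injections_def PiE_def extensional_def)
  qed simp
  note bij = this
  have finB: "finite (B \<tau>)" for \<tau> using fin[OF ci] by (auto simp: B_def)
  have cardB: "card (B \<tau>) = card (S (c i)) - card {i'\<in>I. c i' = c i}" if "\<tau> \<in> ?T" for \<tau>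
  proof -
    have "S (c i) \<inter> \<tau> ` I = \<tau> ` {i'\<in>I. c i' = c i}"
    proof -
      have "c i' = c i" if "i' \<in> I" "\<tau> i' \<in> S (c i)" for i'
      proof (rule ccontr)
        assume "c i' \<noteq> c i"
        moreover have "c i' \<in> L" using insert that by auto
        ultimately have "S (c i') \<inter> S (c i) = {}" using disj ci by (auto simp: disjoint_family_on_def)
        moreover have "\<tau> i' \<in> S (c i')" using \<open>\<tau> \<in> ?T\<close> that by auto
        ultimately show False using that by auto
      qed
      then show ?thesis using \<open>\<tau> \<in> ?T\<close> by fastforce
    qed
    moreover have "card (\<tau> ` {i'\<in>I. c i' = c i}) = card {i'\<in>I. c i' = c i}"
      using that by (intro card_image) (auto simp: injections_def inj_on_def)
    ultimately show ?thesis
      unfolding B_def using fin[OF ci] insert(1) by (subst card_Diff_subset_Int) auto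
  qed
  have k: "card {i'\<in>insert i I. c i' = s} = card {i'\<in>I. c i' = s} + (if s = c i then 1 else 0)" for s
  proof -
    have "{i'\<in>insert i I. c i' = s} = (if s = c i then insert i {i'\<in>I. c i' = s} else {i'\<in>I. c i' = s})"
      by auto
    then show ?thesis using insert(1,2) by simp
  qed
  have fin': "finite ?T'"
    using bij_betw_finite[OF bij] finB IH(1) by auto
  have "card ?T' = card (SIGMA \<tau>:?T. B \<tau>)" using bij_betw_same_card[OF bij] by simp
  also have "\<dots> = (\<Sum>\<tau>\<in>?T. card (B \<tau>))" using finB IH by (intro card_SigmaI) auto
  also have "\<dots> = card ?T * (card (S (c i)) - card {i'\<in>I. c i' = c i})"
    using cardB by simp
  also have "\<dots> = (\<Prod>s\<in>L. (\<Prod>j<card {i\<in>I. c i = s}. card (S s) - j) *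
      (if s = c i then card (S (c i)) - card {i'\<in>I. c i' = c i} else 1))"
    unfolding prod.distrib IH using ci \<open>finite L\<close> by simp
  also have "\<dots> = (\<Prod>s\<in>L. \<Prod>j<card {i'\<in>insert i I. c i' = s}. card (S s) - j)"
    unfolding k by (intro prod.cong) auto
  finally show ?case using fin' by simp
qed

text \<open>For k < r the product contains the factor k - k = 0 of truncated subtraction. Shifting
  by r cancels the falling factorial against the factorial and leaves \<open>l ^ r\<close> times the
  exponential series.\<close>

lemma poisson_factorial_moment_sums:
  "(\<lambda>k. real (\<Prod>j<r. k - j) * (l ^ k / fact k * exp (- l))) sums (l ^ r)" for l :: real
proof -
  have p: "real (\<Prod>j<r. i + r - j) * fact i = fact (i + r)" for i
  proof (induction r arbitrary: i)
    case (Suc r)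
    have "(\<Prod>j<Suc r. i + Suc r - j) = (i + Suc r) * (\<Prod>j<r. i + r - j)"
      by (subst prod.lessThan_Suc_shift) simp
    then have "real (\<Prod>j<Suc r. i + Suc r - j) * fact i = real (i + Suc r) * (real (\<Prod>j<r. i + r - j) * fact i)"
      by (simp only: of_nat_mult mult.assoc)
    then show ?case unfolding Suc[of i] by simp
  qed simp
  have "(\<lambda>i. l ^ r * exp (- l) * (inverse (fact i) * l ^ i)) sums (l ^ r * exp (-l) * exp l)"
    using exp_converges[of l] by (intro sums_mult) (simp add: scaleR_conv_of_real)
  moreover have "l ^ r * exp (- l) * (inverse (fact i) * l ^ i)
      = real (\<Prod>j<r. i + r - j) * (l ^ (i + r) / fact (i + r) * exp (- l))" for i
  proof -
    have "real (\<Prod>j<r. i + r - j) = fact (i + r) / fact i" using p[of i] by (simp add: field_simps)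
    then show ?thesis by (simp add: field_simps power_add)
  qed
  moreover have "l ^ r * exp (- l) * exp l = l ^ r" by (simp add: exp_minus)
  ultimately have "(\<lambda>i. real (\<Prod>j<r. i + r - j) * (l ^ (i + r) / fact (i + r) * exp (- l))) sums (l ^ r)"
    by (simp only:)
  moreover have "(\<Sum>i<r. real (\<Prod>j<r. i - j) * (l ^ i / fact i * exp (- l))) = 0"
    by (intro sum.neutral) auto
  ultimately show ?thesis
    using sums_iff_shift[of "\<lambda>k. real (\<Prod>j<r. k - j) * (l ^ k / fact k * exp (- l))" r "l ^ r"]
    by simp
qed

section \<open>Law and factorial moments of the number of points in a set\<close>

context unit_poisson_process
begin

lemma measurable_point [measurable]: "(\<lambda>x. x i) \<in> N \<rightarrow>\<^sub>M borel"
  using measurable_component_singleton[of i UNIV "\<lambda>_. borel"]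
  by (simp add: measurable_cong_sets[OF sets_N refl])

lemma point_count_eq_sum: "point_count B x = (\<integral>\<^sup>+i. indicator B (x i) \<partial>count_space UNIV)"
proof -
  have "point_count B x = (\<integral>\<^sup>+i. indicator {i. x i \<in> B} i \<partial>count_space UNIV)"
    by (simp add: point_count_def)
  also have "\<dots> = (\<integral>\<^sup>+i. indicator B (x i) \<partial>count_space UNIV)"
    by (intro nn_integral_cong) (auto split: split_indicator)
  finally show ?thesis .
qed

lemma measurable_point_count [measurable]:
  assumes [measurable]: "B \<in> sets borel" shows "point_count B \<in> borel_measurable N"
proof -
  have "(\<lambda>x. \<Sum>i. indicator B (x i) :: ennreal) \<in> borel_measurable N" by measurable
  then show ?thesis
    by (subst measurable_cong[where g="\<lambda>x. \<Sum>i. indicator B (x i) :: ennreal"])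
       (auto simp: point_count_eq_sum nn_integral_count_space_nat)
qed

lemma point_count_eq_of_nat_iff:
  "point_count B x = of_nat k \<longleftrightarrow> finite {i. x i \<in> B} \<and> card {i. x i \<in> B} = k"
  by (auto simp: point_count_def emeasure_count_space)

text \<open>Finiteness of the count is derived, not assumed: the Poisson weights already have total
  mass 1, so the events \<open>E k\<close> cover the space up to a null set and the integral becomes
  a series.\<close>

lemma nn_integral_point_count:
  assumes [measurable]: "B \<in> sets borel" and fin: "emeasure lborel B < \<infinity>"
  assumes f[measurable]: "f \<in> borel_measurable borel"
  shows "(\<integral>\<^sup>+x. f (point_count B x) \<partial>N) =
    (\<Sum>k. f (of_nat k) * ennreal (measure lborel B ^ k / fact k * exp (- measure lborel B)))"
proof -
  let ?l = "measure lborel B"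
  define E where "E k = {x \<in> space N. point_count B x = of_nat k}" for k :: nat
  have E[measurable]: "E k \<in> sets N" for k unfolding E_def by measurable
  have PE: "emeasure N (E k) = ennreal (?l ^ k / fact k * exp (- ?l))" for k
    using poisson[of B k] fin by (simp add: E_def emeasure_eq_measure)
  have disj: "disjoint_family E" by (auto simp: disjoint_family_on_def E_def)
  have "(\<lambda>k. measure N (E k)) sums measure N (\<Union>k. E k)"
    using disj by (intro finite_measure_UNION) auto
  \<comment> \<open>The factorial moment of order 0 says that the Poisson weights sum to 1.\<close>
  moreover have "(\<lambda>k. measure N (E k)) sums 1"
    using poisson_factorial_moment_sums[of 0 ?l] poisson[of B] fin by (simp add: E_def)
  ultimately have "measure N (\<Union>k. E k) = 1" by (rule sums_unique2)
  then have "AE x in N. x \<in> (\<Union>k. E k)" by (subst prob_eq_1[symmetric]) auto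
  then have "AE x in N. f (point_count B x) = (\<Sum>k. f (of_nat k) * indicator (E k) x)"
  proof eventually_elim
    case (elim x)
    then obtain k where k: "x \<in> E k" by auto
    then have "indicator (E i) x = (if i = k then 1 else 0 :: ennreal)" for i
      by (auto simp: E_def)
    then have "(\<Sum>i. f (of_nat i) * indicator (E i) x) = (\<Sum>i. if i = k then f (of_nat k) else 0)"
      by (intro suminf_cong) auto
    also have "\<dots> = f (of_nat k)" by (subst suminf_finite[of "{k}"]) auto
    finally show ?case using k by (simp add: E_def)
  qed
  then have "(\<integral>\<^sup>+x. f (point_count B x) \<partial>N) = (\<integral>\<^sup>+x. (\<Sum>k. f (of_nat k) * indicator (E k) x) \<partial>N)"
    by (rule nn_integral_cong_AE)
  also have "\<dots> = (\<Sum>k. f (of_nat k) * emeasure N (E k))"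
    by (subst nn_integral_suminf) (auto simp: nn_integral_cmult_indicator)
  finally show ?thesis by (simp add: PE)
qed

lemma AE_finite_points:
  assumes [measurable]: "B \<in> sets borel" and fin: "emeasure lborel B < \<infinity>"
  shows "AE x in N. finite {i. x i \<in> B}"
proof -
  have "(\<integral>\<^sup>+x. indicator {\<infinity>} (point_count B x) \<partial>N) = 0"
    by (subst nn_integral_point_count) (use fin in auto)
  then have "AE x in N. point_count B x \<noteq> \<infinity>"
    by (subst (asm) nn_integral_0_iff_AE) (auto split: split_indicator elim!: eventually_mono)
  then show ?thesis
    by eventually_elim (auto simp: point_count_def emeasure_count_space split: if_splits)
qed

text \<open>For a count k this is the number of ordered r-tuples of distinct points. Subtraction on
  \<open>ennreal\<close> truncates at 0, as on the naturals, so the value is 0 for k < r.\<close>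

definition falling :: "nat \<Rightarrow> ennreal \<Rightarrow> ennreal" where
  "falling r y = (\<Prod>j<r. y - of_nat j)"

lemma measurable_falling [measurable]: "falling r \<in> borel_measurable borel"
  unfolding falling_def by measurable

lemma falling_of_nat: "falling r (of_nat k) = of_nat (\<Prod>j<r. k - j)"
  unfolding falling_def by (simp add: ennreal_of_nat_minus)

lemma factorial_moment_point_count:
  assumes [measurable]: "B \<in> sets borel" and fin: "emeasure lborel B < \<infinity>"
  shows "(\<integral>\<^sup>+x. falling r (point_count B x) \<partial>N) = emeasure lborel B ^ r"
proof -
  let ?l = "measure lborel B"
  have "(\<integral>\<^sup>+x. falling r (point_count B x) \<partial>N) =
      (\<Sum>k. falling r (of_nat k) * ennreal (?l ^ k / fact k * exp (- ?l)))"
    by (rule nn_integral_point_count[OF assms]) measurable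
  also have "\<dots> = (\<Sum>k. ennreal (real (\<Prod>j<r. k - j) * (?l ^ k / fact k * exp (- ?l))))"
    unfolding falling_of_nat unfolding ennreal_of_nat_eq_real_of_nat
    by (intro suminf_cong ennreal_mult[symmetric]) (auto intro!: mult_nonneg_nonneg prod_nonneg)
  also have "\<dots> = ennreal (?l ^ r)"
    using poisson_factorial_moment_sums[of r ?l]
    by (intro suminf_ennreal_eq) (auto intro!: mult_nonneg_nonneg divide_nonneg_nonneg prod_nonneg)
  also have "\<dots> = emeasure lborel B ^ r"
    using fin by (simp add: emeasure_eq_ennreal_measure ennreal_power top_unique less_top)
  finally show ?thesis .
qed

end

section \<open>Factorial moment measures and Campbell's formula\<close>

context unit_poisson_process
begin

lemma sigma_finite_injections: "finite I \<Longrightarrow> sigma_finite_measure (count_space (injections I))"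
  by (intro sigma_finite_measure_count_space_countable countable_injections)

text \<open>The factorial moment measure: the mean measure of tuples of distinct points. Coordinates
  are indexed by a finite set instead of an order r, so that they can be the positions on a path.
  Summing over injective index tuples makes the result independent of the enumeration.\<close>

definition factorial_measure :: "nat set \<Rightarrow> (nat \<Rightarrow> 'a) measure" where
  "factorial_measure I = distr (count_space (injections I) \<Otimes>\<^sub>M N) (PiM I (\<lambda>_. lborel))
    (\<lambda>(\<tau>, x). \<lambda>l\<in>I. x (\<tau> l))"

lemma sets_factorial_measure [simp, measurable_cong]: "sets (factorial_measure I) = sets (PiM I (\<lambda>_. lborel))"
  by (simp add: factorial_measure_def)

lemma measurable_select [measurable]: "(\<lambda>x. \<lambda>l\<in>I. x (\<tau> l)) \<in> N \<rightarrow>\<^sub>M PiM I (\<lambda>_. lborel)"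
  by (intro measurable_restrict) simp

lemma nn_integral_factorial_measure:
  assumes I: "finite I" and f[measurable]: "f \<in> borel_measurable (PiM I (\<lambda>_. lborel))"
  shows "(\<integral>\<^sup>+z. f z \<partial>factorial_measure I) =
    (\<integral>\<^sup>+x. \<integral>\<^sup>+\<tau>. f (\<lambda>l\<in>I. x (\<tau> l)) \<partial>count_space (injections I) \<partial>N)"
proof -
  have m: "(\<lambda>(\<tau>, x). \<lambda>l\<in>I. x (\<tau> l)) \<in> count_space (injections I) \<Otimes>\<^sub>M N \<rightarrow>\<^sub>M PiM I (\<lambda>_. lborel)"
    using I by (intro measurable_pair_measure_countable1) auto
  have "(\<integral>\<^sup>+z. f z \<partial>factorial_measure I) =
      (\<integral>\<^sup>+p. f (case p of (\<tau>, x) \<Rightarrow> \<lambda>l\<in>I. x (\<tau> l)) \<partial>(count_space (injections I) \<Otimes>\<^sub>M N))"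
    unfolding factorial_measure_def using m by (intro nn_integral_distr) auto
  also have "\<dots> = (\<integral>\<^sup>+\<tau>. \<integral>\<^sup>+x. f (\<lambda>l\<in>I. x (\<tau> l)) \<partial>N \<partial>count_space (injections I))"
    using m by (subst nn_integral_fst[symmetric]) auto
  also have "\<dots> = (\<integral>\<^sup>+x. \<integral>\<^sup>+\<tau>. f (\<lambda>l\<in>I. x (\<tau> l)) \<partial>count_space (injections I) \<partial>N)"
    using I by (intro nn_integral_count_space_nn_integral[symmetric]) auto
  finally show ?thesis .
qed

text \<open>In a box whose sides are pairwise equal or disjoint, the tuples are counted by a product
  of falling factorials, one for each distinct side. Independence over disjoint sides separates the
  expectations, and each of them is a factorial moment of a Poisson variable.\<close>

lemma emeasure_factorial_measure_labelled:
  fixes B :: "nat \<Rightarrow> 'a set"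
  assumes I: "finite I" and B[measurable]: "\<And>k. B k \<in> sets borel" and disj: "disjoint_family B"
    and fin: "\<And>i. i \<in> I \<Longrightarrow> emeasure lborel (B (c i)) < \<infinity>"
  shows "emeasure (factorial_measure I) (\<Pi>\<^sub>E i\<in>I. B (c i)) = (\<Prod>i\<in>I. emeasure lborel (B (c i)))"
proof -
  let ?k = "\<lambda>s. card {i\<in>I. c i = s}"
  have [measurable]: "(\<Pi>\<^sub>E i\<in>I. B (c i)) \<in> sets (PiM I (\<lambda>_. lborel))"
    using I by (intro sets_PiM_I_finite) auto
  have "emeasure (factorial_measure I) (\<Pi>\<^sub>E i\<in>I. B (c i)) =
      (\<integral>\<^sup>+z. indicator (\<Pi>\<^sub>E i\<in>I. B (c i)) z \<partial>factorial_measure I)" by simp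
  also have "\<dots> = (\<integral>\<^sup>+x. \<integral>\<^sup>+\<tau>. indicator (\<Pi>\<^sub>E i\<in>I. B (c i)) (\<lambda>l\<in>I. x (\<tau> l))
      \<partial>count_space (injections I) \<partial>N)"
    using I by (intro nn_integral_factorial_measure) auto
  also have "\<dots> = (\<integral>\<^sup>+x. (\<Prod>s\<in>c`I. falling (?k s) (point_count (B s) x)) \<partial>N)"
  proof (rule nn_integral_cong_AE)
    have "AE x in N. \<forall>s\<in>c`I. finite {j. x j \<in> B s}"
      using I fin by (intro AE_finite_allI AE_finite_points) auto
    then show "AE x in N. (\<integral>\<^sup>+\<tau>. indicator (\<Pi>\<^sub>E i\<in>I. B (c i)) (\<lambda>l\<in>I. x (\<tau> l))
      \<partial>count_space (injections I)) = (\<Prod>s\<in>c`I. falling (?k s) (point_count (B s) x))"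
    proof eventually_elim
      case (elim x)
      let ?S = "\<lambda>s. {j. x j \<in> B s}"
      let ?T = "{\<tau> \<in> injections I. \<forall>i\<in>I. \<tau> i \<in> ?S (c i)}"
      have T: "finite ?T" "card ?T = (\<Prod>s\<in>c`I. \<Prod>j<?k s. card (?S s) - j)"
        using card_injections_labelled[of I "c`I" c ?S] I elim disj
        by (auto simp: disjoint_family_on_def)
      have "(\<integral>\<^sup>+\<tau>. indicator (\<Pi>\<^sub>E i\<in>I. B (c i)) (\<lambda>l\<in>I. x (\<tau> l)) \<partial>count_space (injections I)) =
          (\<integral>\<^sup>+\<tau>. indicator ?T \<tau> \<partial>count_space (injections I))"
        by (intro nn_integral_cong) (auto simp: PiE_iff split: split_indicator)
      also have "\<dots> = of_nat (card ?T)"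
        using T(1) by (simp add: emeasure_count_space)
      also have "\<dots> = (\<Prod>s\<in>c`I. falling (?k s) (of_nat (card (?S s))))"
        unfolding T(2) by (simp add: falling_of_nat)
      also have "\<dots> = (\<Prod>s\<in>c`I. falling (?k s) (point_count (B s) x))"
        using elim by (intro prod.cong refl) (auto simp: point_count_def emeasure_count_space)
      finally show ?case .
    qed
  qed
  also have "\<dots> = (\<Prod>s\<in>c`I. \<integral>\<^sup>+x. falling (?k s) (point_count (B s) x) \<partial>N)"
  proof (rule indep_vars_nn_integral)
    have "range B \<subseteq> sets borel" using B by auto
    then have "indep_vars (\<lambda>_. borel) (\<lambda>n. point_count (B n)) (c`I)"
      using indep_vars_subset[OF independent[OF _ disj], of "c`I"] by blast
    then show "indep_vars (\<lambda>_. borel) (\<lambda>s x. falling (?k s) (point_count (B s) x)) (c`I)"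
      by (rule indep_vars_compose2) measurable
  qed (use I in auto)
  also have "\<dots> = (\<Prod>s\<in>c`I. emeasure lborel (B s) ^ ?k s)"
    using fin by (intro prod.cong refl factorial_moment_point_count) auto
  also have "\<dots> = (\<Prod>s\<in>c`I. \<Prod>i\<in>{i\<in>I. c i = s}. emeasure lborel (B (c i)))"
    by (intro prod.cong refl) simp
  also have "\<dots> = (\<Prod>i\<in>I. emeasure lborel (B (c i)))"
    using I by (intro prod.group) auto
  finally show ?thesis .
qed

lemma emeasure_factorial_measure_rectangle_finite:
  fixes A :: "nat \<Rightarrow> 'a set"
  assumes I: "finite I" and A[measurable]: "\<And>i. i \<in> I \<Longrightarrow> A i \<in> sets borel"
    and fin: "\<And>i. i \<in> I \<Longrightarrow> emeasure lborel (A i) < \<infinity>"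
  shows "emeasure (factorial_measure I) (Pi\<^sub>E I A) = (\<Prod>i\<in>I. emeasure lborel (A i))"
proof -
  text \<open>The atoms of the algebra generated by the sets \<open>A i\<close>, labelled by natural numbers.\<close>
  define atom where "atom k = {x. {i\<in>I. x \<in> A i} = set_decode k}" for k
  \<comment> \<open>\<open>set_encode\<close> numbers the finite sets of naturals; natural labels
    are needed because independence is stated for sequences of disjoint sets. \<open>D i\<close>
    collects the atoms that make up \<open>A i\<close>.\<close>
  define D where "D i = set_encode ` {S \<in> Pow I. i \<in> S}" for i
  have D: "finite (D i)" for i using I by (auto simp: D_def)
  have atom[measurable]: "atom k \<in> sets borel" for k
  proof -
    have "atom k = (if set_decode k \<subseteq> I then {x. \<forall>i\<in>I. x \<in> A i \<longleftrightarrow> i \<in> set_decode k} else {})"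
      by (auto simp: atom_def)
    moreover have "{x\<in>space borel. \<forall>i\<in>I. x \<in> A i \<longleftrightarrow> i \<in> set_decode k} \<in> sets borel"
      using I by measurable
    ultimately show ?thesis by auto
  qed
  have disj: "disjoint_family atom" by (auto simp: disjoint_family_on_def atom_def) (metis set_decode_inverse)
  have AD: "A i = (\<Union>k\<in>D i. atom k)" if "i \<in> I" for i
  proof -
    have "\<exists>k\<in>D i. x \<in> atom k" if "x \<in> A i" for x
      using that \<open>i \<in> I\<close> I by (intro bexI[of _ "set_encode {i\<in>I. x \<in> A i}"]) (auto simp: D_def atom_def)
    moreover have "x \<in> A i" if k: "k \<in> D i" "x \<in> atom k" for k x
    proof -
      obtain S where "S \<subseteq> I" "i \<in> S" "k = set_encode S" using k by (auto simp: D_def)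
      moreover from this have "finite S" using I finite_subset by auto
      ultimately show ?thesis using k by (auto simp: atom_def)
    qed
    ultimately show ?thesis by auto
  qed
  have finat: "emeasure lborel (atom k) < \<infinity>" if "i \<in> I" "k \<in> D i" for i k
  proof -
    have "emeasure lborel (atom k) \<le> emeasure lborel (A i)"
      using that A by (intro emeasure_mono) (auto simp: AD)
    then show ?thesis using fin[OF \<open>i \<in> I\<close>] by (rule le_less_trans)
  qed
  \<comment> \<open>Choosing an atom for every coordinate splits the box into disjoint labelled
    boxes; the product formula then follows by expanding a product of sums.\<close>
  have U: "Pi\<^sub>E I A = (\<Union>\<sigma>\<in>Pi\<^sub>E I D. \<Pi>\<^sub>E i\<in>I. atom (\<sigma> i))"
  proof (intro set_eqI iffI)
    fix z assume z: "z \<in> Pi\<^sub>E I A"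
    then have "\<forall>i\<in>I. \<exists>k\<in>D i. z i \<in> atom k" using AD by (auto simp: PiE_iff)
    then obtain \<sigma> where "\<forall>i\<in>I. \<sigma> i \<in> D i \<and> z i \<in> atom (\<sigma> i)" by metis
    then have "restrict \<sigma> I \<in> Pi\<^sub>E I D" "z \<in> (\<Pi>\<^sub>E i\<in>I. atom (restrict \<sigma> I i))"
      using z by (auto simp: PiE_iff)
    then show "z \<in> (\<Union>\<sigma>\<in>Pi\<^sub>E I D. \<Pi>\<^sub>E i\<in>I. atom (\<sigma> i))" by blast
  next
    fix z assume "z \<in> (\<Union>\<sigma>\<in>Pi\<^sub>E I D. \<Pi>\<^sub>E i\<in>I. atom (\<sigma> i))"
    then obtain \<sigma> where \<sigma>: "\<sigma> \<in> Pi\<^sub>E I D" "z \<in> (\<Pi>\<^sub>E i\<in>I. atom (\<sigma> i))" by blast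
    have "z i \<in> A i" if "i \<in> I" for i
    proof -
      have "\<sigma> i \<in> D i" "z i \<in> atom (\<sigma> i)" using \<sigma> that by (auto simp: PiE_iff)
      then show ?thesis using AD[OF that] by blast
    qed
    then show "z \<in> Pi\<^sub>E I A" using \<sigma>(2) by (simp add: PiE_iff)
  qed
  have dj: "disjoint_family_on (\<lambda>\<sigma>. \<Pi>\<^sub>E i\<in>I. atom (\<sigma> i)) (Pi\<^sub>E I D)"
  proof (unfold disjoint_family_on_def, intro ballI impI, rule ccontr)
    fix \<sigma> \<sigma>' assume *: "\<sigma> \<in> Pi\<^sub>E I D" "\<sigma>' \<in> Pi\<^sub>E I D" "\<sigma> \<noteq> \<sigma>'"
      "(\<Pi>\<^sub>E i\<in>I. atom (\<sigma> i)) \<inter> (\<Pi>\<^sub>E i\<in>I. atom (\<sigma>' i)) \<noteq> {}"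
    then obtain z where z: "z \<in> (\<Pi>\<^sub>E i\<in>I. atom (\<sigma> i))" "z \<in> (\<Pi>\<^sub>E i\<in>I. atom (\<sigma>' i))" by auto
    have "\<sigma> i = \<sigma>' i" if "i \<in> I" for i
    proof -
      have "z i \<in> atom (\<sigma> i) \<inter> atom (\<sigma>' i)" using that z by (auto simp: PiE_iff)
      then show ?thesis using disj by (metis disjoint_family_on_def UNIV_I empty_iff)
    qed
    then have "\<sigma> = \<sigma>'" using *(1,2) by (intro PiE_ext[of \<sigma> I D]) auto
    then show False using * by simp
  qed
  have "emeasure (factorial_measure I) (Pi\<^sub>E I A) =
      (\<Sum>\<sigma>\<in>Pi\<^sub>E I D. emeasure (factorial_measure I) (\<Pi>\<^sub>E i\<in>I. atom (\<sigma> i)))"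
    unfolding U using I D dj
    by (intro sum_emeasure[symmetric] finite_PiE) (auto intro!: sets_PiM_I_finite)
  also have "\<dots> = (\<Sum>\<sigma>\<in>Pi\<^sub>E I D. \<Prod>i\<in>I. emeasure lborel (atom (\<sigma> i)))"
    using finat by (intro sum.cong refl emeasure_factorial_measure_labelled I atom disj) (auto simp: PiE_iff)
  also have "\<dots> = (\<Prod>i\<in>I. \<Sum>k\<in>D i. emeasure lborel (atom k))"
    using I D by (subst prod_sum_PiE) auto
  also have "\<dots> = (\<Prod>i\<in>I. emeasure lborel (A i))"
  proof (intro prod.cong refl)
    fix i assume "i \<in> I"
    have "(\<Sum>k\<in>D i. emeasure lborel (atom k)) = emeasure lborel (\<Union>k\<in>D i. atom k)"
      using disj D by (intro sum_emeasure) (auto simp: disjoint_family_on_def)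
    then show "(\<Sum>k\<in>D i. emeasure lborel (atom k)) = emeasure lborel (A i)" using AD \<open>i \<in> I\<close> by simp
  qed
  finally show ?thesis .
qed

text \<open>A product of \<sigma>-finite measures is determined by its values on boxes. Sides of
  infinite volume are exhausted by their intersections with balls, where all moments are
  finite.\<close>

lemma factorial_measure_eq: "finite I \<Longrightarrow> factorial_measure I = PiM I (\<lambda>_. lborel)"
proof -
  assume I: "finite I"
  interpret product_sigma_finite "\<lambda>_ :: nat. lborel :: 'a measure" ..
  show ?thesis
  proof (rule PiM_eqI[OF I])
    fix A :: "nat \<Rightarrow> 'a set" assume A: "\<And>i. i \<in> I \<Longrightarrow> A i \<in> sets lborel"
    define C where "C n i = A i \<inter> ball 0 (real n)" for n i
    have C[measurable]: "i \<in> I \<Longrightarrow> C n i \<in> sets borel" for i n using A by (auto simp: C_def)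
    have fin: "emeasure lborel (C n i) < \<infinity>" if "i \<in> I" for i n
    proof -
      have "emeasure lborel (C n i) \<le> emeasure lborel (ball (0::'a) (real n))"
        unfolding C_def by (intro emeasure_mono) auto
      then show ?thesis using emeasure_lborel_ball_finite by (auto simp: less_top intro: le_less_trans)
    qed
    have eq: "emeasure (factorial_measure I) (Pi\<^sub>E I (C n)) = emeasure (PiM I (\<lambda>_. lborel)) (Pi\<^sub>E I (C n))" for n
      using emeasure_factorial_measure_rectangle_finite[OF I C fin] emeasure_PiM[OF I, of "C n"] C by simp
    have U: "(\<Union>n. Pi\<^sub>E I (C n)) = Pi\<^sub>E I A"
    proof (intro set_eqI iffI)
      fix z assume z: "z \<in> Pi\<^sub>E I A"
      obtain n :: nat where n: "\<forall>i\<in>I. norm (z i) < real n"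
      proof -
        have "\<forall>i. \<exists>n. norm (z i) < real n" using reals_Archimedean2 by blast
        then obtain N' where N': "\<And>i. norm (z i) < real (N' i)" by metis
        have "norm (z i) < real (\<Sum>i\<in>I. N' i)" if "i \<in> I" for i
          using N'[of i] member_le_sum[OF that, of N'] I
          by (meson less_le_trans of_nat_le_iff zero_le)
        then show ?thesis using that by blast
      qed
      then have "z \<in> Pi\<^sub>E I (C n)" using z by (auto simp: PiE_iff C_def)
      then show "z \<in> (\<Union>n. Pi\<^sub>E I (C n))" by blast
    qed (auto simp: PiE_iff C_def)
    have inc: "incseq (\<lambda>n. Pi\<^sub>E I (C n))"
      unfolding incseq_def C_def by (intro allI impI PiE_mono) auto
    have "emeasure (factorial_measure I) (Pi\<^sub>E I A) = (SUP n. emeasure (factorial_measure I) (Pi\<^sub>E I (C n)))"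
      unfolding U[symmetric] using I inc by (intro SUP_emeasure_incseq[symmetric]) (auto intro!: sets_PiM_I_finite)
    also have "\<dots> = (SUP n. emeasure (PiM I (\<lambda>_. lborel)) (Pi\<^sub>E I (C n)))"
      by (simp add: eq)
    also have "\<dots> = emeasure (PiM I (\<lambda>_. lborel)) (Pi\<^sub>E I A)"
      unfolding U[symmetric] using I inc by (intro SUP_emeasure_incseq) (auto intro!: sets_PiM_I_finite)
    also have "\<dots> = (\<Prod>i\<in>I. emeasure lborel (A i))"
      using A by (intro emeasure_PiM[OF I]) auto
    finally show "emeasure (factorial_measure I) (Pi\<^sub>E I A) = (\<Prod>i\<in>I. emeasure lborel (A i))" .
  qed simp
qed

text \<open>Only positions occur here. Marks belong to indices rather than to points, so they can be
  integrated out for each index tuple before this formula is applied.\<close>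

lemma multivariate_campbell:
  fixes f :: "(nat \<Rightarrow> 'a) \<Rightarrow> ennreal"
  assumes "finite I" and "f \<in> borel_measurable (PiM I (\<lambda>_. lborel))"
  shows "(\<integral>\<^sup>+x. \<integral>\<^sup>+\<tau>. f (\<lambda>l\<in>I. x (\<tau> l)) \<partial>count_space (injections I) \<partial>N) =
    (\<integral>\<^sup>+z. f z \<partial>PiM I (\<lambda>_. lborel))"
  using nn_integral_factorial_measure[OF assms] factorial_measure_eq[OF assms(1)] by simp

end

section \<open>Expected numbers of paths\<close>

lemma prob_space_uniform01 [simp, intro]: "prob_space uniform01"
  unfolding uniform01_def by (intro prob_space_uniform_measure) auto

interpretation uniform01: prob_space uniform01 by simp

lemma sets_uniform01 [simp, measurable_cong]: "sets uniform01 = sets borel"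
  by (simp add: uniform01_def)

lemma space_uniform01 [simp]: "space uniform01 = UNIV"
  by (simp add: uniform01_def)

lemma nn_integral_uniform01:
  assumes [measurable]: "f \<in> borel_measurable borel"
  shows "(\<integral>\<^sup>+u. f u \<partial>uniform01) = (\<integral>\<^sup>+u. f u * indicator {0<..<1} u \<partial>lborel)"
  unfolding uniform01_def by (subst nn_integral_uniform_measure) (auto simp: divide_ennreal_def)

lemma AE_uniform01: "AE u in uniform01. 0 < u \<and> u < 1"
  unfolding uniform01_def by (rule AE_uniform_measureI) auto

lemma emeasure_uniform01_atMost:
  assumes "0 \<le> r" "r \<le> 1" shows "emeasure uniform01 {..r} = ennreal r"
proof -
  have "{0<..<1} \<inter> {..r} = (if r < 1 then {0<..r} else {0<..<1})" using assms by auto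
  then show ?thesis using assms unfolding uniform01_def
    by (subst emeasure_uniform_measure) (auto simp: divide_ennreal_def)
qed

abbreviation vmeas :: "('a::euclidean_space \<times> real) measure" where
  "vmeas \<equiv> lborel \<Otimes>\<^sub>M uniform01"

interpretation vmeas: sigma_finite_measure "vmeas :: ('a::euclidean_space \<times> real) measure"
  by (intro sigma_finite_pair_measure) (auto intro: lborel.sigma_finite_measure_axioms uniform01.sigma_finite_measure_axioms)

text \<open>Campbell's formula delivers all positions first and all marks afterwards, while paths
  are integrated vertex by vertex. Induction on the index set: coordinate i is peeled off both
  products, and its mark is exchanged with the remaining positions by Tonelli's theorem.\<close>

lemma nn_integral_PiM_pair:
  assumes "sigma_finite_measure M1" "sigma_finite_measure M2" and I: "finite I"
    and F: "F \<in> borel_measurable (PiM I (\<lambda>i. M1 \<Otimes>\<^sub>M M2))"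
  shows "(\<integral>\<^sup>+z. \<integral>\<^sup>+w. F (\<lambda>l\<in>I. (z l, w l)) \<partial>PiM I (\<lambda>_. M2) \<partial>PiM I (\<lambda>_. M1)) =
    (\<integral>\<^sup>+y. F y \<partial>PiM I (\<lambda>i. M1 \<Otimes>\<^sub>M M2))"
proof -
  interpret S1: sigma_finite_measure M1 by fact
  interpret S2: sigma_finite_measure M2 by fact
  interpret M1: product_sigma_finite "\<lambda>_. M1" ..
  interpret M2: product_sigma_finite "\<lambda>_. M2" ..
  interpret M: product_sigma_finite "\<lambda>_. M1 \<Otimes>\<^sub>M M2"
    by (intro product_sigma_finite.intro sigma_finite_pair_measure assms)
  show ?thesis
    using I F
  proof (induction I arbitrary: F rule: finite_induct)
    case empty
    then show ?case by (simp add: nn_integral_count_space_finite PiM_empty)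
  next
    case (insert i I)
    interpret F1: finite_product_sigma_finite "\<lambda>_. M1" I by unfold_locales (rule insert)
    interpret F2: finite_product_sigma_finite "\<lambda>_. M2" I by unfold_locales (rule insert)
    interpret F2': finite_product_sigma_finite "\<lambda>_. M2" "insert i I" by unfold_locales (use insert in simp)
    interpret Q: pair_sigma_finite "PiM I (\<lambda>_. M1)" M2 ..
    interpret FP: finite_product_sigma_finite "\<lambda>_. M1 \<Otimes>\<^sub>M M2" I by unfold_locales (rule insert)
    note [measurable] = insert.prems
    define G where "G a b z w = F ((\<lambda>l\<in>I. (z l, w l))(i := (a, b)))" for a b z w
    have G[measurable (raw)]: "(\<lambda>x. G (A x) (B x) (Z x) (W x)) \<in> borel_measurable X"
      if [measurable]: "A \<in> X \<rightarrow>\<^sub>M M1" "B \<in> X \<rightarrow>\<^sub>M M2" "Z \<in> X \<rightarrow>\<^sub>M PiM I (\<lambda>_. M1)" "W \<in> X \<rightarrow>\<^sub>M PiM I (\<lambda>_. M2)"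
      for A B Z W and X :: "'x measure"
    proof -
      have "(\<lambda>x. (\<lambda>l\<in>I. (Z x l, W x l))(i := (A x, B x))) \<in> X \<rightarrow>\<^sub>M PiM (insert i I) (\<lambda>_. M1 \<Otimes>\<^sub>M M2)"
        by (rule measurable_fun_upd[where J=I]) (simp, measurable)
      then show ?thesis unfolding G_def by (rule measurable_compose) (rule insert.prems)
    qed
    have upd[measurable (raw)]: "(\<lambda>x. F ((Y x)(i := C x))) \<in> borel_measurable X"
      if [measurable]: "C \<in> X \<rightarrow>\<^sub>M M1 \<Otimes>\<^sub>M M2" "Y \<in> X \<rightarrow>\<^sub>M PiM I (\<lambda>_. M1 \<Otimes>\<^sub>M M2)"
      for Y C and X :: "'x measure"
    proof -
      have "(\<lambda>x. (Y x)(i := C x)) \<in> X \<rightarrow>\<^sub>M PiM (insert i I) (\<lambda>_. M1 \<Otimes>\<^sub>M M2)"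
        by (rule measurable_fun_upd[where J=I]) (simp, measurable)
      then show ?thesis by (rule measurable_compose) (rule insert.prems)
    qed
    have F: "F (\<lambda>l\<in>insert i I. ((z(i := a)) l, (w(i := b)) l)) = G a b z w" for a b z w
      unfolding G_def using insert.hyps by (intro arg_cong[where f=F]) (auto simp: fun_eq_iff)
    have "(\<integral>\<^sup>+z. \<integral>\<^sup>+w. F (\<lambda>l\<in>insert i I. (z l, w l)) \<partial>PiM (insert i I) (\<lambda>_. M2) \<partial>PiM (insert i I) (\<lambda>_. M1)) =
        (\<integral>\<^sup>+a. \<integral>\<^sup>+z. \<integral>\<^sup>+w. F (\<lambda>l\<in>insert i I. ((z(i := a)) l, w l)) \<partial>PiM (insert i I) (\<lambda>_. M2) \<partial>PiM I (\<lambda>_. M1) \<partial>M1)"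
      by (rule M1.product_nn_integral_insert_rev) (use insert.hyps in simp_all)
    also have "\<dots> = (\<integral>\<^sup>+a. \<integral>\<^sup>+z. \<integral>\<^sup>+b. \<integral>\<^sup>+w. G a b z w \<partial>PiM I (\<lambda>_. M2) \<partial>M2 \<partial>PiM I (\<lambda>_. M1) \<partial>M1)"
    proof (intro nn_integral_cong)
      fix a z assume az: "a \<in> space M1" "z \<in> space (PiM I (\<lambda>_. M1))"
      then have "(z(i := a)) l \<in> space M1" if "l \<in> insert i I" for l
        using that by (auto simp: space_PiM)
      then have "(\<lambda>w. F (\<lambda>l\<in>insert i I. ((z(i := a)) l, w l))) \<in> borel_measurable (PiM (insert i I) (\<lambda>_. M2))"
        by measurable
      from M2.product_nn_integral_insert_rev[OF insert.hyps this]
      show "(\<integral>\<^sup>+w. F (\<lambda>l\<in>insert i I. ((z(i := a)) l, w l)) \<partial>PiM (insert i I) (\<lambda>_. M2)) =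
          (\<integral>\<^sup>+b. \<integral>\<^sup>+w. G a b z w \<partial>PiM I (\<lambda>_. M2) \<partial>M2)"
        unfolding F .
    qed
    also have "\<dots> = (\<integral>\<^sup>+a. \<integral>\<^sup>+b. \<integral>\<^sup>+z. \<integral>\<^sup>+w. G a b z w \<partial>PiM I (\<lambda>_. M2) \<partial>PiM I (\<lambda>_. M1) \<partial>M2 \<partial>M1)"
      by (intro nn_integral_cong Q.Fubini'[symmetric]) measurable
    also have "\<dots> = (\<integral>\<^sup>+a. \<integral>\<^sup>+b. (\<integral>\<^sup>+y. F (y(i := (a, b))) \<partial>PiM I (\<lambda>_. M1 \<Otimes>\<^sub>M M2)) \<partial>M2 \<partial>M1)"
      unfolding G_def
      by (intro nn_integral_cong insert.IH upd) (auto simp: space_pair_measure)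
    also have "\<dots> = (\<integral>\<^sup>+c. (\<integral>\<^sup>+y. F (y(i := c)) \<partial>PiM I (\<lambda>_. M1 \<Otimes>\<^sub>M M2)) \<partial>(M1 \<Otimes>\<^sub>M M2))"
      by (rule S2.nn_integral_fst) measurable
    also have "\<dots> = (\<integral>\<^sup>+y. F y \<partial>PiM (insert i I) (\<lambda>_. M1 \<Otimes>\<^sub>M M2))"
      using insert.hyps by (intro M.product_nn_integral_insert_rev[symmetric]) simp_all
    finally show ?case .
  qed
qed

section \<open>Links and vertex sequences of a configuration\<close>

definition vert :: "'a::euclidean_space config \<Rightarrow> nat \<Rightarrow> 'a \<times> real" where
  "vert \<omega> i = (location (fst \<omega>) i, fst (snd \<omega>) i)"

text \<open>The edge marks are those of the model, so two connection functions give two graphs on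
  the same configuration, and the larger function gives the larger graph.\<close>

definition linked :: "('a::euclidean_space \<times> real \<Rightarrow> 'a \<times> real \<Rightarrow> real) \<Rightarrow> 'a config \<Rightarrow> nat \<Rightarrow> nat \<Rightarrow> bool" where
  "linked L \<omega> i j \<longleftrightarrow> i \<noteq> j \<and> snd (snd \<omega>) {i, j} \<le> L (vert \<omega> i) (vert \<omega> j)"

text \<open>Position 0 of a path is the added vertex. The shift by \<open>Suc\<close> reflects that
  the i-th Poisson point carries the name \<open>Suc i\<close>, so \<tau> selects Poisson points
  only.\<close>

definition label :: "(nat \<Rightarrow> nat) \<Rightarrow> nat \<Rightarrow> nat" where
  "label \<tau> l = (if l = 0 then 0 else Suc (\<tau> l))"

lemma inj_on_label:
  assumes "\<tau> \<in> injections {1..n}" shows "inj_on (label \<tau>) {..n}"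
proof (rule inj_onI)
  fix k l assume kl: "k \<in> {..n}" "l \<in> {..n}" "label \<tau> k = label \<tau> l"
  have "inj_on \<tau> {1..n}" using assms by (simp add: injections_def)
  from inj_onD[OF this, of k l] show "k = l"
    using kl by (cases "k = 0"; cases "l = 0") (auto simp: label_def)
qed

interpretation edge_marks: product_prob_space "\<lambda>_ :: nat set. uniform01" "{e :: nat set. card e = 2}"
  by unfold_locales

interpretation vertex_marks: product_prob_space "\<lambda>_ :: nat. uniform01" UNIV
  by unfold_locales

text \<open>A sequence without repetitions uses each unordered pair at most once, so the marks read
  along it are independent uniform variables.\<close>

lemma emeasure_edge_marks_path:
  assumes a: "inj_on a {..n}" and r: "\<And>l. l < n \<Longrightarrow> 0 \<le> r l \<and> r l \<le> 1"
  shows "(\<integral>\<^sup>+v. of_bool (\<forall>l<n. v {a l, a (Suc l)} \<le> r l) \<partial>PiM {e :: nat set. card e = 2} (\<lambda>_. uniform01)) =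
    (\<Prod>l<n. ennreal (r l))"
proof -
  let ?E = "{e :: nat set. card e = 2}" and ?e = "\<lambda>l. {a l, a (Suc l)}"
  have inj: "inj_on ?e {..<n}"
  proof (rule inj_onI)
    fix k l assume kl: "k \<in> {..<n}" "l \<in> {..<n}" "?e k = ?e l"
    then consider "a k = a l" | "a k = a (Suc l)" "a (Suc k) = a l" by (auto simp: doubleton_eq_iff)
    then show "k = l"
    proof cases
      case 1
      then show ?thesis using inj_onD[OF a, of k l] kl by auto
    next
      case 2
      then show ?thesis using inj_onD[OF a, of k "Suc l"] inj_onD[OF a, of "Suc k" l] kl by auto
    qed
  qed
  have card: "card (?e l) = 2" if "l < n" for l
    using that inj_onD[OF a, of l "Suc l"] by (cases "a l = a (Suc l)") auto
  \<comment> \<open>The product measure is indexed by edges but the thresholds by positions; the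
    inverse of the injective edge map translates between the two.\<close>
  define X where "X e = {..r (the_inv_into {..<n} ?e e)}" for e
  have X: "X (?e l) = {..r l}" if "l < n" for l
    unfolding X_def using that by (subst the_inv_into_f_f[OF inj]) auto
  have "(\<integral>\<^sup>+v. of_bool (\<forall>l<n. v (?e l) \<le> r l) \<partial>PiM ?E (\<lambda>_. uniform01)) =
      (\<integral>\<^sup>+v. indicator {v\<in>space (PiM ?E (\<lambda>_. uniform01)). \<forall>e\<in>?e`{..<n}. v e \<in> X e} v \<partial>PiM ?E (\<lambda>_. uniform01))"
    using X by (intro nn_integral_cong) (auto split: split_indicator)
  also have "\<dots> = emeasure (PiM ?E (\<lambda>_. uniform01)) {v\<in>space (PiM ?E (\<lambda>_. uniform01)). \<forall>e\<in>?e`{..<n}. v e \<in> X e}"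
    using card by (intro nn_integral_indicator) (auto simp: X_def intro!: sets.sets_Collect_finite_All)
  also have "\<dots> = (\<Prod>e\<in>?e`{..<n}. emeasure uniform01 (X e))"
    using card by (intro edge_marks.emeasure_PiM_Collect) (auto simp: X_def)
  also have "\<dots> = (\<Prod>l<n. ennreal (r l))"
    using X r by (subst prod.reindex[OF inj]) (auto intro!: prod.cong emeasure_uniform01_atMost)
  finally show ?thesis .
qed


section \<open>The expected number of paths as an integral over marked vertices\<close>

context unit_poisson_process
begin

text \<open>For a fixed \<tau> the edge marks are integrated first, which produces the product of
  \<open>L\<close>, then the vertex marks. The result depends on \<tau> only through the selected
  positions, so Campbell's formula applies to the sum over \<tau>. The origin stays outside of it,
  with position 0 and a mark of its own.\<close>

lemma
  fixes L :: "'a \<times> real \<Rightarrow> 'a \<times> real \<Rightarrow> real"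
  assumes L[measurable]: "(\<lambda>(p, q). L p q) \<in> borel_measurable ((borel \<Otimes>\<^sub>M borel) \<Otimes>\<^sub>M (borel \<Otimes>\<^sub>M borel))"
    and L01: "\<And>p q. 0 \<le> L p q" "\<And>p q. L p q \<le> 1"
    and f[measurable]: "f \<in> borel_measurable (PiM {..n} (\<lambda>_. borel \<Otimes>\<^sub>M borel))"
  shows measurable_path_count: "(\<lambda>\<omega>. \<integral>\<^sup>+\<tau>. of_bool (\<forall>l<n. linked L \<omega> (label \<tau> l) (label \<tau> (Suc l))) *
        f (\<lambda>l\<in>{..n}. vert \<omega> (label \<tau> l)) \<partial>count_space (injections {1..n})) \<in> borel_measurable (palm_law N)"
      (is "(\<lambda>\<omega>. \<integral>\<^sup>+\<tau>. ?F \<tau> \<omega> \<partial>_) \<in> _")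
    and expected_path_count: "(\<integral>\<^sup>+\<omega>. \<integral>\<^sup>+\<tau>. of_bool (\<forall>l<n. linked L \<omega> (label \<tau> l) (label \<tau> (Suc l))) *
        f (\<lambda>l\<in>{..n}. vert \<omega> (label \<tau> l)) \<partial>count_space (injections {1..n}) \<partial>palm_law N) =
    (\<integral>\<^sup>+u. \<integral>\<^sup>+z. ennreal (\<Prod>l<n. L ((z(0 := (0, u))) l) ((z(0 := (0, u))) (Suc l))) * f (z(0 := (0, u)))
        \<partial>PiM {1..n} (\<lambda>_. vmeas) \<partial>uniform01)"
proof -
  let ?U = "PiM UNIV (\<lambda>_ :: nat. uniform01)" and ?V = "PiM {e :: nat set. card e = 2} (\<lambda>_. uniform01)"
  have Vs: "sigma_finite_measure ?V" by (intro prob_space_imp_sigma_finite prob_space_PiM) simp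
  have UVs: "sigma_finite_measure (?U \<Otimes>\<^sub>M ?V)"
    by (intro sigma_finite_pair_measure prob_space_imp_sigma_finite prob_space_PiM) simp_all
  interpret W': finite_product_prob_space "\<lambda>_ :: nat. uniform01" "{1..n}" by unfold_locales auto
  interpret Z: finite_product_sigma_finite "\<lambda>_ :: nat. lborel :: 'a measure" "{1..n}" by unfold_locales auto
  interpret ZU: pair_sigma_finite "PiM {1..n} (\<lambda>_ :: nat. lborel :: 'a measure)" uniform01 ..
  define g where "g p = ennreal (\<Prod>l<n. L (p l) (p (Suc l))) * f p" for p
  have g[measurable]: "g \<in> borel_measurable (PiM {..n} (\<lambda>_. borel \<Otimes>\<^sub>M borel))"
    unfolding g_def by measurable
  have [measurable]: "(\<lambda>x. location x i) \<in> N \<rightarrow>\<^sub>M borel" for i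
    by (cases i) auto
  have vert[measurable]: "(\<lambda>\<omega>. vert \<omega> i) \<in> palm_law N \<rightarrow>\<^sub>M borel \<Otimes>\<^sub>M borel" for i
    unfolding vert_def palm_law_def by measurable
  have both: "(\<lambda>\<omega>. of_bool (\<forall>l<n. linked L \<omega> (label \<tau> l) (label \<tau> (Suc l))) *
        f (\<lambda>l\<in>{..n}. vert \<omega> (label \<tau> l))) \<in> borel_measurable (palm_law N) \<and> (\<integral>\<^sup>+\<omega>. of_bool (\<forall>l<n. linked L \<omega> (label \<tau> l) (label \<tau> (Suc l))) *
        f (\<lambda>l\<in>{..n}. vert \<omega> (label \<tau> l)) \<partial>palm_law N) =
      (\<integral>\<^sup>+x. \<integral>\<^sup>+w. g (\<lambda>l\<in>{..n}. (location x (label \<tau> l), w l)) \<partial>PiM {..n} (\<lambda>_. uniform01) \<partial>N)"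
    if \<tau>: "\<tau> \<in> injections {1..n}" for \<tau>
  proof -
    let ?a = "label \<tau>"
    have a: "inj_on ?a {..n}" using \<tau> by (rule inj_on_label)
    have ne: "?a l \<noteq> ?a (Suc l)" if "l < n" for l
      using inj_onD[OF a, of l "Suc l"] that by auto
    have card: "card {?a l, ?a (Suc l)} = 2" if "l < n" for l using ne[OF that] by simp
    have mv: "(\<lambda>v. v {?a l, ?a (Suc l)}) \<in> ?V \<rightarrow>\<^sub>M borel" if "l < n" for l
      using card[OF that] measurable_component_singleton[of "{?a l, ?a (Suc l)}" "{e. card e = 2}" "\<lambda>_. uniform01"]
      by simp
    define h where "h x u v = of_bool (\<forall>l\<in>{..<n}. v {?a l, ?a (Suc l)} \<le> L (location x (?a l), u (?a l)) (location x (?a (Suc l)), u (?a (Suc l)))) *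
        f (\<lambda>l\<in>{..n}. (location x (?a l), u (?a l)))" for x u v
    let ?P = "N \<Otimes>\<^sub>M ?U \<Otimes>\<^sub>M ?V"
    have m1[measurable]: "(\<lambda>\<omega>. snd (snd \<omega>) {?a l, ?a (Suc l)}) \<in> ?P \<rightarrow>\<^sub>M borel" if "l \<in> {..<n}" for l
      using that by (intro measurable_compose[OF measurable_compose[OF measurable_snd measurable_snd] mv]) simp
    have m2[measurable]: "(\<lambda>\<omega>. (location (fst \<omega>) (?a l), fst (snd \<omega>) (?a l))) \<in> ?P \<rightarrow>\<^sub>M borel \<Otimes>\<^sub>M borel" for l
      by measurable
    have m3: "(\<lambda>\<omega>. L (location (fst \<omega>) (?a l), fst (snd \<omega>) (?a l)) (location (fst \<omega>) (?a k), fst (snd \<omega>) (?a k))) \<in> ?P \<rightarrow>\<^sub>M borel" for l k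
      using measurable_compose[OF measurable_Pair[OF m2[of l] m2[of k]] L] by simp
    have m4: "(\<lambda>\<omega>. f (\<lambda>l\<in>{..n}. (location (fst \<omega>) (?a l), fst (snd \<omega>) (?a l)))) \<in> borel_measurable ?P"
      by (rule measurable_compose[OF measurable_restrict f]) (rule m2)
    have h: "(\<lambda>\<omega>. h (fst \<omega>) (fst (snd \<omega>)) (snd (snd \<omega>))) \<in> borel_measurable ?P"
      unfolding h_def
    proof (intro borel_measurable_times_ennreal m4 measurable_compose[OF _ measurable_of_bool]
        pred_intros_finite)
      fix l assume "l \<in> {..<n}"
      from borel_measurable_le[OF m1[OF this] m3[of l "Suc l"]]
      show "Measurable.pred ?P (\<lambda>\<omega>. snd (snd \<omega>) {?a l, ?a (Suc l)} \<le>
          L (location (fst \<omega>) (?a l), fst (snd \<omega>) (?a l)) (location (fst \<omega>) (?a (Suc l)), fst (snd \<omega>) (?a (Suc l))))"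
        by (simp add: pred_def)
    qed simp
    have eq: "of_bool (\<forall>l<n. linked L \<omega> (?a l) (?a (Suc l))) * f (\<lambda>l\<in>{..n}. vert \<omega> (?a l)) =
        h (fst \<omega>) (fst (snd \<omega>)) (snd (snd \<omega>))" for \<omega>
      using ne unfolding h_def linked_def vert_def lessThan_iff Ball_def by simp
    have "(\<integral>\<^sup>+\<omega>. of_bool (\<forall>l<n. linked L \<omega> (?a l) (?a (Suc l))) * f (\<lambda>l\<in>{..n}. vert \<omega> (?a l)) \<partial>palm_law N) =
        (\<integral>\<^sup>+\<omega>. h (fst \<omega>) (fst (snd \<omega>)) (snd (snd \<omega>)) \<partial>palm_law N)"
      unfolding eq ..
    also have "\<dots> = (\<integral>\<^sup>+x. \<integral>\<^sup>+y. h x (fst y) (snd y) \<partial>(?U \<Otimes>\<^sub>M ?V) \<partial>N)"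
      unfolding palm_law_def using sigma_finite_measure.nn_integral_fst[OF UVs h] by simp
    also have "\<dots> = (\<integral>\<^sup>+x. \<integral>\<^sup>+u. \<integral>\<^sup>+v. h x u v \<partial>?V \<partial>?U \<partial>N)"
    proof (intro nn_integral_cong)
      fix x assume x: "x \<in> space N"
      have "(\<lambda>y. h x (fst y) (snd y)) \<in> borel_measurable (?U \<Otimes>\<^sub>M ?V)"
        using measurable_compose[OF measurable_Pair[OF measurable_const[OF x] measurable_ident] h] by simp
      from sigma_finite_measure.nn_integral_fst[OF Vs this, symmetric]
      show "(\<integral>\<^sup>+y. h x (fst y) (snd y) \<partial>(?U \<Otimes>\<^sub>M ?V)) = (\<integral>\<^sup>+u. \<integral>\<^sup>+v. h x u v \<partial>?V \<partial>?U)"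
        unfolding fst_conv snd_conv .
    qed
    also have "\<dots> = (\<integral>\<^sup>+x. \<integral>\<^sup>+u. g (\<lambda>l\<in>{..n}. (location x (?a l), u (?a l))) \<partial>?U \<partial>N)"
    proof (intro nn_integral_cong)
      fix x u
      let ?r = "\<lambda>l. L (location x (?a l), u (?a l)) (location x (?a (Suc l)), u (?a (Suc l)))"
      let ?f = "f (\<lambda>l\<in>{..n}. (location x (?a l), u (?a l)))"
      have "(\<integral>\<^sup>+v. h x u v \<partial>?V) = (\<integral>\<^sup>+v. of_bool (\<forall>l<n. v {?a l, ?a (Suc l)} \<le> ?r l) \<partial>?V) * ?f"
      proof -
        have "(\<lambda>v. of_bool (\<forall>l\<in>{..<n}. v {?a l, ?a (Suc l)} \<le> ?r l)) \<in> borel_measurable ?V"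
        proof (intro measurable_compose[OF _ measurable_of_bool] pred_intros_finite)
          fix l assume "l \<in> {..<n}"
          then have "l < n" by simp
          from borel_measurable_le[OF mv[OF this] borel_measurable_const[of "?r l"]]
          show "Measurable.pred ?V (\<lambda>v. v {?a l, ?a (Suc l)} \<le> ?r l)" by (simp add: pred_def)
        qed simp
        from nn_integral_multc[OF this, of ?f] show ?thesis unfolding h_def Ball_def lessThan_iff .
      qed
      also have "\<dots> = (\<Prod>l<n. ennreal (?r l)) * ?f"
        using emeasure_edge_marks_path[OF a, of ?r] L01 by simp
      also have "\<dots> = g (\<lambda>l\<in>{..n}. (location x (?a l), u (?a l)))"
        unfolding g_def using L01 by (simp add: prod_ennreal)
      finally show "(\<integral>\<^sup>+v. h x u v \<partial>?V) = g (\<lambda>l\<in>{..n}. (location x (?a l), u (?a l)))" .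
    qed
    also have "\<dots> = (\<integral>\<^sup>+x. \<integral>\<^sup>+w. g (\<lambda>l\<in>{..n}. (location x (?a l), w l)) \<partial>PiM {..n} (\<lambda>_. uniform01) \<partial>N)"
    proof (intro nn_integral_cong)
      \<comment> \<open>The names along the path are distinct, so the marks read at them are again
        independent and uniform; the infinite product reduces to one over positions.\<close>
      fix x
      have "(\<integral>\<^sup>+w. g (\<lambda>l\<in>{..n}. (location x (?a l), w l)) \<partial>PiM {..n} (\<lambda>_. uniform01)) =
          (\<integral>\<^sup>+w. g (\<lambda>l\<in>{..n}. (location x (?a l), w l)) \<partial>distr ?U (PiM {..n} (\<lambda>_. uniform01)) (\<lambda>u. \<lambda>l\<in>{..n}. u (?a l)))"
        using distr_PiM_reindex[of UNIV "\<lambda>_. uniform01" ?a "{..n}"] a by simp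
      also have "\<dots> = (\<integral>\<^sup>+u. g (\<lambda>l\<in>{..n}. (location x (?a l), (\<lambda>l\<in>{..n}. u (?a l)) l)) \<partial>?U)"
        by (intro nn_integral_distr) measurable
      also have "\<dots> = (\<integral>\<^sup>+u. g (\<lambda>l\<in>{..n}. (location x (?a l), u (?a l))) \<partial>?U)"
        by (intro nn_integral_cong arg_cong[where f=g]) (auto simp: fun_eq_iff)
      finally show "(\<integral>\<^sup>+u. g (\<lambda>l\<in>{..n}. (location x (?a l), u (?a l))) \<partial>?U) =
          (\<integral>\<^sup>+w. g (\<lambda>l\<in>{..n}. (location x (?a l), w l)) \<partial>PiM {..n} (\<lambda>_. uniform01))" ..
    qed
    finally show ?thesis unfolding eq using h unfolding palm_law_def by (intro conjI)
  qed
  \<comment> \<open>Coordinate 0 is separated: it carries the fixed position 0 and the mark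
    u.\<close>
  define G where "G z u w = g (\<lambda>l\<in>{..n}. (if l = 0 then 0 else z l, if l = 0 then u else w l))"
    for z :: "nat \<Rightarrow> 'a" and u w
  have G[measurable (raw)]: "(\<lambda>x. G (A x) (B x) (C x)) \<in> borel_measurable X"
    if ABC: "A \<in> X \<rightarrow>\<^sub>M PiM {1..n} (\<lambda>_. lborel)" "B \<in> borel_measurable X" "C \<in> X \<rightarrow>\<^sub>M PiM {1..n} (\<lambda>_. uniform01)"
    for A B C and X :: "'x measure"
  proof -
    have "(\<lambda>x. (if l = 0 then 0 else A x l, if l = 0 then B x else C x l)) \<in> X \<rightarrow>\<^sub>M borel \<Otimes>\<^sub>M borel"
      if "l \<in> {..n}" for l
    proof (cases "l = 0")
      case False
      then have l: "l \<in> {1..n}" using that by simp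
      have "(\<lambda>x. A x l) \<in> borel_measurable X" "(\<lambda>x. C x l) \<in> borel_measurable X"
        using measurable_compose[OF ABC(1) measurable_component_singleton[OF l]]
          measurable_compose[OF ABC(3) measurable_component_singleton[OF l]]
        by (simp_all cong: measurable_cong_sets)
      then show ?thesis using False by simp
    qed (use ABC(2) in simp)
    then show ?thesis unfolding G_def
      by (intro measurable_compose[OF measurable_restrict g])
  qed
  have ins: "{..n} = insert 0 {1..n}" by auto
  \<comment> \<open>With all marks integrated out, this is the function of the positions alone to
    which Campbell's formula is applied.\<close>
  define H where "H z = (\<integral>\<^sup>+u. \<integral>\<^sup>+w. G z u w \<partial>PiM {1..n} (\<lambda>_. uniform01) \<partial>uniform01)" for z
  have Hm: "H \<in> borel_measurable (PiM {1..n} (\<lambda>_. lborel))" unfolding H_def by measurable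
  have H: "(\<integral>\<^sup>+w. g (\<lambda>l\<in>{..n}. (location x (label \<tau> l), w l)) \<partial>PiM {..n} (\<lambda>_. uniform01)) =
      H (\<lambda>l\<in>{1..n}. x (\<tau> l))" for x \<tau>
  proof -
    have "(\<lambda>w. g (\<lambda>l\<in>{..n}. (location x (label \<tau> l), w l))) \<in> borel_measurable (PiM {..n} (\<lambda>_. uniform01))"
      by measurable
    then have "(\<integral>\<^sup>+w. g (\<lambda>l\<in>{..n}. (location x (label \<tau> l), w l)) \<partial>PiM {..n} (\<lambda>_. uniform01)) =
      (\<integral>\<^sup>+u. \<integral>\<^sup>+w. g (\<lambda>l\<in>{..n}. (location x (label \<tau> l), (w(0 := u)) l)) \<partial>PiM {1..n} (\<lambda>_. uniform01) \<partial>uniform01)"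
      unfolding ins by (intro vertex_marks.product_nn_integral_insert_rev) auto
    also have "\<dots> = H (\<lambda>l\<in>{1..n}. x (\<tau> l))"
      unfolding H_def G_def by (intro nn_integral_cong arg_cong[where f=g]) (auto simp: fun_eq_iff label_def)
    finally show ?thesis .
  qed
  have "(\<integral>\<^sup>+\<omega>. \<integral>\<^sup>+\<tau>. of_bool (\<forall>l<n. linked L \<omega> (label \<tau> l) (label \<tau> (Suc l))) *
        f (\<lambda>l\<in>{..n}. vert \<omega> (label \<tau> l)) \<partial>count_space (injections {1..n}) \<partial>palm_law N) =
      (\<integral>\<^sup>+\<tau>. \<integral>\<^sup>+\<omega>. of_bool (\<forall>l<n. linked L \<omega> (label \<tau> l) (label \<tau> (Suc l))) *
        f (\<lambda>l\<in>{..n}. vert \<omega> (label \<tau> l)) \<partial>palm_law N \<partial>count_space (injections {1..n}))"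
    by (rule nn_integral_count_space_nn_integral[OF countable_injections[OF finite_atLeastAtMost] conjunct1[OF both]])
  also have "\<dots> = (\<integral>\<^sup>+\<tau>. \<integral>\<^sup>+x. H (\<lambda>l\<in>{1..n}. x (\<tau> l)) \<partial>N \<partial>count_space (injections {1..n}))"
    unfolding H[symmetric] by (rule nn_integral_cong) (rule conjunct2[OF both], simp)
  also have "\<dots> = (\<integral>\<^sup>+x. \<integral>\<^sup>+\<tau>. H (\<lambda>l\<in>{1..n}. x (\<tau> l)) \<partial>count_space (injections {1..n}) \<partial>N)"
    by (rule nn_integral_count_space_nn_integral[symmetric, OF countable_injections[OF finite_atLeastAtMost]
        measurable_compose[OF measurable_select Hm]])
  also have "\<dots> = (\<integral>\<^sup>+z. H z \<partial>PiM {1..n} (\<lambda>_. lborel))"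
    by (rule multivariate_campbell[OF finite_atLeastAtMost Hm])
  also have "\<dots> = (\<integral>\<^sup>+u. \<integral>\<^sup>+z. \<integral>\<^sup>+w. G z u w \<partial>PiM {1..n} (\<lambda>_. uniform01) \<partial>PiM {1..n} (\<lambda>_. lborel) \<partial>uniform01)"
    unfolding H_def by (intro ZU.Fubini'[symmetric]) measurable
  also have "\<dots> = (\<integral>\<^sup>+u. \<integral>\<^sup>+y. g (y(0 := (0, u))) \<partial>PiM {1..n} (\<lambda>_. vmeas) \<partial>uniform01)"
  proof (intro nn_integral_cong)
    fix u :: real
    have "(\<lambda>y. y(0 := (0, u))) \<in> PiM {1..n} (\<lambda>_. vmeas :: ('a \<times> real) measure) \<rightarrow>\<^sub>M PiM {..n} (\<lambda>_. borel \<Otimes>\<^sub>M borel)"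
      by (rule measurable_fun_upd[where J="{1..n}"]) (auto simp: ins)
    then have m: "(\<lambda>y. g (y(0 := (0, u)))) \<in> borel_measurable (PiM {1..n} (\<lambda>_. vmeas))"
      by (rule measurable_compose) (rule g)
    have "(\<integral>\<^sup>+z. \<integral>\<^sup>+w. G z u w \<partial>PiM {1..n} (\<lambda>_. uniform01) \<partial>PiM {1..n} (\<lambda>_. lborel)) =
        (\<integral>\<^sup>+z. \<integral>\<^sup>+w. g ((\<lambda>l\<in>{1..n}. (z l, w l))(0 := (0, u))) \<partial>PiM {1..n} (\<lambda>_. uniform01) \<partial>PiM {1..n} (\<lambda>_. lborel))"
      unfolding G_def by (intro nn_integral_cong arg_cong[where f=g]) (auto simp: fun_eq_iff)
    also have "\<dots> = (\<integral>\<^sup>+y. g (y(0 := (0, u))) \<partial>PiM {1..n} (\<lambda>_. vmeas))"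
      by (intro nn_integral_PiM_pair m lborel.sigma_finite_measure_axioms uniform01.sigma_finite_measure_axioms) auto
    finally show "(\<integral>\<^sup>+z. \<integral>\<^sup>+w. G z u w \<partial>PiM {1..n} (\<lambda>_. uniform01) \<partial>PiM {1..n} (\<lambda>_. lborel)) =
        (\<integral>\<^sup>+y. g (y(0 := (0, u))) \<partial>PiM {1..n} (\<lambda>_. vmeas))" .
  qed
  also have "\<dots> = (\<integral>\<^sup>+u. \<integral>\<^sup>+z. ennreal (\<Prod>l<n. L ((z(0 := (0, u))) l) ((z(0 := (0, u))) (Suc l))) * f (z(0 := (0, u)))
        \<partial>PiM {1..n} (\<lambda>_. vmeas) \<partial>uniform01)"
    by (simp only: g_def)
  finally show "(\<integral>\<^sup>+\<omega>. \<integral>\<^sup>+\<tau>. ?F \<tau> \<omega> \<partial>count_space (injections {1..n}) \<partial>palm_law N) =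
    (\<integral>\<^sup>+u. \<integral>\<^sup>+z. ennreal (\<Prod>l<n. L ((z(0 := (0, u))) l) ((z(0 := (0, u))) (Suc l))) * f (z(0 := (0, u)))
        \<partial>PiM {1..n} (\<lambda>_. vmeas) \<partial>uniform01)" .
  interpret sigma_finite_measure "count_space (injections {1..n})" by (rule sigma_finite_injections) simp
  define F where "F \<tau> \<omega> = ?F \<tau> \<omega>" for \<tau> \<omega>
  have "case_prod F \<in> borel_measurable (count_space (injections {1..n}) \<Otimes>\<^sub>M palm_law N)"
  proof (rule measurable_pair_measure_countable1[OF countable_injections[OF finite_atLeastAtMost]])
    fix \<tau> assume "\<tau> \<in> injections {1..n}"
    from conjunct1[OF both[OF this]] show "(\<lambda>\<omega>. case_prod F (\<tau>, \<omega>)) \<in> borel_measurable (palm_law N)"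
      unfolding prod.case F_def .
  qed
  from borel_measurable_nn_integral[of "\<lambda>\<omega> \<tau>. F \<tau> \<omega>", OF measurable_pair_swap[OF this, unfolded prod.case]]
  have "(\<lambda>\<omega>. \<integral>\<^sup>+\<tau>. F \<tau> \<omega> \<partial>count_space (injections {1..n})) \<in> borel_measurable (palm_law N)" .
  then show "(\<lambda>\<omega>. \<integral>\<^sup>+\<tau>. ?F \<tau> \<omega> \<partial>count_space (injections {1..n})) \<in> borel_measurable (palm_law N)"
    by (simp only: F_def)
qed

end

section \<open>Convolution estimates\<close>

lemma rho_nonneg [simp]: "0 \<le> rho \<delta> t" and rho_le_1 [simp]: "rho \<delta> t \<le> 1"
  by (auto simp: rho_def)

lemma rho_eq_1: "0 \<le> t \<Longrightarrow> t \<le> 1 \<Longrightarrow> 0 < \<delta> \<Longrightarrow> rho \<delta> t = 1"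
  by (auto simp: rho_def powr_minus field_simps min_def powr_le1 not_le)

lemma rho_le_powr: "0 < t \<Longrightarrow> rho \<delta> t \<le> t powr (- \<delta>)"
  by (auto simp: rho_def)

lemma rho_eq_powr: "1 \<le> t \<Longrightarrow> 0 < \<delta> \<Longrightarrow> rho \<delta> t = t powr (- \<delta>)"
  using powr_mono2'[of "-\<delta>" 1 t] by (auto simp: rho_def)

lemma rho_antimono: "0 \<le> s \<Longrightarrow> s \<le> t \<Longrightarrow> 0 < \<delta> \<Longrightarrow> rho \<delta> t \<le> rho \<delta> s"
  using powr_mono2'[of "-\<delta>" s t] by (auto simp: rho_def min_le_iff_disj)

lemma measurable_rho [measurable]: "rho \<delta> \<in> borel_measurable borel"
  unfolding rho_def by measurable

lemma nn_integral_powr_Icc: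
  fixes a c :: real
  assumes "a < 1" "0 \<le> c"
  shows "(\<integral>\<^sup>+u. ennreal (u powr (- a)) * indicator {0..c} u \<partial>lborel) = ennreal (c powr (1 - a) / (1 - a))"
proof -
  have "((\<lambda>u. u powr (- a)) has_integral (c powr (- a + 1) / (- a + 1))) {0..c}"
    using assms by (intro has_integral_powr_from_0) auto
  then have "((\<lambda>u. if u \<in> {0..c} then u powr (- a) else 0) has_integral (c powr (1 - a) / (1 - a))) UNIV"
    by (simp only: has_integral_restrict_UNIV) (simp add: add.commute)
  then have "(\<integral>\<^sup>+u. ennreal (if u \<in> {0..c} then u powr (- a) else 0) \<partial>lborel) = ennreal (c powr (1 - a) / (1 - a))"
    by (intro nn_integral_has_integral_lborel) auto
  moreover have "ennreal (if u \<in> {0..c} then u powr (- a) else 0) = ennreal (u powr (- a)) * indicator {0..c} u" for u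
    by auto
  ultimately show ?thesis by simp
qed

lemma nn_integral_uniform01_powr:
  assumes "a < 1" shows "(\<integral>\<^sup>+u. ennreal (u powr (- a)) \<partial>uniform01) = ennreal (1 / (1 - a))"
proof -
  have "(\<integral>\<^sup>+u. ennreal (u powr (- a)) \<partial>uniform01) = (\<integral>\<^sup>+u. ennreal (u powr (- a)) * indicator {0..1} u \<partial>lborel)"
    by (subst nn_integral_uniform01, simp, rule nn_integral_cong_AE)
       (use AE_lborel_singleton[of 0] AE_lborel_singleton[of 1] in \<open>eventually_elim; auto split: split_indicator\<close>)
  then show ?thesis using nn_integral_powr_Icc[OF assms, of 1] by simp
qed

lemma nn_integral_uniform01_powr_less:
  assumes "a < 1" "0 \<le> c"
  shows "(\<integral>\<^sup>+u. ennreal (u powr (- a)) * of_bool (u < c) \<partial>uniform01) \<le> ennreal (c powr (1 - a) / (1 - a))"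
proof -
  have "(\<integral>\<^sup>+u. ennreal (u powr (- a)) * of_bool (u < c) \<partial>uniform01) \<le>
      (\<integral>\<^sup>+u. ennreal (u powr (- a)) * indicator {0..c} u \<partial>lborel)"
    by (subst nn_integral_uniform01, simp, rule nn_integral_mono) (auto split: split_indicator)
  then show ?thesis using nn_integral_powr_Icc[OF assms] by simp
qed

section \<open>Integrals of kernels with polynomial decay\<close>

lemma emeasure_norm_power_less:
  fixes c :: "'a::euclidean_space"
  assumes "0 \<le> s"
  shows "emeasure lborel {x. norm (x - c) ^ DIM('a) < s} = ennreal (measure lborel (ball (0::'a) 1) * s)"
proof -
  define r where "r = root DIM('a) s"
  have r: "r \<ge> 0" "r ^ DIM('a) = s" using assms by (auto simp: r_def)
  have "norm (x - c) ^ DIM('a) < s \<longleftrightarrow> dist c x < r" for x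
    unfolding r(2)[symmetric] using r(1) power_mono_iff[of r "norm (x - c)" "DIM('a)"]
    by (simp add: dist_norm norm_minus_commute linorder_not_le[symmetric])
  then have "{x. norm (x - c) ^ DIM('a) < s} = ball c r" unfolding ball_def by simp
  then show ?thesis using r by (simp add: emeasure_ball content_ball)
qed

text \<open>Layer-cake formula: the set where \<open>f\<close> exceeds a level \<tau> < h lies in a
  ball of volume \<open>T * \<tau> powr - (1/\<delta>)\<close> times that of the unit ball, and
  levels from h on are not exceeded. The cap h covers two uses: h = 1 for a whole kernel, h = its
  height at distance r for its tail.\<close>

lemma nn_integral_power_decay_bound:
  fixes c :: "'a::euclidean_space" and f :: "'a \<Rightarrow> real"
  assumes f[measurable]: "f \<in> borel_measurable borel" and "\<delta> > 1" "T > 0" "0 \<le> h"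
    and h: "\<And>x. f x \<le> h" and T: "\<And>x. x \<noteq> c \<Longrightarrow> f x \<le> (norm (x - c) ^ DIM('a) / T) powr (- \<delta>)"
  shows "(\<integral>\<^sup>+x. ennreal (f x) \<partial>lborel) \<le>
    ennreal (measure lborel (ball (0::'a) 1) * T * (\<delta> / (\<delta> - 1)) * h powr (1 - 1 / \<delta>))"
proof -
  let ?v = "measure lborel (ball (0::'a) 1)"
  have "(\<integral>\<^sup>+x. ennreal (f x) \<partial>lborel) = (\<integral>\<^sup>+x. \<integral>\<^sup>+\<tau>. indicator {p. 0 < snd p \<and> snd p < f (fst p)} (x, \<tau>) \<partial>lborel \<partial>lborel)"
  proof (intro nn_integral_cong)
    fix x
    have "(\<integral>\<^sup>+\<tau>. indicator {p. 0 < snd p \<and> snd p < f (fst p)} (x, \<tau>) \<partial>lborel) = (\<integral>\<^sup>+\<tau>. indicator {0<..<f x} \<tau> \<partial>lborel)"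
      by (intro nn_integral_cong) (auto split: split_indicator)
    also have "\<dots> = ennreal (f x)"
      by (cases "f x \<ge> 0") (auto simp: ennreal_neg)
    finally show "ennreal (f x) = (\<integral>\<^sup>+\<tau>. indicator {p. 0 < snd p \<and> snd p < f (fst p)} (x, \<tau>) \<partial>lborel)" ..
  qed
  also have "\<dots> = (\<integral>\<^sup>+\<tau>. \<integral>\<^sup>+x. indicator {p. 0 < snd p \<and> snd p < f (fst p)} (x, \<tau>) \<partial>lborel \<partial>lborel)"
  proof (rule lborel_pair.Fubini'[symmetric])
    have "{p. 0 < snd p \<and> snd p < f (fst p)} = {p \<in> space (borel \<Otimes>\<^sub>M borel). 0 < snd p \<and> snd p < f (fst p)}"
      by (auto simp: space_pair_measure)
    also have "\<dots> \<in> sets (borel \<Otimes>\<^sub>M borel)" by measurable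
    finally show "(\<lambda>(x, \<tau>). indicator {p. 0 < snd p \<and> snd p < f (fst p)} (x, \<tau>) :: ennreal) \<in> borel_measurable (lborel \<Otimes>\<^sub>M lborel)"
      by (simp add: borel_measurable_indicator_iff cong: measurable_cong_sets)
  qed
  also have "\<dots> \<le> (\<integral>\<^sup>+\<tau>. ennreal (?v * T) * (ennreal (\<tau> powr (- (1 / \<delta>))) * indicator {0..h} \<tau>) \<partial>lborel)"
  proof (intro nn_integral_mono)
    fix \<tau> :: real
    show "(\<integral>\<^sup>+x. indicator {p. 0 < snd p \<and> snd p < f (fst p)} (x, \<tau>) \<partial>lborel)
        \<le> ennreal (?v * T) * (ennreal (\<tau> powr (- (1 / \<delta>))) * indicator {0..h} \<tau>)"
    proof (cases "0 < \<tau> \<and> \<tau> \<le> h")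
      case False
      then have "indicator {p. 0 < snd p \<and> snd p < f (fst p)} (x, \<tau>) = (0 :: ennreal)" for x
        using h[of x] by (auto split: split_indicator)
      then show ?thesis by simp
    next
      case \<tau>: True
      \<comment> \<open>The decay hypothesis is silent at the centre, where the norm vanishes;
        elsewhere it is inverted.\<close>
      have sub: "norm (x - c) ^ DIM('a) < T * \<tau> powr (- (1 / \<delta>))" if "\<tau> < f x" for x
      proof (cases "x = c")
        case True
        then show ?thesis using \<tau> \<open>T > 0\<close> by (simp add: power_0_left)
      next
        case False
        define s where "s = norm (x - c) ^ DIM('a) / T"
        have "s > 0" using False \<open>T > 0\<close> by (simp add: s_def)
        have "\<tau> < s powr (- \<delta>)" using T[OF False] that by (simp add: s_def)
        then have "(s powr (- \<delta>)) powr (- (1 / \<delta>)) < \<tau> powr (- (1 / \<delta>))"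
          using \<tau> \<open>\<delta> > 1\<close> by (intro powr_less_mono2_neg) auto
        then have "s < \<tau> powr (- (1 / \<delta>))" using \<open>s > 0\<close> \<open>\<delta> > 1\<close> by (simp add: powr_powr)
        then show ?thesis using \<open>T > 0\<close> by (simp add: s_def field_simps)
      qed
      have "(\<integral>\<^sup>+x. indicator {p. 0 < snd p \<and> snd p < f (fst p)} (x, \<tau>) \<partial>lborel) \<le>
          (\<integral>\<^sup>+x. indicator {x. norm (x - c) ^ DIM('a) < T * \<tau> powr (- (1 / \<delta>))} x \<partial>lborel)"
        using sub by (intro nn_integral_mono) (auto split: split_indicator)
      also have "\<dots> = ennreal (?v * (T * \<tau> powr (- (1 / \<delta>))))"
        using \<open>T > 0\<close> by (subst emeasure_norm_power_less[symmetric]) auto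
      also have "\<dots> = ennreal (?v * T) * (ennreal (\<tau> powr (- (1 / \<delta>))) * indicator {0..h} \<tau>)"
        using \<tau> \<open>T > 0\<close> by (simp add: ennreal_mult mult.assoc)
      finally show ?thesis .
    qed
  qed
  also have "\<dots> = ennreal (?v * T) * ennreal (h powr (1 - 1 / \<delta>) / (1 - 1 / \<delta>))"
    using assms by (subst nn_integral_cmult) (auto simp: nn_integral_powr_Icc)
  also have "\<dots> = ennreal (?v * T * (\<delta> / (\<delta> - 1)) * h powr (1 - 1 / \<delta>))"
    using assms by (subst ennreal_mult[symmetric]) (auto simp: field_simps)
  finally show ?thesis .
qed

text \<open>The argument \<open>ty\<close> fixes the space, through which dimension and unit ball
  enter the constants. \<open>subcritical\<close> is 1/\<delta> < 1/\<gamma> - 1 multiplied by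
  \<gamma>.\<close>

locale soft_boolean_parameters =
  fixes ty :: "'a::euclidean_space itself" and \<beta> \<gamma> \<delta> :: real
  assumes \<beta>: "0 < \<beta>" and \<gamma>: "0 < \<gamma>" "\<gamma> < 1" and \<delta>: "1 < \<delta>"
    and subcritical: "\<gamma> + \<gamma> / \<delta> < 1"
begin

definition kap :: real where "kap = \<beta> * measure lborel (ball (0::'a) 1) * (\<delta> / (\<delta> - 1))"
definition th :: real where "th = \<gamma> + \<gamma> / \<delta>"
definition M :: real where "M = 1 / (1 - th)"

text \<open>
  \<open>kap * u powr -\<gamma> * v powr -(\<gamma>/\<delta>)\<close> is the integral over one position of the kernel \<open>kst\<close> between marks
  \<open>u \<le> v\<close>, and \<open>M\<close> is the integral of \<open>u powr -th\<close> over \<open>(0,1)\<close>; it is finite because \<open>th < 1\<close>.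
  The connection probability \<open>lam\<close> of the enlarged graph is at most \<open>kst\<close>.
\<close>

definition soft :: "'a \<times> real \<Rightarrow> 'a \<times> real \<Rightarrow> real" where
  "soft p q = inverse \<beta> * min (snd p) (snd q) powr \<gamma> * max (snd p) (snd q) powr (\<gamma> / \<delta>) * norm (fst p - fst q) ^ DIM('a)"

definition kst :: "'a \<times> real \<Rightarrow> 'a \<times> real \<Rightarrow> real" where "kst p q = rho \<delta> (soft p q)"

definition lam :: "'a \<times> real \<Rightarrow> 'a \<times> real \<Rightarrow> real" where
  "lam p q = (if soft p q \<le> 1 then 1 else
    rho \<delta> (inverse \<beta> * min (snd p) (snd q) powr \<gamma> * norm (fst p - fst q) ^ DIM('a)))"

lemma kap_pos: "0 < kap" and th: "0 < th" "th < 1" and M_ge_1: "1 \<le> M"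
proof -
  have "measure lborel (ball (0::'a) 1) > 0" by (simp add: content_ball)
  then show "0 < kap" using \<beta> \<delta> by (simp add: kap_def)
  show "0 < th" "th < 1" using \<gamma> \<delta> subcritical by (auto simp: th_def add_pos_pos)
  then show "1 \<le> M" by (simp add: M_def field_simps)
qed

lemma soft_nonneg [simp]: "0 \<le> soft p q"
  using \<beta> by (simp add: soft_def)

lemma soft_commute: "soft p q = soft q p"
  by (simp add: soft_def min.commute max.commute norm_minus_commute)

lemma kst_commute: "kst p q = kst q p"
  by (simp add: kst_def soft_commute)

lemma kst_nonneg [simp]: "0 \<le> kst p q" and kst_le_1 [simp]: "kst p q \<le> 1"
  by (auto simp: kst_def)

lemma lam_nonneg [simp]: "0 \<le> lam p q" and lam_le_1 [simp]: "lam p q \<le> 1"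
  by (auto simp: lam_def)

lemma measurable_soft [measurable]: "(\<lambda>(p, q). soft p q) \<in> borel_measurable ((borel \<Otimes>\<^sub>M borel) \<Otimes>\<^sub>M (borel \<Otimes>\<^sub>M borel))"
  unfolding soft_def by measurable

lemma measurable_kst [measurable]: "(\<lambda>(p, q). kst p q) \<in> borel_measurable ((borel \<Otimes>\<^sub>M borel) \<Otimes>\<^sub>M (borel \<Otimes>\<^sub>M borel))"
  unfolding kst_def by measurable

lemma measurable_lam [measurable]: "(\<lambda>(p, q). lam p q) \<in> borel_measurable ((borel \<Otimes>\<^sub>M borel) \<Otimes>\<^sub>M (borel \<Otimes>\<^sub>M borel))"
  unfolding lam_def by measurable

lemma measurable_kst_position [measurable]: "(\<lambda>x. kst p (x, v)) \<in> borel_measurable borel"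
  unfolding kst_def soft_def fst_conv snd_conv by measurable

text \<open>Where \<open>soft\<close> is at most 1 both sides are 1. Elsewhere \<open>soft\<close>
  differs from the argument of the model by a power of a mark below 1, which can only decrease the
  argument of the antitone \<open>rho\<close>.\<close>

lemma lam_le_kst:
  assumes "0 < snd p" "snd p < 1" "0 < snd q" "snd q < 1" shows "lam p q \<le> kst p q"
proof (cases "soft p q \<le> 1")
  case True
  then show ?thesis using \<delta> by (simp add: lam_def kst_def rho_eq_1)
next
  case False
  have "max (snd p) (snd q) powr (\<gamma> / \<delta>) \<le> 1"
    using assms \<gamma> \<delta> by (intro powr_le1) auto
  then have "soft p q \<le> inverse \<beta> * min (snd p) (snd q) powr \<gamma> * norm (fst p - fst q) ^ DIM('a)"
    unfolding soft_def using \<beta>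
    by (intro mult_right_mono mult_right_le_one_le) auto
  then show ?thesis using False \<delta> by (auto simp: lam_def kst_def intro!: rho_antimono)
qed

lemma soft_powr:
  assumes "0 < u" "0 < w" "0 < s"
  shows "(inverse \<beta> * u powr \<gamma> * w powr (\<gamma> / \<delta>) * s) powr (- \<delta>) =
    \<beta> powr \<delta> * u powr (- (\<gamma> * \<delta>)) * w powr (- \<gamma>) * s powr (- \<delta>)"
proof -
  have "inverse \<beta> powr (- \<delta>) = \<beta> powr \<delta>"
    using \<beta> by (simp add: powr_minus inverse_eq_divide powr_divide)
  then show ?thesis using assms \<beta> \<delta> by (simp add: powr_mult powr_powr)
qed

text \<open>For fixed marks \<open>soft\<close> is the d-th power of the distance divided by T, so
  the decay bound applies with cap 1.\<close>

lemma nn_integral_kst_le: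
  assumes "0 < snd p" "0 < v"
  shows "(\<integral>\<^sup>+x. ennreal (kst p (x, v)) \<partial>lborel) \<le>
    ennreal (kap * min (snd p) v powr (- \<gamma>) * max (snd p) v powr (- (\<gamma> / \<delta>)))"
proof -
  define T where "T = \<beta> * min (snd p) v powr (- \<gamma>) * max (snd p) v powr (- (\<gamma> / \<delta>))"
  have T: "T > 0" using assms \<beta> by (simp add: T_def min_def max_def)
  have s: "soft p (x, v) = norm (x - fst p) ^ DIM('a) / T" for x
    using assms \<beta> by (simp add: soft_def T_def norm_minus_commute powr_minus field_simps)
  have "(\<integral>\<^sup>+x. ennreal (kst p (x, v)) \<partial>lborel) \<le>
      ennreal (measure lborel (ball (0::'a) 1) * T * (\<delta> / (\<delta> - 1)) * 1 powr (1 - 1 / \<delta>))"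
  proof (rule nn_integral_power_decay_bound[OF measurable_kst_position \<delta> T])
    fix x assume "x \<noteq> fst p"
    then show "kst p (x, v) \<le> (norm (x - fst p) ^ DIM('a) / T) powr (- \<delta>)"
      unfolding kst_def s using T by (intro rho_le_powr) auto
  qed auto
  also have "\<dots> = ennreal (kap * min (snd p) v powr (- \<gamma>) * max (snd p) v powr (- (\<gamma> / \<delta>)))"
    by (simp add: kap_def T_def mult_ac)
  finally show ?thesis .
qed

definition psi :: "real \<Rightarrow> real \<Rightarrow> real" where
  "psi u v = min u v powr (- (\<gamma> * \<delta>)) * max u v powr (- \<gamma>)"

text \<open>Beyond distance r the kernel is at most \<open>(r / T) powr - \<delta>\<close>, which
  serves as the cap. One factor T from the volume and \<open>T powr (\<delta> - 1)\<close> from the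
  cap combine to \<open>T powr \<delta>\<close>, whose dependence on the marks is
  \<open>psi\<close>.\<close>

lemma nn_integral_kst_tail_le:
  assumes "0 < snd p" "0 < v" "0 < r"
  shows "(\<integral>\<^sup>+x. ennreal (kst p (x, v)) * of_bool (r \<le> norm (fst p - x) ^ DIM('a)) \<partial>lborel) \<le>
    ennreal (kap * \<beta> powr (\<delta> - 1) * r powr (1 - \<delta>) * psi (snd p) v)"
proof -
  define T where "T = \<beta> * min (snd p) v powr (- \<gamma>) * max (snd p) v powr (- (\<gamma> / \<delta>))"
  define f where "f x = kst p (x, v) * of_bool (r \<le> norm (fst p - x) ^ DIM('a))" for x
  have T: "T > 0" using assms \<beta> by (simp add: T_def min_def max_def)
  have s: "soft p (x, v) = norm (x - fst p) ^ DIM('a) / T" for x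
    using assms \<beta> by (simp add: soft_def T_def norm_minus_commute powr_minus field_simps)
  have m: "f \<in> borel_measurable borel" unfolding f_def by measurable
  have le: "f x \<le> (norm (x - fst p) ^ DIM('a) / T) powr (- \<delta>)" if "x \<noteq> fst p" for x
    using that T rho_le_powr[of "norm (x - fst p) ^ DIM('a) / T" \<delta>] by (simp add: f_def kst_def s)
  have "(\<integral>\<^sup>+x. ennreal (f x) \<partial>lborel) \<le>
      ennreal (measure lborel (ball (0::'a) 1) * T * (\<delta> / (\<delta> - 1)) * ((r / T) powr (- \<delta>)) powr (1 - 1 / \<delta>))"
  proof (rule nn_integral_power_decay_bound[OF m \<delta> T _ _ le])
    fix x
    show "f x \<le> (r / T) powr (- \<delta>)"
    proof (cases "r \<le> norm (fst p - x) ^ DIM('a)")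
      case True
      then have "x \<noteq> fst p" using assms by (auto simp: power_0_left)
      from le[OF this] have "f x \<le> (norm (x - fst p) ^ DIM('a) / T) powr (- \<delta>)" .
      also have "\<dots> \<le> (r / T) powr (- \<delta>)"
        using True T assms \<delta> by (intro powr_mono2') (auto simp: norm_minus_commute divide_right_mono)
      finally show ?thesis .
    qed (auto simp: f_def)
  qed auto
  also have "((r / T) powr (- \<delta>)) powr (1 - 1 / \<delta>) = T powr (\<delta> - 1) * r powr (1 - \<delta>)"
  proof -
    have "- \<delta> * (1 - 1 / \<delta>) = 1 - \<delta>" using \<delta> by (simp add: field_simps)
    then have "((r / T) powr (- \<delta>)) powr (1 - 1 / \<delta>) = (r / T) powr (1 - \<delta>)"
      by (simp only: powr_powr)
    also have "\<dots> = T powr (\<delta> - 1) * r powr (1 - \<delta>)"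
      using T assms by (simp add: powr_divide powr_minus[of T "\<delta> - 1", simplified] field_simps)
    finally show ?thesis .
  qed
  also have "measure lborel (ball (0::'a) 1) * T * (\<delta> / (\<delta> - 1)) * (T powr (\<delta> - 1) * r powr (1 - \<delta>)) =
      kap * \<beta> powr (\<delta> - 1) * r powr (1 - \<delta>) * psi (snd p) v"
  proof -
    have "T * T powr (\<delta> - 1) = T powr \<delta>" using T by (simp add: powr_diff)
    also have "T powr \<delta> = \<beta> powr \<delta> * psi (snd p) v"
      unfolding T_def psi_def using assms \<beta> \<delta> by (simp add: powr_mult powr_powr)
    also have "\<beta> powr \<delta> = \<beta> * \<beta> powr (\<delta> - 1)" using \<beta> by (simp add: powr_diff)
    finally show ?thesis by (simp add: kap_def mult_ac)
  qed
  finally show ?thesis by (simp add: f_def ennreal_mult' cong: nn_integral_cong_simp) (simp add: f_def ennreal_mult'' of_bool_def if_distrib cong: if_cong)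
qed

text \<open>The middle vertex is at least half the distance of the ends away from a or from b. The
  kernel towards that end is replaced by its power law at half distance, and the other kernel is
  integrated. Since \<open>1 < soft a b\<close>, \<open>kst a b\<close> is itself a power law, so
  the result can be written with it. The two alternatives turn \<open>2 powr (d * \<delta>)\<close>
  into \<open>2 powr (d * \<delta> + 1)\<close>.\<close>

lemma nn_integral_kst_convolution_ordered:
  assumes a: "0 < snd a" "snd a \<le> snd b" and w: "snd b \<le> w" and far: "1 < soft a b"
  shows "(\<integral>\<^sup>+z. ennreal (kst a (z, w) * kst (z, w) b) \<partial>lborel) \<le>
    ennreal (2 powr (DIM('a) * \<delta> + 1) * kap * w powr (- th) * kst a b)"
proof -
  let ?D = "norm (fst a - fst b)" and ?d = "DIM('a)"
  have b: "0 < snd b" and w0: "0 < w" using a w by auto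
  have D: "?D > 0" using far by (auto simp: soft_def power_0_left)
  \<comment> \<open>The power law between a vertex of mark u and one of mark w, for u at most w, at
    half the distance of a and b.\<close>
  define K where "K u = \<beta> powr \<delta> * u powr (- (\<gamma> * \<delta>)) * w powr (- \<gamma>) * ((?D / 2) ^ ?d) powr (- \<delta>)" for u
  have K: "kst p (z, w) \<le> K (snd p)" if "?D / 2 \<le> norm (fst p - z)" "0 < snd p" "snd p \<le> w" for p z
  proof -
    have "(?D / 2) ^ ?d \<le> norm (fst p - z) ^ ?d" using that D by (intro power_mono) auto
    then have "inverse \<beta> * snd p powr \<gamma> * w powr (\<gamma> / \<delta>) * (?D / 2) ^ ?d \<le> soft p (z, w)"
      unfolding soft_def using that \<beta> by (simp add: min_def max_def mult_left_mono)
    moreover have pos: "0 < inverse \<beta> * snd p powr \<gamma> * w powr (\<gamma> / \<delta>) * (?D / 2) ^ ?d"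
      using that \<beta> D w0 by simp
    ultimately have "kst p (z, w) \<le> rho \<delta> (inverse \<beta> * snd p powr \<gamma> * w powr (\<gamma> / \<delta>) * (?D / 2) ^ ?d)"
      unfolding kst_def using \<delta> by (intro rho_antimono) auto
    also have "\<dots> \<le> (inverse \<beta> * snd p powr \<gamma> * w powr (\<gamma> / \<delta>) * (?D / 2) ^ ?d) powr (- \<delta>)"
      using pos by (rule rho_le_powr)
    also have "\<dots> = K (snd p)" unfolding K_def using that w0 D by (intro soft_powr) auto
    finally show ?thesis .
  qed
  have K0: "0 \<le> K u" for u using \<beta> by (simp add: K_def)
  have X: "kst a b = \<beta> powr \<delta> * snd a powr (- (\<gamma> * \<delta>)) * snd b powr (- \<gamma>) * (?D ^ ?d) powr (- \<delta>)"
    using far \<delta> a b D soft_powr[of "snd a" "snd b" "?D ^ ?d"]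
    by (simp add: kst_def rho_eq_powr soft_def min_def max_def)
  have half: "((?D / 2) ^ ?d) powr (- \<delta>) = 2 powr (?d * \<delta>) * (?D ^ ?d) powr (- \<delta>)"
    using D by (simp add: powr_divide power_divide powr_minus powr_realpow[symmetric] powr_powr field_simps)
  have ww: "w powr (- th) = w powr (- \<gamma>) * w powr (- (\<gamma> / \<delta>))"
    unfolding th_def using w0 by (simp add: powr_add[symmetric])
  \<comment> \<open>The marks trade places: K supplies the power -\<gamma> of w where
    \<open>kst a b\<close> has that of b, and the integral over the kernel at b supplies the missing
    one.\<close>
  have e1: "K (snd a) * (kap * snd b powr (- \<gamma>) * w powr (- (\<gamma> / \<delta>))) =
      2 powr (?d * \<delta>) * kap * w powr (- th) * kst a b"
    unfolding K_def X half ww by (simp add: mult_ac)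
  \<comment> \<open>If instead the middle vertex is far from b, the marks of a and b appear with
    exchanged exponents. As a has the smaller mark and \<delta> > 1, this is the smaller
    term.\<close>
  have "snd b powr (- (\<gamma> * \<delta>)) * snd a powr (- \<gamma>) \<le> snd a powr (- (\<gamma> * \<delta>)) * snd b powr (- \<gamma>)"
  proof -
    have "snd b powr (- (\<gamma> * (\<delta> - 1))) \<le> snd a powr (- (\<gamma> * (\<delta> - 1)))"
      using a \<gamma> \<delta> by (intro powr_mono2') auto
    then have "snd b powr (- (\<gamma> * (\<delta> - 1))) * (snd a powr (- \<gamma>) * snd b powr (- \<gamma>)) \<le>
        snd a powr (- (\<gamma> * (\<delta> - 1))) * (snd a powr (- \<gamma>) * snd b powr (- \<gamma>))"
      by (intro mult_right_mono) auto
    moreover have split: "u powr (- (\<gamma> * \<delta>)) = u powr (- (\<gamma> * (\<delta> - 1))) * u powr (- \<gamma>)" if "0 < u" for u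
      using that by (simp add: powr_add[symmetric] algebra_simps)
    ultimately show ?thesis
      unfolding split[OF a(1)] split[OF b] by (simp only: mult_ac)
  qed
  then have e2: "K (snd b) * (kap * snd a powr (- \<gamma>) * w powr (- (\<gamma> / \<delta>))) \<le>
      2 powr (?d * \<delta>) * kap * w powr (- th) * kst a b"
  proof -
    assume "snd b powr (- (\<gamma> * \<delta>)) * snd a powr (- \<gamma>) \<le> snd a powr (- (\<gamma> * \<delta>)) * snd b powr (- \<gamma>)"
    then have "(2 powr (?d * \<delta>) * kap * w powr (- th) * \<beta> powr \<delta> * (?D ^ ?d) powr (- \<delta>)) *
        (snd b powr (- (\<gamma> * \<delta>)) * snd a powr (- \<gamma>)) \<le>
        (2 powr (?d * \<delta>) * kap * w powr (- th) * \<beta> powr \<delta> * (?D ^ ?d) powr (- \<delta>)) *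
        (snd a powr (- (\<gamma> * \<delta>)) * snd b powr (- \<gamma>))"
      using kap_pos by (intro mult_left_mono) auto
    then show ?thesis unfolding K_def X half ww by (simp add: mult_ac)
  qed
  have "(\<integral>\<^sup>+z. ennreal (kst a (z, w) * kst (z, w) b) \<partial>lborel) \<le>
      (\<integral>\<^sup>+z. ennreal (K (snd a)) * ennreal (kst b (z, w)) + ennreal (K (snd b)) * ennreal (kst a (z, w)) \<partial>lborel)"
  proof (intro nn_integral_mono)
    fix z
    have "?D \<le> norm (fst a - z) + norm (fst b - z)"
      using norm_triangle_ineq[of "fst a - z" "z - fst b"] by (simp add: norm_minus_commute)
    then consider "?D / 2 \<le> norm (fst a - z)" | "?D / 2 \<le> norm (fst b - z)" by linarith
    then have "kst a (z, w) * kst (z, w) b \<le> K (snd a) * kst b (z, w) + K (snd b) * kst a (z, w)"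
    proof cases
      case 1
      then have "kst a (z, w) * kst b (z, w) \<le> K (snd a) * kst b (z, w)"
        using a w by (intro mult_right_mono K) auto
      then show ?thesis using K0[of "snd b"] by (simp add: kst_commute[of _ b] add_increasing2)
    next
      case 2
      then have "kst b (z, w) * kst a (z, w) \<le> K (snd b) * kst a (z, w)"
        using b w by (intro mult_right_mono K) auto
      then show ?thesis using K0[of "snd a"] by (simp add: kst_commute[of _ b] mult.commute add_increasing)
    qed
    then show "ennreal (kst a (z, w) * kst (z, w) b) \<le>
        ennreal (K (snd a)) * ennreal (kst b (z, w)) + ennreal (K (snd b)) * ennreal (kst a (z, w))"
      using K0 by (simp add: ennreal_mult[symmetric] ennreal_plus[symmetric] del: ennreal_plus)
  qed
  also have "\<dots> = ennreal (K (snd a)) * (\<integral>\<^sup>+z. ennreal (kst b (z, w)) \<partial>lborel) +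
      ennreal (K (snd b)) * (\<integral>\<^sup>+z. ennreal (kst a (z, w)) \<partial>lborel)"
    by (subst nn_integral_add) (auto simp: nn_integral_cmult)
  also have "\<dots> \<le> ennreal (K (snd a)) * ennreal (kap * snd b powr (- \<gamma>) * w powr (- (\<gamma> / \<delta>))) +
      ennreal (K (snd b)) * ennreal (kap * snd a powr (- \<gamma>) * w powr (- (\<gamma> / \<delta>)))"
    using nn_integral_kst_le[of b w] nn_integral_kst_le[of a w] a b w w0
    by (intro add_mono mult_left_mono) (auto simp: min_def max_def split: if_splits)
  also have "\<dots> = ennreal (K (snd a) * (kap * snd b powr (- \<gamma>) * w powr (- (\<gamma> / \<delta>))) +
      K (snd b) * (kap * snd a powr (- \<gamma>) * w powr (- (\<gamma> / \<delta>))))"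
    using K0 kap_pos by (simp add: ennreal_mult[symmetric] ennreal_plus[symmetric] del: ennreal_plus)
  also have "\<dots> \<le> ennreal (2 powr (?d * \<delta> + 1) * kap * w powr (- th) * kst a b)"
  proof (intro ennreal_leI)
    have two: "2 powr (?d * \<delta> + 1) = 2 * 2 powr (?d * \<delta>)" by (simp add: powr_add)
    show "K (snd a) * (kap * snd b powr (- \<gamma>) * w powr (- (\<gamma> / \<delta>))) +
        K (snd b) * (kap * snd a powr (- \<gamma>) * w powr (- (\<gamma> / \<delta>))) \<le>
        2 powr (?d * \<delta> + 1) * kap * w powr (- th) * kst a b"
      unfolding e1 two using e2 by linarith
  qed
  finally show ?thesis .
qed

lemma nn_integral_kst_convolution:
  assumes "0 < snd a" "0 < snd b" and w: "max (snd a) (snd b) \<le> w" and far: "1 < soft a b"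
  shows "(\<integral>\<^sup>+z. ennreal (kst a (z, w) * kst (z, w) b) \<partial>lborel) \<le>
    ennreal (2 powr (DIM('a) * \<delta> + 1) * kap * w powr (- th) * kst a b)"
proof (cases "snd a \<le> snd b")
  case True
  then show ?thesis using assms by (intro nn_integral_kst_convolution_ordered) auto
next
  case False
  have "kst a (z, w) * kst (z, w) b = kst b (z, w) * kst (z, w) a" for z
    by (metis kst_commute mult.commute)
  then show ?thesis using nn_integral_kst_convolution_ordered[of b a w] False assms
    by (auto simp: kst_commute[of b a] soft_commute[of b a])
qed

end

section \<open>Paths ordered by their marks\<close>

text \<open>The mark is the outer variable because the kernel estimates integrate over the position
  at a fixed mark.\<close>

lemma nn_integral_vmeas:
  fixes f :: "'a::euclidean_space \<times> real \<Rightarrow> ennreal"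
  assumes "f \<in> borel_measurable vmeas"
  shows "(\<integral>\<^sup>+c. f c \<partial>vmeas) = (\<integral>\<^sup>+w. \<integral>\<^sup>+z. f (z, w) \<partial>lborel \<partial>uniform01)"
proof -
  interpret pair_sigma_finite "lborel :: 'a measure" uniform01 ..
  show ?thesis using nn_integral_snd[OF assms] by simp
qed

lemma AE_vmeas: "AE c in (vmeas :: ('a::euclidean_space \<times> real) measure). 0 < snd c \<and> snd c < 1"
proof -
  interpret pair_sigma_finite "lborel :: 'a measure" uniform01 ..
  have "AE x in (lborel :: 'a measure). AE u in uniform01. 0 < snd (x, u) \<and> snd (x, u) < 1"
    using AE_uniform01 by simp
  moreover have "{c \<in> space (vmeas :: ('a \<times> real) measure). 0 < snd c \<and> snd c < 1} \<in> sets vmeas" by measurable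
  ultimately show ?thesis by (subst AE_pair_iff[symmetric]) auto
qed

section \<open>Paths as sequences and integration over inner vertices\<close>

abbreviation path_space :: "(nat \<Rightarrow> 'a::euclidean_space \<times> real) measure" where
  "path_space \<equiv> PiM UNIV (\<lambda>_. borel \<Otimes>\<^sub>M borel)"

lemma measurable_mark [measurable]:
  "(\<lambda>p :: nat \<Rightarrow> 'a::euclidean_space \<times> real. snd (p i)) \<in> borel_measurable path_space"
  by (rule measurable_compose[of "\<lambda>p. p i" _ "borel \<Otimes>\<^sub>M borel"]) (auto intro: measurable_component_singleton)

lemma pred_mark_le [measurable]:
  "Measurable.pred path_space (\<lambda>p :: nat \<Rightarrow> 'a::euclidean_space \<times> real. snd (p i) \<le> snd (p j))"
  "Measurable.pred path_space (\<lambda>p :: nat \<Rightarrow> 'a::euclidean_space \<times> real. max (snd (p i)) (snd (p j)) \<le> snd (p k))"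
  "Measurable.pred path_space (\<lambda>p :: nat \<Rightarrow> 'a::euclidean_space \<times> real. c \<le> snd (p i))"
  unfolding pred_def
  by (intro borel_measurable_le borel_measurable_max measurable_mark borel_measurable_const)+

lemma sets_vmeas [measurable_cong]:
  "sets (vmeas :: ('a::euclidean_space \<times> real) measure) = sets (borel \<Otimes>\<^sub>M borel)"
  by (intro sets_pair_measure_cong) auto

lemma measurable_vmeas_mark [measurable]:
  "(\<lambda>c. snd c) \<in> borel_measurable (vmeas :: ('a::euclidean_space \<times> real) measure)"
  using measurable_snd[of "lborel :: 'a measure" uniform01] by simp

lemma pred_vmeas_mark [measurable]:
  "Measurable.pred (vmeas :: ('a::euclidean_space \<times> real) measure) (\<lambda>c. t \<le> snd c)"
  "Measurable.pred (vmeas :: ('a::euclidean_space \<times> real) measure) (\<lambda>c. snd c \<le> t)"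
  unfolding pred_def by (intro borel_measurable_le borel_measurable_const measurable_vmeas_mark)+

text \<open>All pieces of a path are functions of one total sequence; this records which vertices a
  piece looks at, so that pieces can be integrated separately.\<close>

definition depends_on :: "nat set \<Rightarrow> ((nat \<Rightarrow> 'v) \<Rightarrow> 'b) \<Rightarrow> bool" where
  "depends_on S G \<longleftrightarrow> (\<forall>p q. (\<forall>l\<in>S. p l = q l) \<longrightarrow> G p = G q)"

text \<open>Integration over the interior vertices of a path whose end points \<open>a\<close> and \<open>b\<close> have the
  indices \<open>i\<close> and \<open>j\<close>.\<close>

definition interior_integral ::
    "((nat \<Rightarrow> 'a::euclidean_space \<times> real) \<Rightarrow> ennreal) \<Rightarrow> nat \<Rightarrow> nat \<Rightarrow> 'a \<times> real \<Rightarrow> 'a \<times> real \<Rightarrow> ennreal" where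
  "interior_integral G i j a b = (\<integral>\<^sup>+z. G (z(i := a, j := b)) \<partial>PiM {i<..<j} (\<lambda>_. vmeas))"

interpretation vprod: product_sigma_finite "\<lambda>_ :: nat. vmeas :: ('a::euclidean_space \<times> real) measure" ..

lemma space_vmeas [simp]: "space (vmeas :: ('a::euclidean_space \<times> real) measure) = UNIV"
  by (simp add: space_pair_measure)

text \<open>Outside its index set an element of a product space has the constant value
  \<open>undefined\<close>, so every coordinate, even a foreign one, is measurable.\<close>

lemma measurable_vprod_component:
  assumes Z: "Z \<in> X \<rightarrow>\<^sub>M PiM I (\<lambda>_. vmeas)"
  shows "(\<lambda>x. Z x l) \<in> X \<rightarrow>\<^sub>M borel \<Otimes>\<^sub>M borel"
proof (cases "l \<in> I")
  case True
  then show ?thesis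
    using measurable_compose[OF Z measurable_component_singleton[OF True]] by (simp cong: measurable_cong_sets)
next
  case False
  have "Z x l = undefined" if "x \<in> space X" for x
    using measurable_space[OF Z that] False by (auto simp: space_PiM)
  then show ?thesis
    by (subst measurable_cong[where g="\<lambda>_. undefined"]) (auto intro!: measurable_const simp: space_pair_measure)
qed

lemma measurable_path_upd:
  assumes Z: "Z \<in> X \<rightarrow>\<^sub>M PiM I (\<lambda>_. vmeas)" and A: "A \<in> X \<rightarrow>\<^sub>M borel \<Otimes>\<^sub>M borel" and B: "B \<in> X \<rightarrow>\<^sub>M borel \<Otimes>\<^sub>M borel"
  shows "(\<lambda>x. (Z x)(i := A x, j := B x)) \<in> X \<rightarrow>\<^sub>M path_space"
proof (rule measurable_PiM_single')
  show "(\<lambda>x. ((Z x)(i := A x, j := B x)) l) \<in> X \<rightarrow>\<^sub>M borel \<Otimes>\<^sub>M borel" for l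
    using A B measurable_vprod_component[OF Z] by (cases "l = j"; cases "l = i") simp_all
qed (simp add: space_pair_measure)

lemma measurable_interior_integral [measurable (raw)]:
  assumes G: "G \<in> borel_measurable path_space"
    and A: "A \<in> X \<rightarrow>\<^sub>M borel \<Otimes>\<^sub>M borel" and B: "B \<in> X \<rightarrow>\<^sub>M borel \<Otimes>\<^sub>M borel"
  shows "(\<lambda>x. interior_integral G i j (A x) (B x)) \<in> borel_measurable X"
proof -
  interpret finite_product_sigma_finite "\<lambda>_ :: nat. vmeas :: ('a \<times> real) measure" "{i<..<j}" by unfold_locales simp
  have "(\<lambda>y. G ((snd y)(i := A (fst y), j := B (fst y)))) \<in> borel_measurable (X \<Otimes>\<^sub>M PiM {i<..<j} (\<lambda>_. vmeas))"
    using A B by (intro measurable_compose[OF measurable_path_upd G]) auto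
  from borel_measurable_nn_integral[of "\<lambda>x z. G (z(i := A x, j := B x))" X] this
  show ?thesis unfolding interior_integral_def by (simp add: split_beta')
qed

lemma interior_integral_mono:
  "(\<And>z. G (z(i := a, j := b)) \<le> G' (z(i := a, j := b))) \<Longrightarrow> interior_integral G i j a b \<le> interior_integral G' i j a b"
  unfolding interior_integral_def by (intro nn_integral_mono)

lemma measurable_interior_integrand:
  assumes G: "G \<in> borel_measurable path_space" and a: "a \<in> space (borel \<Otimes>\<^sub>M borel)" "b \<in> space (borel \<Otimes>\<^sub>M borel)"
  shows "(\<lambda>z. G (z(i := a, j := b))) \<in> borel_measurable (PiM I (\<lambda>_. vmeas))"
  using a by (intro measurable_compose[OF measurable_path_upd[where I=I] G]) auto

lemma space_vertex [simp]: "space (borel \<Otimes>\<^sub>M borel) = UNIV"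
  by (simp add: space_pair_measure)

lemma interior_integral_sum:
  assumes "finite K" "\<And>k. k \<in> K \<Longrightarrow> G k \<in> borel_measurable path_space"
  shows "interior_integral (\<lambda>p. \<Sum>k\<in>K. G k p) i j a b = (\<Sum>k\<in>K. interior_integral (G k) i j a b)"
  unfolding interior_integral_def using assms
  by (intro nn_integral_sum measurable_interior_integrand) auto

lemma interior_integral_add:
  assumes "G \<in> borel_measurable path_space" "G' \<in> borel_measurable path_space"
  shows "interior_integral (\<lambda>p. G p + G' p) i j a b = interior_integral G i j a b + interior_integral G' i j a b"
  unfolding interior_integral_def using assms
  by (intro nn_integral_add measurable_interior_integrand) auto

text \<open>A single step has no inner vertex: the product over the empty set is the point mass at
  the function that is \<open>undefined\<close> everywhere.\<close>

lemma interior_integral_Suc: 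
  "interior_integral G i (Suc i) a b = G ((\<lambda>_. undefined)(i := a, Suc i := b))"
proof -
  have "{i<..<Suc i} = {}" by auto
  then show ?thesis unfolding interior_integral_def
    by (simp add: PiM_empty nn_integral_count_space_finite fun_upd_def)
qed

text \<open>Once the vertex c at position k is fixed, the two halves involve disjoint sets of inner
  vertices and their integral factorises. This is how every cut of a path enters the
  estimates.\<close>

lemma interior_integral_split:
  assumes ij: "i < k" "k < j"
    and G1: "G1 \<in> borel_measurable path_space" "depends_on {i..k} G1"
    and G2: "G2 \<in> borel_measurable path_space" "depends_on {k..j} G2"
  shows "interior_integral (\<lambda>p. G1 p * G2 p) i j a b =
    (\<integral>\<^sup>+c. interior_integral G1 i k a c * interior_integral G2 k j c b \<partial>vmeas)"
proof -
  let ?I = "{i<..<k}" and ?J = "{k<..<j}"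
  have I: "{i<..<j} = insert k (?I \<union> ?J)" using ij by auto
  let ?G = "\<lambda>p. G1 p * G2 p"
  have G: "?G \<in> borel_measurable path_space" using G1 G2 by measurable
  have "interior_integral ?G i j a b = (\<integral>\<^sup>+z. ?G (z(i := a, j := b)) \<partial>PiM (insert k (?I \<union> ?J)) (\<lambda>_. vmeas))"
    unfolding interior_integral_def I ..
  also have "\<dots> = (\<integral>\<^sup>+c. \<integral>\<^sup>+z. ?G (z(k := c, i := a, j := b)) \<partial>PiM (?I \<union> ?J) (\<lambda>_. vmeas) \<partial>vmeas)"
    using measurable_interior_integrand[OF G] by (intro vprod.product_nn_integral_insert_rev) auto
  also have "\<dots> = (\<integral>\<^sup>+c. interior_integral G1 i k a c * interior_integral G2 k j c b \<partial>vmeas)"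
  proof (intro nn_integral_cong)
    fix c :: "'a \<times> real"
    have "(\<lambda>z. z(k := c)) \<in> PiM (?I \<union> ?J) (\<lambda>_. vmeas :: ('a \<times> real) measure) \<rightarrow>\<^sub>M PiM (insert k (?I \<union> ?J)) (\<lambda>_. vmeas)"
      by (rule measurable_fun_upd[where J="?I \<union> ?J"]) auto
    then have m: "(\<lambda>z. ?G (z(k := c, i := a, j := b))) \<in> borel_measurable (PiM (?I \<union> ?J) (\<lambda>_. vmeas))"
      by (rule measurable_compose) (intro measurable_interior_integrand G, auto)
    have eq: "?G ((merge ?I ?J (x, y))(k := c, i := a, j := b)) = G1 (x(i := a, k := c)) * G2 (y(k := c, j := b))" for x y
    proof -
      have "G1 ((merge ?I ?J (x, y))(k := c, i := a, j := b)) = G1 (x(i := a, k := c))"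
        using G1(2) ij unfolding depends_on_def by (auto simp: merge_def)
      moreover have "G2 ((merge ?I ?J (x, y))(k := c, i := a, j := b)) = G2 (y(k := c, j := b))"
        using G2(2) ij unfolding depends_on_def by (auto simp: merge_def)
      ultimately show ?thesis by simp
    qed
    have "(\<integral>\<^sup>+z. ?G (z(k := c, i := a, j := b)) \<partial>PiM (?I \<union> ?J) (\<lambda>_. vmeas)) =
        (\<integral>\<^sup>+x. \<integral>\<^sup>+y. ?G ((merge ?I ?J (x, y))(k := c, i := a, j := b)) \<partial>PiM ?J (\<lambda>_. vmeas) \<partial>PiM ?I (\<lambda>_. vmeas))"
      by (rule vprod.product_nn_integral_fold[OF _ _ _ m]) auto
    also have "\<dots> = (\<integral>\<^sup>+x. G1 (x(i := a, k := c)) * (\<integral>\<^sup>+y. G2 (y(k := c, j := b)) \<partial>PiM ?J (\<lambda>_. vmeas)) \<partial>PiM ?I (\<lambda>_. vmeas))"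
      unfolding eq by (intro nn_integral_cong nn_integral_cmult measurable_interior_integrand G2) auto
    also have "\<dots> = interior_integral G1 i k a c * interior_integral G2 k j c b"
      unfolding interior_integral_def
      by (intro nn_integral_multc measurable_interior_integrand G1) auto
    finally show "(\<integral>\<^sup>+z. ?G (z(k := c, i := a, j := b)) \<partial>PiM (?I \<union> ?J) (\<lambda>_. vmeas)) =
      interior_integral G1 i k a c * interior_integral G2 k j c b" .
  qed
  finally show ?thesis .
qed

lemma exists_argmin:
  fixes f :: "nat \<Rightarrow> real"
  assumes "finite K" "K \<noteq> {}" shows "\<exists>k\<in>K. \<forall>l\<in>K. f k \<le> f l"
  using ex_min_if_finite[of "f ` K"] assms by (metis finite_imageI image_is_empty image_iff not_le imageI)

section \<open>Weights of paths and of their pieces\<close>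

context soft_boolean_parameters
begin

text \<open>The indicator ranges over all pairs that are not consecutive, not only over the two
  ends, so that it passes to every piece when the path is cut.\<close>

definition path_weight :: "nat \<Rightarrow> nat \<Rightarrow> (nat \<Rightarrow> 'a \<times> real) \<Rightarrow> ennreal" where
  "path_weight i j p = ennreal (\<Prod>l\<in>{i..<j}. lam (p l) (p (Suc l))) *
     of_bool (\<forall>l\<in>{i..j}. \<forall>m\<in>{l + 2..j}. 1 < soft (p l) (p m))"

definition connector_weight :: "nat \<Rightarrow> nat \<Rightarrow> (nat \<Rightarrow> 'a \<times> real) \<Rightarrow> ennreal" where
  "connector_weight i j p = path_weight i j p *
     of_bool (\<forall>l\<in>{i<..<j}. max (snd (p i)) (snd (p j)) \<le> snd (p l))"

text \<open>A path cut at its smallest mark is a descent followed by an ascent. A descent is in turn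
  a chain of connectors between successive running minima of the marks; an ascent is the same read
  backwards.\<close>

definition descent_weight :: "nat \<Rightarrow> nat \<Rightarrow> (nat \<Rightarrow> 'a \<times> real) \<Rightarrow> ennreal" where
  "descent_weight i j p = path_weight i j p * of_bool (\<forall>l\<in>{i..<j}. snd (p j) \<le> snd (p l))"

definition ascent_weight :: "nat \<Rightarrow> nat \<Rightarrow> (nat \<Rightarrow> 'a \<times> real) \<Rightarrow> ennreal" where
  "ascent_weight i j p = path_weight i j p * of_bool (\<forall>l\<in>{i<..j}. snd (p i) \<le> snd (p l))"

lemma measurable_kst_vertices:
  "A \<in> X \<rightarrow>\<^sub>M borel \<Otimes>\<^sub>M borel \<Longrightarrow> B \<in> X \<rightarrow>\<^sub>M borel \<Otimes>\<^sub>M borel \<Longrightarrow> (\<lambda>x. kst (A x) (B x)) \<in> borel_measurable X"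
  using measurable_compose[OF measurable_Pair measurable_kst] by simp

lemma measurable_lam_vertices:
  "A \<in> X \<rightarrow>\<^sub>M borel \<Otimes>\<^sub>M borel \<Longrightarrow> B \<in> X \<rightarrow>\<^sub>M borel \<Otimes>\<^sub>M borel \<Longrightarrow> (\<lambda>x. lam (A x) (B x)) \<in> borel_measurable X"
  using measurable_compose[OF measurable_Pair measurable_lam] by simp

lemmas [measurable (raw)] = measurable_kst_vertices measurable_lam_vertices

lemma measurable_path_weight [measurable]: "path_weight i j \<in> borel_measurable path_space"
  unfolding path_weight_def by measurable

lemma measurable_connector_weight [measurable]: "connector_weight i j \<in> borel_measurable path_space"
  unfolding connector_weight_def by measurable

lemma measurable_descent_weight [measurable]: "descent_weight i j \<in> borel_measurable path_space"
  unfolding descent_weight_def by measurable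

lemma measurable_ascent_weight [measurable]: "ascent_weight i j \<in> borel_measurable path_space"
  unfolding ascent_weight_def by measurable

lemma depends_on_path_weight: "depends_on {i..j} (path_weight i j)"
  unfolding depends_on_def path_weight_def
  by (intro allI impI arg_cong2[where f="(*)"] arg_cong[where f=ennreal] prod.cong arg_cong[where f=of_bool] ball_cong refl) auto

lemma depends_on_weights:
  "i \<le> j \<Longrightarrow> depends_on {i..j} (connector_weight i j)"
  "i \<le> j \<Longrightarrow> depends_on {i..j} (descent_weight i j)"
  "i \<le> j \<Longrightarrow> depends_on {i..j} (ascent_weight i j)"
  using depends_on_path_weight[of i j]
  unfolding depends_on_def connector_weight_def descent_weight_def ascent_weight_def
  by (auto intro!: arg_cong2[where f="(*)"] arg_cong[where f=of_bool])

lemma depends_on_mult_vertex: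
  "depends_on S G \<Longrightarrow> k \<in> S \<Longrightarrow> depends_on S (\<lambda>p. G p * H (p k))"
  unfolding depends_on_def by (metis (no_types, lifting))

text \<open>The product of probabilities factorises exactly; the loss consists of the indicators of
  pairs lying on different sides of k.\<close>

lemma path_weight_split:
  assumes "i \<le> k" "k \<le> j" shows "path_weight i j p \<le> path_weight i k p * path_weight k j p"
proof -
  have "(\<Prod>l\<in>{i..<j}. lam (p l) (p (Suc l))) = (\<Prod>l\<in>{i..<k}. lam (p l) (p (Suc l))) * (\<Prod>l\<in>{k..<j}. lam (p l) (p (Suc l)))"
    using assms by (simp add: prod.atLeastLessThan_concat)
  then have e: "ennreal (\<Prod>l\<in>{i..<j}. lam (p l) (p (Suc l))) =
      ennreal (\<Prod>l\<in>{i..<k}. lam (p l) (p (Suc l))) * ennreal (\<Prod>l\<in>{k..<j}. lam (p l) (p (Suc l)))"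
    by (simp add: ennreal_mult prod_nonneg)
  show ?thesis
  proof (cases "\<forall>l\<in>{i..j}. \<forall>m\<in>{l + 2..j}. 1 < soft (p l) (p m)")
    case True
    then have "\<forall>l\<in>{i..k}. \<forall>m\<in>{l + 2..k}. 1 < soft (p l) (p m)" "\<forall>l\<in>{k..j}. \<forall>m\<in>{l + 2..j}. 1 < soft (p l) (p m)"
      using assms by auto
    then show ?thesis unfolding path_weight_def e by simp
  next
    case False
    then have "path_weight i j p = 0"
      unfolding path_weight_def by (simp only: of_bool_eq mult_zero_right)
    then show ?thesis by simp
  qed
qed

end

text \<open>For n > 0 this is the Catalan number with index n - 1 times \<open>y ^ (n - 1)\<close>.
  The binary trees it counts are the orders in which successive minima cut a path of n steps, with
  one factor y for each inner vertex; the value at 0 is 0.\<close>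

function catalan_weight :: "real \<Rightarrow> nat \<Rightarrow> real" where
  "catalan_weight y n = (if n \<le> 1 then real n else
    y * (\<Sum>k\<in>{1..<n}. catalan_weight y k * catalan_weight y (n - k)))"
  by auto
termination by (relation "Wellfounded.measure snd") auto

declare catalan_weight.simps [simp del]

text \<open>Sums over all ways to compose n steps of connectors, with a factor s at each
  joint.\<close>

function chain_weight :: "real \<Rightarrow> real \<Rightarrow> nat \<Rightarrow> real" where
  "chain_weight y s n = catalan_weight y n + s * (\<Sum>k\<in>{1..<n}. chain_weight y s k * catalan_weight y (n - k))"
  by auto
termination by (relation "Wellfounded.measure (\<lambda>(y, s, n). n)") auto

declare chain_weight.simps [simp del]

lemma catalan_weight_nonneg: "0 \<le> y \<Longrightarrow> 0 \<le> catalan_weight y n"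
proof (induction n rule: less_induct)
  case (less n)
  then show ?case
    by (subst catalan_weight.simps) (auto intro!: mult_nonneg_nonneg sum_nonneg)
qed

lemma chain_weight_nonneg: "0 \<le> y \<Longrightarrow> 0 \<le> s \<Longrightarrow> 0 \<le> chain_weight y s n"
proof (induction n rule: less_induct)
  case (less n)
  then show ?case
    by (subst chain_weight.simps) (auto intro!: add_nonneg_nonneg mult_nonneg_nonneg sum_nonneg catalan_weight_nonneg)
qed

section \<open>Generating function bounds for the two recursions\<close>

lemma sum_convolution_le:
  fixes f g :: "nat \<Rightarrow> real"
  assumes "\<And>n. 0 \<le> f n" "\<And>n. 0 \<le> g n"
  shows "(\<Sum>n\<in>{1..Suc N}. \<Sum>k\<in>{1..<n}. f k * g (n - k)) \<le> (\<Sum>k\<in>{1..N}. f k) * (\<Sum>k\<in>{1..N}. g k)"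
proof -
  have "(\<Sum>n\<in>{1..Suc N}. \<Sum>k\<in>{1..<n}. f k * g (n - k)) =
      (\<Sum>(n, k)\<in>(SIGMA n:{1..Suc N}. {1..<n}). f k * g (n - k))"
    by (subst sum.Sigma) auto
  also have "\<dots> = (\<Sum>(k, l)\<in>(\<lambda>(n, k). (k, n - k)) ` (SIGMA n:{1..Suc N}. {1..<n}). f k * g l)"
    by (subst sum.reindex) (auto simp: inj_on_def case_prod_beta)
  also have "\<dots> \<le> (\<Sum>(k, l)\<in>{1..N} \<times> {1..N}. f k * g l)"
    using assms by (intro sum_mono2) auto
  also have "\<dots> = (\<Sum>k\<in>{1..N}. f k) * (\<Sum>k\<in>{1..N}. g k)"
    by (simp add: sum_product sum.cartesian_product)
  finally show ?thesis .
qed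

text \<open>The generating function F solves F = t + yF^2, whose smaller root is at most 2t while
  4yt \<le> 1. Induction over partial sums avoids any question of convergence: both factors of a
  convolution are shorter than the whole, so the sum up to \<open>Suc N\<close> is at most t +
  y(2t)^2 \<le> 2t.\<close>

lemma sum_catalan_weight_le:
  assumes "0 < y" "4 * y * t \<le> 1" "0 \<le> t"
  shows "(\<Sum>n\<in>{1..N}. catalan_weight y n * t ^ n) \<le> 2 * t"
proof (induction N)
  case 0
  then show ?case using assms by simp
next
  case (Suc N)
  let ?c = "catalan_weight y"
  have c: "0 \<le> ?c n * t ^ n" for n using assms by (simp add: catalan_weight_nonneg)
  have "(\<Sum>n\<in>{1..Suc N}. ?c n * t ^ n) \<le>
      (\<Sum>n\<in>{1..Suc N}. of_bool (n = 1) * t + y * (\<Sum>k\<in>{1..<n}. (?c k * t ^ k) * (?c (n - k) * t ^ (n - k))))"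
  proof (intro sum_mono)
    fix n assume "n \<in> {1..Suc N}"
    then consider "n = 1" | "n > 1" by force
    then show "?c n * t ^ n \<le> of_bool (n = 1) * t + y * (\<Sum>k\<in>{1..<n}. (?c k * t ^ k) * (?c (n - k) * t ^ (n - k)))"
    proof cases
      case 2
      have "(?c k * t ^ k) * (?c (n - k) * t ^ (n - k)) = ?c k * ?c (n - k) * t ^ n" if "k \<in> {1..<n}" for k
        using that by (simp add: mult_ac power_add[symmetric])
      from sum.cong[OF refl this]
      have "(\<Sum>k\<in>{1..<n}. (?c k * t ^ k) * (?c (n - k) * t ^ (n - k))) = (\<Sum>k\<in>{1..<n}. ?c k * ?c (n - k)) * t ^ n"
        unfolding sum_distrib_right .
      then show ?thesis using 2 by (subst catalan_weight.simps) simp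
    qed (simp add: catalan_weight.simps)
  qed
  also have "\<dots> = t + y * (\<Sum>n\<in>{1..Suc N}. \<Sum>k\<in>{1..<n}. (?c k * t ^ k) * (?c (n - k) * t ^ (n - k)))"
  proof -
    have "(\<Sum>n\<in>{1..Suc N}. of_bool (n = 1) * t) = (\<Sum>n\<in>{1..Suc N}. if n = 1 then t else 0)"
      by (intro sum.cong) auto
    also have "\<dots> = t" by (subst sum.delta) auto
    finally show ?thesis by (simp only: sum.distrib sum_distrib_left)
  qed
  also have "\<dots> \<le> t + y * ((\<Sum>n\<in>{1..N}. ?c n * t ^ n) * (\<Sum>n\<in>{1..N}. ?c n * t ^ n))"
    using assms c by (intro add_left_mono mult_left_mono sum_convolution_le) auto
  also have "\<dots> \<le> t + y * (2 * t * (2 * t))"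
    using assms c Suc by (intro add_left_mono mult_left_mono mult_mono sum_nonneg) auto
  also have "\<dots> = t + (4 * y * t) * t" by simp
  also have "\<dots> \<le> 2 * t" using mult_right_mono[OF assms(2,3)] by simp
  finally show ?case .
qed

text \<open>The generating function E of the chains satisfies E = F + sEF. With F \<le> 2t and 4st
  \<le> 1 the bound 4t reproduces itself: 2t + s(4t)(2t) \<le> 4t.\<close>

lemma sum_chain_weight_le:
  assumes "0 < y" "4 * y * t \<le> 1" "0 \<le> t" "0 \<le> s" "4 * s * t \<le> 1"
  shows "(\<Sum>n\<in>{1..N}. chain_weight y s n * t ^ n) \<le> 4 * t"
proof (induction N)
  case 0
  then show ?case using assms by simp
next
  case (Suc N)
  let ?c = "catalan_weight y" and ?e = "chain_weight y s"
  have c: "0 \<le> ?c n * t ^ n" and e: "0 \<le> ?e n * t ^ n" for n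
    using assms by (simp_all add: catalan_weight_nonneg chain_weight_nonneg)
  have "?e n * t ^ n = ?c n * t ^ n + s * (\<Sum>k\<in>{1..<n}. (?e k * t ^ k) * (?c (n - k) * t ^ (n - k)))" for n
  proof -
    have "(?e k * t ^ k) * (?c (n - k) * t ^ (n - k)) = ?e k * ?c (n - k) * t ^ n" if "k \<in> {1..<n}" for k
      using that by (simp add: mult_ac power_add[symmetric])
    from sum.cong[OF refl this]
    have eq: "(\<Sum>k\<in>{1..<n}. (?e k * t ^ k) * (?c (n - k) * t ^ (n - k))) = (\<Sum>k\<in>{1..<n}. ?e k * ?c (n - k)) * t ^ n"
      unfolding sum_distrib_right .
    have "?e n = ?c n + s * (\<Sum>k\<in>{1..<n}. ?e k * ?c (n - k))" by (rule chain_weight.simps)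
    then show ?thesis unfolding eq by (simp only: distrib_right mult.assoc)
  qed
  from sum.cong[OF refl this]
  have "(\<Sum>n\<in>{1..Suc N}. ?e n * t ^ n) = (\<Sum>n\<in>{1..Suc N}. ?c n * t ^ n) +
      s * (\<Sum>n\<in>{1..Suc N}. \<Sum>k\<in>{1..<n}. (?e k * t ^ k) * (?c (n - k) * t ^ (n - k)))"
    unfolding sum.distrib sum_distrib_left .
  also have "\<dots> \<le> 2 * t + s * ((\<Sum>n\<in>{1..N}. ?e n * t ^ n) * (\<Sum>n\<in>{1..N}. ?c n * t ^ n))"
    using assms c e by (intro add_mono mult_left_mono sum_convolution_le sum_catalan_weight_le) auto
  also have "\<dots> \<le> 2 * t + s * (4 * t * (2 * t))"
    using assms c e Suc sum_catalan_weight_le[of y t N]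
    by (intro add_left_mono mult_left_mono mult_mono sum_nonneg) auto
  also have "\<dots> = 2 * t + 2 * ((4 * s * t) * t)" by simp
  also have "\<dots> \<le> 4 * t" using mult_right_mono[OF assms(5,3)] by simp
  finally show ?case .
qed

lemma sum_shift_interval:
  fixes f :: "nat \<Rightarrow> 'b::comm_monoid_add"
  assumes "i \<le> j" shows "(\<Sum>k\<in>{i<..<j}. f (k - i)) = (\<Sum>k\<in>{1..<j - i}. f k)"
  by (rule sum.reindex_bij_witness[of _ "\<lambda>k. k + i" "\<lambda>k. k - i"]) auto

section \<open>Recursive bounds for connectors, descents and ascents\<close>

context soft_boolean_parameters
begin

text \<open>
  \<open>y\<close> is the factor lost when two kernels meeting in a larger mark are convolved; \<open>\<beta> < \<beta>\<^sub>0\<close> gives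
  \<open>4 * y < 1\<close>, the radius of convergence of the Catalan series. \<open>q n\<close> belongs to paths of \<open>n\<close> steps
  whose interior marks exceed those of both ends, \<open>e n\<close> to paths that end at their smallest mark.
\<close>

definition y :: real where "y = 2 powr (DIM('a) * \<delta> + 1) * kap * M"

definition q :: "nat \<Rightarrow> real" where "q = catalan_weight y"
definition e :: "nat \<Rightarrow> real" where "e = chain_weight y (kap * M)"

lemma y_pos: "0 < y"
  using kap_pos M_ge_1 by (simp add: y_def)

lemma q_nonneg [simp]: "0 \<le> q n" and e_nonneg [simp]: "0 \<le> e n"
  using y_pos kap_pos M_ge_1 by (simp_all add: q_def e_def catalan_weight_nonneg chain_weight_nonneg)

text \<open>The cut is at the smallest inner mark, so both halves are connectors again. The ends are
  at least two steps apart, hence \<open>1 < soft\<close> holds between them; the convolution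
  estimate asks for exactly this.\<close>

lemma connector_weight_split:
  assumes ij: "i + 2 \<le> j"
  shows "connector_weight i j p \<le> of_bool (1 < soft (p i) (p j)) *
    (\<Sum>k\<in>{i<..<j}. connector_weight i k p *
      (connector_weight k j p * of_bool (max (snd (p i)) (snd (p j)) \<le> snd (p k))))"
proof (cases "(1 < soft (p i) (p j)) \<and> (\<forall>l\<in>{i<..<j}. max (snd (p i)) (snd (p j)) \<le> snd (p l))")
  case True
  obtain k where k: "k \<in> {i<..<j}" "\<forall>l\<in>{i<..<j}. snd (p k) \<le> snd (p l)"
    using exists_argmin[of "{i<..<j}" "\<lambda>l. snd (p l)"] ij by fastforce
  have "connector_weight i j p = path_weight i j p" using True by (simp add: connector_weight_def)
  also have "\<dots> \<le> path_weight i k p * path_weight k j p" using k by (intro path_weight_split) auto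
  also have "\<dots> = connector_weight i k p * (connector_weight k j p * of_bool (max (snd (p i)) (snd (p j)) \<le> snd (p k)))"
  proof -
    have "\<forall>l\<in>{i<..<k}. max (snd (p i)) (snd (p k)) \<le> snd (p l)" "\<forall>l\<in>{k<..<j}. max (snd (p k)) (snd (p j)) \<le> snd (p l)"
      using k True by auto
    then show ?thesis using k True by (simp add: connector_weight_def)
  qed
  also have "\<dots> \<le> (\<Sum>k\<in>{i<..<j}. connector_weight i k p *
      (connector_weight k j p * of_bool (max (snd (p i)) (snd (p j)) \<le> snd (p k))))"
    using k by (intro member_le_sum) auto
  finally show ?thesis using True by simp
next
  case False
  moreover have "connector_weight i j p = 0" if "\<not> 1 < soft (p i) (p j)"
  proof -
    have "\<not> (\<forall>l\<in>{i..j}. \<forall>m\<in>{l + 2..j}. 1 < soft (p l) (p m))" using ij that by force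
    then show ?thesis unfolding connector_weight_def path_weight_def by (simp only: of_bool_eq mult_zero_right mult_zero_left)
  qed
  moreover have "connector_weight i j p = 0" if "\<not> (\<forall>l\<in>{i<..<j}. max (snd (p i)) (snd (p j)) \<le> snd (p l))"
    unfolding connector_weight_def using that by (simp only: of_bool_eq mult_zero_right)
  ultimately show ?thesis by fastforce
qed

text \<open>The cut is at the smallest mark before the end, the last running minimum but one. What
  follows it is a connector; if the minimum is the start itself, the whole descent is one connector,
  which is the first summand.\<close>

lemma descent_weight_split:
  assumes ij: "i < j"
  shows "descent_weight i j p \<le> connector_weight i j p * of_bool (snd (p j) \<le> snd (p i)) +
    (\<Sum>k\<in>{i<..<j}. descent_weight i k p * (connector_weight k j p * of_bool (snd (p j) \<le> snd (p k))))"
proof (cases "\<forall>l\<in>{i..<j}. snd (p j) \<le> snd (p l)")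
  case True
  obtain k where k: "k \<in> {i..<j}" "\<forall>l\<in>{i..<j}. snd (p k) \<le> snd (p l)"
    using exists_argmin[of "{i..<j}" "\<lambda>l. snd (p l)"] ij by fastforce
  have W: "descent_weight i j p = path_weight i j p" using True by (simp add: descent_weight_def)
  show ?thesis
  proof (cases "k = i")
    case True': True
    have "\<forall>l\<in>{i<..<j}. max (snd (p i)) (snd (p j)) \<le> snd (p l)" "snd (p j) \<le> snd (p i)"
      using k True ij True' by auto
    then have "path_weight i j p = connector_weight i j p * of_bool (snd (p j) \<le> snd (p i))"
      by (simp add: connector_weight_def)
    then show ?thesis unfolding W by simp
  next
    case False
    then have k': "k \<in> {i<..<j}" using k by auto
    have "path_weight i j p \<le> path_weight i k p * path_weight k j p" using k by (intro path_weight_split) auto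
    also have "\<dots> = descent_weight i k p * (connector_weight k j p * of_bool (snd (p j) \<le> snd (p k)))"
    proof -
      have "\<forall>l\<in>{i..<k}. snd (p k) \<le> snd (p l)" "\<forall>l\<in>{k<..<j}. max (snd (p k)) (snd (p j)) \<le> snd (p l)"
        using k True by auto
      then show ?thesis using k True by (simp add: connector_weight_def descent_weight_def)
    qed
    also have "\<dots> \<le> (\<Sum>k\<in>{i<..<j}. descent_weight i k p * (connector_weight k j p * of_bool (snd (p j) \<le> snd (p k))))"
      using k' by (intro member_le_sum) auto
    finally show ?thesis unfolding W by (simp add: add_increasing)
  qed
next
  case False
  then have "descent_weight i j p = 0" unfolding descent_weight_def by (simp only: of_bool_eq mult_zero_right)
  then show ?thesis by simp
qed

lemma ascent_weight_split:
  assumes ij: "i < j"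
  shows "ascent_weight i j p \<le> connector_weight i j p * of_bool (snd (p i) \<le> snd (p j)) +
    (\<Sum>k\<in>{i<..<j}. (connector_weight i k p * of_bool (snd (p i) \<le> snd (p k))) * ascent_weight k j p)"
proof (cases "\<forall>l\<in>{i<..j}. snd (p i) \<le> snd (p l)")
  case True
  obtain k where k: "k \<in> {i<..j}" "\<forall>l\<in>{i<..j}. snd (p k) \<le> snd (p l)"
    using exists_argmin[of "{i<..j}" "\<lambda>l. snd (p l)"] ij by fastforce
  have W: "ascent_weight i j p = path_weight i j p" using True by (simp add: ascent_weight_def)
  show ?thesis
  proof (cases "k = j")
    case True': True
    have "\<forall>l\<in>{i<..<j}. max (snd (p i)) (snd (p j)) \<le> snd (p l)" "snd (p i) \<le> snd (p j)"
      using k True ij True' by auto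
    then have "path_weight i j p = connector_weight i j p * of_bool (snd (p i) \<le> snd (p j))"
      by (simp add: connector_weight_def)
    then show ?thesis unfolding W by simp
  next
    case False
    then have k': "k \<in> {i<..<j}" using k by auto
    have "path_weight i j p \<le> path_weight i k p * path_weight k j p" using k by (intro path_weight_split) auto
    also have "\<dots> = (connector_weight i k p * of_bool (snd (p i) \<le> snd (p k))) * ascent_weight k j p"
    proof -
      have "\<forall>l\<in>{i<..<k}. max (snd (p i)) (snd (p k)) \<le> snd (p l)" "\<forall>l\<in>{k<..j}. snd (p k) \<le> snd (p l)"
        using k True by auto
      then show ?thesis using k True by (simp add: connector_weight_def ascent_weight_def)
    qed
    also have "\<dots> \<le> (\<Sum>k\<in>{i<..<j}. (connector_weight i k p * of_bool (snd (p i) \<le> snd (p k))) * ascent_weight k j p)"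
      using k' by (intro member_le_sum) auto
    finally show ?thesis unfolding W by (simp add: add_increasing)
  qed
next
  case False
  then have "ascent_weight i j p = 0" unfolding ascent_weight_def by (simp only: of_bool_eq mult_zero_right)
  then show ?thesis by simp
qed

lemma ennreal_prod_nonneg: "0 \<le> a \<Longrightarrow> 0 \<le> b \<Longrightarrow> ennreal a * ennreal b = ennreal (a * b)"
  by (simp add: ennreal_mult)

lemma nn_integral_uniform01_powr_th: "(\<integral>\<^sup>+w. ennreal (w powr (- th)) \<partial>uniform01) = ennreal M"
  using nn_integral_uniform01_powr[of th] th by (simp add: M_def)

text \<open>The origin of \<open>y\<close>: the position of the middle vertex costs
  \<open>2 powr (d * \<delta> + 1) * kap * w powr - th\<close>, and its mark then contributes the
  factor M.\<close>

lemma nn_integral_kst_kst: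
  assumes a: "0 < snd a" "0 < snd b" and far: "1 < soft a b"
  shows "(\<integral>\<^sup>+c. ennreal (kst a c * kst c b) * of_bool (max (snd a) (snd b) \<le> snd c) \<partial>vmeas) \<le> ennreal (y * kst a b)"
proof -
  let ?K = "2 powr (DIM('a) * \<delta> + 1) * kap * kst a b"
  have "(\<integral>\<^sup>+c. ennreal (kst a c * kst c b) * of_bool (max (snd a) (snd b) \<le> snd c) \<partial>vmeas) =
      (\<integral>\<^sup>+w. \<integral>\<^sup>+z. ennreal (kst a (z, w) * kst (z, w) b) * of_bool (max (snd a) (snd b) \<le> w) \<partial>lborel \<partial>uniform01)"
  proof (subst nn_integral_vmeas)
    have id: "(\<lambda>c. c) \<in> (vmeas :: ('a \<times> real) measure) \<rightarrow>\<^sub>M borel \<Otimes>\<^sub>M borel"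
      by (rule measurable_ident_sets[OF sets_vmeas])
    have "(\<lambda>c. kst a c) \<in> borel_measurable vmeas" "(\<lambda>c. kst c b) \<in> borel_measurable vmeas"
      using id by (auto intro!: measurable_kst_vertices)
    then show "(\<lambda>c. ennreal (kst a c * kst c b) * of_bool (max (snd a) (snd b) \<le> snd c)) \<in> borel_measurable vmeas"
      by (intro borel_measurable_times_ennreal measurable_compose[OF pred_vmeas_mark(1) measurable_of_bool]) measurable
  qed simp
  also have "\<dots> \<le> (\<integral>\<^sup>+w. ennreal ?K * ennreal (w powr (- th)) \<partial>uniform01)"
  proof (intro nn_integral_mono)
    fix w :: real
    show "(\<integral>\<^sup>+z. ennreal (kst a (z, w) * kst (z, w) b) * of_bool (max (snd a) (snd b) \<le> w) \<partial>lborel) \<le> ennreal ?K * ennreal (w powr (- th))"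
    proof (cases "max (snd a) (snd b) \<le> w")
      case True
      then show ?thesis using nn_integral_kst_convolution[OF a True far] kap_pos
        by (simp add: ennreal_prod_nonneg mult_ac)
    next
      case False
      then have z: "of_bool (max (snd a) (snd b) \<le> w) = (0 :: ennreal)" by simp
      show ?thesis unfolding z by simp
    qed
  qed
  also have "\<dots> = ennreal ?K * ennreal M"
    by (subst nn_integral_cmult) (auto simp: nn_integral_uniform01_powr_th)
  also have "\<dots> = ennreal (y * kst a b)"
    using kap_pos M_ge_1 by (simp add: ennreal_prod_nonneg y_def mult_ac)
  finally show ?thesis .
qed

text \<open>The bound reproduces itself under cutting: both halves are bounded by their kernels, and
  the convolution over the cut vertex returns the kernel of the ends with a factor y. The constants
  therefore follow the Catalan recursion.\<close>

lemma connector_integral_le: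
  assumes "i < j" "0 < snd a" "snd a < 1" "0 < snd b" "snd b < 1"
  shows "interior_integral (connector_weight i j) i j a b \<le> ennreal (q (j - i) * kst a b)"
  using assms
proof (induction "j - i" arbitrary: i j a b rule: less_induct)
  case less
  let ?X = "interior_integral (connector_weight i j) i j a b"
  show ?case
  proof (cases "j = Suc i")
    case True
    have "?X \<le> ennreal (lam a b)"
      unfolding True interior_integral_Suc connector_weight_def path_weight_def by (auto intro: mult_left_le)
    also have "\<dots> \<le> ennreal (kst a b)" using less.prems by (intro ennreal_leI lam_le_kst)
    finally show ?thesis using True by (simp add: q_def catalan_weight.simps)
  next
    case False
    then have ij: "i + 2 \<le> j" using less.prems by simp
    show ?thesis
    proof (cases "1 < soft a b")
      \<comment> \<open>The ends are not consecutive, so a connector between ends with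
        \<open>soft a b \<le> 1\<close> has weight 0.\<close>
      case far: False
      have "?X \<le> interior_integral (\<lambda>_. 0) i j a b"
      proof (rule interior_integral_mono)
        fix z
        show "connector_weight i j (z(i := a, j := b)) \<le> 0"
          using connector_weight_split[OF ij, of "z(i := a, j := b)"] ij far by simp
      qed
      then show ?thesis by (simp add: interior_integral_def)
    next
      case far: True
      \<comment> \<open>The requirement on the mark of the cut vertex is attached to the right half,
        so that each half remains a function of its own vertices.\<close>
      define G where "G k p = connector_weight k j p * of_bool (max (snd a) (snd b) \<le> snd (p k))" for k p
      have [measurable]: "G k \<in> borel_measurable path_space" for k unfolding G_def by measurable
      have Gint: "interior_integral (G k) k j c b = interior_integral (connector_weight k j) k j c b * of_bool (max (snd a) (snd b) \<le> snd c)"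
        if "k < j" for k c
      proof -
        have "G k (z(k := c, j := b)) = connector_weight k j (z(k := c, j := b)) * of_bool (max (snd a) (snd b) \<le> snd c)" for z
          using that by (simp add: G_def)
        then show ?thesis unfolding interior_integral_def
          by (simp add: nn_integral_multc measurable_interior_integrand)
      qed
      have "?X \<le> interior_integral (\<lambda>p. \<Sum>k\<in>{i<..<j}. connector_weight i k p * G k p) i j a b"
      proof (rule interior_integral_mono)
        fix z
        show "connector_weight i j (z(i := a, j := b)) \<le>
            (\<Sum>k\<in>{i<..<j}. connector_weight i k (z(i := a, j := b)) * G k (z(i := a, j := b)))"
          using connector_weight_split[OF ij, of "z(i := a, j := b)"] ij far unfolding G_def by simp
      qed
      also have "\<dots> = (\<Sum>k\<in>{i<..<j}. interior_integral (\<lambda>p. connector_weight i k p * G k p) i j a b)"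
        by (rule interior_integral_sum) auto
      also have "\<dots> = (\<Sum>k\<in>{i<..<j}. \<integral>\<^sup>+c. interior_integral (connector_weight i k) i k a c *
          (interior_integral (connector_weight k j) k j c b * of_bool (max (snd a) (snd b) \<le> snd c)) \<partial>vmeas)"
        unfolding Gint[symmetric, simplified]
      proof (intro sum.cong refl)
        fix k assume k: "k \<in> {i<..<j}"
        have "depends_on {k..j} (G k)"
          unfolding G_def using k by (intro depends_on_mult_vertex depends_on_weights) auto
        then show "interior_integral (\<lambda>p. connector_weight i k p * G k p) i j a b = (\<integral>\<^sup>+c. interior_integral (connector_weight i k) i k a c *
          (interior_integral (connector_weight k j) k j c b * of_bool (max (snd a) (snd b) \<le> snd c)) \<partial>vmeas)"
          using k by (subst interior_integral_split[of i k j]) (auto simp: depends_on_weights Gint)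
      qed
      also have "\<dots> \<le> (\<Sum>k\<in>{i<..<j}. ennreal (q (k - i) * q (j - k)) * ennreal (y * kst a b))"
      proof (intro sum_mono)
        fix k assume k: "k \<in> {i<..<j}"
        have "(\<integral>\<^sup>+c. interior_integral (connector_weight i k) i k a c *
            (interior_integral (connector_weight k j) k j c b * of_bool (max (snd a) (snd b) \<le> snd c)) \<partial>vmeas) \<le>
          (\<integral>\<^sup>+c. ennreal (q (k - i) * q (j - k)) * (ennreal (kst a c * kst c b) * of_bool (max (snd a) (snd b) \<le> snd c)) \<partial>vmeas)"
        proof (rule nn_integral_mono_AE)
          show "AE c in vmeas. interior_integral (connector_weight i k) i k a c *
            (interior_integral (connector_weight k j) k j c b * of_bool (max (snd a) (snd b) \<le> snd c)) \<le>
            ennreal (q (k - i) * q (j - k)) * (ennreal (kst a c * kst c b) * of_bool (max (snd a) (snd b) \<le> snd c))"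
            using AE_vmeas
          proof eventually_elim
            case (elim c)
            have "interior_integral (connector_weight i k) i k a c * interior_integral (connector_weight k j) k j c b \<le>
                ennreal (q (k - i) * kst a c) * ennreal (q (j - k) * kst c b)"
              using elim k less.prems by (intro mult_mono less.hyps) auto
            also have "\<dots> = ennreal (q (k - i) * q (j - k)) * ennreal (kst a c * kst c b)"
              by (simp add: ennreal_prod_nonneg mult_ac)
            finally show ?case by (simp add: mult_right_mono mult.assoc[symmetric])
          qed
        qed
        also have "\<dots> = ennreal (q (k - i) * q (j - k)) *
            (\<integral>\<^sup>+c. ennreal (kst a c * kst c b) * of_bool (max (snd a) (snd b) \<le> snd c) \<partial>vmeas)"
          by (rule nn_integral_cmult) measurable
        also have "\<dots> \<le> ennreal (q (k - i) * q (j - k)) * ennreal (y * kst a b)"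
          using less.prems far by (intro mult_left_mono nn_integral_kst_kst) auto
        finally show "(\<integral>\<^sup>+c. interior_integral (connector_weight i k) i k a c *
            (interior_integral (connector_weight k j) k j c b * of_bool (max (snd a) (snd b) \<le> snd c)) \<partial>vmeas) \<le>
          ennreal (q (k - i) * q (j - k)) * ennreal (y * kst a b)" .
      qed
      also have "\<dots> = ennreal ((y * (\<Sum>k\<in>{i<..<j}. q (k - i) * q ((j - i) - (k - i)))) * kst a b)"
        using y_pos by (simp add: ennreal_prod_nonneg sum_ennreal sum_nonneg sum_distrib_left sum_distrib_right mult_ac)
      also have "y * (\<Sum>k\<in>{i<..<j}. q (k - i) * q ((j - i) - (k - i))) = q (j - i)"
        unfolding sum_shift_interval[OF less_imp_le[OF less.prems(1)], of "\<lambda>k. q k * q ((j - i) - k)"]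
        unfolding q_def using ij by (subst (2) catalan_weight.simps) simp
      finally show ?thesis .
    qed
  qed
qed

text \<open>At the vertex joining two pieces the powers of its mark from both sides multiply to -th,
  whose integral is M. Descents and ascents use it with \<gamma> and \<gamma>/\<delta> in opposite
  order.\<close>

lemma nn_integral_chain_step:
  fixes D :: "'a \<times> real \<Rightarrow> ennreal"
  assumes D: "D \<in> borel_measurable vmeas" and s: "s1 + s2 = th" and "0 \<le> A" "0 \<le> C"
    and H: "\<And>w. 0 < w \<Longrightarrow> w < 1 \<Longrightarrow> (\<integral>\<^sup>+z. D (z, w) \<partial>lborel) \<le> ennreal (A * w powr (- s1))"
  shows "(\<integral>\<^sup>+c. D c * ennreal (C * snd c powr (- s2)) \<partial>vmeas) \<le> ennreal (A * C * M)"
proof -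
  have "(\<integral>\<^sup>+c. D c * ennreal (C * snd c powr (- s2)) \<partial>vmeas) =
      (\<integral>\<^sup>+w. \<integral>\<^sup>+z. D (z, w) * ennreal (C * w powr (- s2)) \<partial>lborel \<partial>uniform01)"
  proof (subst nn_integral_vmeas)
    have "(\<lambda>c. ennreal (C * snd c powr (- s2))) \<in> borel_measurable (vmeas :: ('a \<times> real) measure)"
      by (rule measurable_compose[OF measurable_vmeas_mark, where g="\<lambda>u. ennreal (C * u powr (- s2))"]) measurable
    then show "(\<lambda>c. D c * ennreal (C * snd c powr (- s2))) \<in> borel_measurable vmeas"
      by (rule borel_measurable_times_ennreal[OF D])
  qed simp
  also have "\<dots> = (\<integral>\<^sup>+w. (\<integral>\<^sup>+z. D (z, w) \<partial>lborel) * ennreal (C * w powr (- s2)) \<partial>uniform01)"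
  proof (intro nn_integral_cong nn_integral_multc)
    fix w :: real
    have "(\<lambda>z. (z, w)) \<in> (lborel :: 'a measure) \<rightarrow>\<^sub>M vmeas" by (intro measurable_Pair measurable_const) auto
    then show "(\<lambda>z. D (z, w)) \<in> borel_measurable lborel" by (rule measurable_compose[OF _ D])
  qed
  also have "\<dots> \<le> (\<integral>\<^sup>+w. ennreal (A * C) * ennreal (w powr (- th)) \<partial>uniform01)"
  proof (rule nn_integral_mono_AE)
    show "AE w in uniform01. (\<integral>\<^sup>+z. D (z, w) \<partial>lborel) * ennreal (C * w powr (- s2)) \<le> ennreal (A * C) * ennreal (w powr (- th))"
      using AE_uniform01
    proof eventually_elim
      case (elim w)
      have "(\<integral>\<^sup>+z. D (z, w) \<partial>lborel) * ennreal (C * w powr (- s2)) \<le> ennreal (A * w powr (- s1)) * ennreal (C * w powr (- s2))"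
        using elim by (intro mult_right_mono H) auto
      also have "\<dots> = ennreal (A * C * (w powr (- s1) * w powr (- s2)))"
        using assms by (simp add: ennreal_prod_nonneg mult_ac)
      also have "w powr (- s1) * w powr (- s2) = w powr (- th)"
        unfolding powr_add[symmetric] using s by (intro arg_cong[where f="\<lambda>r. w powr r"]) simp
      finally show ?case using assms by (simp add: ennreal_prod_nonneg)
    qed
  qed
  also have "\<dots> = ennreal (A * C * M)"
    using assms M_ge_1 by (subst nn_integral_cmult) (auto simp: nn_integral_uniform01_powr_th ennreal_prod_nonneg)
  finally show ?thesis .
qed

lemma chain_weight_unfold: "e n = q n + kap * M * (\<Sum>k\<in>{1..<n}. e k * q (n - k))"
  unfolding e_def q_def by (rule chain_weight.simps)

lemma chain_weight_unfold': "e n = q n + kap * M * (\<Sum>k\<in>{1..<n}. q k * e (n - k))"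
proof -
  have "(\<Sum>k\<in>{1..<n}. e k * q (n - k)) = (\<Sum>k\<in>{1..<n}. q k * e (n - k))"
    by (rule sum.reindex_bij_witness[of _ "\<lambda>k. n - k" "\<lambda>k. n - k"]) auto
  then show ?thesis unfolding chain_weight_unfold[of n] by (simp only:)
qed

text \<open>The exponents are those of a single kernel, \<gamma>/\<delta> at the larger mark and
  \<gamma> at the smaller, with the position of the end integrated out. Removing the last connector
  leaves a shorter descent; its end and the start of the connector meet with total exponent -th, so
  a joint costs \<open>kap * M\<close>.\<close>

lemma descent_integral_le:
  assumes "i < j" "0 < snd a" "snd a < 1" "0 < v" "v < 1"
  shows "(\<integral>\<^sup>+x. interior_integral (descent_weight i j) i j a (x, v) \<partial>lborel) \<le>
    ennreal (e (j - i) * kap * snd a powr (- (\<gamma> / \<delta>)) * v powr (- \<gamma>))"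
  using assms
proof (induction "j - i" arbitrary: j v rule: less_induct)
  case less
  interpret LV: pair_sigma_finite "lborel :: 'a measure" "vmeas :: ('a \<times> real) measure" ..
  define D where "D k c = interior_integral (descent_weight i k) i k a c" for k c
  have D[measurable]: "(\<lambda>x. D k (A x)) \<in> borel_measurable X" if [measurable]: "A \<in> X \<rightarrow>\<^sub>M borel \<Otimes>\<^sub>M borel"
    for A k and X :: "'x measure"
    unfolding D_def by measurable
  let ?u = "snd a powr (- (\<gamma> / \<delta>))"
  let ?f = "\<lambda>k c x. D k c * (ennreal (q (j - k) * kst c (x, v)) * of_bool (v \<le> snd c))"
  have pt: "interior_integral (descent_weight i j) i j a (x, v) \<le>
      ennreal (q (j - i) * kst a (x, v)) * of_bool (v \<le> snd a) + (\<Sum>k\<in>{i<..<j}. \<integral>\<^sup>+c. ?f k c x \<partial>vmeas)" for x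
  proof -
    let ?b = "(x, v)"
    define G where "G k p = connector_weight k j p * of_bool (v \<le> snd (p k))" for k p
    have [measurable]: "G k \<in> borel_measurable path_space" for k unfolding G_def by measurable
    have Gint: "interior_integral (G k) k j c ?b = interior_integral (connector_weight k j) k j c ?b * of_bool (v \<le> snd c)"
      if "k < j" for k c
    proof -
      have "G k (z(k := c, j := ?b)) = connector_weight k j (z(k := c, j := ?b)) * of_bool (v \<le> snd c)" for z
        using that by (simp add: G_def)
      then show ?thesis unfolding interior_integral_def
        by (simp add: nn_integral_multc measurable_interior_integrand)
    qed
    have "interior_integral (descent_weight i j) i j a ?b \<le>
        interior_integral (\<lambda>p. G i p + (\<Sum>k\<in>{i<..<j}. descent_weight i k p * G k p)) i j a ?b"
    proof (rule interior_integral_mono)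
      fix z
      show "descent_weight i j (z(i := a, j := ?b)) \<le> G i (z(i := a, j := ?b)) +
          (\<Sum>k\<in>{i<..<j}. descent_weight i k (z(i := a, j := ?b)) * G k (z(i := a, j := ?b)))"
        using descent_weight_split[of i j "z(i := a, j := ?b)"] less.prems unfolding G_def by simp
    qed
    also have "\<dots> = interior_integral (G i) i j a ?b + (\<Sum>k\<in>{i<..<j}. interior_integral (\<lambda>p. descent_weight i k p * G k p) i j a ?b)"
      by (subst interior_integral_add, measurable) (subst interior_integral_sum, auto)
    also have "\<dots> \<le> ennreal (q (j - i) * kst a ?b) * of_bool (v \<le> snd a) + (\<Sum>k\<in>{i<..<j}. \<integral>\<^sup>+c. ?f k c x \<partial>vmeas)"
    proof (intro add_mono sum_mono)
      show "interior_integral (G i) i j a ?b \<le> ennreal (q (j - i) * kst a ?b) * of_bool (v \<le> snd a)"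
        unfolding Gint[OF less.prems(1)] using less.prems by (intro mult_right_mono connector_integral_le) auto
      fix k assume k: "k \<in> {i<..<j}"
      have "depends_on {k..j} (G k)"
        unfolding G_def using k by (intro depends_on_mult_vertex depends_on_weights) auto
      then have "interior_integral (\<lambda>p. descent_weight i k p * G k p) i j a ?b =
          (\<integral>\<^sup>+c. D k c * (interior_integral (connector_weight k j) k j c ?b * of_bool (v \<le> snd c)) \<partial>vmeas)"
        using k by (subst interior_integral_split[of i k j]) (auto simp: depends_on_weights Gint D_def)
      also have "\<dots> \<le> (\<integral>\<^sup>+c. ?f k c x \<partial>vmeas)"
      proof (rule nn_integral_mono_AE)
        show "AE c in vmeas. D k c * (interior_integral (connector_weight k j) k j c ?b * of_bool (v \<le> snd c)) \<le> ?f k c x"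
          using AE_vmeas by eventually_elim (use k less.prems in \<open>intro mult_left_mono mult_right_mono connector_integral_le; auto\<close>)
      qed
      finally show "interior_integral (\<lambda>p. descent_weight i k p * G k p) i j a ?b \<le> (\<integral>\<^sup>+c. ?f k c x \<partial>vmeas)" .
    qed
    finally show ?thesis .
  qed
  have first: "(\<integral>\<^sup>+x. ennreal (q (j - i) * kst a (x, v)) * of_bool (v \<le> snd a) \<partial>lborel) \<le> ennreal (q (j - i) * kap * ?u * v powr (- \<gamma>))"
  proof (cases "v \<le> snd a")
    case True
    then have "(\<integral>\<^sup>+x. ennreal (q (j - i) * kst a (x, v)) * of_bool (v \<le> snd a) \<partial>lborel) = ennreal (q (j - i)) * (\<integral>\<^sup>+x. ennreal (kst a (x, v)) \<partial>lborel)"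
      by (simp add: ennreal_mult nn_integral_cmult)
    also have "\<dots> \<le> ennreal (q (j - i)) * ennreal (kap * v powr (- \<gamma>) * ?u)"
      using nn_integral_kst_le[of a v] less.prems True by (intro mult_left_mono) (auto simp: min_def max_def split: if_splits)
    finally show ?thesis using kap_pos by (simp add: ennreal_prod_nonneg mult_ac)
  qed simp
  have step: "(\<integral>\<^sup>+x. \<integral>\<^sup>+c. ?f k c x \<partial>vmeas \<partial>lborel) \<le> ennreal (kap * M * (e (k - i) * q ((j - i) - (k - i))) * (kap * ?u * v powr (- \<gamma>)))"
    if k: "k \<in> {i<..<j}" for k
  proof -
    have "(\<integral>\<^sup>+x. \<integral>\<^sup>+c. ?f k c x \<partial>vmeas \<partial>lborel) = (\<integral>\<^sup>+c. \<integral>\<^sup>+x. ?f k c x \<partial>lborel \<partial>vmeas)"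
      by (rule LV.Fubini'[symmetric]) measurable
    also have "\<dots> \<le> (\<integral>\<^sup>+c. D k c * ennreal ((q (j - k) * kap * v powr (- \<gamma>)) * snd c powr (- (\<gamma> / \<delta>))) \<partial>vmeas)"
    proof (rule nn_integral_mono_AE)
      show "AE c in vmeas. (\<integral>\<^sup>+x. ?f k c x \<partial>lborel) \<le> D k c * ennreal ((q (j - k) * kap * v powr (- \<gamma>)) * snd c powr (- (\<gamma> / \<delta>)))"
        using AE_vmeas
      proof eventually_elim
        case (elim c)
        have "(\<integral>\<^sup>+x. ?f k c x \<partial>lborel) = D k c * (ennreal (q (j - k)) * (\<integral>\<^sup>+x. ennreal (kst c (x, v)) \<partial>lborel) * of_bool (v \<le> snd c))"
          by (simp add: ennreal_mult nn_integral_cmult nn_integral_multc)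
        also have "\<dots> \<le> D k c * ennreal ((q (j - k) * kap * v powr (- \<gamma>)) * snd c powr (- (\<gamma> / \<delta>)))"
        proof (cases "v \<le> snd c")
          case True
          have "ennreal (q (j - k)) * (\<integral>\<^sup>+x. ennreal (kst c (x, v)) \<partial>lborel) \<le> ennreal (q (j - k)) * ennreal (kap * v powr (- \<gamma>) * snd c powr (- (\<gamma> / \<delta>)))"
            using nn_integral_kst_le[of c v] less.prems True elim by (intro mult_left_mono) (auto simp: min_def max_def split: if_splits)
          also have "\<dots> = ennreal ((q (j - k) * kap * v powr (- \<gamma>)) * snd c powr (- (\<gamma> / \<delta>)))"
            using kap_pos by (simp add: ennreal_prod_nonneg mult_ac)
          finally show ?thesis using True by (simp add: mult_left_mono)
        qed simp
        finally show ?case .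
      qed
    qed
    also have "\<dots> \<le> ennreal ((e (k - i) * kap * ?u) * (q (j - k) * kap * v powr (- \<gamma>)) * M)"
    proof (rule nn_integral_chain_step)
      show "D k \<in> borel_measurable vmeas" by measurable
      show "\<gamma> + \<gamma> / \<delta> = th" by (simp add: th_def)
      fix w :: real assume w: "0 < w" "w < 1"
      show "(\<integral>\<^sup>+z. D k (z, w) \<partial>lborel) \<le> ennreal (e (k - i) * kap * ?u * w powr (- \<gamma>))"
        unfolding D_def using k less.prems w by (intro less.hyps) auto
    qed (use kap_pos in auto)
    also have "\<dots> = ennreal (kap * M * (e (k - i) * q ((j - i) - (k - i))) * (kap * ?u * v powr (- \<gamma>)))"
      using k by (simp add: mult_ac)
    finally show ?thesis .
  qed
  have "(\<integral>\<^sup>+x. interior_integral (descent_weight i j) i j a (x, v) \<partial>lborel) \<le>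
      (\<integral>\<^sup>+x. ennreal (q (j - i) * kst a (x, v)) * of_bool (v \<le> snd a) + (\<Sum>k\<in>{i<..<j}. \<integral>\<^sup>+c. ?f k c x \<partial>vmeas) \<partial>lborel)"
    by (intro nn_integral_mono pt)
  also have "\<dots> = (\<integral>\<^sup>+x. ennreal (q (j - i) * kst a (x, v)) * of_bool (v \<le> snd a) \<partial>lborel) +
      (\<Sum>k\<in>{i<..<j}. \<integral>\<^sup>+x. \<integral>\<^sup>+c. ?f k c x \<partial>vmeas \<partial>lborel)"
    by (subst nn_integral_add, measurable) (subst nn_integral_sum, measurable)
  also have "\<dots> \<le> ennreal (q (j - i) * kap * ?u * v powr (- \<gamma>)) +
      (\<Sum>k\<in>{i<..<j}. ennreal (kap * M * (e (k - i) * q ((j - i) - (k - i))) * (kap * ?u * v powr (- \<gamma>))))"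
    by (intro add_mono sum_mono first step)
  also have "\<dots> = ennreal ((q (j - i) + kap * M * (\<Sum>k\<in>{i<..<j}. e (k - i) * q ((j - i) - (k - i)))) * (kap * ?u * v powr (- \<gamma>)))"
  proof -
    have "(\<Sum>k\<in>{i<..<j}. ennreal (kap * M * (e (k - i) * q ((j - i) - (k - i))) * (kap * ?u * v powr (- \<gamma>)))) =
        ennreal (kap * M * (\<Sum>k\<in>{i<..<j}. e (k - i) * q ((j - i) - (k - i))) * (kap * ?u * v powr (- \<gamma>)))"
      using kap_pos M_ge_1 by (subst sum_ennreal) (auto simp: sum_distrib_left sum_distrib_right)
    moreover have "0 \<le> kap * M * (\<Sum>k\<in>{i<..<j}. e (k - i) * q ((j - i) - (k - i))) * (kap * ?u * v powr (- \<gamma>))"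
      using kap_pos M_ge_1 by (intro mult_nonneg_nonneg sum_nonneg) auto
    moreover have "0 \<le> q (j - i) * kap * ?u * v powr (- \<gamma>)" using kap_pos by simp
    ultimately show ?thesis by (simp only: ennreal_plus[symmetric]) (simp only: distrib_right mult.assoc)
  qed
  also have "q (j - i) + kap * M * (\<Sum>k\<in>{i<..<j}. e (k - i) * q ((j - i) - (k - i))) = e (j - i)"
    unfolding sum_shift_interval[OF less_imp_le[OF less.prems(1)], of "\<lambda>k. e k * q ((j - i) - k)"]
    using chain_weight_unfold[of "j - i"] by simp
  finally show ?case by (simp only: mult.assoc)
qed

text \<open>The mirror image of the bound for descents, with the exponents exchanged. The first
  connector is removed instead of the last, so the induction varies the start a and keeps the end
  fixed.\<close>

lemma ascent_integral_le:
  assumes "i < j" "0 < snd a" "snd a < 1" "0 < v" "v < 1"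
  shows "(\<integral>\<^sup>+x. interior_integral (ascent_weight i j) i j a (x, v) \<partial>lborel) \<le>
    ennreal (e (j - i) * kap * snd a powr (- \<gamma>) * v powr (- (\<gamma> / \<delta>)))"
  using assms
proof (induction "j - i" arbitrary: i a rule: less_induct)
  case less
  interpret LV: pair_sigma_finite "lborel :: 'a measure" "vmeas :: ('a \<times> real) measure" ..
  define F where "F k c x = interior_integral (ascent_weight k j) k j c (x, v)" for k c x
  have F[measurable (raw)]: "(\<lambda>x. F k (A x) (B x)) \<in> borel_measurable X"
    if [measurable]: "A \<in> X \<rightarrow>\<^sub>M borel \<Otimes>\<^sub>M borel" "B \<in> X \<rightarrow>\<^sub>M borel"
    for A B k and X :: "'x measure"
    unfolding F_def by measurable
  let ?u = "snd a powr (- \<gamma>)" and ?v = "v powr (- (\<gamma> / \<delta>))"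
  define D where "D k c = ennreal (q (k - i) * kst a c) * of_bool (snd a \<le> snd c)" for k c
  have D: "D k \<in> borel_measurable vmeas" for k
  proof -
    have "(\<lambda>c. kst a c) \<in> borel_measurable vmeas"
      by (intro measurable_kst_vertices measurable_ident_sets[OF sets_vmeas]) simp
    then show ?thesis unfolding D_def
      by (intro borel_measurable_times_ennreal measurable_compose[OF pred_vmeas_mark(1) measurable_of_bool]) measurable
  qed
  have pt: "interior_integral (ascent_weight i j) i j a (x, v) \<le>
      ennreal (q (j - i) * kst a (x, v)) * of_bool (snd a \<le> v) + (\<Sum>k\<in>{i<..<j}. \<integral>\<^sup>+c. D k c * F k c x \<partial>vmeas)" for x
  proof -
    let ?b = "(x, v)"
    define G where "G k p = connector_weight i k p * of_bool (snd a \<le> snd (p k))" for k p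
    have [measurable]: "G k \<in> borel_measurable path_space" for k unfolding G_def by measurable
    have Gint: "interior_integral (G k) i k a c = interior_integral (connector_weight i k) i k a c * of_bool (snd a \<le> snd c)"
      if "i < k" for k c
    proof -
      have "G k (z(i := a, k := c)) = connector_weight i k (z(i := a, k := c)) * of_bool (snd a \<le> snd c)" for z
        using that by (simp add: G_def)
      then show ?thesis unfolding interior_integral_def
        by (simp add: nn_integral_multc measurable_interior_integrand)
    qed
    have "interior_integral (ascent_weight i j) i j a ?b \<le>
        interior_integral (\<lambda>p. G j p + (\<Sum>k\<in>{i<..<j}. G k p * ascent_weight k j p)) i j a ?b"
    proof (rule interior_integral_mono)
      fix z
      show "ascent_weight i j (z(i := a, j := ?b)) \<le> G j (z(i := a, j := ?b)) +
          (\<Sum>k\<in>{i<..<j}. G k (z(i := a, j := ?b)) * ascent_weight k j (z(i := a, j := ?b)))"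
        using ascent_weight_split[of i j "z(i := a, j := ?b)"] less.prems unfolding G_def by simp
    qed
    also have "\<dots> = interior_integral (G j) i j a ?b + (\<Sum>k\<in>{i<..<j}. interior_integral (\<lambda>p. G k p * ascent_weight k j p) i j a ?b)"
      by (subst interior_integral_add, measurable) (subst interior_integral_sum, auto)
    also have "\<dots> \<le> ennreal (q (j - i) * kst a ?b) * of_bool (snd a \<le> v) + (\<Sum>k\<in>{i<..<j}. \<integral>\<^sup>+c. D k c * F k c x \<partial>vmeas)"
    proof (intro add_mono sum_mono)
      have "interior_integral (G j) i j a ?b = interior_integral (connector_weight i j) i j a ?b * of_bool (snd a \<le> v)"
        using Gint[OF less.prems(1)] by simp
      also have "\<dots> \<le> ennreal (q (j - i) * kst a ?b) * of_bool (snd a \<le> v)"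
        using less.prems by (intro mult_right_mono connector_integral_le) auto
      finally show "interior_integral (G j) i j a ?b \<le> ennreal (q (j - i) * kst a ?b) * of_bool (snd a \<le> v)" .
      fix k assume k: "k \<in> {i<..<j}"
      have "depends_on {i..k} (G k)"
        unfolding G_def using k by (intro depends_on_mult_vertex depends_on_weights) auto
      then have "interior_integral (\<lambda>p. G k p * ascent_weight k j p) i j a ?b =
          (\<integral>\<^sup>+c. interior_integral (connector_weight i k) i k a c * of_bool (snd a \<le> snd c) * F k c x \<partial>vmeas)"
        using k by (subst interior_integral_split[of i k j]) (auto simp: depends_on_weights Gint F_def)
      also have "\<dots> \<le> (\<integral>\<^sup>+c. D k c * F k c x \<partial>vmeas)"
      proof (rule nn_integral_mono_AE)
        show "AE c in vmeas. interior_integral (connector_weight i k) i k a c * of_bool (snd a \<le> snd c) * F k c x \<le> D k c * F k c x"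
          unfolding D_def
          using AE_vmeas by eventually_elim (use k less.prems in \<open>intro mult_right_mono connector_integral_le; auto\<close>)
      qed
      finally show "interior_integral (\<lambda>p. G k p * ascent_weight k j p) i j a ?b \<le> (\<integral>\<^sup>+c. D k c * F k c x \<partial>vmeas)" .
    qed
    finally show ?thesis .
  qed
  have first: "(\<integral>\<^sup>+x. ennreal (q n * kst a (x, w)) * of_bool (snd a \<le> w) \<partial>lborel) \<le> ennreal (q n * kap * ?u * w powr (- (\<gamma> / \<delta>)))"
    if "0 < w" for n w
  proof (cases "snd a \<le> w")
    case True
    then have "(\<integral>\<^sup>+x. ennreal (q n * kst a (x, w)) * of_bool (snd a \<le> w) \<partial>lborel) = ennreal (q n) * (\<integral>\<^sup>+x. ennreal (kst a (x, w)) \<partial>lborel)"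
      by (simp add: ennreal_mult nn_integral_cmult)
    also have "\<dots> \<le> ennreal (q n) * ennreal (kap * ?u * w powr (- (\<gamma> / \<delta>)))"
      using nn_integral_kst_le[of a w] less.prems True that by (intro mult_left_mono) (auto simp: min_def max_def split: if_splits)
    finally show ?thesis using kap_pos by (simp add: ennreal_prod_nonneg mult_ac)
  qed simp
  have step: "(\<integral>\<^sup>+x. \<integral>\<^sup>+c. D k c * F k c x \<partial>vmeas \<partial>lborel) \<le> ennreal (kap * M * (q (k - i) * e ((j - i) - (k - i))) * (kap * ?u * ?v))"
    if k: "k \<in> {i<..<j}" for k
  proof -
    note [measurable] = D
    have "(\<integral>\<^sup>+x. \<integral>\<^sup>+c. D k c * F k c x \<partial>vmeas \<partial>lborel) = (\<integral>\<^sup>+c. \<integral>\<^sup>+x. D k c * F k c x \<partial>lborel \<partial>vmeas)"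
      by (rule LV.Fubini'[symmetric]) measurable
    also have "\<dots> \<le> (\<integral>\<^sup>+c. D k c * ennreal ((e (j - k) * kap * ?v) * snd c powr (- \<gamma>)) \<partial>vmeas)"
    proof (rule nn_integral_mono_AE)
      show "AE c in vmeas. (\<integral>\<^sup>+x. D k c * F k c x \<partial>lborel) \<le> D k c * ennreal ((e (j - k) * kap * ?v) * snd c powr (- \<gamma>))"
        using AE_vmeas
      proof eventually_elim
        case (elim c)
        have "(\<integral>\<^sup>+x. D k c * F k c x \<partial>lborel) = D k c * (\<integral>\<^sup>+x. F k c x \<partial>lborel)"
          by (rule nn_integral_cmult) measurable
        also have "\<dots> \<le> D k c * ennreal (e (j - k) * kap * snd c powr (- \<gamma>) * ?v)"
          unfolding F_def using k less.prems elim by (intro mult_left_mono less.hyps) auto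
        finally show ?case by (simp only: mult_ac)
      qed
    qed
    also have "\<dots> \<le> ennreal ((q (k - i) * kap * ?u) * (e (j - k) * kap * ?v) * M)"
    proof (rule nn_integral_chain_step[OF D])
      show "\<gamma> / \<delta> + \<gamma> = th" by (simp add: th_def)
      show "(\<integral>\<^sup>+z. D k (z, w) \<partial>lborel) \<le> ennreal (q (k - i) * kap * ?u * w powr (- (\<gamma> / \<delta>)))" if "0 < w" for w
        using first[OF that] by (simp add: D_def)
    qed (use kap_pos in auto)
    also have "\<dots> = ennreal (kap * M * (q (k - i) * e ((j - i) - (k - i))) * (kap * ?u * ?v))"
      using k by (simp add: mult_ac)
    finally show ?thesis .
  qed
  have [measurable]: "(\<lambda>x. \<integral>\<^sup>+c. D k c * F k c x \<partial>vmeas) \<in> borel_measurable lborel" for k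
    using D by measurable
  have "(\<integral>\<^sup>+x. interior_integral (ascent_weight i j) i j a (x, v) \<partial>lborel) \<le>
      (\<integral>\<^sup>+x. ennreal (q (j - i) * kst a (x, v)) * of_bool (snd a \<le> v) + (\<Sum>k\<in>{i<..<j}. \<integral>\<^sup>+c. D k c * F k c x \<partial>vmeas) \<partial>lborel)"
    by (intro nn_integral_mono pt)
  also have "\<dots> = (\<integral>\<^sup>+x. ennreal (q (j - i) * kst a (x, v)) * of_bool (snd a \<le> v) \<partial>lborel) +
      (\<Sum>k\<in>{i<..<j}. \<integral>\<^sup>+x. \<integral>\<^sup>+c. D k c * F k c x \<partial>vmeas \<partial>lborel)"
    by (subst nn_integral_add, measurable) (subst nn_integral_sum, measurable)
  also have "\<dots> \<le> ennreal (q (j - i) * kap * ?u * ?v) +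
      (\<Sum>k\<in>{i<..<j}. ennreal (kap * M * (q (k - i) * e ((j - i) - (k - i))) * (kap * ?u * ?v)))"
    using less.prems by (intro add_mono sum_mono first step)
  also have "\<dots> = ennreal ((q (j - i) + kap * M * (\<Sum>k\<in>{i<..<j}. q (k - i) * e ((j - i) - (k - i)))) * (kap * ?u * ?v))"
  proof -
    have "(\<Sum>k\<in>{i<..<j}. ennreal (kap * M * (q (k - i) * e ((j - i) - (k - i))) * (kap * ?u * ?v))) =
        ennreal (kap * M * (\<Sum>k\<in>{i<..<j}. q (k - i) * e ((j - i) - (k - i))) * (kap * ?u * ?v))"
      using kap_pos M_ge_1 by (subst sum_ennreal) (auto simp: sum_distrib_left sum_distrib_right)
    moreover have "0 \<le> kap * M * (\<Sum>k\<in>{i<..<j}. q (k - i) * e ((j - i) - (k - i))) * (kap * ?u * ?v)"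
      using kap_pos M_ge_1 by (intro mult_nonneg_nonneg sum_nonneg) auto
    moreover have "0 \<le> q (j - i) * kap * ?u * ?v" using kap_pos by simp
    ultimately show ?thesis by (simp only: ennreal_plus[symmetric]) (simp only: distrib_right mult.assoc)
  qed
  also have "q (j - i) + kap * M * (\<Sum>k\<in>{i<..<j}. q (k - i) * e ((j - i) - (k - i))) = e (j - i)"
    unfolding sum_shift_interval[OF less_imp_le[OF less.prems(1)], of "\<lambda>k. q k * e ((j - i) - k)"]
    using chain_weight_unfold'[of "j - i"] by simp
  finally show ?case by (simp only: mult.assoc)
qed

end

section \<open>Paths with a weak end or a long jump\<close>

lemma powr_neg_antimono: "0 < (a::real) \<Longrightarrow> a \<le> b \<Longrightarrow> 0 \<le> s \<Longrightarrow> b powr (- s) \<le> a powr (- s)"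
  by (intro powr_mono2') auto

lemma powr_neg_mono_exponent: "0 < (a::real) \<Longrightarrow> a < 1 \<Longrightarrow> s \<le> t \<Longrightarrow> a powr (- s) \<le> a powr (- t)"
  by (intro powr_mono') auto

section \<open>Paths that end at a weak vertex\<close>

context soft_boolean_parameters
begin

text \<open>The start is the origin but the end is free; it becomes the outermost variable, and the
  remaining vertices form an interior integral.\<close>

lemma path_integral_end:
  assumes G: "G \<in> borel_measurable path_space" "depends_on {..n} G" and n: "0 < n"
  shows "(\<integral>\<^sup>+z. G (z(0 := a)) \<partial>PiM {1..n} (\<lambda>_. vmeas :: ('a \<times> real) measure)) =
    (\<integral>\<^sup>+b. interior_integral G 0 n a b \<partial>vmeas)"
proof -
  have I: "{1..n} = insert n {0<..<n}" using n by auto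
  have "(\<integral>\<^sup>+z. G (z(0 := a)) \<partial>PiM (insert n {0<..<n}) (\<lambda>_. vmeas)) =
      (\<integral>\<^sup>+b. \<integral>\<^sup>+z. G (z(n := b, 0 := a)) \<partial>PiM {0<..<n} (\<lambda>_. vmeas) \<partial>vmeas)"
  proof (rule vprod.product_nn_integral_insert_rev)
    have "(\<lambda>z. G (z(0 := a, 0 := a))) \<in> borel_measurable (PiM (insert n {0<..<n}) (\<lambda>_. vmeas))"
      by (rule measurable_interior_integrand[OF G(1)]) auto
    then show "(\<lambda>z. G (z(0 := a))) \<in> borel_measurable (PiM (insert n {0<..<n}) (\<lambda>_. vmeas))" by simp
  qed auto
  also have "\<dots> = (\<integral>\<^sup>+b. interior_integral G 0 n a b \<partial>vmeas)"
    unfolding interior_integral_def using n by (intro nn_integral_cong) (simp add: fun_upd_twist)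
  finally show ?thesis unfolding I .
qed

lemma path_integral_end':
  assumes G: "G \<in> borel_measurable path_space" "depends_on {..n} G" and n: "0 < n"
  shows "(\<integral>\<^sup>+z. G (z(0 := a)) \<partial>PiM {1..n} (\<lambda>_. vmeas :: ('a \<times> real) measure)) =
    (\<integral>\<^sup>+v. \<integral>\<^sup>+x. interior_integral G 0 n a (x, v) \<partial>lborel \<partial>uniform01)"
  unfolding path_integral_end[OF assms]
proof (rule nn_integral_vmeas)
  show "interior_integral G 0 n a \<in> borel_measurable vmeas"
    by (rule measurable_interior_integral[OF G(1)]) (auto intro: measurable_ident_sets sets_vmeas)
qed

lemma nn_integral_powr_le_M:
  assumes "s \<le> th" shows "(\<integral>\<^sup>+u. ennreal (u powr (- s)) \<partial>uniform01) \<le> ennreal M"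
proof -
  have "(\<integral>\<^sup>+u. ennreal (u powr (- s)) \<partial>uniform01) \<le> (\<integral>\<^sup>+u. ennreal (u powr (- th)) \<partial>uniform01)"
    by (rule nn_integral_mono_AE) (use AE_uniform01 in \<open>eventually_elim; auto intro!: ennreal_leI powr_neg_mono_exponent assms\<close>)
  then show ?thesis by (simp add: nn_integral_uniform01_powr_th)
qed

text \<open>The descent bound leaves \<open>v powr - \<gamma>\<close> at the end, and its integral
  over v < us gives the rate \<open>us powr (1 - \<gamma>)\<close>. The power of the starting mark
  has an exponent of size at most th and costs at most M.\<close>

lemma weak_end_paths_le:
  assumes n: "0 < n" and us: "0 < us" "us < 1"
  shows "(\<integral>\<^sup>+u. \<integral>\<^sup>+z. descent_weight 0 n (z(0 := (0, u))) * of_bool (snd ((z(0 := (0, u))) n) < us)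
      \<partial>PiM {1..n} (\<lambda>_. vmeas :: ('a \<times> real) measure) \<partial>uniform01) \<le> ennreal (e n * kap * M * (us powr (1 - \<gamma>) / (1 - \<gamma>)))"
proof -
  have "(\<integral>\<^sup>+u. \<integral>\<^sup>+z. descent_weight 0 n (z(0 := (0, u))) * of_bool (snd ((z(0 := (0, u))) n) < us)
      \<partial>PiM {1..n} (\<lambda>_. vmeas) \<partial>uniform01) \<le>
      (\<integral>\<^sup>+u. ennreal (e n * kap * (us powr (1 - \<gamma>) / (1 - \<gamma>))) * ennreal (u powr (- (\<gamma> / \<delta>))) \<partial>uniform01)"
  proof (rule nn_integral_mono_AE)
    show "AE u in uniform01. (\<integral>\<^sup>+z. descent_weight 0 n (z(0 := (0, u))) * of_bool (snd ((z(0 := (0, u))) n) < us)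
      \<partial>PiM {1..n} (\<lambda>_. vmeas :: ('a \<times> real) measure)) \<le> ennreal (e n * kap * (us powr (1 - \<gamma>) / (1 - \<gamma>))) * ennreal (u powr (- (\<gamma> / \<delta>)))"
      using AE_uniform01
    proof eventually_elim
      case (elim u)
      let ?a = "(0, u) :: 'a \<times> real"
      have m: "(\<lambda>p :: nat \<Rightarrow> 'a \<times> real. of_bool (snd (p n) < us) :: ennreal) \<in> borel_measurable path_space"
        by (rule measurable_compose[OF measurable_mark, where g="\<lambda>u. of_bool (u < us)"]) measurable
      let ?G = "\<lambda>p. descent_weight 0 n p * of_bool (snd (p n) < us)"
      have G: "?G \<in> borel_measurable path_space" using m by measurable
      have "depends_on {..n} ?G"
        using depends_on_mult_vertex[OF depends_on_weights(2), of 0 n n "\<lambda>c. of_bool (snd c < us)"] by (simp add: atLeast0AtMost)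
      from path_integral_end'[OF G this n, of ?a]
      have "(\<integral>\<^sup>+z. ?G (z(0 := ?a)) \<partial>PiM {1..n} (\<lambda>_. vmeas)) = (\<integral>\<^sup>+v. \<integral>\<^sup>+x. interior_integral ?G 0 n ?a (x, v) \<partial>lborel \<partial>uniform01)" .
      also have "\<dots> \<le> (\<integral>\<^sup>+v. ennreal (e n * kap * u powr (- (\<gamma> / \<delta>))) * (ennreal (v powr (- \<gamma>)) * of_bool (v < us)) \<partial>uniform01)"
      proof (rule nn_integral_mono_AE)
        show "AE v in uniform01. (\<integral>\<^sup>+x. interior_integral ?G 0 n ?a (x, v) \<partial>lborel) \<le>
            ennreal (e n * kap * u powr (- (\<gamma> / \<delta>))) * (ennreal (v powr (- \<gamma>)) * of_bool (v < us))"
          using AE_uniform01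
        proof eventually_elim
          case (elim v)
          have "interior_integral ?G 0 n ?a (x, v) = interior_integral (descent_weight 0 n) 0 n ?a (x, v) * of_bool (v < us)" for x
            unfolding interior_integral_def by (simp add: nn_integral_multc measurable_interior_integrand)
          then have "(\<integral>\<^sup>+x. interior_integral ?G 0 n ?a (x, v) \<partial>lborel) =
              (\<integral>\<^sup>+x. interior_integral (descent_weight 0 n) 0 n ?a (x, v) \<partial>lborel) * of_bool (v < us)"
            by (simp add: nn_integral_multc measurable_interior_integral)
          also have "\<dots> \<le> ennreal (e (n - 0) * kap * snd ?a powr (- (\<gamma> / \<delta>)) * v powr (- \<gamma>)) * of_bool (v < us)"
            using elim \<open>0 < u \<and> u < 1\<close> n by (intro mult_right_mono descent_integral_le) auto
          finally show ?case using kap_pos by (simp add: ennreal_mult mult.assoc)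
        qed
      qed
      also have "\<dots> = ennreal (e n * kap * u powr (- (\<gamma> / \<delta>))) * (\<integral>\<^sup>+v. ennreal (v powr (- \<gamma>)) * of_bool (v < us) \<partial>uniform01)"
        by (rule nn_integral_cmult) measurable
      also have "\<dots> \<le> ennreal (e n * kap * u powr (- (\<gamma> / \<delta>))) * ennreal (us powr (1 - \<gamma>) / (1 - \<gamma>))"
        using \<gamma> us by (intro mult_left_mono nn_integral_uniform01_powr_less) auto
      finally show ?case using kap_pos \<gamma> by (simp add: ennreal_prod_nonneg mult_ac)
    qed
  qed
  also have "\<dots> = ennreal (e n * kap * (us powr (1 - \<gamma>) / (1 - \<gamma>))) * (\<integral>\<^sup>+u. ennreal (u powr (- (\<gamma> / \<delta>))) \<partial>uniform01)"
    by (rule nn_integral_cmult) measurable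
  also have "\<dots> \<le> ennreal (e n * kap * (us powr (1 - \<gamma>) / (1 - \<gamma>))) * ennreal M"
    using \<gamma> by (intro mult_left_mono nn_integral_powr_le_M) (auto simp: th_def)
  also have "\<dots> = ennreal (e n * kap * M * (us powr (1 - \<gamma>) / (1 - \<gamma>)))"
    using kap_pos \<gamma> M_ge_1 by (simp add: ennreal_prod_nonneg mult_ac)
  finally show ?thesis .
qed

text \<open>\<open>psi\<close> is the dependence on the marks of the tail of \<open>kst\<close> at long distance. \<open>J\<close> stays bounded
  as \<open>us\<close> tends to 0 iff \<open>\<gamma> + \<gamma> * \<delta> < 1\<close>, i.e. in case (i).\<close>

definition J :: "real \<Rightarrow> ennreal" where
  "J us = (\<integral>\<^sup>+u. ennreal (u powr (- (\<gamma> + \<gamma> * \<delta>))) * of_bool (us \<le> u) \<partial>uniform01)"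

text \<open>The weight of a long jump leaving a vertex of mark u, once the landing point is
  integrated out and only its mark v, at least us, remains.\<close>

definition Z :: "real \<Rightarrow> real \<Rightarrow> ennreal" where
  "Z us u = (\<integral>\<^sup>+v. ennreal (psi u v) * of_bool (us \<le> v) \<partial>uniform01)"

section \<open>Mark integrals for long jumps\<close>

lemma psi_nonneg [simp]: "0 \<le> psi u v"
  by (simp add: psi_def)

lemma measurable_Z [measurable]: "Z us \<in> borel_measurable borel"
  unfolding Z_def psi_def by measurable

lemma powr_split: "0 < (u::real) \<Longrightarrow> a = b + c \<Longrightarrow> u powr (- a) = u powr (- b) * u powr (- c)"
  by (simp add: powr_add[symmetric])

text \<open>The smaller of the two marks takes the exponent \<gamma> + \<gamma>\<delta>, which leads
  to \<open>J\<close>; the other must keep one of size at most th, which leads to M. If v is the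
  smaller mark, u has exponent -2\<gamma>, possibly not integrable; the excess \<gamma> -
  \<gamma>/\<delta> is moved to v, where it still fits below \<gamma>.\<close>

lemma psi_bound:
  assumes u: "0 < u" "u < 1" and v: "0 < v" "v < 1"
  shows "u powr (- \<gamma>) * psi u v \<le> u powr (- (\<gamma> + \<gamma> * \<delta>)) * v powr (- th) + u powr (- th) * v powr (- (\<gamma> + \<gamma> * \<delta>))"
proof (cases "u \<le> v")
  case True
  have "v powr (- \<gamma>) \<le> v powr (- th)" using v \<gamma> \<delta> by (intro powr_neg_mono_exponent) (auto simp: th_def)
  then have "u powr (- (\<gamma> + \<gamma> * \<delta>)) * v powr (- \<gamma>) \<le> u powr (- (\<gamma> + \<gamma> * \<delta>)) * v powr (- th)"
    by (intro mult_left_mono) auto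
  moreover have "u powr (- \<gamma>) * psi u v = u powr (- (\<gamma> + \<gamma> * \<delta>)) * v powr (- \<gamma>)"
    unfolding powr_split[OF u(1), of "\<gamma> + \<gamma> * \<delta>" \<gamma> "\<gamma> * \<delta>", OF refl] using True by (simp add: psi_def)
  ultimately show ?thesis by (simp add: add_increasing2)
next
  case False
  have g: "\<gamma> / \<delta> \<le> \<gamma>" using \<gamma> \<delta> by (simp add: field_simps)
  have "u powr (- (\<gamma> - \<gamma> / \<delta>)) \<le> v powr (- (\<gamma> - \<gamma> / \<delta>))" using False v g by (intro powr_neg_antimono) auto
  also have "\<dots> \<le> v powr (- \<gamma>)" using v \<gamma> \<delta> by (intro powr_neg_mono_exponent) auto
  finally have "(u powr (- th) * v powr (- (\<gamma> * \<delta>))) * u powr (- (\<gamma> - \<gamma> / \<delta>)) \<le> (u powr (- th) * v powr (- (\<gamma> * \<delta>))) * v powr (- \<gamma>)"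
    by (intro mult_left_mono) auto
  moreover have "u powr (- \<gamma>) * u powr (- \<gamma>) = u powr (- th) * u powr (- (\<gamma> - \<gamma> / \<delta>))"
    using u by (simp add: powr_add[symmetric] th_def)
  moreover have "u powr (- \<gamma>) * psi u v = (u powr (- \<gamma>) * u powr (- \<gamma>)) * v powr (- (\<gamma> * \<delta>))"
    using False by (simp add: psi_def)
  ultimately have "u powr (- \<gamma>) * psi u v \<le> u powr (- th) * v powr (- (\<gamma> + \<gamma> * \<delta>))"
    unfolding powr_split[OF v(1), of "\<gamma> + \<gamma> * \<delta>" \<gamma> "\<gamma> * \<delta>", OF refl] by (simp only: mult_ac)
  then show ?thesis by (simp add: add_increasing)
qed

text \<open>Here w is the smallest mark of the path before the jump, u the mark from which the jump
  departs and v the one at which it lands. Descent and ascent each contribute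
  \<open>w powr - \<gamma>\<close>. The large exponent \<gamma> + \<gamma>\<delta> goes to whichever
  of w and v is smaller, and the other two marks keep th.\<close>

lemma psi_bound_double:
  assumes w: "0 < w" "w \<le> u" and u: "u < 1" and v: "0 < v" "v < 1"
  shows "w powr (- \<gamma>) * w powr (- \<gamma>) * (u powr (- (\<gamma> / \<delta>)) * psi u v) \<le>
    u powr (- th) * (w powr (- (\<gamma> + \<gamma> * \<delta>)) * v powr (- th) + w powr (- th) * v powr (- (\<gamma> + \<gamma> * \<delta>)))"
proof -
  have u0: "0 < u" and w1: "w < 1" using w u by auto
  have uth: "u powr (- th) = u powr (- (\<gamma> / \<delta>)) * u powr (- \<gamma>)"
    using u0 by (intro powr_split) (auto simp: th_def)
  have vth: "v powr (- \<gamma>) \<le> v powr (- th)" using v \<gamma> \<delta> by (intro powr_neg_mono_exponent) (auto simp: th_def)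
  have ws: "w powr (- (\<gamma> + \<gamma> * \<delta>)) = w powr (- \<gamma>) * w powr (- \<gamma>) * w powr (- (\<gamma> * (\<delta> - 1)))"
    using w by (simp add: powr_add[symmetric] algebra_simps)
  have split: "t powr (- (\<gamma> * \<delta>)) = t powr (- \<gamma>) * t powr (- (\<gamma> * (\<delta> - 1)))" if "0 < t" for t
    using that by (simp add: powr_add[symmetric] algebra_simps)
  have anti: "t powr (- (\<gamma> * (\<delta> - 1))) \<le> w powr (- (\<gamma> * (\<delta> - 1)))" if "w \<le> t" for t
    using that w \<gamma> \<delta> by (intro powr_neg_antimono) auto
  \<comment> \<open>The surplus exponent \<gamma>(\<delta> - 1) of a larger mark t is moved to w,
    where with -2\<gamma> it makes up -(\<gamma> + \<gamma>\<delta>).\<close>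
  have main: "w powr (- \<gamma>) * w powr (- \<gamma>) * (u powr (- th) * (v powr (- \<gamma>) * t powr (- (\<gamma> * (\<delta> - 1))))) \<le>
      u powr (- th) * (w powr (- (\<gamma> + \<gamma> * \<delta>)) * v powr (- th))" if "w \<le> t" for t
  proof -
    have "(w powr (- \<gamma>) * w powr (- \<gamma>) * u powr (- th)) * (v powr (- \<gamma>) * t powr (- (\<gamma> * (\<delta> - 1)))) \<le>
        (w powr (- \<gamma>) * w powr (- \<gamma>) * u powr (- th)) * (v powr (- th) * w powr (- (\<gamma> * (\<delta> - 1))))"
      by (intro mult_left_mono mult_mono vth anti that) auto
    then show ?thesis unfolding ws by (simp only: mult_ac)
  qed
  have nn: "0 \<le> u powr (- th) * (w powr (- th) * v powr (- (\<gamma> + \<gamma> * \<delta>)))"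
    "0 \<le> u powr (- th) * (w powr (- (\<gamma> + \<gamma> * \<delta>)) * v powr (- th))" by simp_all
  consider "u \<le> v" | "v < u" "w \<le> v" | "v < u" "v < w" by linarith
  then show ?thesis
  proof cases
    case 1
    then have "u powr (- (\<gamma> / \<delta>)) * psi u v = u powr (- th) * (v powr (- \<gamma>) * u powr (- (\<gamma> * (\<delta> - 1))))"
      unfolding psi_def uth using split[OF u0] by (simp add: mult_ac)
    then show ?thesis unfolding distrib_left using main[OF w(2)] nn by (simp only: add_increasing2)
  next
    case 2
    then have "u powr (- (\<gamma> / \<delta>)) * psi u v = u powr (- th) * (v powr (- \<gamma>) * v powr (- (\<gamma> * (\<delta> - 1))))"
      unfolding psi_def uth using split[OF v(1)] by (simp add: mult_ac)
    then show ?thesis unfolding distrib_left using main[OF 2(2)] nn by (simp only: add_increasing2)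
  next
    case 3
    have g: "\<gamma> / \<delta> \<le> \<gamma>" using \<gamma> \<delta> by (simp add: field_simps)
    have "w powr (- (\<gamma> - \<gamma> / \<delta>)) \<le> v powr (- (\<gamma> - \<gamma> / \<delta>))" using 3 v g by (intro powr_neg_antimono) auto
    also have "\<dots> \<le> v powr (- \<gamma>)" using v \<gamma> \<delta> by (intro powr_neg_mono_exponent) auto
    finally have "(u powr (- th) * v powr (- (\<gamma> * \<delta>)) * w powr (- th)) * w powr (- (\<gamma> - \<gamma> / \<delta>)) \<le>
        (u powr (- th) * v powr (- (\<gamma> * \<delta>)) * w powr (- th)) * v powr (- \<gamma>)"
      by (intro mult_left_mono) auto
    moreover have "w powr (- \<gamma>) * w powr (- \<gamma>) = w powr (- th) * w powr (- (\<gamma> - \<gamma> / \<delta>))"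
      using w by (simp add: powr_add[symmetric] th_def)
    moreover have "u powr (- (\<gamma> / \<delta>)) * psi u v = u powr (- th) * v powr (- (\<gamma> * \<delta>))"
      using 3 by (simp add: psi_def uth)
    ultimately have "w powr (- \<gamma>) * w powr (- \<gamma>) * (u powr (- (\<gamma> / \<delta>)) * psi u v) \<le>
        u powr (- th) * (w powr (- th) * v powr (- (\<gamma> + \<gamma> * \<delta>)))"
      unfolding powr_split[OF v(1), of "\<gamma> + \<gamma> * \<delta>" \<gamma> "\<gamma> * \<delta>", OF refl] by (simp only: mult_ac)
    then show ?thesis unfolding distrib_left using nn by linarith
  qed
qed

text \<open>After the pointwise bound both summands are products in u and v: one mark gives
  \<open>J us\<close>, the other gives M.\<close>

lemma nn_integral_Z:
  "(\<integral>\<^sup>+u. ennreal (u powr (- \<gamma>)) * of_bool (us \<le> u) * Z us u \<partial>uniform01) \<le> 2 * ennreal M * J us"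
proof -
  let ?s = "\<gamma> + \<gamma> * \<delta>"
  have "(\<integral>\<^sup>+u. ennreal (u powr (- \<gamma>)) * of_bool (us \<le> u) * Z us u \<partial>uniform01) =
      (\<integral>\<^sup>+u. \<integral>\<^sup>+v. ennreal (u powr (- \<gamma>)) * of_bool (us \<le> u) * (ennreal (psi u v) * of_bool (us \<le> v)) \<partial>uniform01 \<partial>uniform01)"
    unfolding Z_def psi_def by (intro nn_integral_cong nn_integral_cmult[symmetric]) measurable
  also have "\<dots> \<le> (\<integral>\<^sup>+u. \<integral>\<^sup>+v. (ennreal (u powr (- ?s)) * of_bool (us \<le> u)) * ennreal (v powr (- th)) +
      ennreal (u powr (- th)) * (ennreal (v powr (- ?s)) * of_bool (us \<le> v)) \<partial>uniform01 \<partial>uniform01)"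
  proof (rule nn_integral_mono_AE, use AE_uniform01 in eventually_elim, rule nn_integral_mono_AE, use AE_uniform01 in eventually_elim)
    fix u v :: real assume uv: "0 < u \<and> u < 1" "0 < v \<and> v < 1"
    have "ennreal (u powr (- \<gamma>)) * ennreal (psi u v) \<le> ennreal (u powr (- ?s) * v powr (- th) + u powr (- th) * v powr (- ?s))"
      using psi_bound[of u v] uv by (simp add: ennreal_prod_nonneg ennreal_leI del: ennreal_plus)
    also have "\<dots> = ennreal (u powr (- ?s)) * ennreal (v powr (- th)) + ennreal (u powr (- th)) * ennreal (v powr (- ?s))"
      by (simp add: ennreal_prod_nonneg)
    finally show "ennreal (u powr (- \<gamma>)) * of_bool (us \<le> u) * (ennreal (psi u v) * of_bool (us \<le> v)) \<le>
        (ennreal (u powr (- ?s)) * of_bool (us \<le> u)) * ennreal (v powr (- th)) + ennreal (u powr (- th)) * (ennreal (v powr (- ?s)) * of_bool (us \<le> v))"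
      by (cases "us \<le> u"; cases "us \<le> v") simp_all
  qed
  also have "\<dots> = (\<integral>\<^sup>+u. (ennreal (u powr (- ?s)) * of_bool (us \<le> u)) * ennreal M + ennreal (u powr (- th)) * J us \<partial>uniform01)"
    by (intro nn_integral_cong, subst nn_integral_add)
       (simp_all add: nn_integral_cmult nn_integral_uniform01_powr_th J_def)
  also have "\<dots> = J us * ennreal M + ennreal M * J us"
    by (subst nn_integral_add) (simp_all add: nn_integral_multc nn_integral_uniform01_powr_th J_def)
  also have "\<dots> = 2 * ennreal M * J us" by (simp add: mult_2 distrib_left distrib_right mult.commute)
  finally show ?thesis .
qed

lemma nn_integral_Z_double:
  "(\<integral>\<^sup>+w. of_bool (us \<le> w) * ennreal (w powr (- \<gamma>) * w powr (- \<gamma>)) *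
      (\<integral>\<^sup>+u. of_bool (w \<le> u) * ennreal (u powr (- (\<gamma> / \<delta>))) * Z us u \<partial>uniform01) \<partial>uniform01) \<le> 2 * ennreal M * ennreal M * J us"
proof -
  let ?s = "\<gamma> + \<gamma> * \<delta>"
  have [measurable]: "(\<lambda>(u, v). psi u v) \<in> borel_measurable (borel \<Otimes>\<^sub>M borel)" unfolding psi_def by measurable
  have "(\<integral>\<^sup>+w. of_bool (us \<le> w) * ennreal (w powr (- \<gamma>) * w powr (- \<gamma>)) *
      (\<integral>\<^sup>+u. of_bool (w \<le> u) * ennreal (u powr (- (\<gamma> / \<delta>))) * Z us u \<partial>uniform01) \<partial>uniform01) =
      (\<integral>\<^sup>+w. \<integral>\<^sup>+u. \<integral>\<^sup>+v. of_bool (us \<le> w) * ennreal (w powr (- \<gamma>) * w powr (- \<gamma>)) *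
        (of_bool (w \<le> u) * ennreal (u powr (- (\<gamma> / \<delta>))) * (ennreal (psi u v) * of_bool (us \<le> v))) \<partial>uniform01 \<partial>uniform01 \<partial>uniform01)"
    unfolding Z_def by (simp add: nn_integral_cmult)
  also have "\<dots> \<le> (\<integral>\<^sup>+w. \<integral>\<^sup>+u. \<integral>\<^sup>+v. ennreal (u powr (- th)) * ((ennreal (w powr (- ?s)) * of_bool (us \<le> w)) * ennreal (v powr (- th)) +
      ennreal (w powr (- th)) * (ennreal (v powr (- ?s)) * of_bool (us \<le> v))) \<partial>uniform01 \<partial>uniform01 \<partial>uniform01)"
  proof (rule nn_integral_mono_AE, use AE_uniform01 in eventually_elim, rule nn_integral_mono_AE, use AE_uniform01 in eventually_elim,
      rule nn_integral_mono_AE, use AE_uniform01 in eventually_elim)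
    fix w u v :: real assume *: "0 < w \<and> w < 1" "0 < u \<and> u < 1" "0 < v \<and> v < 1"
    have "ennreal (w powr (- \<gamma>) * w powr (- \<gamma>)) * (ennreal (u powr (- (\<gamma> / \<delta>))) * ennreal (psi u v)) \<le>
        ennreal (u powr (- th) * (w powr (- ?s) * v powr (- th) + w powr (- th) * v powr (- ?s)))" if "w \<le> u"
      using psi_bound_double[of w u v] * that by (simp add: ennreal_prod_nonneg ennreal_leI)
    also have "ennreal (u powr (- th) * (w powr (- ?s) * v powr (- th) + w powr (- th) * v powr (- ?s))) =
        ennreal (u powr (- th)) * (ennreal (w powr (- ?s)) * ennreal (v powr (- th)) + ennreal (w powr (- th)) * ennreal (v powr (- ?s)))"
      by (simp add: ennreal_mult)
    finally show "of_bool (us \<le> w) * ennreal (w powr (- \<gamma>) * w powr (- \<gamma>)) *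
        (of_bool (w \<le> u) * ennreal (u powr (- (\<gamma> / \<delta>))) * (ennreal (psi u v) * of_bool (us \<le> v))) \<le>
        ennreal (u powr (- th)) * ((ennreal (w powr (- ?s)) * of_bool (us \<le> w)) * ennreal (v powr (- th)) +
        ennreal (w powr (- th)) * (ennreal (v powr (- ?s)) * of_bool (us \<le> v)))"
      by (cases "us \<le> w"; cases "us \<le> v"; cases "w \<le> u") simp_all
  qed
  also have "\<dots> = (\<integral>\<^sup>+w. \<integral>\<^sup>+u. ennreal (u powr (- th)) * ((ennreal (w powr (- ?s)) * of_bool (us \<le> w)) * ennreal M + ennreal (w powr (- th)) * J us) \<partial>uniform01 \<partial>uniform01)"
    by (intro nn_integral_cong, subst nn_integral_cmult, simp, subst nn_integral_add)
       (simp_all add: nn_integral_cmult nn_integral_uniform01_powr_th J_def)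
  also have "\<dots> = (\<integral>\<^sup>+w. ennreal M * ((ennreal (w powr (- ?s)) * of_bool (us \<le> w)) * ennreal M + ennreal (w powr (- th)) * J us) \<partial>uniform01)"
    by (intro nn_integral_cong, subst nn_integral_multc) (simp_all add: nn_integral_uniform01_powr_th)
  also have "\<dots> = ennreal M * (J us * ennreal M + ennreal M * J us)"
    by (subst nn_integral_cmult, simp, subst nn_integral_add)
       (simp_all add: nn_integral_multc nn_integral_uniform01_powr_th J_def)
  also have "\<dots> = 2 * ennreal M * ennreal M * J us" by (simp add: mult_ac mult_2[symmetric])
  finally show ?thesis .
qed

text \<open>A smallest mark at either end of the path contributes a single chain of k steps, which
  explains the factor 2; one in between contributes a descent and an ascent. For k = 0 the jump
  leaves directly from the origin.\<close>

definition path_coefficient :: "nat \<Rightarrow> real" where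
  "path_coefficient k = (if k = 0 then 1 else 2 * kap * e k + kap * kap * (\<Sum>i\<in>{0<..<k}. e i * e (k - i)))"

lemma path_coefficient_nonneg: "0 \<le> path_coefficient k"
  using kap_pos by (auto simp: path_coefficient_def intro!: add_nonneg_nonneg mult_nonneg_nonneg sum_nonneg)

section \<open>Paths of strong vertices followed by a long jump\<close>

definition strong_weight :: "real \<Rightarrow> nat \<Rightarrow> (nat \<Rightarrow> 'a \<times> real) \<Rightarrow> ennreal" where
  "strong_weight us k p = path_weight 0 k p * of_bool (\<forall>l\<in>{0..k}. us \<le> snd (p l))"

lemma measurable_strong_weight [measurable]: "strong_weight us k \<in> borel_measurable path_space"
  unfolding strong_weight_def by measurable

lemma depends_on_strong_weight: "depends_on {0..k} (strong_weight us k)"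
  using depends_on_path_weight[of 0 k] unfolding depends_on_def strong_weight_def
  by (auto intro!: arg_cong2[where f="(*)"] arg_cong[where f=of_bool])

text \<open>The cut is at the smallest mark. Of the lower bounds by us only the one at a single
  vertex is kept; the order between the smallest mark and the mark of the last vertex is kept too,
  since the estimate with three marks relies on it.\<close>

lemma strong_weight_split:
  assumes k: "0 < k"
  shows "strong_weight us k p \<le> descent_weight 0 k p * of_bool (us \<le> snd (p k)) +
    of_bool (us \<le> snd (p 0)) * (ascent_weight 0 k p * of_bool (snd (p 0) \<le> snd (p k))) +
    (\<Sum>i\<in>{0<..<k}. (descent_weight 0 i p * of_bool (us \<le> snd (p i))) * (ascent_weight i k p * of_bool (snd (p i) \<le> snd (p k))))"
proof (cases "\<forall>l\<in>{0..k}. us \<le> snd (p l)")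
  case True
  obtain i where i: "i \<in> {0..k}" "\<forall>l\<in>{0..k}. snd (p i) \<le> snd (p l)"
    using exists_argmin[of "{0..k}" "\<lambda>l. snd (p l)"] by fastforce
  have W: "strong_weight us k p = path_weight 0 k p" using True by (simp add: strong_weight_def)
  consider "i = k" | "i = 0" | "i \<in> {0<..<k}" using i by fastforce
  then show ?thesis
  proof cases
    case 1
    then have "\<forall>l\<in>{0..<k}. snd (p k) \<le> snd (p l)" "us \<le> snd (p k)" using i True by auto
    then have "path_weight 0 k p = descent_weight 0 k p * of_bool (us \<le> snd (p k))" by (simp add: descent_weight_def)
    then show ?thesis unfolding W by (simp add: add_increasing2)
  next
    case 2
    then have "\<forall>l\<in>{0<..k}. snd (p 0) \<le> snd (p l)" "us \<le> snd (p 0)" "snd (p 0) \<le> snd (p k)" using i True by auto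
    then have "path_weight 0 k p = of_bool (us \<le> snd (p 0)) * (ascent_weight 0 k p * of_bool (snd (p 0) \<le> snd (p k)))"
      by (simp add: ascent_weight_def)
    then show ?thesis unfolding W by (simp add: add_increasing add_increasing2)
  next
    case 3
    have "path_weight 0 k p \<le> path_weight 0 i p * path_weight i k p" using 3 by (intro path_weight_split) auto
    also have "\<dots> = (descent_weight 0 i p * of_bool (us \<le> snd (p i))) * (ascent_weight i k p * of_bool (snd (p i) \<le> snd (p k)))"
    proof -
      have "\<forall>l\<in>{0..<i}. snd (p i) \<le> snd (p l)" "\<forall>l\<in>{i<..k}. snd (p i) \<le> snd (p l)" "us \<le> snd (p i)" "snd (p i) \<le> snd (p k)"
        using i 3 True by auto
      then show ?thesis by (simp add: descent_weight_def ascent_weight_def)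
    qed
    also have "\<dots> \<le> (\<Sum>i\<in>{0<..<k}. (descent_weight 0 i p * of_bool (us \<le> snd (p i))) * (ascent_weight i k p * of_bool (snd (p i) \<le> snd (p k))))"
      using 3 by (intro member_le_sum[where f="\<lambda>i. (descent_weight 0 i p * of_bool (us \<le> snd (p i))) * (ascent_weight i k p * of_bool (snd (p i) \<le> snd (p k)))"]) auto
    finally show ?thesis unfolding W by (simp add: add_increasing)
  qed
next
  case False
  then have "strong_weight us k p = 0" unfolding strong_weight_def by (simp only: of_bool_eq mult_zero_right)
  then show ?thesis by simp
qed

lemma interior_integral_mark:
  assumes "G \<in> borel_measurable path_space" "i < j"
  shows "interior_integral (\<lambda>p. G p * of_bool (P (snd (p i)) (snd (p j)))) i j a b =
    interior_integral G i j a b * of_bool (P (snd a) (snd b))"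
  using assms unfolding interior_integral_def
  by (simp add: nn_integral_multc measurable_interior_integrand)

lemma nn_integral_weighted:
  fixes D :: "'a \<times> real \<Rightarrow> ennreal"
  assumes D: "D \<in> borel_measurable (borel \<Otimes>\<^sub>M borel)" and H: "H \<in> borel_measurable borel"
  shows "(\<integral>\<^sup>+c. D c * H (snd c) \<partial>vmeas) = (\<integral>\<^sup>+w. (\<integral>\<^sup>+z. D (z, w) \<partial>lborel) * H w \<partial>uniform01)"
proof -
  have D': "D \<in> borel_measurable vmeas" using D by (simp cong: measurable_cong_sets)
  have H': "(\<lambda>c :: 'a \<times> real. H (snd c)) \<in> borel_measurable vmeas"
    by (rule measurable_compose[OF measurable_vmeas_mark H])
  have "(\<integral>\<^sup>+c. D c * H (snd c) \<partial>vmeas) = (\<integral>\<^sup>+w. \<integral>\<^sup>+z. D (z, w) * H w \<partial>lborel \<partial>uniform01)"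
    by (subst nn_integral_vmeas) (intro borel_measurable_times_ennreal D' H', simp)
  also have "\<dots> = (\<integral>\<^sup>+w. (\<integral>\<^sup>+z. D (z, w) \<partial>lborel) * H w \<partial>uniform01)"
  proof (intro nn_integral_cong nn_integral_multc)
    fix w :: real
    have "(\<lambda>z. (z, w)) \<in> (lborel :: 'a measure) \<rightarrow>\<^sub>M borel \<Otimes>\<^sub>M borel" by (intro measurable_Pair measurable_const) auto
    then show "(\<lambda>z. D (z, w)) \<in> borel_measurable lborel" by (rule measurable_compose[OF _ D])
  qed
  finally show ?thesis .
qed

lemma measurable_interior_right:
  "G \<in> borel_measurable path_space \<Longrightarrow> interior_integral G i j a \<in> borel_measurable (borel \<Otimes>\<^sub>M borel :: ('a \<times> real) measure)"
  by (rule measurable_interior_integral) auto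

text \<open>The three terms correspond to the position of the vertex of smallest mark: at the end, at
  the start, or in between.\<close>

lemma arrival_le:
  assumes us: "0 < us" and k: "0 < k"
  shows "(\<integral>\<^sup>+u0. \<integral>\<^sup>+c. interior_integral (strong_weight us k) 0 k (0, u0) c * Z us (snd c) \<partial>vmeas \<partial>uniform01) \<le>
    ennreal (path_coefficient k * (2 * M ^ 3)) * J us"
proof -
  let ?a = "\<lambda>u0. (0, u0) :: 'a \<times> real"
  let ?D = "\<lambda>u0 i c. interior_integral (descent_weight 0 i) 0 i (?a u0) c"
  let ?A = "\<lambda>i c d. interior_integral (ascent_weight i k) i k c d"
  \<comment> \<open>Weight of all departures from marks above w: an ascent leaves
    \<open>u powr - (\<gamma>/\<delta>)\<close> at its end, and the jump contributes
    \<open>Z us u\<close>.\<close>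
  define Y where "Y w = (\<integral>\<^sup>+u. of_bool (w \<le> u) * ennreal (u powr (- (\<gamma> / \<delta>))) * Z us u \<partial>uniform01)" for w
  have Y[measurable]: "Y \<in> borel_measurable borel" unfolding Y_def by measurable
  have asc: "(\<integral>\<^sup>+d. (?A i c d * of_bool (snd c \<le> snd d)) * Z us (snd d) \<partial>vmeas) \<le>
      ennreal (e (k - i) * kap * snd c powr (- \<gamma>)) * Y (snd c)" if "i < k" "0 < snd c" "snd c < 1" for i c
  proof -
    have "(\<integral>\<^sup>+d. (?A i c d * of_bool (snd c \<le> snd d)) * Z us (snd d) \<partial>vmeas) =
        (\<integral>\<^sup>+d. ?A i c d * (of_bool (snd c \<le> snd d) * Z us (snd d)) \<partial>vmeas)" by (simp only: mult.assoc)
    also have "\<dots> = (\<integral>\<^sup>+u. (\<integral>\<^sup>+z. ?A i c (z, u) \<partial>lborel) * (of_bool (snd c \<le> u) * Z us u) \<partial>uniform01)"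
      by (rule nn_integral_weighted) (auto intro!: measurable_interior_right)
    also have "\<dots> \<le> (\<integral>\<^sup>+u. ennreal (e (k - i) * kap * snd c powr (- \<gamma>)) * (of_bool (snd c \<le> u) * ennreal (u powr (- (\<gamma> / \<delta>))) * Z us u) \<partial>uniform01)"
    proof (rule nn_integral_mono_AE, use AE_uniform01 in eventually_elim)
      case (elim u)
      have "(\<integral>\<^sup>+z. ?A i c (z, u) \<partial>lborel) * (of_bool (snd c \<le> u) * Z us u) \<le>
          ennreal (e (k - i) * kap * snd c powr (- \<gamma>) * u powr (- (\<gamma> / \<delta>))) * (of_bool (snd c \<le> u) * Z us u)"
        using that elim by (intro mult_right_mono ascent_integral_le) auto
      also have "\<dots> = ennreal (e (k - i) * kap * snd c powr (- \<gamma>)) * (of_bool (snd c \<le> u) * ennreal (u powr (- (\<gamma> / \<delta>))) * Z us u)"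
        using kap_pos by (subst ennreal_mult) (simp_all add: mult_ac)
      finally show ?case .
    qed
    also have "\<dots> = ennreal (e (k - i) * kap * snd c powr (- \<gamma>)) * Y (snd c)"
      unfolding Y_def by (rule nn_integral_cmult) measurable
    finally show ?thesis .
  qed
  have desc: "(\<integral>\<^sup>+c. ?D u0 i c * H (snd c) \<partial>vmeas) \<le>
      ennreal (e i * kap * u0 powr (- (\<gamma> / \<delta>))) * (\<integral>\<^sup>+w. ennreal (w powr (- \<gamma>)) * H w \<partial>uniform01)"
    if "0 < i" "0 < u0" "u0 < 1" and H[measurable]: "H \<in> borel_measurable borel" for i u0 H
  proof -
    have "(\<integral>\<^sup>+c. ?D u0 i c * H (snd c) \<partial>vmeas) = (\<integral>\<^sup>+w. (\<integral>\<^sup>+z. ?D u0 i (z, w) \<partial>lborel) * H w \<partial>uniform01)"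
      by (rule nn_integral_weighted[OF measurable_interior_right H]) measurable
    also have "\<dots> \<le> (\<integral>\<^sup>+w. ennreal (e i * kap * u0 powr (- (\<gamma> / \<delta>))) * (ennreal (w powr (- \<gamma>)) * H w) \<partial>uniform01)"
    proof (rule nn_integral_mono_AE, use AE_uniform01 in eventually_elim)
      case (elim w)
      have "(\<integral>\<^sup>+z. ?D u0 i (z, w) \<partial>lborel) * H w \<le> ennreal (e (i - 0) * kap * snd (?a u0) powr (- (\<gamma> / \<delta>)) * w powr (- \<gamma>)) * H w"
        using that elim by (intro mult_right_mono descent_integral_le) auto
      also have "\<dots> = ennreal (e i * kap * u0 powr (- (\<gamma> / \<delta>))) * (ennreal (w powr (- \<gamma>)) * H w)"
        using kap_pos by (simp add: ennreal_mult mult_ac)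
      finally show ?case .
    qed
    also have "\<dots> = ennreal (e i * kap * u0 powr (- (\<gamma> / \<delta>))) * (\<integral>\<^sup>+w. ennreal (w powr (- \<gamma>)) * H w \<partial>uniform01)"
      by (rule nn_integral_cmult) measurable
    finally show ?thesis .
  qed
  have start: "(\<integral>\<^sup>+u0. ennreal (C * u0 powr (- (\<gamma> / \<delta>))) * X \<partial>uniform01) \<le> ennreal (C * M) * X" if "0 \<le> C" for C X
  proof -
    have "(\<integral>\<^sup>+u0. ennreal (C * u0 powr (- (\<gamma> / \<delta>))) * X \<partial>uniform01) = (\<integral>\<^sup>+u0. ennreal (C) * ennreal (u0 powr (- (\<gamma> / \<delta>))) * X \<partial>uniform01)"
      using that by (simp add: ennreal_mult)
    also have "\<dots> = ennreal C * (\<integral>\<^sup>+u0. ennreal (u0 powr (- (\<gamma> / \<delta>))) \<partial>uniform01) * X"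
      by (subst nn_integral_multc) (simp_all add: nn_integral_cmult)
    also have "\<dots> \<le> ennreal C * ennreal M * X"
      using \<gamma> by (intro mult_right_mono mult_left_mono nn_integral_powr_le_M) (auto simp: th_def)
    finally show ?thesis using that M_ge_1 by (simp add: ennreal_prod_nonneg)
  qed
  have ZY: "(\<integral>\<^sup>+w. of_bool (us \<le> w) * ennreal (w powr (- \<gamma>) * w powr (- \<gamma>)) * Y w \<partial>uniform01) \<le> 2 * ennreal M * ennreal M * J us"
    unfolding Y_def by (rule nn_integral_Z_double)
  have pt: "(\<integral>\<^sup>+c. interior_integral (strong_weight us k) 0 k (?a u0) c * Z us (snd c) \<partial>vmeas) \<le>
      ennreal (e k * kap * u0 powr (- (\<gamma> / \<delta>))) * (2 * ennreal M * J us) +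
      ennreal (e k * kap) * (of_bool (us \<le> u0) * ennreal (u0 powr (- \<gamma>) * u0 powr (- \<gamma>)) * Y u0) +
      (\<Sum>i\<in>{0<..<k}. ennreal (e i * kap * (e (k - i) * kap) * u0 powr (- (\<gamma> / \<delta>))) * (2 * ennreal M * ennreal M * J us))"
    if u0: "0 < u0" "u0 < 1" for u0
  proof -
    define G where "G i p = descent_weight 0 i p * of_bool (us \<le> snd (p i))" for i p
    define F where "F i p = ascent_weight i k p * of_bool (snd (p i) \<le> snd (p k))" for i p
    have [measurable]: "G i \<in> borel_measurable path_space" "F i \<in> borel_measurable path_space" for i
      unfolding G_def F_def by measurable
    have Gint: "interior_integral (G i) 0 i (?a u0) c = ?D u0 i c * of_bool (us \<le> snd c)" if "0 < i" for i c
      unfolding G_def using that by (rule interior_integral_mark[OF measurable_descent_weight, where P="\<lambda>_ v. us \<le> v"])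
    have Fint: "interior_integral (F i) i k c d = ?A i c d * of_bool (snd c \<le> snd d)" if "i < k" for i c d
      unfolding F_def using that by (rule interior_integral_mark[OF measurable_ascent_weight, where P="\<lambda>u v. u \<le> v"])
    have mA: "(\<lambda>d. (?A i c d * of_bool (snd c \<le> snd d)) * Z us (snd d)) \<in> borel_measurable vmeas" if "i < k" for i c
      unfolding Fint[OF that, symmetric]
      by (intro borel_measurable_times_ennreal measurable_compose[OF measurable_vmeas_mark measurable_Z] measurable_interior_integral
          measurable_ident_sets[OF sets_vmeas]) auto
    have split: "interior_integral (\<lambda>p. G i p * F i p) 0 k (?a u0) d = (\<integral>\<^sup>+c. (?D u0 i c * of_bool (us \<le> snd c)) * (?A i c d * of_bool (snd c \<le> snd d)) \<partial>vmeas)"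
      if i: "i \<in> {0<..<k}" for i d
    proof -
      have "depends_on {0..i} (G i)" unfolding G_def using i by (intro depends_on_mult_vertex depends_on_weights) auto
      moreover have "depends_on {i..k} (F i)"
      proof -
        have "depends_on {i..k} (ascent_weight i k)" using i by (intro depends_on_weights) auto
        then show ?thesis unfolding F_def depends_on_def using i by (auto intro!: arg_cong2[where f="(*)"])
      qed
      ultimately show ?thesis
        using i by (subst interior_integral_split[of 0 i k]) (auto simp: Gint Fint)
    qed
    have le: "interior_integral (strong_weight us k) 0 k (?a u0) d \<le>
        interior_integral (G k) 0 k (?a u0) d + of_bool (us \<le> u0) * interior_integral (F 0) 0 k (?a u0) d +
        (\<Sum>i\<in>{0<..<k}. interior_integral (\<lambda>p. G i p * F i p) 0 k (?a u0) d)" for d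
    proof -
      have "interior_integral (strong_weight us k) 0 k (?a u0) d \<le>
          interior_integral (\<lambda>p. G k p + of_bool (us \<le> u0) * F 0 p + (\<Sum>i\<in>{0<..<k}. G i p * F i p)) 0 k (?a u0) d"
      proof (rule interior_integral_mono)
        fix z
        show "strong_weight us k (z(0 := ?a u0, k := d)) \<le> G k (z(0 := ?a u0, k := d)) + of_bool (us \<le> u0) * F 0 (z(0 := ?a u0, k := d)) +
            (\<Sum>i\<in>{0<..<k}. G i (z(0 := ?a u0, k := d)) * F i (z(0 := ?a u0, k := d)))"
          using strong_weight_split[OF k, of us "z(0 := ?a u0, k := d)"] k unfolding G_def F_def by simp
      qed
      also have "\<dots> = interior_integral (G k) 0 k (?a u0) d + interior_integral (\<lambda>p. of_bool (us \<le> u0) * F 0 p) 0 k (?a u0) d +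
          (\<Sum>i\<in>{0<..<k}. interior_integral (\<lambda>p. G i p * F i p) 0 k (?a u0) d)"
        by (subst interior_integral_add, measurable, subst interior_integral_add, measurable, subst interior_integral_sum, auto)
      also have "interior_integral (\<lambda>p. of_bool (us \<le> u0) * F 0 p) 0 k (?a u0) d = of_bool (us \<le> u0) * interior_integral (F 0) 0 k (?a u0) d"
        unfolding interior_integral_def by (intro nn_integral_cmult measurable_interior_integrand) auto
      finally show ?thesis .
    qed
    have "(\<integral>\<^sup>+d. interior_integral (strong_weight us k) 0 k (?a u0) d * Z us (snd d) \<partial>vmeas) \<le>
        (\<integral>\<^sup>+d. interior_integral (G k) 0 k (?a u0) d * Z us (snd d) +
          of_bool (us \<le> u0) * (interior_integral (F 0) 0 k (?a u0) d * Z us (snd d)) +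
        (\<Sum>i\<in>{0<..<k}. interior_integral (\<lambda>p. G i p * F i p) 0 k (?a u0) d * Z us (snd d)) \<partial>vmeas)"
    proof (rule nn_integral_mono)
      fix d
      from mult_right_mono[OF le[of d], of "Z us (snd d)"]
      show "interior_integral (strong_weight us k) 0 k (?a u0) d * Z us (snd d) \<le> interior_integral (G k) 0 k (?a u0) d * Z us (snd d) +
          of_bool (us \<le> u0) * (interior_integral (F 0) 0 k (?a u0) d * Z us (snd d)) +
        (\<Sum>i\<in>{0<..<k}. interior_integral (\<lambda>p. G i p * F i p) 0 k (?a u0) d * Z us (snd d))"
        unfolding distrib_right sum_distrib_right mult.assoc by simp
    qed
    also have "\<dots> = (\<integral>\<^sup>+d. interior_integral (G k) 0 k (?a u0) d * Z us (snd d) \<partial>vmeas) +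
        of_bool (us \<le> u0) * (\<integral>\<^sup>+d. interior_integral (F 0) 0 k (?a u0) d * Z us (snd d) \<partial>vmeas) +
        (\<Sum>i\<in>{0<..<k}. \<integral>\<^sup>+d. interior_integral (\<lambda>p. G i p * F i p) 0 k (?a u0) d * Z us (snd d) \<partial>vmeas)"
    proof -
      have m: "(\<lambda>d. interior_integral H 0 k (?a u0) d * Z us (snd d)) \<in> borel_measurable vmeas"
        if "H \<in> borel_measurable path_space" for H
        using that by (intro borel_measurable_times_ennreal measurable_compose[OF measurable_vmeas_mark measurable_Z] measurable_interior_integral
          measurable_ident_sets[OF sets_vmeas]) auto
      have m1: "(\<lambda>d. interior_integral (G k) 0 k (?a u0) d * Z us (snd d)) \<in> borel_measurable vmeas" by (rule m) measurable
      have m2: "(\<lambda>d. interior_integral (F 0) 0 k (?a u0) d * Z us (snd d)) \<in> borel_measurable vmeas" by (rule m) measurable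
      have m3: "(\<lambda>d. interior_integral (\<lambda>p. G i p * F i p) 0 k (?a u0) d * Z us (snd d)) \<in> borel_measurable vmeas" for i by (rule m) measurable
      show ?thesis using m1 m2 m3
        by (subst nn_integral_add, simp, simp, subst nn_integral_add, simp, simp, subst nn_integral_sum, simp, simp add: nn_integral_cmult)
    qed
    also have "\<dots> \<le> ennreal (e k * kap * u0 powr (- (\<gamma> / \<delta>))) * (2 * ennreal M * J us) +
      ennreal (e k * kap) * (of_bool (us \<le> u0) * ennreal (u0 powr (- \<gamma>) * u0 powr (- \<gamma>)) * Y u0) +
      (\<Sum>i\<in>{0<..<k}. ennreal (e i * kap * (e (k - i) * kap) * u0 powr (- (\<gamma> / \<delta>))) * (2 * ennreal M * ennreal M * J us))"
    proof (intro add_mono sum_mono)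
      have "(\<integral>\<^sup>+d. interior_integral (G k) 0 k (?a u0) d * Z us (snd d) \<partial>vmeas) =
          (\<integral>\<^sup>+d. ?D u0 k d * (of_bool (us \<le> snd d) * Z us (snd d)) \<partial>vmeas)"
        unfolding Gint[OF k] by (simp only: mult.assoc)
      also have "\<dots> \<le> ennreal (e k * kap * u0 powr (- (\<gamma> / \<delta>))) * (\<integral>\<^sup>+w. ennreal (w powr (- \<gamma>)) * (of_bool (us \<le> w) * Z us w) \<partial>uniform01)"
        using k u0 by (intro desc[where H="\<lambda>w. of_bool (us \<le> w) * Z us w"]) auto
      also have "\<dots> \<le> ennreal (e k * kap * u0 powr (- (\<gamma> / \<delta>))) * (2 * ennreal M * J us)"
        using nn_integral_Z[of us] by (intro mult_left_mono) (auto simp: mult.assoc)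
      finally show "(\<integral>\<^sup>+d. interior_integral (G k) 0 k (?a u0) d * Z us (snd d) \<partial>vmeas) \<le> \<dots>" .
    next
      have "(\<integral>\<^sup>+d. interior_integral (F 0) 0 k (?a u0) d * Z us (snd d) \<partial>vmeas) \<le> ennreal (e k * kap * u0 powr (- \<gamma>)) * Y u0"
        unfolding Fint[OF k] using asc[OF k, of "?a u0"] u0 by simp
      also have "\<dots> \<le> ennreal (e k * kap) * (ennreal (u0 powr (- \<gamma>) * u0 powr (- \<gamma>)) * Y u0)"
      proof -
        \<comment> \<open>With the smallest mark at the origin there is no descent, hence only one
          factor \<open>u0 powr - \<gamma>\<close>. A second one, at least 1, is inserted so that
          the same mark integral covers this case.\<close>
        have "1 \<le> u0 powr (- \<gamma>)" using powr_neg_mono_exponent[of u0 0 \<gamma>] u0 \<gamma> by simp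
        then have "e k * kap * u0 powr (- \<gamma>) * 1 \<le> e k * kap * u0 powr (- \<gamma>) * u0 powr (- \<gamma>)"
          using kap_pos by (intro mult_left_mono) auto
        then have "ennreal (e k * kap * u0 powr (- \<gamma>)) \<le> ennreal (e k * kap) * ennreal (u0 powr (- \<gamma>) * u0 powr (- \<gamma>))"
          using kap_pos by (simp add: ennreal_prod_nonneg ennreal_leI mult.assoc)
        then show ?thesis unfolding mult.assoc[symmetric] by (rule mult_right_mono) simp
      qed
      finally show "of_bool (us \<le> u0) * (\<integral>\<^sup>+d. interior_integral (F 0) 0 k (?a u0) d * Z us (snd d) \<partial>vmeas) \<le>
          ennreal (e k * kap) * (of_bool (us \<le> u0) * ennreal (u0 powr (- \<gamma>) * u0 powr (- \<gamma>)) * Y u0)"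
        by (cases "us \<le> u0") simp_all
    next
      fix i assume i: "i \<in> {0<..<k}"
      interpret V2: pair_sigma_finite "vmeas :: ('a \<times> real) measure" "vmeas :: ('a \<times> real) measure" ..
      have "(\<integral>\<^sup>+d. interior_integral (\<lambda>p. G i p * F i p) 0 k (?a u0) d * Z us (snd d) \<partial>vmeas) =
          (\<integral>\<^sup>+d. \<integral>\<^sup>+c. interior_integral (G i) 0 i (?a u0) c * (interior_integral (F i) i k c d * Z us (snd d)) \<partial>vmeas \<partial>vmeas)"
      proof (intro nn_integral_cong)
        fix d :: "'a \<times> real"
        have id: "(\<lambda>c. c) \<in> (vmeas :: ('a \<times> real) measure) \<rightarrow>\<^sub>M borel \<Otimes>\<^sub>M borel" by (rule measurable_ident_sets[OF sets_vmeas])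
        have "interior_integral (\<lambda>p. G i p * F i p) 0 k (?a u0) d = (\<integral>\<^sup>+c. interior_integral (G i) 0 i (?a u0) c * interior_integral (F i) i k c d \<partial>vmeas)"
          using i by (simp add: split[OF i] Gint Fint)
        also have "\<dots> * Z us (snd d) = (\<integral>\<^sup>+c. interior_integral (G i) 0 i (?a u0) c * interior_integral (F i) i k c d * Z us (snd d) \<partial>vmeas)"
          by (intro nn_integral_multc[symmetric] borel_measurable_times_ennreal measurable_interior_integral id measurable_const) auto
        finally show "interior_integral (\<lambda>p. G i p * F i p) 0 k (?a u0) d * Z us (snd d) =
            (\<integral>\<^sup>+c. interior_integral (G i) 0 i (?a u0) c * (interior_integral (F i) i k c d * Z us (snd d)) \<partial>vmeas)"
          by (simp only: mult.assoc)
      qed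
      also have "\<dots> = (\<integral>\<^sup>+c. \<integral>\<^sup>+d. interior_integral (G i) 0 i (?a u0) c * (interior_integral (F i) i k c d * Z us (snd d)) \<partial>vmeas \<partial>vmeas)"
      proof (rule V2.Fubini')
        have f: "(\<lambda>x. fst x) \<in> (vmeas :: ('a \<times> real) measure) \<Otimes>\<^sub>M (vmeas :: ('a \<times> real) measure) \<rightarrow>\<^sub>M borel \<Otimes>\<^sub>M borel"
          "(\<lambda>x. snd x) \<in> (vmeas :: ('a \<times> real) measure) \<Otimes>\<^sub>M (vmeas :: ('a \<times> real) measure) \<rightarrow>\<^sub>M borel \<Otimes>\<^sub>M borel"
          by (rule measurable_compose[OF measurable_fst measurable_ident_sets[OF sets_vmeas]],
              rule measurable_compose[OF measurable_snd measurable_ident_sets[OF sets_vmeas]])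
        show "(\<lambda>(c, d). interior_integral (G i) 0 i (?a u0) c * (interior_integral (F i) i k c d * Z us (snd d)))
            \<in> borel_measurable (vmeas \<Otimes>\<^sub>M vmeas)"
          unfolding split_beta'
          by (intro borel_measurable_times_ennreal measurable_interior_integral f measurable_const
              measurable_compose[OF measurable_compose[OF f(2) measurable_snd] measurable_Z]) auto
      qed
      also have "\<dots> = (\<integral>\<^sup>+c. (?D u0 i c * of_bool (us \<le> snd c)) * (\<integral>\<^sup>+d. (?A i c d * of_bool (snd c \<le> snd d)) * Z us (snd d) \<partial>vmeas) \<partial>vmeas)"
        using i mA by (intro nn_integral_cong) (simp add: Gint Fint nn_integral_cmult)
      also have "\<dots> \<le> (\<integral>\<^sup>+c. ?D u0 i c * (of_bool (us \<le> snd c) * (ennreal (e (k - i) * kap * snd c powr (- \<gamma>)) * Y (snd c))) \<partial>vmeas)"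
      proof (rule nn_integral_mono_AE, use AE_vmeas in eventually_elim)
        case (elim c)
        then show ?case
          unfolding mult.assoc[of "?D u0 i c"] using i by (intro mult_left_mono asc) auto
      qed
      also have "\<dots> \<le> ennreal (e i * kap * u0 powr (- (\<gamma> / \<delta>))) *
          (\<integral>\<^sup>+w. ennreal (w powr (- \<gamma>)) * (of_bool (us \<le> w) * (ennreal (e (k - i) * kap * w powr (- \<gamma>)) * Y w)) \<partial>uniform01)"
        using i u0 by (intro desc[where H="\<lambda>w. of_bool (us \<le> w) * (ennreal (e (k - i) * kap * w powr (- \<gamma>)) * Y w)"]) auto
      also have "(\<integral>\<^sup>+w. ennreal (w powr (- \<gamma>)) * (of_bool (us \<le> w) * (ennreal (e (k - i) * kap * w powr (- \<gamma>)) * Y w)) \<partial>uniform01) =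
          (\<integral>\<^sup>+w. ennreal (e (k - i) * kap) * (of_bool (us \<le> w) * ennreal (w powr (- \<gamma>) * w powr (- \<gamma>)) * Y w) \<partial>uniform01)"
        using kap_pos by (simp add: ennreal_mult mult_ac)
      also have "\<dots> = ennreal (e (k - i) * kap) * (\<integral>\<^sup>+w. of_bool (us \<le> w) * ennreal (w powr (- \<gamma>) * w powr (- \<gamma>)) * Y w \<partial>uniform01)"
        by (rule nn_integral_cmult) measurable
      also have "ennreal (e i * kap * u0 powr (- (\<gamma> / \<delta>))) * \<dots> \<le>
          ennreal (e i * kap * u0 powr (- (\<gamma> / \<delta>))) * (ennreal (e (k - i) * kap) * (2 * ennreal M * ennreal M * J us))"
        by (intro mult_left_mono ZY) auto
      also have "\<dots> = ennreal (e i * kap * (e (k - i) * kap) * u0 powr (- (\<gamma> / \<delta>))) * (2 * ennreal M * ennreal M * J us)"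
        using kap_pos by (simp add: ennreal_mult mult_ac)
      finally show "(\<integral>\<^sup>+d. interior_integral (\<lambda>p. G i p * F i p) 0 k (?a u0) d * Z us (snd d) \<partial>vmeas) \<le> \<dots>" .
    qed
    finally show ?thesis .
  qed
  have "(\<integral>\<^sup>+u0. \<integral>\<^sup>+c. interior_integral (strong_weight us k) 0 k (?a u0) c * Z us (snd c) \<partial>vmeas \<partial>uniform01) \<le>
      (\<integral>\<^sup>+u0. ennreal (e k * kap * u0 powr (- (\<gamma> / \<delta>))) * (2 * ennreal M * J us) +
      ennreal (e k * kap) * (of_bool (us \<le> u0) * ennreal (u0 powr (- \<gamma>) * u0 powr (- \<gamma>)) * Y u0) +
      (\<Sum>i\<in>{0<..<k}. ennreal (e i * kap * (e (k - i) * kap) * u0 powr (- (\<gamma> / \<delta>))) * (2 * ennreal M * ennreal M * J us)) \<partial>uniform01)"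
    by (rule nn_integral_mono_AE, use AE_uniform01 in eventually_elim) (rule pt, auto)
  also have "\<dots> = (\<integral>\<^sup>+u0. ennreal (e k * kap * u0 powr (- (\<gamma> / \<delta>))) * (2 * ennreal M * J us) \<partial>uniform01) +
      ennreal (e k * kap) * (\<integral>\<^sup>+u0. of_bool (us \<le> u0) * ennreal (u0 powr (- \<gamma>) * u0 powr (- \<gamma>)) * Y u0 \<partial>uniform01) +
      (\<Sum>i\<in>{0<..<k}. \<integral>\<^sup>+u0. ennreal (e i * kap * (e (k - i) * kap) * u0 powr (- (\<gamma> / \<delta>))) * (2 * ennreal M * ennreal M * J us) \<partial>uniform01)"
    by (subst nn_integral_add, measurable, subst nn_integral_add, measurable, subst nn_integral_sum, measurable, subst nn_integral_cmult, auto)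
  also have "\<dots> \<le> ennreal (e k * kap * M) * (2 * ennreal M * J us) + ennreal (e k * kap) * (2 * ennreal M * ennreal M * J us) +
      (\<Sum>i\<in>{0<..<k}. ennreal (e i * kap * (e (k - i) * kap) * M) * (2 * ennreal M * ennreal M * J us))"
    using kap_pos by (intro add_mono sum_mono start mult_left_mono ZY) auto
  also have "\<dots> = ennreal (e k * kap * M * 2 * M + e k * kap * 2 * M * M + (\<Sum>i\<in>{0<..<k}. e i * kap * (e (k - i) * kap) * M * 2 * M * M)) * J us"
  proof -
    have c1: "ennreal A * (2 * ennreal M * J us) = ennreal (A * 2 * M) * J us" if "0 \<le> A" for A
      using that M_ge_1 by (simp add: ennreal_mult mult_ac)
    have c2: "ennreal A * (2 * ennreal M * ennreal M * J us) = ennreal (A * 2 * M * M) * J us" if "0 \<le> A" for A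
      using that M_ge_1 by (simp add: ennreal_mult mult_ac)
    have nn: "0 \<le> e k * kap * M" "0 \<le> e k * kap" "0 \<le> e i * kap * (e (k - i) * kap) * M" for i
      using kap_pos M_ge_1 by simp_all
    have pos: "0 \<le> e k * kap * M * 2 * M" "0 \<le> e k * kap * 2 * M * M" "0 \<le> e i * kap * (e (k - i) * kap) * M * 2 * M * M" for i
      using kap_pos M_ge_1 by simp_all
    have "(\<Sum>i\<in>{0<..<k}. ennreal (e i * kap * (e (k - i) * kap) * M * 2 * M * M) * J us) =
        ennreal (\<Sum>i\<in>{0<..<k}. e i * kap * (e (k - i) * kap) * M * 2 * M * M) * J us"
      by (subst sum_distrib_right[symmetric], subst sum_ennreal) (use pos in auto)
    moreover have "ennreal x * J us + ennreal y * J us + ennreal z * J us = ennreal (x + y + z) * J us"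
      if "0 \<le> x" "0 \<le> y" "0 \<le> z" for x y z
      using that by (simp add: distrib_right)
    ultimately show ?thesis
      unfolding c1[OF nn(1)] c2[OF nn(2)] c2[OF nn(3)] using pos by (simp only: sum_nonneg)
  qed
  also have "\<dots> \<le> ennreal (path_coefficient k * (2 * M ^ 3)) * J us"
  proof (intro mult_right_mono ennreal_leI)
    have M: "M * M \<le> M ^ 3" using M_ge_1 by (simp add: power3_eq_cube mult_le_cancel_right1)
    have "e k * kap * M * 2 * M + e k * kap * 2 * M * M + (\<Sum>i\<in>{0<..<k}. e i * kap * (e (k - i) * kap) * M * 2 * M * M) =
        (2 * kap * e k) * (2 * (M * M)) + (kap * kap * (\<Sum>i\<in>{0<..<k}. e i * e (k - i))) * (2 * M ^ 3)"
      by (simp add: sum_distrib_left sum_distrib_right power3_eq_cube mult_ac)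
    also have "\<dots> \<le> (2 * kap * e k) * (2 * M ^ 3) + (kap * kap * (\<Sum>i\<in>{0<..<k}. e i * e (k - i))) * (2 * M ^ 3)"
      using M kap_pos by (intro add_right_mono mult_left_mono) auto
    also have "\<dots> = path_coefficient k * (2 * M ^ 3)" using k by (simp add: path_coefficient_def distrib_right)
    finally show "e k * kap * M * 2 * M + e k * kap * 2 * M * M + (\<Sum>i\<in>{0<..<k}. e i * kap * (e (k - i) * kap) * M * 2 * M * M) \<le> path_coefficient k * (2 * M ^ 3)" .
  qed simp
  finally show ?thesis .
qed

text \<open>The landing vertex is asked to be strong and far away, but not to satisfy the shortest
  path condition with the vertices before it.\<close>

definition jump :: "real \<Rightarrow> real \<Rightarrow> 'a \<times> real \<Rightarrow> 'a \<times> real \<Rightarrow> ennreal" where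
  "jump us r c b = ennreal (lam c b) * (of_bool (us \<le> snd b) * of_bool (r \<le> norm (fst c - fst b) ^ DIM('a)))"

lemma measurable_jump:
  "A \<in> X \<rightarrow>\<^sub>M borel \<Otimes>\<^sub>M borel \<Longrightarrow> B \<in> X \<rightarrow>\<^sub>M borel \<Otimes>\<^sub>M borel \<Longrightarrow> (\<lambda>x. jump us r (A x) (B x)) \<in> borel_measurable X"
proof -
  assume A: "A \<in> X \<rightarrow>\<^sub>M borel \<Otimes>\<^sub>M borel" and B: "B \<in> X \<rightarrow>\<^sub>M borel \<Otimes>\<^sub>M borel"
  have [measurable]: "(\<lambda>x. fst (A x)) \<in> borel_measurable X" "(\<lambda>x. fst (B x)) \<in> borel_measurable X" "(\<lambda>x. snd (B x)) \<in> borel_measurable X"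
    using measurable_compose[OF A measurable_fst] measurable_compose[OF B measurable_fst] measurable_compose[OF B measurable_snd] .
  have [measurable]: "(\<lambda>x. lam (A x) (B x)) \<in> borel_measurable X" by (rule measurable_lam_vertices[OF A B])
  show ?thesis unfolding jump_def by measurable
qed

lemma nn_integral_jump_le:
  assumes c: "0 < snd c" "snd c < 1" and r: "0 < r"
  shows "(\<integral>\<^sup>+b. jump us r c b \<partial>vmeas) \<le> ennreal (kap * \<beta> powr (\<delta> - 1) * r powr (1 - \<delta>)) * Z us (snd c)"
proof -
  let ?C = "kap * \<beta> powr (\<delta> - 1) * r powr (1 - \<delta>)"
  have "(\<integral>\<^sup>+b. jump us r c b \<partial>vmeas) = (\<integral>\<^sup>+v. \<integral>\<^sup>+x. jump us r c (x, v) \<partial>lborel \<partial>uniform01)"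
    by (rule nn_integral_vmeas, rule measurable_jump) (auto intro: measurable_ident_sets sets_vmeas)
  also have "\<dots> \<le> (\<integral>\<^sup>+v. ennreal ?C * (ennreal (psi (snd c) v) * of_bool (us \<le> v)) \<partial>uniform01)"
  proof (rule nn_integral_mono_AE, use AE_uniform01 in eventually_elim)
    case (elim v)
    show ?case
    proof (cases "us \<le> v")
      case True
      have "(\<integral>\<^sup>+x. jump us r c (x, v) \<partial>lborel) \<le> (\<integral>\<^sup>+x. ennreal (kst c (x, v)) * of_bool (r \<le> norm (fst c - x) ^ DIM('a)) \<partial>lborel)"
        unfolding jump_def using True elim c by (intro nn_integral_mono) (auto intro!: mult_right_mono ennreal_leI lam_le_kst)
      also have "\<dots> \<le> ennreal (?C * psi (snd c) v)"
        using elim c r by (intro nn_integral_kst_tail_le) auto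
      finally show ?thesis using True kap_pos by (simp add: ennreal_mult)
    qed (simp add: jump_def)
  qed
  also have "\<dots> = ennreal ?C * Z us (snd c)"
    unfolding Z_def psi_def by (rule nn_integral_cmult) measurable
  finally show ?thesis .
qed

text \<open>The landing vertex is integrated first: it yields the power of r and \<open>Z us\<close>
  at the mark of departure, after which the path before the jump is the arrival estimate. A jump
  from the origin has no such path and uses the simpler mark integral.\<close>

lemma strong_jump_paths_le:
  assumes us: "0 < us" and r: "0 < r"
  shows "(\<integral>\<^sup>+u. \<integral>\<^sup>+z. strong_weight us k (z(0 := (0, u))) * jump us r ((z(0 := (0, u))) k) ((z(0 := (0, u))) (Suc k))
      \<partial>PiM {1..Suc k} (\<lambda>_. vmeas :: ('a \<times> real) measure) \<partial>uniform01) \<le>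
    ennreal (kap * \<beta> powr (\<delta> - 1) * r powr (1 - \<delta>) * (path_coefficient k * (2 * M ^ 3))) * J us"
proof -
  let ?C = "kap * \<beta> powr (\<delta> - 1) * r powr (1 - \<delta>)"
  let ?G = "\<lambda>p. strong_weight us k p * jump us r (p k) (p (Suc k))"
  have mj: "(\<lambda>p. jump us r (p k) (p (Suc k))) \<in> borel_measurable path_space"
    by (intro measurable_jump measurable_component_singleton) auto
  have mG: "?G \<in> borel_measurable path_space"
    by (intro borel_measurable_times_ennreal measurable_strong_weight mj)
  have dG: "depends_on {..Suc k} ?G"
    using depends_on_strong_weight[of k us] unfolding depends_on_def by (auto intro!: arg_cong2[where f="(*)"])
  have id: "(\<lambda>c. c) \<in> (vmeas :: ('a \<times> real) measure) \<rightarrow>\<^sub>M borel \<Otimes>\<^sub>M borel" by (rule measurable_ident_sets[OF sets_vmeas])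
  have C: "0 \<le> ?C" using kap_pos by simp
  have step: "(\<integral>\<^sup>+u. \<integral>\<^sup>+z. ?G (z(0 := (0, u))) \<partial>PiM {1..Suc k} (\<lambda>_. vmeas :: ('a \<times> real) measure) \<partial>uniform01) =
      (\<integral>\<^sup>+u. \<integral>\<^sup>+b. interior_integral ?G 0 (Suc k) (0, u) b \<partial>vmeas \<partial>uniform01)"
    by (intro nn_integral_cong path_integral_end mG dG) simp
  also have "\<dots> \<le> ennreal ?C * (ennreal (path_coefficient k * (2 * M ^ 3)) * J us)"
  proof (cases "k = 0")
    case True
    have "(\<integral>\<^sup>+u. \<integral>\<^sup>+b. interior_integral ?G 0 (Suc k) (0, u) b \<partial>vmeas \<partial>uniform01) \<le>
        (\<integral>\<^sup>+u. ennreal ?C * (ennreal (u powr (- \<gamma>)) * of_bool (us \<le> u) * Z us u) \<partial>uniform01)"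
    proof (rule nn_integral_mono_AE, use AE_uniform01 in eventually_elim)
      case (elim u)
      have "interior_integral ?G 0 (Suc k) (0, u) b = of_bool (us \<le> u) * jump us r (0, u) b" for b
        unfolding True interior_integral_Suc by (simp add: strong_weight_def path_weight_def)
      then have "(\<integral>\<^sup>+b. interior_integral ?G 0 (Suc k) (0, u) b \<partial>vmeas) = of_bool (us \<le> u) * (\<integral>\<^sup>+b. jump us r (0, u) b \<partial>vmeas)"
        by (simp add: nn_integral_cmult measurable_jump id)
      also have "\<dots> \<le> of_bool (us \<le> u) * (ennreal ?C * Z us u)"
        using nn_integral_jump_le[of "(0, u)" r us] elim r by (intro mult_left_mono) auto
      also have "\<dots> = ennreal ?C * (ennreal 1 * of_bool (us \<le> u) * Z us u)" by (simp add: mult_ac)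
      \<comment> \<open>The factor \<open>u powr - \<gamma>\<close> is at least 1; it is inserted to
        match the integral already bounded by \<open>J\<close>.\<close>
      also have "\<dots> \<le> ennreal ?C * (ennreal (u powr (- \<gamma>)) * of_bool (us \<le> u) * Z us u)"
        using powr_neg_mono_exponent[of u 0 \<gamma>] elim \<gamma> by (intro mult_left_mono mult_right_mono ennreal_leI) auto
      finally show ?case .
    qed
    also have "\<dots> = ennreal ?C * (\<integral>\<^sup>+u. ennreal (u powr (- \<gamma>)) * of_bool (us \<le> u) * Z us u \<partial>uniform01)"
      by (rule nn_integral_cmult) measurable
    also have "\<dots> \<le> ennreal ?C * (2 * ennreal M * J us)"
      by (intro mult_left_mono nn_integral_Z) simp
    also have "2 * ennreal M = ennreal (2 * M)" using M_ge_1 by (simp add: ennreal_mult)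
    also have "ennreal ?C * (ennreal (2 * M) * J us) \<le> ennreal ?C * (ennreal (path_coefficient k * (2 * M ^ 3)) * J us)"
      using True M_ge_1 self_le_power[of M 3] by (intro mult_left_mono mult_right_mono ennreal_leI) (auto simp: path_coefficient_def)
    finally show ?thesis .
  next
    case False
    interpret V2: pair_sigma_finite "vmeas :: ('a \<times> real) measure" "vmeas :: ('a \<times> real) measure" ..
    let ?S = "\<lambda>u c. interior_integral (strong_weight us k) 0 k ((0, u) :: 'a \<times> real) c"
    have "(\<integral>\<^sup>+u. \<integral>\<^sup>+b. interior_integral ?G 0 (Suc k) (0, u) b \<partial>vmeas \<partial>uniform01) \<le>
        (\<integral>\<^sup>+u. ennreal ?C * (\<integral>\<^sup>+c. ?S u c * Z us (snd c) \<partial>vmeas) \<partial>uniform01)"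
    proof (rule nn_integral_mono)
      fix u :: real
      have "interior_integral ?G 0 (Suc k) (0, u) b = (\<integral>\<^sup>+c. ?S u c * jump us r c b \<partial>vmeas)" for b
      proof -
        have "depends_on {k..Suc k} (\<lambda>p. jump us r (p k) (p (Suc k)))" by (auto simp: depends_on_def)
        from interior_integral_split[OF _ _ measurable_strong_weight depends_on_strong_weight mj this]
        show ?thesis using False by (simp add: interior_integral_Suc)
      qed
      then have "(\<integral>\<^sup>+b. interior_integral ?G 0 (Suc k) (0, u) b \<partial>vmeas) = (\<integral>\<^sup>+b. \<integral>\<^sup>+c. ?S u c * jump us r c b \<partial>vmeas \<partial>vmeas)" by simp
      also have "\<dots> = (\<integral>\<^sup>+c. \<integral>\<^sup>+b. ?S u c * jump us r c b \<partial>vmeas \<partial>vmeas)"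
      proof (rule V2.Fubini')
        have f: "(\<lambda>x. fst x) \<in> (vmeas :: ('a \<times> real) measure) \<Otimes>\<^sub>M (vmeas :: ('a \<times> real) measure) \<rightarrow>\<^sub>M borel \<Otimes>\<^sub>M borel"
          "(\<lambda>x. snd x) \<in> (vmeas :: ('a \<times> real) measure) \<Otimes>\<^sub>M (vmeas :: ('a \<times> real) measure) \<rightarrow>\<^sub>M borel \<Otimes>\<^sub>M borel"
          by (rule measurable_compose[OF measurable_fst measurable_ident_sets[OF sets_vmeas]],
              rule measurable_compose[OF measurable_snd measurable_ident_sets[OF sets_vmeas]])
        show "(\<lambda>(c, b). ?S u c * jump us r c b) \<in> borel_measurable (vmeas \<Otimes>\<^sub>M vmeas)"
          unfolding split_beta'
          by (intro borel_measurable_times_ennreal measurable_interior_integral measurable_jump f measurable_const) auto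
      qed
      also have "\<dots> = (\<integral>\<^sup>+c. ?S u c * (\<integral>\<^sup>+b. jump us r c b \<partial>vmeas) \<partial>vmeas)"
        by (intro nn_integral_cong nn_integral_cmult measurable_jump id measurable_const) auto
      also have "\<dots> \<le> (\<integral>\<^sup>+c. ?S u c * (ennreal ?C * Z us (snd c)) \<partial>vmeas)"
        by (rule nn_integral_mono_AE, use AE_vmeas in eventually_elim) (auto intro!: mult_left_mono nn_integral_jump_le r)
      also have "\<dots> = (\<integral>\<^sup>+c. ennreal ?C * (?S u c * Z us (snd c)) \<partial>vmeas)" by (simp add: mult_ac)
      also have "\<dots> = ennreal ?C * (\<integral>\<^sup>+c. ?S u c * Z us (snd c) \<partial>vmeas)"
        by (intro nn_integral_cmult borel_measurable_times_ennreal measurable_interior_integral id measurable_const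
            measurable_compose[OF measurable_vmeas_mark measurable_Z]) auto
      finally show "(\<integral>\<^sup>+b. interior_integral ?G 0 (Suc k) (0, u) b \<partial>vmeas) \<le> ennreal ?C * (\<integral>\<^sup>+c. ?S u c * Z us (snd c) \<partial>vmeas)" .
    qed
    also have "\<dots> = ennreal ?C * (\<integral>\<^sup>+u. \<integral>\<^sup>+c. ?S u c * Z us (snd c) \<partial>vmeas \<partial>uniform01)"
    proof (rule nn_integral_cmult)
      have f: "(\<lambda>x. (0 :: 'a, fst x)) \<in> uniform01 \<Otimes>\<^sub>M (vmeas :: ('a \<times> real) measure) \<rightarrow>\<^sub>M borel \<Otimes>\<^sub>M borel"
        "(\<lambda>x. snd x) \<in> uniform01 \<Otimes>\<^sub>M (vmeas :: ('a \<times> real) measure) \<rightarrow>\<^sub>M borel \<Otimes>\<^sub>M borel"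
        by (intro measurable_Pair measurable_const) (auto intro: measurable_compose[OF measurable_snd measurable_ident_sets[OF sets_vmeas]])
      have "(\<lambda>x. ?S (fst x) (snd x) * Z us (snd (snd x))) \<in> borel_measurable (uniform01 \<Otimes>\<^sub>M vmeas)"
        by (intro borel_measurable_times_ennreal measurable_interior_integral f
            measurable_compose[OF measurable_compose[OF f(2) measurable_snd] measurable_Z]) auto
      then show "(\<lambda>u. \<integral>\<^sup>+c. ?S u c * Z us (snd c) \<partial>vmeas) \<in> borel_measurable uniform01"
        using vmeas.borel_measurable_nn_integral[of "\<lambda>u c. ?S u c * Z us (snd c)" uniform01] by (simp add: split_beta')
    qed
    also have "\<dots> \<le> ennreal ?C * (ennreal (path_coefficient k * (2 * M ^ 3)) * J us)"
      using False us by (intro mult_left_mono arrival_le) auto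
    finally show ?thesis .
  qed
  also have "\<dots> = ennreal (?C * (path_coefficient k * (2 * M ^ 3))) * J us"
    using C path_coefficient_nonneg[of k] M_ge_1 by (simp add: ennreal_prod_nonneg mult.assoc[symmetric])
  finally show ?thesis .
qed

end

section \<open>Shortest paths and the tail event\<close>

text \<open>In a walk of minimal length a repeated vertex could be cut out, and a chord between
  vertices at least two steps apart would replace them by one step; both contradict
  minimality.\<close>

lemma geodesic_exists:
  assumes "R\<^sup>*\<^sup>* x y"
  shows "\<exists>n f. f 0 = x \<and> f n = y \<and> (\<forall>l<n. R (f l) (f (Suc l))) \<and> inj_on f {..n} \<and>
    (\<forall>l m. l + 2 \<le> m \<longrightarrow> m \<le> n \<longrightarrow> \<not> R (f l) (f m))"
proof -
  obtain n0 where "(R ^^ n0) x y" using assms rtranclp_imp_relpowp by metis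
  define n where "n = (LEAST n. (R ^^ n) x y)"
  have n: "(R ^^ n) x y" unfolding n_def by (rule LeastI) fact
  have least: "n \<le> k" if "(R ^^ k) x y" for k unfolding n_def using that by (rule Least_le)
  obtain f where f: "f 0 = x" "f n = y" "\<And>l. l < n \<Longrightarrow> R (f l) (f (Suc l))"
    using n unfolding relpowp_fun_conv by blast
  have seg: "(R ^^ (m - l)) (f l) (f m)" if "l \<le> m" "m \<le> n" for l m
    unfolding relpowp_fun_conv by (rule exI[of _ "\<lambda>i. f (l + i)"]) (use that f(3) in auto)
  have cat: "(R ^^ (a + b)) u w" if "(R ^^ a) u v" "(R ^^ b) v w" for a b u v w
    using that by (auto simp: relpowp_add)
  have short: "l = m" if "l \<le> m" "m \<le> n" "f l = f m" for l m
  proof -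
    have "(R ^^ l) x (f l)" using seg[of 0 l] that f(1) by simp
    moreover have "(R ^^ (n - m)) (f l) y" using seg[of m n] that f(2) by simp
    ultimately have "n \<le> l + (n - m)" by (intro least cat)
    then show ?thesis using that by simp
  qed
  have "inj_on f {..n}"
  proof (rule inj_onI)
    fix l m assume *: "l \<in> {..n}" "m \<in> {..n}" "f l = f m"
    then show "l = m" using short[of l m] short[of m l] by (cases "l \<le> m") auto
  qed
  moreover have "\<not> R (f l) (f m)" if lm: "l + 2 \<le> m" "m \<le> n" for l m
  proof
    assume "R (f l) (f m)"
    then have "(R ^^ 1) (f l) (f m)" by (simp only: relpowp_1)
    moreover have "(R ^^ l) x (f l)" using seg[of 0 l] lm f(1) by simp
    moreover have "(R ^^ (n - m)) (f m) y" using seg[of m n] lm f(2) by simp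
    ultimately have "(R ^^ (l + 1 + (n - m))) x y" by (blast intro: cat)
    then have "n \<le> l + 1 + (n - m)" by (rule least)
    then show False using lm by simp
  qed
  ultimately show ?thesis using f by blast
qed

lemma measurable_location:
  assumes "sets N = sets (PiM UNIV (\<lambda>_. borel :: 'a::euclidean_space measure))"
  shows "(\<lambda>x. location x i) \<in> N \<rightarrow>\<^sub>M (borel :: 'a measure)"
proof (cases i)
  case (Suc j)
  have "(\<lambda>x. x j) \<in> N \<rightarrow>\<^sub>M (borel :: 'a measure)"
    using measurable_component_singleton[of j UNIV "\<lambda>_. borel"] by (simp add: measurable_cong_sets[OF assms refl])
  then show ?thesis using Suc by simp
qed simp

section \<open>Measurability of the cluster and the almost sure range of marks\<close>

context unit_poisson_process
begin

lemma measurable_palm_location [measurable]: "(\<lambda>\<omega>. location (fst \<omega>) i) \<in> palm_law N \<rightarrow>\<^sub>M (borel :: 'a measure)"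
  unfolding palm_law_def by (rule measurable_compose[OF measurable_fst measurable_location[OF sets_N]])

lemma measurable_palm_mark [measurable]: "(\<lambda>\<omega>. fst (snd \<omega>) i) \<in> palm_law N \<rightarrow>\<^sub>M (borel :: real measure)"
proof -
  have "(\<lambda>u :: nat \<Rightarrow> real. u i) \<in> PiM UNIV (\<lambda>_. uniform01) \<rightarrow>\<^sub>M borel"
    using measurable_component_singleton[of i UNIV "\<lambda>_. uniform01"] by simp
  then show ?thesis unfolding palm_law_def
    by (rule measurable_compose[OF measurable_compose[OF measurable_snd measurable_fst]])
qed

lemma measurable_palm_edge:
  assumes "card e = 2" shows "(\<lambda>\<omega>. snd (snd \<omega>) e) \<in> palm_law N \<rightarrow>\<^sub>M (borel :: real measure)"
proof -
  have "(\<lambda>v :: nat set \<Rightarrow> real. v e) \<in> PiM {e. card e = 2} (\<lambda>_. uniform01) \<rightarrow>\<^sub>M borel"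
    using measurable_component_singleton[of e "{e. card e = 2}" "\<lambda>_. uniform01"] assms by simp
  then show ?thesis unfolding palm_law_def
    by (rule measurable_compose[OF measurable_compose[OF measurable_snd measurable_snd]])
qed

lemma nn_integral_palm_law:
  fixes f :: "'a config \<Rightarrow> ennreal"
  assumes f: "f \<in> borel_measurable (palm_law N)"
  shows "(\<integral>\<^sup>+\<omega>. f \<omega> \<partial>palm_law N) = (\<integral>\<^sup>+x. \<integral>\<^sup>+u. \<integral>\<^sup>+v. f (x, u, v)
    \<partial>PiM {e :: nat set. card e = 2} (\<lambda>_. uniform01) \<partial>PiM UNIV (\<lambda>_ :: nat. uniform01) \<partial>N)"
proof -
  let ?U = "PiM UNIV (\<lambda>_ :: nat. uniform01)" and ?V = "PiM {e :: nat set. card e = 2} (\<lambda>_. uniform01)"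
  have Vs: "sigma_finite_measure ?V" by (intro prob_space_imp_sigma_finite prob_space_PiM) simp
  have UVs: "sigma_finite_measure (?U \<Otimes>\<^sub>M ?V)"
    by (intro sigma_finite_pair_measure prob_space_imp_sigma_finite prob_space_PiM) simp_all
  have "(\<integral>\<^sup>+\<omega>. f \<omega> \<partial>palm_law N) = (\<integral>\<^sup>+x. \<integral>\<^sup>+y. f (x, y) \<partial>(?U \<Otimes>\<^sub>M ?V) \<partial>N)"
    unfolding palm_law_def by (rule sigma_finite_measure.nn_integral_fst[OF UVs f[unfolded palm_law_def], symmetric])
  also have "\<dots> = (\<integral>\<^sup>+x. \<integral>\<^sup>+u. \<integral>\<^sup>+v. f (x, u, v) \<partial>?V \<partial>?U \<partial>N)"
  proof (intro nn_integral_cong)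
    fix x assume x: "x \<in> space N"
    have "(\<lambda>y. f (x, y)) \<in> borel_measurable (?U \<Otimes>\<^sub>M ?V)"
      using measurable_compose[OF measurable_Pair1'[OF x] f[unfolded palm_law_def]] .
    from sigma_finite_measure.nn_integral_fst[OF Vs this, symmetric]
    show "(\<integral>\<^sup>+y. f (x, y) \<partial>(?U \<Otimes>\<^sub>M ?V)) = (\<integral>\<^sup>+u. \<integral>\<^sup>+v. f (x, u, v) \<partial>?V \<partial>?U)" .
  qed
  finally show ?thesis .
qed

lemma adjacent_iff: "adjacent \<beta> \<gamma> \<delta> \<omega> i j \<longleftrightarrow> i \<noteq> j \<and> snd (snd \<omega>) {i, j} \<le>
    rho \<delta> (inverse \<beta> * min (fst (snd \<omega>) i) (fst (snd \<omega>) j) powr \<gamma> * norm (location (fst \<omega>) i - location (fst \<omega>) j) ^ DIM('a))"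
  for \<omega> :: "'a config"
  by (cases \<omega>) auto

lemma pred_adjacent [measurable]: "Measurable.pred (palm_law N) (\<lambda>\<omega> :: 'a config. adjacent \<beta> \<gamma> \<delta> \<omega> i j)"
proof (cases "i = j")
  case False
  then have "card {i, j} = 2" by simp
  note [measurable] = measurable_palm_edge[OF this]
  show ?thesis unfolding adjacent_iff using False by measurable
qed (simp add: adjacent_iff)

text \<open>Reachability is a countable union over the number of steps and the intermediate
  vertices, as vertex names are natural numbers.\<close>

lemma pred_reachable [measurable]:
  "Measurable.pred (palm_law N) (\<lambda>\<omega> :: 'a config. j \<in> cluster \<beta> \<gamma> \<delta> \<omega>)"
proof -
  have "Measurable.pred (palm_law N) (\<lambda>\<omega> :: 'a config. (adjacent \<beta> \<gamma> \<delta> \<omega> ^^ n) 0 j)" for n j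
  proof (induction n arbitrary: j)
    case (Suc n)
    have "Measurable.pred (palm_law N) (\<lambda>\<omega> :: 'a config. \<exists>k. (adjacent \<beta> \<gamma> \<delta> \<omega> ^^ n) 0 k \<and> adjacent \<beta> \<gamma> \<delta> \<omega> k j)"
      by (intro pred_intros_countable pred_intros_logic Suc pred_adjacent)
    then show ?case by (simp add: relcompp_apply)
  qed simp
  then have "Measurable.pred (palm_law N) (\<lambda>\<omega> :: 'a config. \<exists>n. (adjacent \<beta> \<gamma> \<delta> \<omega> ^^ n) 0 j)"
    by (intro pred_intros_countable)
  then show ?thesis by (simp add: cluster_def rtranclp_is_Sup_relpowp)
qed

end

text \<open>A supremum strictly exceeds a level iff some member does, so the tail event becomes a
  countable union over vertices. Taking d-th roots removes the power, also for an infinite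
  diameter.\<close>

lemma diameter_greater_iff:
  fixes \<omega> :: "'a::euclidean_space config"
  assumes "0 \<le> m"
  shows "diameter_o \<beta> \<gamma> \<delta> \<omega> ^ DIM('a) > ennreal m \<longleftrightarrow>
    (\<exists>j\<in>cluster \<beta> \<gamma> \<delta> \<omega>. m < norm (location (fst \<omega>) j) ^ DIM('a))"
proof -
  define r where "r = root DIM('a) m"
  have r: "0 \<le> r" "r ^ DIM('a) = m" using assms by (auto simp: r_def)
  have 1: "ennreal m < x ^ DIM('a) \<longleftrightarrow> ennreal r < x" for x :: ennreal
  proof -
    have m: "ennreal m = ennreal r ^ DIM('a)" using r by (simp add: ennreal_power)
    show ?thesis
    proof
      assume "ennreal m < x ^ DIM('a)"
      then show "ennreal r < x" unfolding m by (meson not_le power_mono zero_le leD)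
    next
      assume "ennreal r < x"
      show "ennreal m < x ^ DIM('a)"
      proof (cases x)
        case (real y)
        then have "r < y" using \<open>ennreal r < x\<close> r by (simp add: ennreal_less_iff)
        then have "r ^ DIM('a) < y ^ DIM('a)" using r by (intro power_strict_mono) auto
        then show ?thesis using real r assms by (simp add: ennreal_power ennreal_less_iff)
      qed (simp add: top_power_ennreal)
    qed
  qed
  have 2: "m < norm y ^ DIM('a) \<longleftrightarrow> r < norm y" for y :: 'a
    using power_mono_iff[of "norm y" r "DIM('a)"] r by (simp add: linorder_not_le[symmetric])
  show ?thesis
    unfolding 1 2 diameter_o_def less_SUP_iff using r by (simp add: ennreal_less_iff)
qed

text \<open>A connection function equal to 1 joins a pair outright only if the edge mark is at most
  1. This holds almost surely for all edges at once, since there are countably many.\<close>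

lemma AE_edge_marks_le_1:
  "AE v in PiM {e :: nat set. card e = 2} (\<lambda>_. uniform01). \<forall>e. card e = 2 \<longrightarrow> v e \<le> 1"
proof -
  have c: "countable {e :: nat set. card e = 2}"
    by (rule countable_subset[OF _ countable_Collect_finite]) (auto intro: card_ge_0_finite)
  have "AE v in PiM {e :: nat set. card e = 2} (\<lambda>_. uniform01). v e \<le> 1" if "card e = 2" for e
    using that by (intro AE_PiM_component[where P="\<lambda>t. t \<le> 1"]) (use AE_uniform01 in \<open>auto elim: eventually_mono\<close>)
  then have "AE v in PiM {e :: nat set. card e = 2} (\<lambda>_. uniform01). \<forall>e\<in>{e. card e = 2}. v e \<le> 1"
    using c by (intro AE_ball_countable') auto
  then show ?thesis by simp
qed

context unit_poisson_process
begin

lemma diameter_event_measurable: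
  assumes "0 \<le> m"
  shows "{\<omega> \<in> space (palm_law N). diameter_o \<beta> \<gamma> \<delta> \<omega> ^ DIM('a) > ennreal m} \<in> sets (palm_law N)"
proof -
  have "Measurable.pred (palm_law N) (\<lambda>\<omega> :: 'a config. \<exists>j. j \<in> cluster \<beta> \<gamma> \<delta> \<omega> \<and> m < norm (location (fst \<omega>) j) ^ DIM('a))"
    by measurable
  then show ?thesis unfolding pred_def diameter_greater_iff[OF assms] Bex_def .
qed

lemma AE_edge_marks: "AE \<omega> in palm_law N. \<forall>e. card e = 2 \<longrightarrow> snd (snd \<omega>) e \<le> 1"
proof -
  let ?U = "PiM UNIV (\<lambda>_ :: nat. uniform01)" and ?V = "PiM {e :: nat set. card e = 2} (\<lambda>_. uniform01)"
  have "AE v in ?V. \<forall>e\<in>{e. card e = 2}. v e \<le> 1" using AE_edge_marks_le_1 by simp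
  then obtain A where A: "A \<in> null_sets ?V" "{v\<in>space ?V. \<not> (\<forall>e\<in>{e. card e = 2}. v e \<le> 1)} \<subseteq> A"
    by (auto elim: AE_E simp: null_sets_def)
  have Us: "prob_space ?U" "prob_space ?V" by (intro prob_space_PiM; simp)+
  have "emeasure (?U \<Otimes>\<^sub>M ?V) (space ?U \<times> A) = 0" "space ?U \<times> A \<in> sets (?U \<Otimes>\<^sub>M ?V)"
  proof -
    have "A \<in> sets ?V" "emeasure ?V A = 0" using A(1) by auto
    from sigma_finite_measure.emeasure_pair_measure_Times[OF prob_space_imp_sigma_finite[OF Us(2)] sets.top this(1), of ?U] this
    show "emeasure (?U \<Otimes>\<^sub>M ?V) (space ?U \<times> A) = 0" "space ?U \<times> A \<in> sets (?U \<Otimes>\<^sub>M ?V)" by simp_all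
  qed
  then have "space N \<times> (space ?U \<times> A) \<in> null_sets (palm_law N)"
    using sigma_finite_measure.emeasure_pair_measure_Times[OF prob_space_imp_sigma_finite[OF prob_space_pair[OF Us]], of "space N" N "space ?U \<times> A"]
    unfolding palm_law_def by auto
  then show ?thesis
  proof (rule AE_I')
    show "{\<omega> \<in> space (palm_law N). \<not> (\<forall>e. card e = 2 \<longrightarrow> snd (snd \<omega>) e \<le> 1)} \<subseteq> space N \<times> (space ?U \<times> A)"
    proof
      fix \<omega> assume \<omega>: "\<omega> \<in> {\<omega> \<in> space (palm_law N). \<not> (\<forall>e. card e = 2 \<longrightarrow> snd (snd \<omega>) e \<le> 1)}"
      obtain x u v where xuv: "\<omega> = (x, u, v)" by (cases \<omega>)
      have sp: "x \<in> space N" "u \<in> space ?U" "v \<in> space ?V" using \<omega> by (simp_all add: xuv palm_law_def space_pair_measure)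
      have "\<not> (\<forall>e\<in>{e. card e = 2}. v e \<le> 1)" using \<omega> by (simp add: xuv)
      then have "v \<in> A" using A(2) sp(3) by (intro subsetD[OF A(2)] CollectI conjI)
      then show "\<omega> \<in> space N \<times> (space ?U \<times> A)" using sp by (simp add: xuv)
    qed
  qed
qed

end

lemma nn_integral_count_space_ge_1:
  fixes f :: "'b \<Rightarrow> ennreal"
  assumes "x \<in> A" "1 \<le> f x" shows "1 \<le> (\<integral>\<^sup>+x. f x \<partial>count_space A)"
  using nn_integral_ge_point[OF assms(1), of f] assms(2) by (rule order.trans[rotated])

lemma term_le_suminf: "f n \<le> (\<Sum>n. f n)" for f :: "nat \<Rightarrow> ennreal"
  using sum_le_suminf[of f "{n}"] by simp

text \<open>The scales sum to at most 1, so one of the steps of a path reaching distance \<open>r\<close> exceeds \<open>r\<close>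
  times its scale.\<close>

definition step_scale :: "nat \<Rightarrow> real" where "step_scale l = 1 / ((real l + 1) * (real l + 2))"

lemma step_scale_pos: "0 < step_scale l"
  by (simp add: step_scale_def)

lemma sum_step_scale: "(\<Sum>l<n. step_scale l) = 1 - 1 / (real n + 1)"
proof (induction n)
  case (Suc n)
  have "step_scale n = 1 / (real n + 1) - 1 / (real n + 2)" by (simp add: step_scale_def field_simps)
  then show ?case using Suc by simp
qed simp

text \<open>The threshold depends on the index of the step and not on the length of the path, so the
  alternatives can be summed over steps. It decays polynomially in the index, which the geometric
  decay of path weights absorbs.\<close>

lemma long_step_exists:
  fixes x :: "nat \<Rightarrow> 'a::euclidean_space"
  assumes "x 0 = 0" "0 \<le> m" "m < norm (x n) ^ DIM('a)"
  shows "\<exists>l<n. m * step_scale l ^ DIM('a) \<le> norm (x l - x (Suc l)) ^ DIM('a)"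
proof (rule ccontr)
  assume *: "\<not> ?thesis"
  define r where "r = root DIM('a) m"
  have r: "0 \<le> r" "r ^ DIM('a) = m" using assms by (auto simp: r_def)
  have "norm (x (Suc l) - x l) \<le> r * step_scale l" if "l < n" for l
  proof (rule ccontr)
    assume "\<not> ?thesis"
    then have "(r * step_scale l) ^ DIM('a) \<le> norm (x l - x (Suc l)) ^ DIM('a)"
      using r step_scale_pos[of l] by (intro power_mono) (auto simp: norm_minus_commute)
    then show False using * that r by (auto simp: power_mult_distrib)
  qed
  then have "(\<Sum>l<n. norm (x (Suc l) - x l)) \<le> (\<Sum>l<n. r * step_scale l)" by (intro sum_mono) auto
  moreover have "norm (x n) \<le> (\<Sum>l<n. norm (x (Suc l) - x l))"
    using norm_sum[of "\<lambda>l. x (Suc l) - x l" "{..<n}"] assms(1) by (simp add: sum_lessThan_telescope)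
  moreover have "(\<Sum>l<n. r * step_scale l) \<le> r * 1"
    unfolding sum_distrib_left[symmetric] sum_step_scale using r by (intro mult_left_mono) auto
  ultimately have "norm (x n) ^ DIM('a) \<le> r ^ DIM('a)" by (intro power_mono) auto
  then show False using assms r by simp
qed

section \<open>Covering the tail event by path counts\<close>

context soft_boolean_parameters
begin

definition far_path :: "nat \<Rightarrow> (nat \<Rightarrow> 'a \<times> real) \<Rightarrow> bool" where
  "far_path n p \<longleftrightarrow> (\<forall>l\<in>{0..n}. \<forall>m\<in>{l + 2..n}. 1 < soft (p l) (p m))"

text \<open>Met at the first vertex of mark below us: all earlier marks are at least us, so this
  vertex has the smallest mark so far and the initial piece is a descent.\<close>

definition weak_end :: "real \<Rightarrow> nat \<Rightarrow> (nat \<Rightarrow> 'a \<times> real) \<Rightarrow> bool" where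
  "weak_end us n p \<longleftrightarrow> (\<forall>l\<in>{0..<n}. snd (p n) \<le> snd (p l)) \<and> snd (p n) < us"

definition strong_jump :: "real \<Rightarrow> real \<Rightarrow> nat \<Rightarrow> (nat \<Rightarrow> 'a \<times> real) \<Rightarrow> bool" where
  "strong_jump us r k p \<longleftrightarrow> (\<forall>l\<in>{0..k}. us \<le> snd (p l)) \<and> us \<le> snd (p (Suc k)) \<and>
    r \<le> norm (fst (p k) - fst (p (Suc k))) ^ DIM('a)"

definition path_count :: "nat \<Rightarrow> ((nat \<Rightarrow> 'a \<times> real) \<Rightarrow> ennreal) \<Rightarrow> 'a config \<Rightarrow> ennreal" where
  "path_count n f \<omega> = (\<integral>\<^sup>+\<tau>. of_bool (\<forall>l<n. linked lam \<omega> (label \<tau> l) (label \<tau> (Suc l))) *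
        f (\<lambda>l\<in>{..n}. vert \<omega> (label \<tau> l)) \<partial>count_space (injections {1..n}))"

lemma measurable_finite_path:
  assumes "f \<in> borel_measurable path_space"
  shows "f \<in> borel_measurable (PiM {..n} (\<lambda>_. borel \<Otimes>\<^sub>M borel :: ('a \<times> real) measure))"
proof -
  have "(\<lambda>p. p) \<in> PiM {..n} (\<lambda>_. borel \<Otimes>\<^sub>M borel :: ('a \<times> real) measure) \<rightarrow>\<^sub>M PiM {..n} (\<lambda>_. vmeas)"
    by (intro measurable_ident_sets sets_PiM_cong) (auto simp: sets_vmeas)
  from measurable_vprod_component[OF this]
  have "(\<lambda>p. p) \<in> PiM {..n} (\<lambda>_. borel \<Otimes>\<^sub>M borel :: ('a \<times> real) measure) \<rightarrow>\<^sub>M path_space"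
    by (intro measurable_PiM_single') auto
  from measurable_compose[OF this assms] show ?thesis .
qed

lemma measurable_far_path [measurable]: "Measurable.pred path_space (far_path n)"
  unfolding far_path_def by measurable

lemma measurable_weak_end [measurable]: "Measurable.pred path_space (weak_end us n)"
proof -
  have "Measurable.pred path_space (\<lambda>p :: nat \<Rightarrow> 'a \<times> real. snd (p n) < us)"
    unfolding pred_def by (intro borel_measurable_less measurable_mark borel_measurable_const)
  then show ?thesis unfolding weak_end_def by measurable
qed

lemma measurable_strong_jump [measurable]: "Measurable.pred path_space (strong_jump us r k)"
proof -
  have [measurable]: "(\<lambda>p :: nat \<Rightarrow> 'a \<times> real. fst (p i)) \<in> borel_measurable path_space" for i
    by (rule measurable_compose[of "\<lambda>p. p i" _ "borel \<Otimes>\<^sub>M borel"]) (auto intro: measurable_component_singleton)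
  have "Measurable.pred path_space (\<lambda>p :: nat \<Rightarrow> 'a \<times> real. r \<le> norm (fst (p k) - fst (p (Suc k))) ^ DIM('a))"
    unfolding pred_def by (intro borel_measurable_le) measurable
  then show ?thesis unfolding strong_jump_def by measurable
qed

lemma adjacent_imp_linked:
  assumes "adjacent \<beta> \<gamma> \<delta> \<omega> i j" shows "linked lam \<omega> i j"
proof (cases \<omega>)
  case (fields x u v)
  have "rho \<delta> (inverse \<beta> * min (u i) (u j) powr \<gamma> * norm (location x i - location x j) ^ DIM('a)) \<le> lam (vert \<omega> i) (vert \<omega> j)"
    by (simp add: lam_def vert_def fields)
  then show ?thesis using assms by (simp add: fields linked_def)
qed

lemma soft_gt_1_if_not_linked:
  assumes "\<forall>e. card e = 2 \<longrightarrow> snd (snd \<omega>) e \<le> 1" "i \<noteq> j" "\<not> linked lam \<omega> i j"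
  shows "1 < soft (vert \<omega> i) (vert \<omega> j)"
proof (rule ccontr)
  assume "\<not> ?thesis"
  then have "lam (vert \<omega> i) (vert \<omega> j) = 1" by (simp add: lam_def)
  moreover have "snd (snd \<omega>) {i, j} \<le> 1" using assms by simp
  ultimately show False using assms by (simp add: linked_def)
qed

text \<open>Injectivity and f 0 = 0 keep the later vertices away from name 0, so subtracting 1
  recovers the indices of their Poisson points.\<close>

lemma path_count_ge_1:
  assumes f: "f 0 = 0" "inj_on f {..n}" and link: "\<And>l. l < n \<Longrightarrow> linked lam \<omega> (f l) (f (Suc l))"
    and g: "1 \<le> g (\<lambda>l\<in>{..n}. vert \<omega> (f l))"
  shows "1 \<le> path_count n g \<omega>"
proof -
  define \<tau> where "\<tau> = (\<lambda>l\<in>{1..n}. f l - 1)"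
  have pos: "f l \<noteq> 0" if "l \<in> {1..n}" for l
    using inj_onD[OF f(2), of l 0] that f(1) by auto
  have lab: "label \<tau> l = f l" if "l \<le> n" for l
    using that pos[of l] f(1) by (auto simp: label_def \<tau>_def)
  have "inj_on \<tau> {1..n}"
  proof (rule inj_onI)
    fix k l assume kl: "k \<in> {1..n}" "l \<in> {1..n}" "\<tau> k = \<tau> l"
    then have "f k = f l" using pos[of k] pos[of l] by (simp add: \<tau>_def)
    then show "k = l" using inj_onD[OF f(2), of k l] kl by auto
  qed
  then have "\<tau> \<in> injections {1..n}" by (simp add: injections_def \<tau>_def)
  then show ?thesis unfolding path_count_def
  proof (rule nn_integral_count_space_ge_1)
    have "(\<lambda>l\<in>{..n}. vert \<omega> (label \<tau> l)) = (\<lambda>l\<in>{..n}. vert \<omega> (f l))"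
      using lab by (auto simp: fun_eq_iff)
    moreover have "\<forall>l<n. linked lam \<omega> (label \<tau> l) (label \<tau> (Suc l))" using link lab by simp
    ultimately show "1 \<le> of_bool (\<forall>l<n. linked lam \<omega> (label \<tau> l) (label \<tau> (Suc l))) * g (\<lambda>l\<in>{..n}. vert \<omega> (label \<tau> l))"
      using g by simp
  qed
qed

text \<open>A deterministic statement about a shortest path of the enlarged graph to a distant
  vertex. If it meets a weak vertex, the piece up to the first one is counted; otherwise all its
  vertices are strong and the piece up to a long step is counted. The origin being weak is the
  separate first term.\<close>

lemma long_cluster_cases:
  assumes good: "\<forall>e. card e = 2 \<longrightarrow> snd (snd \<omega>) e \<le> 1" and m: "0 \<le> m"
    and j: "j \<in> cluster \<beta> \<gamma> \<delta> \<omega>" "m < norm (location (fst \<omega>) j) ^ DIM('a)"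
  shows "(1 :: ennreal) \<le> of_bool (fst (snd \<omega>) 0 < us) +
    (\<Sum>n. path_count (Suc n) (\<lambda>p. of_bool (far_path (Suc n) p) * of_bool (weak_end us (Suc n) p)) \<omega>) +
    (\<Sum>k. path_count (Suc k) (\<lambda>p. of_bool (far_path k p) * of_bool (strong_jump us (m * step_scale k ^ DIM('a)) k p)) \<omega>)"
    (is "1 \<le> ?A + (\<Sum>n. ?B n) + (\<Sum>k. ?C k)")
proof -
  have "adjacent \<beta> \<gamma> \<delta> \<omega> \<le> linked lam \<omega>" using adjacent_imp_linked by (intro predicate2I)
  from rtranclp_mono[OF this] have "(linked lam \<omega>)\<^sup>*\<^sup>* 0 j"
    using j(1) unfolding cluster_def by (blast dest: predicate2D)
  then obtain N f where f: "f 0 = 0" "f N = j" and link: "\<forall>l<N. linked lam \<omega> (f l) (f (Suc l))" and inj: "inj_on f {..N}"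
    and nolink: "\<forall>l k. l + 2 \<le> k \<longrightarrow> k \<le> N \<longrightarrow> \<not> linked lam \<omega> (f l) (f k)"
    using geodesic_exists by metis
  have far: "far_path n (\<lambda>l\<in>{..n'}. vert \<omega> (f l))" if "n \<le> n'" "n' \<le> N" for n n'
    unfolding far_path_def
  proof (intro ballI)
    fix l k assume lk: "l \<in> {0..n}" "k \<in> {l + 2..n}"
    then have "f l \<noteq> f k" using inj_onD[OF inj, of l k] that by auto
    then show "1 < soft ((\<lambda>l\<in>{..n'}. vert \<omega> (f l)) l) ((\<lambda>l\<in>{..n'}. vert \<omega> (f l)) k)"
      using soft_gt_1_if_not_linked[OF good] nolink lk that by simp
  qed
  have count: "1 \<le> path_count n g \<omega>" if "n \<le> N" "1 \<le> g (\<lambda>l\<in>{..n}. vert \<omega> (f l))" for n g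
    using that link by (intro path_count_ge_1[of f] f inj_on_subset[OF inj]) auto
  let ?u = "\<lambda>l. fst (snd \<omega>) (f l)"
  show ?thesis
  proof (cases "\<exists>l\<le>N. ?u l < us")
    case True
    define n where "n = (LEAST n. n \<le> N \<and> ?u n < us)"
    have n: "n \<le> N \<and> ?u n < us" unfolding n_def using True by (rule LeastI_ex)
    have before: "us \<le> ?u l" if "l < n" for l
      using not_less_Least[of l "\<lambda>n. n \<le> N \<and> ?u n < us"] that n unfolding n_def[symmetric] by auto
    show ?thesis
    proof (cases n)
      case 0
      then have "?A = 1" using n f by simp
      then show ?thesis by (simp add: add_increasing2)
    next
      case (Suc n')
      have "1 \<le> ?B n'"
      proof (rule count)
        have "weak_end us (Suc n') (\<lambda>l\<in>{..Suc n'}. vert \<omega> (f l))"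
          unfolding weak_end_def using n before Suc by (force simp: vert_def)
        then show "(1 :: ennreal) \<le> of_bool (far_path (Suc n') (\<lambda>l\<in>{..Suc n'}. vert \<omega> (f l))) * of_bool (weak_end us (Suc n') (\<lambda>l\<in>{..Suc n'}. vert \<omega> (f l)))"
          using far[of "Suc n'" "Suc n'"] n Suc by simp
      qed (use n Suc in simp)
      also have "?B n' \<le> (\<Sum>n. ?B n)" by (rule term_le_suminf)
      finally show ?thesis by (simp add: add_increasing add_increasing2)
    qed
  next
    case False
    define x where "x l = location (fst \<omega>) (f l)" for l
    have "x 0 = 0" "m < norm (x N) ^ DIM('a)" using f j(2) by (auto simp: x_def)
    from long_step_exists[OF this(1) m this(2)] obtain k where k: "k < N"
      "m * step_scale k ^ DIM('a) \<le> norm (x k - x (Suc k)) ^ DIM('a)" by auto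
    have "1 \<le> ?C k"
    proof (rule count)
      have "strong_jump us (m * step_scale k ^ DIM('a)) k (\<lambda>l\<in>{..Suc k}. vert \<omega> (f l))"
        unfolding strong_jump_def using False k by (auto simp: vert_def x_def not_less)
      then show "(1 :: ennreal) \<le> of_bool (far_path k (\<lambda>l\<in>{..Suc k}. vert \<omega> (f l))) *
          of_bool (strong_jump us (m * step_scale k ^ DIM('a)) k (\<lambda>l\<in>{..Suc k}. vert \<omega> (f l)))"
        using far[of k "Suc k"] k by simp
    qed (use k in simp)
    also have "?C k \<le> (\<Sum>k. ?C k)" by (rule term_le_suminf)
    finally show ?thesis by (simp add: add_increasing)
  qed
qed

definition tail_event :: "real \<Rightarrow> (nat \<Rightarrow> 'a) measure \<Rightarrow> 'a config set" where
  "tail_event m N = {\<omega> \<in> space (palm_law N). diameter_o \<beta> \<gamma> \<delta> \<omega> ^ DIM('a) > ennreal m}"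

text \<open>First moment method: integrating the pointwise cover replaces the probability by
  expected path counts, and these are the integrals already estimated.\<close>

lemma emeasure_tail_event_le:
  assumes N: "unit_poisson_process N" and m: "0 < m" and us: "0 < us" "us < 1"
  shows "emeasure (palm_law N) (tail_event m N) \<le> ennreal us +
    (\<Sum>n. ennreal (e (Suc n) * kap * M * (us powr (1 - \<gamma>) / (1 - \<gamma>)))) +
    (\<Sum>k. ennreal (kap * \<beta> powr (\<delta> - 1) * (m * step_scale k ^ DIM('a)) powr (1 - \<delta>) * (path_coefficient k * (2 * M ^ 3))) * J us)"
proof -
  interpret unit_poisson_process N by fact
  let ?r = "\<lambda>k. m * step_scale k ^ DIM('a)"
  have r: "0 < ?r k" for k using m step_scale_pos[of k] by simp
  let ?fA = "\<lambda>n p. of_bool (far_path (Suc n) p) * of_bool (weak_end us (Suc n) p) :: ennreal"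
  let ?fB = "\<lambda>k p. of_bool (far_path k p) * of_bool (strong_jump us (?r k) k p) :: ennreal"
  have mA: "?fA n \<in> borel_measurable (PiM {..Suc n} (\<lambda>_. borel \<Otimes>\<^sub>M borel))" for n
    by (rule measurable_finite_path) measurable
  have mB: "?fB k \<in> borel_measurable (PiM {..Suc k} (\<lambda>_. borel \<Otimes>\<^sub>M borel))" for k
    by (rule measurable_finite_path) measurable
  have [measurable]: "path_count (Suc n) (?fA n) \<in> borel_measurable (palm_law N)" for n
    unfolding path_count_def by (rule measurable_path_count[OF measurable_lam lam_nonneg lam_le_1 mA])
  have [measurable]: "path_count (Suc k) (?fB k) \<in> borel_measurable (palm_law N)" for k
    unfolding path_count_def by (rule measurable_path_count[OF measurable_lam lam_nonneg lam_le_1 mB])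
  have m0: "(\<lambda>\<omega>. of_bool (fst (snd \<omega>) 0 < us) :: ennreal) \<in> borel_measurable (palm_law N)"
    by (rule measurable_compose[OF measurable_palm_mark, where g="\<lambda>u. of_bool (u < us)"]) measurable
  have sA: "(\<lambda>\<omega>. \<Sum>n. path_count (Suc n) (?fA n) \<omega>) \<in> borel_measurable (palm_law N)" by measurable
  have sB: "(\<lambda>\<omega>. \<Sum>k. path_count (Suc k) (?fB k) \<omega>) \<in> borel_measurable (palm_law N)" by measurable
  have A: "(\<integral>\<^sup>+\<omega>. path_count (Suc n) (?fA n) \<omega> \<partial>palm_law N) \<le> ennreal (e (Suc n) * kap * M * (us powr (1 - \<gamma>) / (1 - \<gamma>)))" for n
  proof -
    have eq: "ennreal (\<Prod>l<Suc n. lam (p l) (p (Suc l))) * ?fA n p = descent_weight 0 (Suc n) p * of_bool (snd (p (Suc n)) < us)" for p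
      by (simp add: descent_weight_def path_weight_def far_path_def weak_end_def atLeast0LessThan mult_ac of_bool_conj)
    show ?thesis
      unfolding path_count_def expected_path_count[OF measurable_lam lam_nonneg lam_le_1 mA] eq
      by (rule weak_end_paths_le[OF _ us]) simp
  qed
  have B: "(\<integral>\<^sup>+\<omega>. path_count (Suc k) (?fB k) \<omega> \<partial>palm_law N) \<le>
      ennreal (kap * \<beta> powr (\<delta> - 1) * ?r k powr (1 - \<delta>) * (path_coefficient k * (2 * M ^ 3))) * J us" for k
  proof -
    have eq: "ennreal (\<Prod>l<Suc k. lam (p l) (p (Suc l))) * ?fB k p = strong_weight us k p * jump us (?r k) (p k) (p (Suc k))" for p
    proof -
      have "ennreal (\<Prod>l<Suc k. lam (p l) (p (Suc l))) = ennreal (\<Prod>l<k. lam (p l) (p (Suc l))) * ennreal (lam (p k) (p (Suc k)))"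
        by (simp add: ennreal_mult prod_nonneg)
      then show ?thesis
        by (simp only: strong_weight_def jump_def path_weight_def far_path_def strong_jump_def atLeast0LessThan of_bool_conj mult_ac)
    qed
    show ?thesis
      unfolding path_count_def expected_path_count[OF measurable_lam lam_nonneg lam_le_1 mB] eq
      by (rule strong_jump_paths_le[OF us(1) r])
  qed
  have [measurable]: "tail_event m N \<in> sets (palm_law N)"
    unfolding tail_event_def using m by (intro diameter_event_measurable) simp
  have "emeasure (palm_law N) (tail_event m N) = (\<integral>\<^sup>+\<omega>. indicator (tail_event m N) \<omega> \<partial>palm_law N)" by simp
  also have "\<dots> \<le> (\<integral>\<^sup>+\<omega>. of_bool (fst (snd \<omega>) 0 < us) + (\<Sum>n. path_count (Suc n) (?fA n) \<omega>) + (\<Sum>k. path_count (Suc k) (?fB k) \<omega>) \<partial>palm_law N)"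
  proof (rule nn_integral_mono_AE, use AE_edge_marks in eventually_elim)
    case (elim \<omega>)
    show ?case
    proof (cases "\<omega> \<in> tail_event m N")
      case True
      then obtain j where "j \<in> cluster \<beta> \<gamma> \<delta> \<omega>" "m < norm (location (fst \<omega>) j) ^ DIM('a)"
        using m by (auto simp: tail_event_def diameter_greater_iff)
      from long_cluster_cases[OF elim _ this, of us] show ?thesis using True m by simp
    qed simp
  qed
  also have "\<dots> = (\<integral>\<^sup>+\<omega>. of_bool (fst (snd \<omega>) 0 < us) \<partial>palm_law N) + (\<Sum>n. \<integral>\<^sup>+\<omega>. path_count (Suc n) (?fA n) \<omega> \<partial>palm_law N) +
      (\<Sum>k. \<integral>\<^sup>+\<omega>. path_count (Suc k) (?fB k) \<omega> \<partial>palm_law N)"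
    unfolding nn_integral_add[OF borel_measurable_add[OF m0 sA] sB] nn_integral_add[OF m0 sA]
    by (subst nn_integral_suminf, simp, subst nn_integral_suminf, simp_all)
  also have "\<dots> \<le> ennreal us + (\<Sum>n. ennreal (e (Suc n) * kap * M * (us powr (1 - \<gamma>) / (1 - \<gamma>)))) +
    (\<Sum>k. ennreal (kap * \<beta> powr (\<delta> - 1) * ?r k powr (1 - \<delta>) * (path_coefficient k * (2 * M ^ 3))) * J us)"
  proof (intro add_mono suminf_le A B summableI)
    let ?U = "PiM UNIV (\<lambda>_ :: nat. uniform01)" and ?V = "PiM {e :: nat set. card e = 2} (\<lambda>_. uniform01)"
    have ps: "prob_space ?U" "prob_space ?V" by (intro prob_space_PiM; simp)+
    have "(\<integral>\<^sup>+\<omega>. of_bool (fst (snd \<omega>) 0 < us) \<partial>palm_law N) = (\<integral>\<^sup>+x. \<integral>\<^sup>+u. \<integral>\<^sup>+v. of_bool (u 0 < us) \<partial>?V \<partial>?U \<partial>N)"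
      by (subst nn_integral_palm_law[OF m0]) simp
    also have "\<dots> = (\<integral>\<^sup>+u. of_bool (u 0 < us) \<partial>?U)"
      using emeasure_space_1 prob_space.emeasure_space_1[OF ps(2)] by simp
    also have "\<dots> \<le> (\<integral>\<^sup>+u. indicator {u\<in>space ?U. u 0 \<in> {..us}} u \<partial>?U)"
      by (intro nn_integral_mono) (auto split: split_indicator)
    also have "\<dots> = emeasure uniform01 {..us}"
      using vertex_marks.emeasure_PiM_Collect_single[of 0 "{..us}"] by simp
    also have "\<dots> = ennreal us" using us by (simp add: emeasure_uniform01_atMost)
    finally show "(\<integral>\<^sup>+\<omega>. of_bool (fst (snd \<omega>) 0 < us) \<partial>palm_law N) \<le> ennreal us" .
  qed
  finally show ?thesis .
qed

end

text \<open>The linear factor comes from the position of the smallest mark on the path, the power p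
  from the step scales, and z from the decay of path weights.\<close>

lemma summable_powr_geometric:
  fixes z p :: real
  assumes "0 < z" "z < 1"
  shows "summable (\<lambda>k. (real k + 1) * ((real k + 1) * (real k + 2)) powr p * z ^ k)"
proof (rule summable_comparison_test_bigo)
  show "summable (\<lambda>k. norm (1 / real k ^ 2))"
    using inverse_power_summable[of 2, where 'a=real] by (simp add: inverse_eq_divide)
  show "(\<lambda>k. (real k + 1) * ((real k + 1) * (real k + 2)) powr p * z ^ k) \<in> O(\<lambda>k. 1 / real k ^ 2)"
    using assms by real_asymp
qed

section \<open>Summation over path lengths\<close>

context soft_boolean_parameters
begin

context
  assumes y_small: "4 * y < 1"
begin

text \<open>The radius of convergence of the Catalan series; it exceeds 1 by the smallness
  assumption.\<close>

definition t :: real where "t = 1 / (4 * y)"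

lemma t_gt_1: "1 < t" and t_pos: "0 < t"
  using y_small y_pos by (auto simp: t_def)

text \<open>A series of nonnegative terms bounded at t > 1 has terms of order
  \<open>(1/t) ^ n\<close>.\<close>

lemma e_le: "e n \<le> 4 * t * (1 / t) ^ n"
proof (cases "n = 0")
  case True
  then show ?thesis using t_pos chain_weight_unfold[of 0] by (simp add: q_def catalan_weight.simps)
next
  case False
  \<comment> \<open>The cost \<open>kap * M\<close> of a joint is at most y, which contains an extra
    power of 2, so the smallness of y covers both conditions of the chain bound.\<close>
  have s: "4 * (kap * M) * t \<le> 1"
  proof -
    have "1 \<le> 2 powr (real DIM('a) * \<delta> + 1)" using \<delta> by (intro ge_one_powr_ge_zero) auto
    then have "kap * M \<le> y" using mult_right_mono[of 1 "2 powr (real DIM('a) * \<delta> + 1)" "kap * M"] kap_pos M_ge_1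
      by (simp add: y_def mult.assoc)
    then show ?thesis using y_pos by (simp add: t_def field_simps)
  qed
  have "e n * t ^ n \<le> (\<Sum>n\<in>{1..n}. e n * t ^ n)"
    using False t_pos by (intro member_le_sum[where f="\<lambda>n. e n * t ^ n"]) auto
  also have "\<dots> \<le> 4 * t"
    unfolding e_def using y_pos t_pos kap_pos M_ge_1 s by (intro sum_chain_weight_le) (auto simp: t_def)
  finally show ?thesis using t_pos by (simp add: power_divide field_simps)
qed

text \<open>Convolving a geometric sequence with itself costs a factor linear in k.\<close>

lemma path_coefficient_le:
  "path_coefficient k \<le> (1 + 8 * kap * t + 16 * kap\<^sup>2 * t\<^sup>2) * ((real k + 1) * (1 / t) ^ k)"
proof (cases "k = 0")
  case True
  then show ?thesis using kap_pos t_pos by (simp add: path_coefficient_def)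
next
  case False
  have "(\<Sum>i\<in>{0<..<k}. e i * e (k - i)) \<le> (\<Sum>i\<in>{0<..<k}. (4 * t * (1 / t) ^ i) * (4 * t * (1 / t) ^ (k - i)))"
    using t_pos by (intro sum_mono mult_mono e_le) auto
  also have "\<dots> = (\<Sum>i\<in>{0<..<k}. 16 * t\<^sup>2 * (1 / t) ^ k)"
    by (intro sum.cong refl) (simp add: power2_eq_square mult_ac power_add[symmetric])
  also have "\<dots> \<le> real k * (16 * t\<^sup>2 * (1 / t) ^ k)"
    using t_pos by simp
  finally have S: "(\<Sum>i\<in>{0<..<k}. e i * e (k - i)) \<le> real k * (16 * t\<^sup>2 * (1 / t) ^ k)" .
  have "path_coefficient k \<le> 2 * kap * (4 * t * (1 / t) ^ k) + kap * kap * (real k * (16 * t\<^sup>2 * (1 / t) ^ k))"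
    using False kap_pos S e_le[of k] by (simp add: path_coefficient_def add_mono mult_left_mono)
  also have "\<dots> = (8 * kap * t + 16 * kap\<^sup>2 * t\<^sup>2 * real k) * (1 / t) ^ k"
    by (simp add: algebra_simps power2_eq_square)
  also have "\<dots> \<le> ((1 + 8 * kap * t + 16 * kap\<^sup>2 * t\<^sup>2) * (real k + 1)) * (1 / t) ^ k"
    using kap_pos t_pos by (intro mult_right_mono) (auto simp: algebra_simps add_nonneg_nonneg)
  finally show ?thesis by (simp only: mult.assoc)
qed

lemma suminf_ennreal_le:
  assumes "\<And>n. 0 \<le> f n" "\<And>n. f n \<le> g n" "summable g"
  shows "(\<Sum>n. ennreal (f n)) \<le> ennreal (\<Sum>n. g n)"
proof -
  have "0 \<le> g n" for n using assms(1,2)[of n] by linarith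
  then have "(\<Sum>n. ennreal (g n)) = ennreal (\<Sum>n. g n)" using assms(3) by (intro suminf_ennreal2) auto
  moreover have "(\<Sum>n. ennreal (f n)) \<le> (\<Sum>n. ennreal (g n))"
    using assms(2) by (intro suminf_le ennreal_leI) auto
  ultimately show ?thesis by simp
qed

text \<open>Both series converge to constants that do not involve the point process, m or us, so us
  can be chosen afterwards as a function of m.\<close>

lemma upper_tail:
  obtains C1 C2 where "0 \<le> C1" "0 \<le> C2"
    "\<And>N m us. unit_poisson_process N \<Longrightarrow> 0 < m \<Longrightarrow> 0 < us \<Longrightarrow> us < 1 \<Longrightarrow>
      emeasure (palm_law N) (tail_event m N) \<le> ennreal us + ennreal (C1 * us powr (1 - \<gamma>)) + ennreal (C2 * m powr (1 - \<delta>)) * J us"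
proof -
  define z where "z = 1 / t"
  have z: "0 < z" "z < 1" using t_gt_1 by (auto simp: z_def)
  define gA where "gA n = 4 * t * z ^ Suc n * kap * M / (1 - \<gamma>)" for n
  \<comment> \<open>Step k has to reach m times the d-th power of its scale; the exponent 1 -
    \<delta> of the jump tail turns this into the power p = d(\<delta> - 1) of the inverse
    scale.\<close>
  define p where "p = DIM('a) * (\<delta> - 1)"
  define K where "K = kap * \<beta> powr (\<delta> - 1) * ((1 + 8 * kap * t + 16 * kap\<^sup>2 * t\<^sup>2) * (2 * M ^ 3))"
  define gB where "gB k = K * ((real k + 1) * ((real k + 1) * (real k + 2)) powr p * z ^ k)" for k
  have K0: "0 \<le> K" using kap_pos t_pos M_ge_1 by (simp add: K_def)
  have sA: "summable gA"
    unfolding gA_def using z by (auto intro!: summable_divide summable_mult summable_mult2 summable_geometric simp: mult.assoc)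
  have sB: "summable gB" unfolding gB_def by (intro summable_mult summable_powr_geometric z)
  have gA0: "0 \<le> gA n" for n using z t_pos kap_pos M_ge_1 \<gamma> by (simp add: gA_def)
  have gB0: "0 \<le> gB n" for n using z K0 by (simp add: gB_def)
  show ?thesis
  proof (rule that[of "\<Sum>n. gA n" "\<Sum>n. gB n"])
    show "0 \<le> (\<Sum>n. gA n)" "0 \<le> (\<Sum>n. gB n)" using sA sB gA0 gB0 by (auto intro!: suminf_nonneg)
    fix N :: "(nat \<Rightarrow> 'a) measure" and m us :: real
    assume N: "unit_poisson_process N" and m: "0 < m" and us: "0 < us" "us < 1"
    have A: "(\<Sum>n. ennreal (e (Suc n) * kap * M * (us powr (1 - \<gamma>) / (1 - \<gamma>)))) \<le> ennreal ((\<Sum>n. gA n) * us powr (1 - \<gamma>))"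
      unfolding suminf_mult2[OF sA]
    proof (rule suminf_ennreal_le)
      fix n
      show "0 \<le> e (Suc n) * kap * M * (us powr (1 - \<gamma>) / (1 - \<gamma>))" using kap_pos M_ge_1 \<gamma> by simp
      have "e (Suc n) * (kap * M * us powr (1 - \<gamma>) / (1 - \<gamma>)) \<le> 4 * t * z ^ Suc n * (kap * M * us powr (1 - \<gamma>) / (1 - \<gamma>))"
        unfolding z_def using kap_pos M_ge_1 \<gamma> by (intro mult_right_mono e_le) auto
      then show "e (Suc n) * kap * M * (us powr (1 - \<gamma>) / (1 - \<gamma>)) \<le> gA n * us powr (1 - \<gamma>)"
        by (simp add: gA_def mult_ac)
    qed (intro summable_mult2 sA)
    have B: "(\<Sum>k. ennreal (kap * \<beta> powr (\<delta> - 1) * (m * step_scale k ^ DIM('a)) powr (1 - \<delta>) * (path_coefficient k * (2 * M ^ 3)))) \<le>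
        ennreal ((\<Sum>k. gB k) * m powr (1 - \<delta>))"
      unfolding suminf_mult2[OF sB]
    proof (rule suminf_ennreal_le)
      fix k
      show "0 \<le> kap * \<beta> powr (\<delta> - 1) * (m * step_scale k ^ DIM('a)) powr (1 - \<delta>) * (path_coefficient k * (2 * M ^ 3))"
        using kap_pos path_coefficient_nonneg[of k] M_ge_1 by simp
      define w where "w = (real k + 1) * (real k + 2)"
      have w: "0 < w" by (simp add: w_def)
      have "(m * step_scale k ^ DIM('a)) powr (1 - \<delta>) = m powr (1 - \<delta>) * w powr p"
      proof -
        have "step_scale k ^ DIM('a) = w powr (- real DIM('a))"
          using w by (simp add: step_scale_def w_def[symmetric] powr_minus powr_realpow power_divide inverse_eq_divide)
        then have "(step_scale k ^ DIM('a)) powr (1 - \<delta>) = w powr p" by (simp add: powr_powr p_def algebra_simps)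
        then show ?thesis using m step_scale_pos[of k] by (simp add: powr_mult)
      qed
      moreover have "kap * \<beta> powr (\<delta> - 1) * (m powr (1 - \<delta>) * w powr p) * (path_coefficient k * (2 * M ^ 3)) \<le>
          kap * \<beta> powr (\<delta> - 1) * (m powr (1 - \<delta>) * w powr p) * (((1 + 8 * kap * t + 16 * kap\<^sup>2 * t\<^sup>2) * ((real k + 1) * z ^ k)) * (2 * M ^ 3))"
        using kap_pos M_ge_1 path_coefficient_le[of k] by (intro mult_left_mono mult_right_mono) (auto simp: z_def)
      ultimately show "kap * \<beta> powr (\<delta> - 1) * (m * step_scale k ^ DIM('a)) powr (1 - \<delta>) * (path_coefficient k * (2 * M ^ 3)) \<le> gB k * m powr (1 - \<delta>)"
        by (simp add: gB_def K_def w_def[symmetric] mult_ac)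
    qed (intro summable_mult2 sB)
    have "emeasure (palm_law N) (tail_event m N) \<le> ennreal us +
      (\<Sum>n. ennreal (e (Suc n) * kap * M * (us powr (1 - \<gamma>) / (1 - \<gamma>)))) +
      (\<Sum>k. ennreal (kap * \<beta> powr (\<delta> - 1) * (m * step_scale k ^ DIM('a)) powr (1 - \<delta>) * (path_coefficient k * (2 * M ^ 3))) * J us)"
      by (rule emeasure_tail_event_le[OF N m us])
    also have "\<dots> \<le> ennreal us + ennreal ((\<Sum>n. gA n) * us powr (1 - \<gamma>)) + ennreal ((\<Sum>k. gB k) * m powr (1 - \<delta>)) * J us"
      unfolding ennreal_suminf_multc by (intro add_mono mult_right_mono A B) auto
    finally show "emeasure (palm_law N) (tail_event m N) \<le> \<dots>" .
  qed
qed

end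

section \<open>Size of the integral over strong marks\<close>

lemma J_le_integral:
  assumes "0 < us" "us < 1"
  shows "J us \<le> (\<integral>\<^sup>+u. ennreal (u powr (- (\<gamma> + \<gamma> * \<delta>))) * indicator {us..1} u \<partial>lborel)"
  unfolding J_def
  by (subst nn_integral_uniform01, simp, rule nn_integral_mono) (auto split: split_indicator)

text \<open>One antiderivative serves both signs of 1 - (\<gamma> + \<gamma>\<delta>): below the
  threshold the bound stays finite as us tends to 0, above it is of order
  \<open>us powr (1 - (\<gamma> + \<gamma> * \<delta>))\<close>.\<close>

lemma J_le:
  assumes us: "0 < us" "us < 1" and s: "\<gamma> + \<gamma> * \<delta> \<noteq> 1"
  shows "J us \<le> ennreal ((1 - us powr (1 - (\<gamma> + \<gamma> * \<delta>))) / (1 - (\<gamma> + \<gamma> * \<delta>)))"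
proof -
  let ?s = "\<gamma> + \<gamma> * \<delta>"
  have "(\<integral>\<^sup>+u. ennreal (u powr (- ?s)) * indicator {us..1} u \<partial>lborel) = ennreal (1 powr (1 - ?s) / (1 - ?s) - us powr (1 - ?s) / (1 - ?s))"
  proof (rule nn_integral_FTC_Icc)
    fix u assume "u \<in> {us..1}"
    then have u: "0 < u" using us by simp
    have "((\<lambda>u. u powr (1 - ?s) / (1 - ?s)) has_real_derivative ((1 - ?s) * u powr (1 - ?s - 1)) / (1 - ?s)) (at u)"
      using u by (intro DERIV_cdivide has_real_derivative_powr)
    then show "((\<lambda>u. u powr (1 - ?s) / (1 - ?s)) has_real_derivative u powr (- ?s)) (at u)"
      using s by simp
  qed (use us in auto)
  then show ?thesis using J_le_integral[OF us] by (simp add: diff_divide_distrib)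
qed

lemma J_le_critical:
  assumes us: "0 < us" "us < 1" and s: "\<gamma> + \<gamma> * \<delta> = 1"
  shows "J us \<le> ennreal (- ln us)"
proof -
  have "(\<integral>\<^sup>+u. ennreal (u powr (- 1)) * indicator {us..1} u \<partial>lborel) = ennreal (ln 1 - ln us)"
  proof (rule nn_integral_FTC_Icc)
    fix u assume "u \<in> {us..1}"
    then have u: "0 < u" using us by simp
    then show "(ln has_real_derivative u powr (- 1)) (at u)"
      using DERIV_ln_divide[of u] by (simp add: powr_minus inverse_eq_divide)
  qed (use us in auto)
  then show ?thesis using J_le_integral[OF us] s by simp
qed

end

section \<open>Lower bounds\<close>

text \<open>\<open>x / (1 + x)\<close> is a rational lower bound for 1 - exp(-x). It is linear for
  small x and bounded below for large x, so it serves both rare and likely events.\<close>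

lemma one_minus_power_ge:
  fixes p x :: real
  assumes "0 \<le> p" "p \<le> 1" "0 \<le> x" "x \<le> real n * p"
  shows "x / (1 + x) \<le> 1 - (1 - p) ^ n"
proof -
  have "(1 - p) ^ n \<le> exp (- p) ^ n" using assms exp_ge_add_one_self[of "-p"] by (intro power_mono) auto
  also have "\<dots> = exp (- (real n * p))" by (simp add: exp_of_nat_mult[symmetric])
  also have "\<dots> \<le> exp (- x)" using assms by simp
  also have "\<dots> \<le> 1 / (1 + x)"
    using exp_ge_add_one_self[of x] assms by (simp add: exp_minus field_simps)
  finally have "1 - 1 / (1 + x) \<le> 1 - (1 - p) ^ n" by simp
  moreover have "x / (1 + x) = 1 - 1 / (1 + x)" using assms by (simp add: field_simps)
  ultimately show ?thesis by simp
qed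

text \<open>The index type is arbitrary because the bound is applied to edge marks, to find a
  connection, and to vertex marks, to find a hub.\<close>

lemma exists_small_mark_ge:
  fixes I :: "'i set"
  assumes J: "J \<subseteq> I" "finite J" and p: "0 \<le> p" "p \<le> 1" and x: "0 \<le> x" "x \<le> real (card J) * p"
  shows "ennreal (x / (1 + x)) \<le> (\<integral>\<^sup>+w. of_bool (\<exists>j\<in>J. w j \<le> p) \<partial>PiM I (\<lambda>_. uniform01))"
proof -
  interpret P: product_prob_space "\<lambda>_ :: 'i. uniform01" I by unfold_locales
  let ?P = "PiM I (\<lambda>_ :: 'i. uniform01)"
  have ps: "prob_space ?P" by (intro prob_space_PiM) simp
  have u: "emeasure uniform01 {p<..} = ennreal (1 - p)"
  proof -
    have "emeasure uniform01 (UNIV - {..p}) = emeasure uniform01 UNIV - emeasure uniform01 {..p}"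
      using emeasure_uniform01_atMost[OF p] by (intro emeasure_compl[of _ uniform01, simplified]) auto
    moreover have "UNIV - {..p} = {p<..}" by auto
    ultimately show ?thesis
      using uniform01.emeasure_space_1 p by (simp add: emeasure_uniform01_atMost ennreal_minus[symmetric] ennreal_1[symmetric] del: ennreal_1)
  qed
  let ?A = "{w\<in>space ?P. \<forall>j\<in>J. w j \<in> {p<..}}"
  have mA: "?A \<in> sets ?P" using J by (intro sets.sets_Collect_finite_All) auto
  have A: "emeasure ?P ?A = ennreal ((1 - p) ^ card J)"
    using J p by (subst P.emeasure_PiM_Collect) (auto simp: u ennreal_power)
  have "ennreal (x / (1 + x)) \<le> ennreal (1 - (1 - p) ^ card J)"
    by (intro ennreal_leI one_minus_power_ge p x)
  also have "\<dots> = emeasure ?P (space ?P) - emeasure ?P ?A"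
    unfolding A prob_space.emeasure_space_1[OF ps] ennreal_1[symmetric] using p by (intro ennreal_minus[symmetric]) simp
  also have "\<dots> = emeasure ?P (space ?P - ?A)" using A mA by (intro emeasure_compl[symmetric]) auto
  also have "\<dots> = (\<integral>\<^sup>+w. indicator (space ?P - ?A) w \<partial>?P)" using mA by (intro nn_integral_indicator[symmetric]) auto
  also have "\<dots> = (\<integral>\<^sup>+w. of_bool (\<exists>j\<in>J. w j \<le> p) \<partial>?P)"
    by (intro nn_integral_cong) (auto simp: indicator_def not_le not_less)
  finally show ?thesis .
qed

section \<open>Second moment bounds for Poisson counts\<close>

context unit_poisson_process
begin

text \<open>Paley--Zygmund, written pointwise: for an integer \<open>k\<close>,
  \<open>k \<le> l/2 + (k(k-1) + k) / (4(l+1)) + (l+1) [k \<ge> l/2]\<close>.\<close>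

lemma point_count_large:
  assumes B[measurable]: "B \<in> sets borel" and l: "emeasure lborel B = ennreal l" "0 < l"
  shows "ennreal (l / (4 * (l + 1))) \<le> (\<integral>\<^sup>+x. of_bool (ennreal (l / 2) \<le> point_count B x) \<partial>N)"
proof -
  have fin: "emeasure lborel B < \<infinity>" using l by simp
  let ?P = "\<integral>\<^sup>+x. of_bool (ennreal (l / 2) \<le> point_count B x) \<partial>N"
  have pw: "real k \<le> l / 2 + (1 / (4 * (l + 1))) * (real (k * (k - 1)) + real k) + (l + 1) * of_bool (l / 2 \<le> real k)" for k :: nat
  proof (cases "l / 2 \<le> real k")
    case True
    have "real (k * (k - 1)) + real k = real k ^ 2" by (cases k) (auto simp: power2_eq_square algebra_simps)
    moreover have "real k \<le> (1 / (4 * (l + 1))) * real k ^ 2 + (l + 1)"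
    proof -
      \<comment> \<open>The square is centred at 2(l + 1), where the weights 1 / (4(l + 1)) and l +
        1 of the pointwise bound balance.\<close>
      have "0 \<le> (real k - 2 * (l + 1)) ^ 2" by simp
      then have "4 * (l + 1) * real k \<le> real k ^ 2 + 4 * (l + 1) ^ 2" by (simp add: power2_eq_square algebra_simps)
      then show ?thesis using l by (simp add: field_simps power2_eq_square)
    qed
    ultimately show ?thesis using True l by simp
  next
    case False
    then have "0 \<le> (1 / (4 * (l + 1))) * (real (k * (k - 1)) + real k)" using l by simp
    moreover have "of_bool (l / 2 \<le> real k) = (0 :: real)" using False by simp
    ultimately show ?thesis using False by (simp only: mult_zero_right)
  qed
  have "AE x in N. point_count B x \<le> ennreal (l / 2) + ennreal (1 / (4 * (l + 1))) * (falling 2 (point_count B x) + falling 1 (point_count B x)) +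
      ennreal (l + 1) * of_bool (ennreal (l / 2) \<le> point_count B x)"
    using AE_finite_points[OF B fin]
  proof eventually_elim
    case (elim x)
    then obtain k where k: "point_count B x = of_nat k" by (auto simp: point_count_eq_of_nat_iff)
    have f: "falling 2 (of_nat k) = of_nat (k * (k - 1))" "falling 1 (of_nat k) = of_nat k"
      unfolding falling_of_nat by (simp_all add: numeral_2_eq_2)
    have b: "ennreal (l / 2) \<le> of_nat k \<longleftrightarrow> l / 2 \<le> real k"
      by (simp add: ennreal_of_nat_eq_real_of_nat ennreal_le_iff)
    have "of_nat k \<le> ennreal (l / 2 + (1 / (4 * (l + 1))) * (real (k * (k - 1)) + real k) + (l + 1) * of_bool (l / 2 \<le> real k))"
      unfolding ennreal_of_nat_eq_real_of_nat by (intro ennreal_leI pw)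
    also have "\<dots> = ennreal (l / 2) + ennreal (1 / (4 * (l + 1))) * (of_nat (k * (k - 1)) + of_nat k) + ennreal (l + 1) * of_bool (l / 2 \<le> real k)"
      unfolding ennreal_of_nat_eq_real_of_nat using l
      by (subst ennreal_plus, simp, simp, subst ennreal_plus, simp, simp, subst ennreal_mult, simp, simp, subst ennreal_plus) (simp_all add: ennreal_mult)
    finally show ?case unfolding k f b .
  qed
  then have "(\<integral>\<^sup>+x. point_count B x \<partial>N) \<le> (\<integral>\<^sup>+x. ennreal (l / 2) + ennreal (1 / (4 * (l + 1))) * (falling 2 (point_count B x) + falling 1 (point_count B x)) +
      ennreal (l + 1) * of_bool (ennreal (l / 2) \<le> point_count B x) \<partial>N)"
    by (rule nn_integral_mono_AE)
  also have "\<dots> = ennreal (l / 2) + ennreal (1 / (4 * (l + 1))) * ((\<integral>\<^sup>+x. falling 2 (point_count B x) \<partial>N) + (\<integral>\<^sup>+x. falling 1 (point_count B x) \<partial>N)) + ennreal (l + 1) * ?P"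
    by (simp add: nn_integral_add nn_integral_cmult emeasure_space_1)
  also have "(\<integral>\<^sup>+x. falling 2 (point_count B x) \<partial>N) = ennreal (l ^ 2)"
    unfolding factorial_moment_point_count[OF B fin] l(1) using l(2) by (simp add: ennreal_power)
  also have "(\<integral>\<^sup>+x. falling 1 (point_count B x) \<partial>N) = ennreal l"
    unfolding factorial_moment_point_count[OF B fin] l(1) by simp
  also have "ennreal (l / 2) + ennreal (1 / (4 * (l + 1))) * (ennreal (l ^ 2) + ennreal l) = ennreal (3 * l / 4)"
  proof -
    have "ennreal (l / 2) + ennreal (1 / (4 * (l + 1))) * (ennreal (l ^ 2) + ennreal l) = ennreal (l / 2 + 1 / (4 * (l + 1)) * (l ^ 2 + l))"
      using l by (simp add: ennreal_plus[symmetric] ennreal_mult[symmetric] del: ennreal_plus)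
    \<comment> \<open>The second moment term is exactly l/4, so l/4 of the mean l is left for the
      event itself.\<close>
    also have "l / 2 + 1 / (4 * (l + 1)) * (l ^ 2 + l) = 3 * l / 4"
      using l by (simp add: field_simps power2_eq_square)
    finally show ?thesis .
  qed
  finally have le: "(\<integral>\<^sup>+x. point_count B x \<partial>N) \<le> ennreal (3 * l / 4) + ennreal (l + 1) * ?P" .
  have "(\<integral>\<^sup>+x. point_count B x \<partial>N) = (\<integral>\<^sup>+x. falling 1 (point_count B x) \<partial>N)"
    by (simp add: falling_def)
  also have "\<dots> = ennreal l" unfolding factorial_moment_point_count[OF B fin] l(1) by simp
  finally have "ennreal l \<le> ennreal (3 * l / 4) + ennreal (l + 1) * ?P" using le by simp
  moreover have "?P \<le> (\<integral>\<^sup>+x. 1 \<partial>N)" by (intro nn_integral_mono) simp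
  then have "?P \<noteq> \<infinity>" using emeasure_space_1 by (auto simp: top_unique)
  then obtain P where P: "?P = ennreal P" "0 \<le> P" by (cases ?P) auto
  ultimately have "ennreal l \<le> ennreal (3 * l / 4 + (l + 1) * P)"
    using l by (simp add: ennreal_plus[symmetric] ennreal_mult[symmetric] del: ennreal_plus)
  then have "l \<le> 3 * l / 4 + (l + 1) * P" using l P by (subst (asm) ennreal_le_iff) auto
  then have "l / (4 * (l + 1)) \<le> P" using l by (simp add: field_simps)
  then show ?thesis unfolding P(1) by (rule ennreal_leI)
qed

lemma point_counts_large:
  assumes "B \<in> sets borel" "B' \<in> sets borel" "B \<inter> B' = {}"
    and l: "emeasure lborel B = ennreal l" "0 < l" "emeasure lborel B' = ennreal l'" "0 < l'"
  shows "ennreal (l / (4 * (l + 1)) * (l' / (4 * (l' + 1)))) \<le>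
    (\<integral>\<^sup>+x. of_bool (ennreal (l / 2) \<le> point_count B x) * of_bool (ennreal (l' / 2) \<le> point_count B' x) \<partial>N)"
proof -
  \<comment> \<open>Independence is available for sequences, so the pair of sets is continued by
    empty sets.\<close>
  define C where "C n = (if n = 0 then B else if n = Suc 0 then B' else {})" for n :: nat
  define X where "X n y = (of_bool (ennreal ((if n = 0 then l else l') / 2) \<le> y) :: ennreal)" for n :: nat and y
  have "indep_vars (\<lambda>_. borel) (\<lambda>n. point_count (C n)) UNIV"
    using assms by (intro independent) (auto simp: C_def disjoint_family_on_def)
  then have "indep_vars (\<lambda>_. borel) (\<lambda>n. point_count (C n)) {0, Suc 0}" by (rule indep_vars_subset) auto
  then have "indep_vars (\<lambda>_. borel) (\<lambda>n x. X n (point_count (C n) x)) {0, Suc 0}"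
    by (rule indep_vars_compose2) (unfold X_def, measurable)
  then have "(\<integral>\<^sup>+x. (\<Prod>n\<in>{0, Suc 0}. X n (point_count (C n) x)) \<partial>N) = (\<Prod>n\<in>{0, Suc 0}. \<integral>\<^sup>+x. X n (point_count (C n) x) \<partial>N)"
    by (intro indep_vars_nn_integral) auto
  then have "(\<integral>\<^sup>+x. of_bool (ennreal (l / 2) \<le> point_count B x) * of_bool (ennreal (l' / 2) \<le> point_count B' x) \<partial>N) =
      (\<integral>\<^sup>+x. of_bool (ennreal (l / 2) \<le> point_count B x) \<partial>N) * (\<integral>\<^sup>+x. of_bool (ennreal (l' / 2) \<le> point_count B' x) \<partial>N)"
    by (simp add: X_def C_def)
  moreover have "ennreal (l / (4 * (l + 1)) * (l' / (4 * (l' + 1)))) \<le> \<dots>"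
  proof -
    have "ennreal (l / (4 * (l + 1)) * (l' / (4 * (l' + 1)))) = ennreal (l / (4 * (l + 1))) * ennreal (l' / (4 * (l' + 1)))"
      using l by (intro ennreal_mult) simp_all
    also have "\<dots> \<le> (\<integral>\<^sup>+x. of_bool (ennreal (l / 2) \<le> point_count B x) \<partial>N) * (\<integral>\<^sup>+x. of_bool (ennreal (l' / 2) \<le> point_count B' x) \<partial>N)"
      by (intro mult_mono point_count_large assms zero_le)
    finally show ?thesis .
  qed
  ultimately show ?thesis by simp
qed

end

lemma emeasure_annulus:
  assumes "0 \<le> r" "r \<le> s"
  shows "emeasure lborel {x::'a::euclidean_space. r \<le> norm x ^ DIM('a) \<and> norm x ^ DIM('a) < s} =
    ennreal (measure lborel (ball (0::'a) 1) * (s - r))"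
proof -
  let ?B = "\<lambda>s. {x::'a. norm x ^ DIM('a) < s}"
  have "emeasure lborel (?B s - ?B r) = emeasure lborel (?B s) - emeasure lborel (?B r)"
    using assms emeasure_norm_power_less[of r "0::'a"] by (intro emeasure_Diff) auto
  also have "\<dots> = ennreal (measure lborel (ball (0::'a) 1) * (s - r))"
    using assms emeasure_norm_power_less[of r "0::'a"] emeasure_norm_power_less[of s "0::'a"]
    by (simp add: ennreal_minus right_diff_distrib)
  also have "?B s - ?B r = {x. r \<le> norm x ^ DIM('a) \<and> norm x ^ DIM('a) < s}" by auto
  finally show ?thesis .
qed

text \<open>An infinite number of points is not excluded here; the finite subset makes the product
  over independent marks meaningful in every case.\<close>

lemma finite_subset_of_points:
  assumes "ennreal r \<le> point_count B x"
  obtains K where "finite K" "K \<subseteq> {i. x i \<in> B}" "r \<le> real (card K)"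
proof (cases "finite {i. x i \<in> B}")
  case True
  then have "ennreal r \<le> ennreal (real (card {i. x i \<in> B}))"
    using assms by (simp add: point_count_def emeasure_count_space_finite ennreal_of_nat_eq_real_of_nat)
  then have "r \<le> real (card {i. x i \<in> B})" by (simp add: ennreal_le_iff)
  then show ?thesis using that[OF True] by simp
next
  case False
  obtain n where n: "r \<le> real n" using real_arch_simple by blast
  from infinite_arbitrarily_large[OF False, of n] obtain K where
    "finite K" "card K = n" "K \<subseteq> {i. x i \<in> B}" by blast
  then show ?thesis using that[of K] n by simp
qed

lemma AE_vertex_marks:
  "AE u in PiM UNIV (\<lambda>_ :: nat. uniform01). \<forall>i. 0 < u i \<and> u i < 1"
proof -
  have "AE u in PiM UNIV (\<lambda>_ :: nat. uniform01). 0 < u i \<and> u i < 1" for i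
    by (intro AE_PiM_component[where P="\<lambda>t. 0 < t \<and> t < 1"]) (use AE_uniform01 in auto)
  then show ?thesis by (simp only: AE_all_countable) simp
qed

lemma le_rhoI:
  assumes "p \<le> 1" "0 < T" "p \<le> T powr (- \<delta>)" "0 \<le> t" "t \<le> T" "0 < \<delta>"
  shows "p \<le> rho \<delta> t"
proof -
  have "p \<le> rho \<delta> T" using assms by (simp add: rho_def)
  also have "\<dots> \<le> rho \<delta> t" using assms by (intro rho_antimono)
  finally show ?thesis .
qed

lemma two_power_le_norm_diff:
  fixes x y :: "'a::euclidean_space"
  assumes "norm x ^ DIM('a) \<le> norm y ^ DIM('a)"
  shows "norm (x - y) ^ DIM('a) \<le> 2 ^ DIM('a) * norm y ^ DIM('a)"
proof -
  have "norm x \<le> norm y" using assms by (simp add: power_mono_iff)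
  then have "norm (x - y) \<le> 2 * norm y" using norm_triangle_ineq4[of x y] by simp
  then have "norm (x - y) ^ DIM('a) \<le> (2 * norm y) ^ DIM('a)" by (intro power_mono) auto
  then show ?thesis by (simp add: power_mult_distrib)
qed

section \<open>Reaching a distant annulus by one edge or through a hub\<close>

context soft_boolean_parameters
begin

text \<open>The positions are conditioned on: c bounds the probability over the marks from below for
  all positions satisfying P.\<close>

lemma emeasure_tail_event_ge:
  assumes N: "unit_poisson_process N" and m: "0 \<le> m" and P: "Measurable.pred N P"
    and c: "\<And>x. x \<in> space N \<Longrightarrow> P x \<Longrightarrow> c \<le> (\<integral>\<^sup>+u. \<integral>\<^sup>+v. indicator (tail_event m N) (x, u, v)
      \<partial>PiM {e :: nat set. card e = 2} (\<lambda>_. uniform01) \<partial>PiM UNIV (\<lambda>_ :: nat. uniform01))"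
  shows "c * (\<integral>\<^sup>+x. of_bool (P x) \<partial>N) \<le> emeasure (palm_law N) (tail_event m N)"
proof -
  interpret unit_poisson_process N by fact
  have T: "tail_event m N \<in> sets (palm_law N)"
    unfolding tail_event_def using m by (intro diameter_event_measurable) simp
  have "c * (\<integral>\<^sup>+x. of_bool (P x) \<partial>N) = (\<integral>\<^sup>+x. c * of_bool (P x) \<partial>N)"
    using P by (intro nn_integral_cmult[symmetric]) measurable
  also have "\<dots> \<le> (\<integral>\<^sup>+x. \<integral>\<^sup>+u. \<integral>\<^sup>+v. indicator (tail_event m N) (x, u, v)
      \<partial>PiM {e :: nat set. card e = 2} (\<lambda>_. uniform01) \<partial>PiM UNIV (\<lambda>_ :: nat. uniform01) \<partial>N)"
    by (rule nn_integral_mono) (use c in \<open>simp add: of_bool_def\<close>)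
  also have "\<dots> = (\<integral>\<^sup>+\<omega>. indicator (tail_event m N) \<omega> \<partial>palm_law N)"
    using T by (intro nn_integral_palm_law[symmetric]) simp
  also have "\<dots> = emeasure (palm_law N) (tail_event m N)" using T by simp
  finally show ?thesis .
qed

lemma in_tail_eventI:
  assumes "x \<in> space N" "v \<in> space (PiM {e :: nat set. card e = 2} (\<lambda>_. uniform01))" "0 \<le> m"
    and "(adjacent \<beta> \<gamma> \<delta> (x, u, v))\<^sup>*\<^sup>* 0 (Suc j)" "m < norm (x j) ^ DIM('a)"
  shows "(x, u, v) \<in> tail_event m N"
  using assms unfolding tail_event_def
  by (auto simp: diameter_greater_iff palm_law_def space_pair_measure space_PiM cluster_def intro!: bexI[of _ "Suc j"])

text \<open>All marks are below 1, so an edge mark at most p connects the origin to any point of the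
  annulus, whatever the vertex marks. The annulus holds at least l/2 points with probability bounded
  below, and y bounds the mean number of such connections from below.\<close>

lemma tail_event_ge_direct:
  fixes m p y :: real
  assumes N: "unit_poisson_process N" and m: "0 < m"
    and p: "0 \<le> p" "p \<le> 1" "p \<le> (3 * m / \<beta>) powr (- \<delta>)"
    and y: "0 \<le> y" "y \<le> measure lborel (ball (0::'a) 1) * m / 2 * p"
  defines "l \<equiv> measure lborel (ball (0::'a) 1) * m"
  shows "ennreal (y / (1 + y) * (l / (4 * (l + 1)))) \<le> emeasure (palm_law N) (tail_event m N)"
proof -
  interpret unit_poisson_process N by fact
  let ?U = "PiM UNIV (\<lambda>_ :: nat. uniform01)" and ?V = "PiM {e :: nat set. card e = 2} (\<lambda>_. uniform01)"
  let ?S = "{x::'a. 2 * m \<le> norm x ^ DIM('a) \<and> norm x ^ DIM('a) < 3 * m}"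
  have Us: "prob_space ?U" "prob_space ?V" by (intro prob_space_PiM; simp)+
  have "measure lborel (ball (0::'a) 1) > 0" by (simp add: content_ball)
  then have l: "0 < l" using m by (simp add: l_def)
  have S[measurable]: "?S \<in> sets borel" by measurable
  have eS: "emeasure lborel ?S = ennreal l"
    using emeasure_annulus[of "2 * m" "3 * m", where 'a='a] m by (simp add: l_def algebra_simps)
  have "ennreal (y / (1 + y)) * (\<integral>\<^sup>+x. of_bool (ennreal (l / 2) \<le> point_count ?S x) \<partial>N) \<le> emeasure (palm_law N) (tail_event m N)"
  proof (rule emeasure_tail_event_ge[OF N])
    fix x assume x: "x \<in> space N" "ennreal (l / 2) \<le> point_count ?S x"
    obtain K where K: "finite K" "K \<subseteq> {i. x i \<in> ?S}" "l / 2 \<le> real (card K)"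
      using finite_subset_of_points[OF x(2)] .
    \<comment> \<open>Edges from the origin to distinct points are distinct, hence their marks are
      independent.\<close>
    let ?J = "(\<lambda>j. {0, Suc j}) ` K"
    have J: "finite ?J" "?J \<subseteq> {e. card e = 2}" using K(1) by auto
    have "inj_on (\<lambda>j. {0, Suc j}) K" by (auto simp: inj_on_def doubleton_eq_iff)
    then have "card ?J = card K" by (rule card_image)
    then have cJ: "y \<le> real (card ?J) * p"
      using y(2) mult_right_mono[OF K(3) p(1)] by (simp add: l_def)
    have "ennreal (y / (1 + y)) = (\<integral>\<^sup>+u. ennreal (y / (1 + y)) \<partial>?U)"
      using prob_space.emeasure_space_1[OF Us(1)] by simp
    also have "\<dots> \<le> (\<integral>\<^sup>+u. \<integral>\<^sup>+v. indicator (tail_event m N) (x, u, v) \<partial>?V \<partial>?U)"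
    proof (rule nn_integral_mono_AE, use AE_vertex_marks in eventually_elim)
      case (elim u)
      have "ennreal (y / (1 + y)) \<le> (\<integral>\<^sup>+v. of_bool (\<exists>e\<in>?J. v e \<le> p) \<partial>?V)"
        by (rule exists_small_mark_ge[OF J(2,1) p(1,2) y(1) cJ])
      also have "\<dots> \<le> (\<integral>\<^sup>+v. indicator (tail_event m N) (x, u, v) \<partial>?V)"
      proof (rule nn_integral_mono)
        fix v assume v: "v \<in> space ?V"
        show "of_bool (\<exists>e\<in>?J. v e \<le> p) \<le> (indicator (tail_event m N) (x, u, v) :: ennreal)"
        proof (cases "\<exists>e\<in>?J. v e \<le> p")
          case True
          then obtain j where j: "j \<in> K" "v {0, Suc j} \<le> p" by auto
          then have xj: "2 * m \<le> norm (x j) ^ DIM('a)" "norm (x j) ^ DIM('a) < 3 * m" using K(2) by auto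
          have u: "0 < u 0" "0 < u (Suc j)" "u 0 < 1" using elim by auto
          have "min (u 0) (u (Suc j)) powr \<gamma> \<le> 1" using u \<gamma> by (intro powr_le1) auto
          then have "min (u 0) (u (Suc j)) powr \<gamma> * norm (x j) ^ DIM('a) \<le> 1 * (3 * m)"
            using xj m by (intro mult_mono) auto
          then have "inverse \<beta> * min (u 0) (u (Suc j)) powr \<gamma> * norm (x j) ^ DIM('a) \<le> 3 * m / \<beta>"
            using \<beta> by (simp add: field_simps)
          then have "p \<le> rho \<delta> (inverse \<beta> * min (u 0) (u (Suc j)) powr \<gamma> * norm (x j) ^ DIM('a))"
            using p m \<beta> \<delta> by (intro le_rhoI[of _ "3 * m / \<beta>"]) auto
          then have "adjacent \<beta> \<gamma> \<delta> (x, u, v) 0 (Suc j)" using j by simp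
          then have "(x, u, v) \<in> tail_event m N"
            using x(1) v m xj by (intro in_tail_eventI[of _ _ _ _ _ j] r_into_rtranclp) auto
          then show ?thesis by simp
        qed simp
      qed
      finally show ?case .
    qed
    finally show "ennreal (y / (1 + y)) \<le> \<dots>" .
  qed (use m in auto)
  moreover have "ennreal (y / (1 + y) * (l / (4 * (l + 1)))) =
      ennreal (y / (1 + y)) * ennreal (l / (4 * (l + 1)))"
    using y l by (intro ennreal_mult) auto
  ultimately show ?thesis
    using mult_left_mono[OF point_count_large[OF S eS l], of "ennreal (y / (1 + y))"] by (simp del: times_divide_eq_right times_divide_eq_left)
qed

text \<open>The condition \<open>us powr \<gamma> * r \<le> \<beta>\<close> makes the argument of
  the profile at most 1, so a vertex of mark at most us in the ball is joined to the origin with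
  certainty. Since \<open>r \<le> 2 * m\<close>, ball and annulus are disjoint and their counts
  independent. The ball supplies the hub, the annulus its distant neighbour.\<close>

lemma tail_event_ge_hub:
  fixes m us r p y z :: real
  assumes N: "unit_poisson_process N" and m: "0 < m"
    and us: "0 < us" "us < 1" and r: "0 < r" "r \<le> 2 * m" "us powr \<gamma> * r \<le> \<beta>"
    and p: "0 \<le> p" "p \<le> 1" "p \<le> (2 ^ DIM('a) * 3 * m * us powr \<gamma> / \<beta>) powr (- \<delta>)"
    and y: "0 \<le> y" "y \<le> measure lborel (ball (0::'a) 1) * m / 2 * p"
    and z: "0 \<le> z" "z \<le> measure lborel (ball (0::'a) 1) * r / 2 * us"
  defines "l \<equiv> measure lborel (ball (0::'a) 1) * m" and "k \<equiv> measure lborel (ball (0::'a) 1) * r"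
  shows "ennreal (y / (1 + y) * (z / (1 + z)) * (k / (4 * (k + 1)) * (l / (4 * (l + 1))))) \<le>
    emeasure (palm_law N) (tail_event m N)"
proof -
  interpret unit_poisson_process N by fact
  let ?U = "PiM UNIV (\<lambda>_ :: nat. uniform01)" and ?V = "PiM {e :: nat set. card e = 2} (\<lambda>_. uniform01)"
  let ?S = "{x::'a. 2 * m \<le> norm x ^ DIM('a) \<and> norm x ^ DIM('a) < 3 * m}"
  let ?R = "{x::'a. 0 \<le> norm x ^ DIM('a) \<and> norm x ^ DIM('a) < r}"
  have Us: "prob_space ?U" "prob_space ?V" by (intro prob_space_PiM; simp)+
  have "measure lborel (ball (0::'a) 1) > 0" by (simp add: content_ball)
  then have l: "0 < l" "0 < k" using m r by (simp_all add: l_def k_def)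
  have S[measurable]: "?S \<in> sets borel" "?R \<in> sets borel" by measurable
  have eS: "emeasure lborel ?S = ennreal l" "emeasure lborel ?R = ennreal k"
    using emeasure_annulus[of "2 * m" "3 * m", where 'a='a] emeasure_annulus[of 0 r, where 'a='a] m r
    by (simp_all add: l_def k_def algebra_simps)
  have disj: "?R \<inter> ?S = {}" using r by auto
  have "ennreal (y / (1 + y)) * ennreal (z / (1 + z)) *
      (\<integral>\<^sup>+x. of_bool (ennreal (k / 2) \<le> point_count ?R x \<and> ennreal (l / 2) \<le> point_count ?S x) \<partial>N) \<le> emeasure (palm_law N) (tail_event m N)"
  proof (rule emeasure_tail_event_ge[OF N])
    fix x assume x: "x \<in> space N" "ennreal (k / 2) \<le> point_count ?R x \<and> ennreal (l / 2) \<le> point_count ?S x"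
    obtain K where K: "finite K" "K \<subseteq> {i. x i \<in> ?S}" "l / 2 \<le> real (card K)"
      using finite_subset_of_points[OF conjunct2[OF x(2)]] .
    obtain I where I: "finite I" "I \<subseteq> {i. x i \<in> ?R}" "k / 2 \<le> real (card I)"
      using finite_subset_of_points[OF conjunct1[OF x(2)]] .
    have "card (Suc ` I) = card I" by (simp add: card_image)
    moreover have "k / 2 * us \<le> real (card I) * us" using I(3) us by (intro mult_right_mono) auto
    ultimately have cI: "z \<le> real (card (Suc ` I)) * us"
      unfolding k_def by (simp only:) (rule order.trans[OF z(2)])
    have mI: "(\<lambda>u. of_bool (\<exists>i\<in>Suc ` I. u i \<le> us) :: ennreal) \<in> borel_measurable ?U"
    proof -
      have "Measurable.pred ?U (\<lambda>u. u i \<le> us)" for i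
        by (rule measurable_compose[of "\<lambda>u. u i" _ uniform01]) (auto intro: measurable_component_singleton)
      then have "Measurable.pred ?U (\<lambda>u. \<exists>i\<in>Suc ` I. u i \<le> us)"
        using I(1) by (intro pred_intros_finite) auto
      then show ?thesis by measurable
    qed
    have "ennreal (y / (1 + y)) * ennreal (z / (1 + z)) \<le> ennreal (y / (1 + y)) * (\<integral>\<^sup>+u. of_bool (\<exists>i\<in>Suc ` I. u i \<le> us) \<partial>?U)"
      using I(1) us z(1) cI by (intro mult_left_mono exists_small_mark_ge) auto
    also have "\<dots> = (\<integral>\<^sup>+u. ennreal (y / (1 + y)) * of_bool (\<exists>i\<in>Suc ` I. u i \<le> us) \<partial>?U)"
      using mI by (rule nn_integral_cmult[symmetric])
    also have "\<dots> \<le> (\<integral>\<^sup>+u. \<integral>\<^sup>+v. indicator (tail_event m N) (x, u, v) \<partial>?V \<partial>?U)"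
    proof (rule nn_integral_mono_AE, use AE_vertex_marks in eventually_elim)
      case (elim u)
      show ?case
      proof (cases "\<exists>i\<in>Suc ` I. u i \<le> us")
        case True
        then obtain i where i: "i \<in> I" "u (Suc i) \<le> us" by auto
        then have xi: "norm (x i) ^ DIM('a) < r" using I(2) by auto
        let ?J = "(\<lambda>j. {Suc i, Suc j}) ` K"
        \<comment> \<open>The hub lies in the ball and not in the annulus, so the pairs in
          \<open>?J\<close> are genuine edges.\<close>
        have iK: "i \<notin> K" using xi K(2) r by auto
        have J: "finite ?J" "?J \<subseteq> {e. card e = 2}" using K(1) iK by (auto simp: card_insert_if)
        have "inj_on (\<lambda>j. {Suc i, Suc j}) K" by (auto simp: inj_on_def doubleton_eq_iff)
        then have "card ?J = card K" by (rule card_image)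
        then have cJ: "y \<le> real (card ?J) * p"
          using y(2) mult_right_mono[OF K(3) p(1)] by (simp add: l_def)
        have "ennreal (y / (1 + y)) \<le> (\<integral>\<^sup>+v. of_bool (\<exists>e\<in>?J. v e \<le> p) \<partial>?V)"
          by (rule exists_small_mark_ge[OF J(2,1) p(1,2) y(1) cJ])
        also have "\<dots> \<le> (\<integral>\<^sup>+v. indicator (tail_event m N) (x, u, v) \<partial>?V)"
        proof (rule nn_integral_mono_AE, use AE_edge_marks_le_1 AE_space in eventually_elim)
          case (elim v)
          show ?case
          proof (cases "\<exists>e\<in>?J. v e \<le> p")
            case True
            then obtain j where j: "j \<in> K" "v {Suc i, Suc j} \<le> p" by auto
            then have xj: "2 * m \<le> norm (x j) ^ DIM('a)" "norm (x j) ^ DIM('a) < 3 * m" using K(2) by auto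
            have u: "0 < u k" for k using \<open>\<forall>i. 0 < u i \<and> u i < 1\<close> by simp
            have mi: "min s (u (Suc i)) powr \<gamma> \<le> us powr \<gamma>" "min (u (Suc i)) s powr \<gamma> \<le> us powr \<gamma>" if "0 < s" for s
              using that u[of "Suc i"] i \<gamma> by (intro powr_mono2; auto simp: min_le_iff_disj)+
            have "min (u 0) (u (Suc i)) powr \<gamma> * norm (x i) ^ DIM('a) \<le> us powr \<gamma> * r"
              using xi mi(1)[OF u] by (intro mult_mono) auto
            then have "inverse \<beta> * min (u 0) (u (Suc i)) powr \<gamma> * norm (x i) ^ DIM('a) \<le> 1"
              using \<beta> r(3) by (simp add: field_simps)
            then have "rho \<delta> (inverse \<beta> * min (u 0) (u (Suc i)) powr \<gamma> * norm (x i) ^ DIM('a)) = 1"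
              using \<beta> \<delta> by (intro rho_eq_1) auto
            moreover have "v {0, Suc i} \<le> 1" using elim(1) by simp
            ultimately have 1: "adjacent \<beta> \<gamma> \<delta> (x, u, v) 0 (Suc i)" by simp
            \<comment> \<open>The hub is closer to the origin than the annulus, so its distance to a
              point there is at most twice that point's norm. This is the factor
              \<open>2 ^ DIM('a)\<close> in the bound on p.\<close>
            have "norm (x i - x j) ^ DIM('a) \<le> 2 ^ DIM('a) * norm (x j) ^ DIM('a)"
              using xi xj(1) r(2) by (intro two_power_le_norm_diff) linarith
            also have "\<dots> \<le> 2 ^ DIM('a) * (3 * m)" using xj by simp
            finally have "min (u (Suc i)) (u (Suc j)) powr \<gamma> * norm (x i - x j) ^ DIM('a) \<le> us powr \<gamma> * (2 ^ DIM('a) * (3 * m))"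
              using mi(2)[OF u] m by (intro mult_mono) auto
            then have "inverse \<beta> * min (u (Suc i)) (u (Suc j)) powr \<gamma> * norm (x i - x j) ^ DIM('a) \<le> 2 ^ DIM('a) * 3 * m * us powr \<gamma> / \<beta>"
              using \<beta> by (simp add: field_simps)
            then have "p \<le> rho \<delta> (inverse \<beta> * min (u (Suc i)) (u (Suc j)) powr \<gamma> * norm (x i - x j) ^ DIM('a))"
              using p m \<beta> \<delta> us by (intro le_rhoI[of _ "2 ^ DIM('a) * 3 * m * us powr \<gamma> / \<beta>"]) auto
            then have "adjacent \<beta> \<gamma> \<delta> (x, u, v) (Suc i) (Suc j)" using j iK by auto
            with 1 have "(adjacent \<beta> \<gamma> \<delta> (x, u, v))\<^sup>*\<^sup>* 0 (Suc j)" by (meson converse_rtranclp_into_rtranclp rtranclp.rtrancl_refl)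
            then have "(x, u, v) \<in> tail_event m N"
              using x(1) elim(2) m xj by (intro in_tail_eventI[of _ _ _ _ _ j]) auto
            then show ?thesis by simp
          qed simp
        qed
        finally show ?thesis using True by simp
      qed simp
    qed
    finally show "ennreal (y / (1 + y)) * ennreal (z / (1 + z)) \<le> \<dots>" .
  qed (use m in auto)
  then have main: "ennreal (y / (1 + y)) * ennreal (z / (1 + z)) *
      (\<integral>\<^sup>+x. of_bool (ennreal (k / 2) \<le> point_count ?R x) * of_bool (ennreal (l / 2) \<le> point_count ?S x) \<partial>N) \<le>
      emeasure (palm_law N) (tail_event m N)" by (simp only: of_bool_conj)
  define A where "A = y / (1 + y)"
  define B where "B = z / (1 + z)"
  define C where "C = k / (4 * (k + 1)) * (l / (4 * (l + 1)))"
  have "0 \<le> A" "0 \<le> B" "0 \<le> C" using y z l by (simp_all add: A_def B_def C_def)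
  then have "ennreal (A * B * C) = ennreal A * ennreal B * ennreal C" by (simp add: ennreal_mult)
  also have "\<dots> \<le> ennreal A * ennreal B *
      (\<integral>\<^sup>+x. of_bool (ennreal (k / 2) \<le> point_count ?R x) * of_bool (ennreal (l / 2) \<le> point_count ?S x) \<partial>N)"
    unfolding C_def by (intro mult_left_mono point_counts_large S disj eS l zero_le)
  also note main[folded A_def B_def]
  finally show ?thesis unfolding A_def B_def C_def .
qed

end

lemma quotient_four_plus_mono:
  fixes x y :: real
  assumes "0 \<le> x" "x \<le> y" shows "x / (4 * (x + 1)) \<le> y / (4 * (y + 1))"
  using assms by (simp add: field_simps)

section \<open>Lower tails at the chosen scales\<close>

context soft_boolean_parameters
begin

lemma lower_tail_direct:
  obtains c where "0 < c"
    "\<And>N m. unit_poisson_process N \<Longrightarrow> 1 < m \<Longrightarrow> ennreal (c * m powr (1 - \<delta>)) \<le> emeasure (palm_law N) (tail_event m N)"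
proof -
  define w where "w = measure lborel (ball (0::'a) 1)"
  have w: "0 < w" by (simp add: w_def content_ball)
  define c' where "c' = min 1 ((3 / \<beta>) powr (- \<delta>))"
  have c': "0 < c'" "c' \<le> 1" "c' \<le> (3 / \<beta>) powr (- \<delta>)" using \<beta> by (auto simp: c'_def)
  define a where "a = w / 2 * c'"
  have a: "0 < a" using w c' by (simp add: a_def)
  show ?thesis
  proof (rule that[of "a / (1 + a) * (w / (4 * (w + 1)))"])
    show "0 < a / (1 + a) * (w / (4 * (w + 1)))" using a w by simp
    fix N :: "(nat \<Rightarrow> 'a) measure" and m :: real
    assume N: "unit_poisson_process N" and m: "1 < m"
    \<comment> \<open>A connection probability of order \<open>m powr - \<delta>\<close>; the cap of
      c' at 1 keeps p a probability. About m points then give a mean y of order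
      \<open>m powr (1 - \<delta>)\<close>.\<close>
    define p where "p = c' * m powr (- \<delta>)"
    define y where "y = a * m powr (1 - \<delta>)"
    have m1: "m powr (- \<delta>) \<le> 1" "m powr (1 - \<delta>) \<le> 1" using m \<delta> powr_mono[of "- \<delta>" 0 m] powr_mono[of "1 - \<delta>" 0 m] by auto
    have "c' * m powr (- \<delta>) \<le> 1 * 1" using c' m1 by (intro mult_mono) auto
    moreover have "p \<le> (3 / \<beta>) powr (- \<delta>) * m powr (- \<delta>)" unfolding p_def using c' by (intro mult_right_mono) auto
    moreover have "(3 / \<beta>) powr (- \<delta>) * m powr (- \<delta>) = (3 * m / \<beta>) powr (- \<delta>)"
      using m \<beta> by (simp add: powr_mult[symmetric])
    ultimately have p: "0 \<le> p" "p \<le> 1" "p \<le> (3 * m / \<beta>) powr (- \<delta>)" using c' by (auto simp: p_def)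
    have mm: "m * m powr (- \<delta>) = m powr (1 - \<delta>)" using m powr_add[of m 1 "-\<delta>"] by simp
    have y: "0 \<le> y" "y \<le> a" using a mult_left_mono[OF m1(2), of a] by (simp_all add: y_def)
    have yp: "y = w * m / 2 * p" by (simp add: y_def a_def p_def mm[symmetric] mult_ac)
    have "a / (1 + a) * m powr (1 - \<delta>) \<le> y / (1 + y)"
    proof -
      have "a / (1 + a) * m powr (1 - \<delta>) = y / (1 + a)" by (simp add: y_def)
      also have "\<dots> \<le> y / (1 + y)" using y by (intro divide_left_mono) auto
      finally show ?thesis .
    qed
    moreover have "w / (4 * (w + 1)) \<le> w * m / (4 * (w * m + 1))"
      using w m by (intro quotient_four_plus_mono) auto
    ultimately have "a / (1 + a) * m powr (1 - \<delta>) * (w / (4 * (w + 1))) \<le> y / (1 + y) * (w * m / (4 * (w * m + 1)))"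
      using w m y by (intro mult_mono) auto
    then have "ennreal (a / (1 + a) * (w / (4 * (w + 1))) * m powr (1 - \<delta>)) \<le> ennreal (y / (1 + y) * (w * m / (4 * (w * m + 1))))"
      by (intro ennreal_leI) (simp only: mult_ac)
    also have "\<dots> \<le> emeasure (palm_law N) (tail_event m N)"
      unfolding w_def by (rule tail_event_ge_direct[OF N _ p y(1) eq_refl[OF yp[unfolded w_def]]]) (use m in simp)
    finally show "ennreal (a / (1 + a) * (w / (4 * (w + 1))) * m powr (1 - \<delta>)) \<le> emeasure (palm_law N) (tail_event m N)" .
  qed
qed

text \<open>A hub of mark at most us reaches a given point of the annulus with probability of order
  1/m, so one of the roughly m points is reached with probability of order one. The price is the
  existence of the hub, of order r times us, hence of order
  \<open>us powr (1 - \<gamma>)\<close>.\<close>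

lemma lower_tail_hub:
  obtains c where "0 < c"
    "\<And>N m. unit_poisson_process N \<Longrightarrow> 1 < m \<Longrightarrow>
      ennreal (c * m powr (- ((\<delta> - 1) / \<delta> * (1 / \<gamma> - 1)))) \<le> emeasure (palm_law N) (tail_event m N)"
proof -
  define w where "w = measure lborel (ball (0::'a) 1)"
  have w: "0 < w" by (simp add: w_def content_ball)
  define T where "T = 2 ^ DIM('a) * 3 / \<beta>"
  have T: "0 < T" using \<beta> by (simp add: T_def)
  define c' where "c' = min 1 (T powr (- \<delta>))"
  have c': "0 < c'" "c' \<le> 1" "c' \<le> T powr (- \<delta>)" using T by (auto simp: c'_def)
  define b where "b = min 1 \<beta>"
  have b: "0 < b" "b \<le> 1" "b \<le> \<beta>" using \<beta> by (auto simp: b_def)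
  define a where "a = w / 2 * c'"
  define a' where "a' = w * b / 2"
  have a: "0 < a" "0 < a'" using w c' b by (simp_all add: a_def a'_def)
  let ?c = "a / (1 + a) * (1 / (1 + a') * a') * ((w * b) / (4 * (w * b + 1)) * (w / (4 * (w + 1))))"
  show ?thesis
  proof (rule that[of ?c])
    show "0 < ?c" using a w b by (intro mult_pos_pos divide_pos_pos add_pos_pos) auto
    fix N :: "(nat \<Rightarrow> 'a) measure" and m :: real
    assume N: "unit_poisson_process N" and m: "1 < m"
    define us where "us = m powr (- ((\<delta> - 1) / (\<gamma> * \<delta>)))"
    have us: "0 < us" "us < 1" unfolding us_def using m \<gamma> \<delta> by (auto intro!: powr_less_one)
    have usg: "us powr \<gamma> = m powr (- ((\<delta> - 1) / \<delta>))" using \<gamma> by (simp add: us_def powr_powr)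
    have usg1: "us powr (1 - \<gamma>) = m powr (- ((\<delta> - 1) / \<delta> * (1 / \<gamma> - 1)))"
      using \<gamma> \<delta> by (simp add: us_def powr_powr field_simps)
    \<comment> \<open>Up to a constant the largest volume in which a mark us is joined to the origin
      for sure, as \<open>us powr \<gamma> * r = b\<close>. Here b \<le> \<beta> gives the
      connection, b \<le> 1 keeps the ball inside the annulus, and b \<le> r bounds its count from
      below.\<close>
    define r where "r = b * m powr ((\<delta> - 1) / \<delta>)"
    have m1: "1 \<le> m powr ((\<delta> - 1) / \<delta>)" "m powr ((\<delta> - 1) / \<delta>) \<le> m powr 1"
      using m \<delta> powr_mono[of "(\<delta> - 1) / \<delta>" 1 m] by (auto intro!: ge_one_powr_ge_zero)
    have gr: "us powr \<gamma> * r = b" using m by (simp add: usg r_def powr_minus)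
    have r: "0 < r" "r \<le> 2 * m" "us powr \<gamma> * r \<le> \<beta>" "b \<le> r"
    proof -
      show "0 < r" using b m by (simp add: r_def)
      show "us powr \<gamma> * r \<le> \<beta>" using b gr by simp
      have "r \<le> 1 * m" unfolding r_def using b m m1 by (intro mult_mono) auto
      then show "r \<le> 2 * m" using m by simp
      show "b \<le> r" using b m1 mult_left_mono[of 1 "m powr ((\<delta> - 1) / \<delta>)" b] by (simp add: r_def)
    qed
    have rus: "r * us = b * us powr (1 - \<gamma>)"
    proof -
      have e: "us powr \<gamma> * us powr (1 - \<gamma>) = us" using us by (simp add: powr_add[symmetric])
      have "us powr \<gamma> * r * us powr (1 - \<gamma>) = r * (us powr \<gamma> * us powr (1 - \<gamma>))" by (simp only: mult_ac)
      then show ?thesis by (simp only: e gr)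
    qed
    \<comment> \<open>For this us the product \<open>us powr \<gamma> * m\<close> equals
      \<open>m powr (1/\<delta>)\<close>, so the profile is of order 1/m there.\<close>
    define p where "p = c' / m"
    have "m * m powr (- ((\<delta> - 1) / \<delta>)) = m powr (1 / \<delta>)"
      using m \<delta> powr_add[of m 1 "- ((\<delta> - 1) / \<delta>)"] by (simp add: field_simps)
    then have "2 ^ DIM('a) * 3 * m * us powr \<gamma> / \<beta> = T * m powr (1 / \<delta>)"
      unfolding usg T_def by (simp add: mult.assoc)
    then have "(2 ^ DIM('a) * 3 * m * us powr \<gamma> / \<beta>) powr (- \<delta>) = (T * m powr (1 / \<delta>)) powr (- \<delta>)"
      by simp
    also have "\<dots> = T powr (- \<delta>) / m" using T m \<delta> by (simp add: powr_mult powr_powr powr_minus field_simps)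
    finally have "(2 ^ DIM('a) * 3 * m * us powr \<gamma> / \<beta>) powr (- \<delta>) = T powr (- \<delta>) / m" .
    then have p: "0 \<le> p" "p \<le> 1" "p \<le> (2 ^ DIM('a) * 3 * m * us powr \<gamma> / \<beta>) powr (- \<delta>)"
      using c' m by (auto simp: p_def field_simps)
    have y: "0 \<le> a" "a \<le> w * m / 2 * p" using a m by (auto simp: a_def p_def)
    define z where "z = a' * us powr (1 - \<gamma>)"
    have "us powr (1 - \<gamma>) \<le> 1" using us \<gamma> by (intro powr_le1) auto
    then have "0 \<le> z" "z \<le> a'" using a mult_left_mono[of "us powr (1 - \<gamma>)" 1 a'] by (simp_all add: z_def)
    moreover have "z = w * r / 2 * us" using rus by (simp add: z_def a'_def mult_ac)
    ultimately have z: "0 \<le> z" "z \<le> a'" "z = w * r / 2 * us" .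
    have "1 / (1 + a') * a' * us powr (1 - \<gamma>) \<le> z / (1 + z)"
    proof -
      have "1 / (1 + a') * a' * us powr (1 - \<gamma>) = z / (1 + a')" by (simp add: z_def)
      also have "\<dots> \<le> z / (1 + z)" using z by (intro divide_left_mono) auto
      finally show ?thesis .
    qed
    moreover have "w / (4 * (w + 1)) \<le> w * m / (4 * (w * m + 1))"
      using w m by (intro quotient_four_plus_mono) auto
    moreover have "w * b / (4 * (w * b + 1)) \<le> w * r / (4 * (w * r + 1))"
      using w b r by (intro quotient_four_plus_mono) auto
    ultimately have "a / (1 + a) * (1 / (1 + a') * a' * us powr (1 - \<gamma>)) * ((w * b) / (4 * (w * b + 1)) * (w / (4 * (w + 1)))) \<le>
        a / (1 + a) * (z / (1 + z)) * (w * r / (4 * (w * r + 1)) * (w * m / (4 * (w * m + 1))))"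
      using w m a z(1,2) b r by (intro mult_mono) auto
    then have "ennreal (?c * us powr (1 - \<gamma>)) \<le> ennreal (a / (1 + a) * (z / (1 + z)) * (w * r / (4 * (w * r + 1)) * (w * m / (4 * (w * m + 1)))))"
      by (intro ennreal_leI) (simp only: mult_ac)
    also have "\<dots> \<le> emeasure (palm_law N) (tail_event m N)"
      unfolding w_def by (rule tail_event_ge_hub[OF N _ us r(1-3) p y[unfolded w_def] z(1) eq_refl[OF z(3)[unfolded w_def]]]) (use m in simp)
    finally show "ennreal (?c * m powr (- ((\<delta> - 1) / \<delta> * (1 / \<gamma> - 1)))) \<le> emeasure (palm_law N) (tail_event m N)"
      by (simp only: usg1)
  qed
qed

end

section \<open>The tail of the diameter\<close>

context soft_boolean_parameters
begin

lemma emeasure_tail_event: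
  assumes "unit_poisson_process N"
  shows "emeasure (palm_law N) (tail_event m N) = ennreal (diameter_tail N \<beta> \<gamma> \<delta> m)"
proof -
  interpret unit_poisson_process N by fact
  have "prob_space (palm_law N)"
    unfolding palm_law_def by (intro prob_space_pair prob_space_PiM prob_space_axioms) simp_all
  then show ?thesis
    unfolding diameter_tail_def tail_event_def by (simp add: prob_space_def finite_measure.emeasure_eq_measure)
qed

lemma diameter_tail_leI:
  assumes "unit_poisson_process N" "0 \<le> c" "emeasure (palm_law N) (tail_event m N) \<le> ennreal c"
  shows "diameter_tail N \<beta> \<gamma> \<delta> m \<le> c"
  using assms by (simp add: emeasure_tail_event)

lemma diameter_tail_geI:
  assumes "unit_poisson_process N" "ennreal c \<le> emeasure (palm_law N) (tail_event m N)"
  shows "c \<le> diameter_tail N \<beta> \<gamma> \<delta> m"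
proof -
  have "0 \<le> diameter_tail N \<beta> \<gamma> \<delta> m" by (simp add: diameter_tail_def)
  then show ?thesis using assms by (simp add: emeasure_tail_event)
qed

text \<open>At this mark \<open>us powr (1 - \<gamma>)\<close> is the rate of case (iii).\<close>

definition us_at :: "real \<Rightarrow> real" where "us_at m = m powr (- ((\<delta> - 1) / (\<gamma> * \<delta>)))"

lemma us_at: "1 < m \<Longrightarrow> 0 < us_at m" "1 < m \<Longrightarrow> us_at m < 1"
  unfolding us_at_def using \<gamma> \<delta> by (auto intro!: powr_less_one)

lemma us_at_powr: "us_at m powr p = m powr (- ((\<delta> - 1) / (\<gamma> * \<delta>)) * p)"
  by (simp add: us_at_def powr_powr)

lemma us_at_hub: "us_at m powr (1 - \<gamma>) = m powr (- ((\<delta> - 1) / \<delta> * (1 / \<gamma> - 1)))"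
  unfolding us_at_powr using \<gamma> \<delta> by (simp add: field_simps)

text \<open>The exponent of the integrand of \<open>J\<close> is compared with 1; this is where the
  three regimes of the tail come from.\<close>

lemma strong_threshold:
  "\<gamma> + \<gamma> * \<delta> < 1 \<longleftrightarrow> \<delta> < 1 / \<gamma> - 1" "\<gamma> + \<gamma> * \<delta> = 1 \<longleftrightarrow> \<delta> = 1 / \<gamma> - 1"
  using \<gamma> by (auto simp: field_simps)

section \<open>Upper tails in the three regimes\<close>

context
  assumes y_small: "4 * y < 1"
begin

text \<open>As us is below 1, the probability us of a weak origin is absorbed by
  \<open>us powr (1 - \<gamma>)\<close>. Adding 1 to both constants makes them positive.\<close>

lemma upper_tail_at:
  obtains C1 C2 where "0 < C1" "0 < C2"
    "\<And>(N :: (nat \<Rightarrow> 'a) measure) m j. unit_poisson_process N \<Longrightarrow> 1 < m \<Longrightarrow> 0 \<le> j \<Longrightarrow> J (us_at m) \<le> ennreal j \<Longrightarrow>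
      diameter_tail N \<beta> \<gamma> \<delta> m \<le> C1 * m powr (- ((\<delta> - 1) / \<delta> * (1 / \<gamma> - 1))) + C2 * m powr (1 - \<delta>) * j"
proof -
  obtain C1 C2 where C: "0 \<le> C1" "0 \<le> C2" and le:
    "\<And>N m us. unit_poisson_process N \<Longrightarrow> 0 < m \<Longrightarrow> 0 < us \<Longrightarrow> us < 1 \<Longrightarrow>
      emeasure (palm_law N) (tail_event m N) \<le> ennreal us + ennreal (C1 * us powr (1 - \<gamma>)) + ennreal (C2 * m powr (1 - \<delta>)) * J us"
    using upper_tail[OF y_small] by blast
  show ?thesis
  proof (rule that[of "1 + C1" "1 + C2"])
    fix N :: "(nat \<Rightarrow> 'a) measure" and m j :: real
    assume N: "unit_poisson_process N" and m: "1 < m" and j: "0 \<le> j" "J (us_at m) \<le> ennreal j"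
    note us = us_at[OF m]
    define h where "h = us_at m powr (1 - \<gamma>)"
    have "us_at m powr 1 \<le> h" unfolding h_def using us \<gamma> by (intro powr_mono') auto
    then have uh: "us_at m \<le> h" using us by simp
    have "emeasure (palm_law N) (tail_event m N) \<le> ennreal (us_at m) + ennreal (C1 * h) + ennreal (C2 * m powr (1 - \<delta>)) * J (us_at m)"
      unfolding h_def using m us by (intro le[OF N]) auto
    also have "\<dots> \<le> ennreal h + ennreal (C1 * h) + ennreal (C2 * m powr (1 - \<delta>)) * ennreal j"
      using C uh j by (intro add_mono mult_left_mono ennreal_leI) auto
    also have "\<dots> = ennreal (h + C1 * h + C2 * m powr (1 - \<delta>) * j)"
    proof -
      have n: "0 \<le> h" "0 \<le> C1 * h" "0 \<le> C2 * m powr (1 - \<delta>)" "0 \<le> C2 * m powr (1 - \<delta>) * j"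
        using C j by (simp_all add: h_def)
      then show ?thesis unfolding ennreal_mult[OF n(3) j(1), symmetric] by simp
    qed
    also have "\<dots> \<le> ennreal ((1 + C1) * h + (1 + C2) * m powr (1 - \<delta>) * j)"
      using C j by (intro ennreal_leI) (simp add: algebra_simps)
    finally show "diameter_tail N \<beta> \<gamma> \<delta> m \<le> (1 + C1) * m powr (- ((\<delta> - 1) / \<delta> * (1 / \<gamma> - 1))) + (1 + C2) * m powr (1 - \<delta>) * j"
      unfolding us_at_hub[symmetric] h_def using C j by (intro diameter_tail_leI[OF N]) auto
  qed (use C in auto)
qed

text \<open>\<open>J\<close> is bounded, so the long jumps have order
  \<open>m powr (1 - \<delta>)\<close>; the term of weak vertices decays at least as fast because
  1/\<gamma> - 1 > \<delta>.\<close>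

lemma upper_tail_light:
  assumes "\<delta> < 1 / \<gamma> - 1"
  shows "\<exists>C>0. \<forall>N :: (nat \<Rightarrow> 'a) measure. unit_poisson_process N \<longrightarrow> (\<forall>m>1. diameter_tail N \<beta> \<gamma> \<delta> m \<le> C * m powr (1 - \<delta>))"
proof -
  let ?s = "\<gamma> + \<gamma> * \<delta>"
  have s: "?s < 1" using assms strong_threshold by simp
  obtain C1 C2 where C: "0 < C1" "0 < C2" and le:
    "\<And>(N :: (nat \<Rightarrow> 'a) measure) m j. unit_poisson_process N \<Longrightarrow> 1 < m \<Longrightarrow> 0 \<le> j \<Longrightarrow> J (us_at m) \<le> ennreal j \<Longrightarrow>
      diameter_tail N \<beta> \<gamma> \<delta> m \<le> C1 * m powr (- ((\<delta> - 1) / \<delta> * (1 / \<gamma> - 1))) + C2 * m powr (1 - \<delta>) * j"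
    using upper_tail_at by blast
  show ?thesis
  proof (intro exI[of _ "C1 + C2 * (1 / (1 - ?s))"] conjI allI impI)
    show "0 < C1 + C2 * (1 / (1 - ?s))" using C s by (simp add: add_pos_pos)
    fix N :: "(nat \<Rightarrow> 'a) measure" and m :: real
    assume N: "unit_poisson_process N" and m: "1 < m"
    have "J (us_at m) \<le> ennreal ((1 - us_at m powr (1 - ?s)) / (1 - ?s))"
      using s us_at[OF m] by (intro J_le) auto
    also have "\<dots> \<le> ennreal (1 / (1 - ?s))" using s by (intro ennreal_leI divide_right_mono) auto
    finally have "diameter_tail N \<beta> \<gamma> \<delta> m \<le> C1 * m powr (- ((\<delta> - 1) / \<delta> * (1 / \<gamma> - 1))) + C2 * m powr (1 - \<delta>) * (1 / (1 - ?s))"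
      using s by (intro le[OF N m]) auto
    also have "m powr (- ((\<delta> - 1) / \<delta> * (1 / \<gamma> - 1))) \<le> m powr (1 - \<delta>)"
    proof -
      have "(\<delta> - 1) / \<delta> * \<delta> \<le> (\<delta> - 1) / \<delta> * (1 / \<gamma> - 1)" using assms \<delta> by (intro mult_left_mono) auto
      then show ?thesis using m \<delta> by (intro powr_mono) auto
    qed
    finally show "diameter_tail N \<beta> \<gamma> \<delta> m \<le> (C1 + C2 * (1 / (1 - ?s))) * m powr (1 - \<delta>)"
      using C by (simp add: algebra_simps)
  qed
qed

text \<open>Both exponents are 1 - \<delta>, and \<open>J\<close> is of order ln m at the chosen
  mark. The term without a logarithm is absorbed using ln m \<ge> ln m0 > 0, which is the purpose of
  m0.\<close>

lemma upper_tail_critical: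
  assumes "\<delta> = 1 / \<gamma> - 1" "1 < m0"
  shows "\<exists>C>0. \<forall>N :: (nat \<Rightarrow> 'a) measure. unit_poisson_process N \<longrightarrow> (\<forall>m\<ge>m0. diameter_tail N \<beta> \<gamma> \<delta> m \<le> C * ln m * m powr (1 - \<delta>))"
proof -
  let ?r = "(\<delta> - 1) / (\<gamma> * \<delta>)"
  have r: "0 < ?r" using \<gamma> \<delta> by simp
  obtain C1 C2 where C: "0 < C1" "0 < C2" and le:
    "\<And>(N :: (nat \<Rightarrow> 'a) measure) m j. unit_poisson_process N \<Longrightarrow> 1 < m \<Longrightarrow> 0 \<le> j \<Longrightarrow> J (us_at m) \<le> ennreal j \<Longrightarrow>
      diameter_tail N \<beta> \<gamma> \<delta> m \<le> C1 * m powr (- ((\<delta> - 1) / \<delta> * (1 / \<gamma> - 1))) + C2 * m powr (1 - \<delta>) * j"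
    using upper_tail_at by blast
  show ?thesis
  proof (intro exI[of _ "C1 / ln m0 + C2 * ?r"] conjI allI impI)
    show "0 < C1 / ln m0 + C2 * ?r" using C r assms(2) by (intro add_pos_pos[OF divide_pos_pos mult_pos_pos]) auto
    fix N :: "(nat \<Rightarrow> 'a) measure" and m :: real
    assume N: "unit_poisson_process N" and mm: "m0 \<le> m"
    then have m: "1 < m" using assms by simp
    have "J (us_at m) \<le> ennreal (- ln (us_at m))"
      using assms strong_threshold us_at[OF m] by (intro J_le_critical) auto
    also have "- ln (us_at m) = ?r * ln m" using m by (simp add: us_at_def ln_powr)
    finally have "diameter_tail N \<beta> \<gamma> \<delta> m \<le> C1 * m powr (- ((\<delta> - 1) / \<delta> * (1 / \<gamma> - 1))) + C2 * m powr (1 - \<delta>) * (?r * ln m)"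
      using m r by (intro le[OF N m]) (rule mult_nonneg_nonneg, auto)
    also have "- ((\<delta> - 1) / \<delta> * (1 / \<gamma> - 1)) = 1 - \<delta>" using assms(1)[symmetric] \<delta> by simp
    also have "C1 * m powr (1 - \<delta>) \<le> C1 / ln m0 * ln m * m powr (1 - \<delta>)"
    proof -
      have "C1 * ln m0 \<le> C1 * ln m" using mm assms C by simp
      then have "C1 \<le> C1 / ln m0 * ln m" using assms by (simp add: field_simps)
      then show ?thesis by (rule mult_right_mono) simp
    qed
    finally show "diameter_tail N \<beta> \<gamma> \<delta> m \<le> (C1 / ln m0 + C2 * ?r) * ln m * m powr (1 - \<delta>)"
      by (simp only: distrib_left distrib_right mult_ac)
  qed
qed

text \<open>\<open>J\<close> grows like
  \<open>us powr (1 - (\<gamma> + \<gamma> * \<delta>))\<close>, and at the chosen mark its product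
  with \<open>m powr (1 - \<delta>)\<close> has exactly the order of the term of weak
  vertices.\<close>

lemma upper_tail_heavy:
  assumes "1 / \<gamma> - 1 < \<delta>"
  shows "\<exists>C>0. \<forall>N :: (nat \<Rightarrow> 'a) measure. unit_poisson_process N \<longrightarrow> (\<forall>m>1. diameter_tail N \<beta> \<gamma> \<delta> m \<le> C * m powr (- ((\<delta> - 1) / \<delta> * (1 / \<gamma> - 1))))"
proof -
  let ?s = "\<gamma> + \<gamma> * \<delta>" and ?h = "- ((\<delta> - 1) / \<delta> * (1 / \<gamma> - 1))"
  have s: "1 < ?s" using assms strong_threshold by linarith
  obtain C1 C2 where C: "0 < C1" "0 < C2" and le:
    "\<And>(N :: (nat \<Rightarrow> 'a) measure) m j. unit_poisson_process N \<Longrightarrow> 1 < m \<Longrightarrow> 0 \<le> j \<Longrightarrow> J (us_at m) \<le> ennreal j \<Longrightarrow>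
      diameter_tail N \<beta> \<gamma> \<delta> m \<le> C1 * m powr ?h + C2 * m powr (1 - \<delta>) * j"
    using upper_tail_at by blast
  show ?thesis
  proof (intro exI[of _ "C1 + C2 / (?s - 1)"] conjI allI impI)
    show "0 < C1 + C2 / (?s - 1)" using C s by (intro add_pos_pos divide_pos_pos) auto
    fix N :: "(nat \<Rightarrow> 'a) measure" and m :: real
    assume N: "unit_poisson_process N" and m: "1 < m"
    define j where "j = us_at m powr (1 - ?s) / (?s - 1)"
    have "J (us_at m) \<le> ennreal ((1 - us_at m powr (1 - ?s)) / (1 - ?s))"
      using s us_at[OF m] by (intro J_le) auto
    also have "(1 - us_at m powr (1 - ?s)) / (1 - ?s) = (us_at m powr (1 - ?s) - 1) / (?s - 1)"
      using s by (simp add: field_simps)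
    also have "ennreal \<dots> \<le> ennreal j" unfolding j_def using s by (intro ennreal_leI divide_right_mono) auto
    finally have "diameter_tail N \<beta> \<gamma> \<delta> m \<le> C1 * m powr ?h + C2 * m powr (1 - \<delta>) * j"
      using s by (intro le[OF N m]) (auto simp: j_def)
    also have "C2 * m powr (1 - \<delta>) * j = C2 / (?s - 1) * (m powr (1 - \<delta>) * us_at m powr (1 - ?s))"
      by (simp add: j_def)
    also have "m powr (1 - \<delta>) * us_at m powr (1 - ?s) = m powr ?h"
    proof -
      have "1 - \<delta> + - ((\<delta> - 1) / (\<gamma> * \<delta>)) * (1 - ?s) = ?h" using \<gamma> \<delta> by (simp add: field_simps)
      then show ?thesis by (simp only: us_at_powr powr_add[symmetric])
    qed
    finally show "diameter_tail N \<beta> \<gamma> \<delta> m \<le> (C1 + C2 / (?s - 1)) * m powr ?h"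
      by (simp only: distrib_right)
  qed
qed

end
end

text \<open>As m decreases to 1 the tail stays above a positive constant while ln m tends to 0;
  hence the bounds containing a logarithm start at an arbitrary m0 > 1, on which their constants may
  depend. All constants are chosen before N, so they hold for every enumeration of the
  process.\<close>

theorem theorem2p6:
  fixes \<gamma> \<delta> :: real
  assumes "0 < \<gamma>" and "\<gamma> < 1" and "\<delta> > 1" and "1 / \<delta> < 1 / \<gamma> - 1"
  shows "beta0 TYPE('a::euclidean_space) \<gamma> \<delta> > 0 \<and>
    (\<forall>\<beta>. 0 < \<beta> \<and> \<beta> < beta0 TYPE('a) \<gamma> \<delta> \<longrightarrow>
    (\<forall>m0>1. \<exists>c1>0. \<exists>C2>0. \<exists>c3>0. \<exists>C4>0. \<exists>c5>0. \<exists>C6>0.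
      \<forall>N :: (nat \<Rightarrow> 'a) measure. unit_poisson_process N \<longrightarrow> (\<forall>m>1.
        (\<delta> < 1 / \<gamma> - 1 \<longrightarrow>
           c1 * m powr (1 - \<delta>) \<le> diameter_tail N \<beta> \<gamma> \<delta> m \<and>
           diameter_tail N \<beta> \<gamma> \<delta> m \<le> C2 * m powr (1 - \<delta>)) \<and>
        (\<delta> = 1 / \<gamma> - 1 \<longrightarrow>
           c3 * m powr (1 - \<delta>) \<le> diameter_tail N \<beta> \<gamma> \<delta> m \<and>
           (m \<ge> m0 \<longrightarrow> diameter_tail N \<beta> \<gamma> \<delta> m \<le> C4 * ln m * m powr (1 - \<delta>))) \<and>
        (1 / \<gamma> - 1 < \<delta> \<longrightarrow>
           c5 * m powr (- ((\<delta> - 1) / \<delta> * (1 / \<gamma> - 1))) \<le> diameter_tail N \<beta> \<gamma> \<delta> m \<and>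
           (m \<ge> m0 \<longrightarrow> diameter_tail N \<beta> \<gamma> \<delta> m
              \<le> C6 * ln m powr (max 1 (real DIM('a) * (\<delta> - 1)))
                   * m powr (- ((\<delta> - 1) / \<delta> * (1 / \<gamma> - 1))))))))"
proof (intro conjI allI impI)
  define w where "w = measure lborel (ball (0::'a) 1)"
  have w: "0 < w" by (simp add: w_def content_ball)
  have sub: "\<gamma> + \<gamma> / \<delta> < 1" using assms by (simp add: field_simps)
  have eq: "beta0 TYPE('a) \<gamma> \<delta> = (1 - (\<gamma> + \<gamma> / \<delta>)) * (\<delta> - 1) / ((2 powr (real DIM('a) * \<delta> + 3) + 1) * w * \<delta>)"
    using assms by (simp add: beta0_def w_def field_simps)
  have pos: "0 < (2 powr (real DIM('a) * \<delta> + 3) + 1) * w * \<delta>" using w assms by (simp add: add_pos_pos)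
  show "0 < beta0 TYPE('a) \<gamma> \<delta>"
    unfolding eq using sub assms by (intro divide_pos_pos[OF mult_pos_pos pos]) auto
  fix \<beta> m0 :: real
  assume beta: "0 < \<beta> \<and> \<beta> < beta0 TYPE('a) \<gamma> \<delta>" and m0: "1 < m0"
  interpret soft_boolean_parameters "TYPE('a)" \<beta> \<gamma> \<delta>
    using assms beta sub by unfold_locales auto
  have small: "4 * y < 1"
  proof -
    define Z where "Z = 2 powr (real DIM('a) * \<delta> + 3)"
    define D where "D = 1 - (\<gamma> + \<gamma> / \<delta>)"
    have Z: "0 < Z" "0 < D" using sub by (simp_all add: Z_def D_def)
    \<comment> \<open>In terms of the threshold, 4y is \<beta> divided by \<open>beta0\<close>,
      times Z / (Z + 1).\<close>
    have y: "4 * y = \<beta> * (Z * w * \<delta>) / (D * (\<delta> - 1))"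
      by (simp add: y_def kap_def M_def th_def Z_def D_def w_def powr_add mult_ac)
    have "\<beta> * (Z * w * \<delta>) \<le> \<beta> * ((Z + 1) * w * \<delta>)"
      using beta w assms by (intro mult_left_mono mult_right_mono) auto
    also have "\<dots> < D * (\<delta> - 1)"
      using beta pos unfolding eq Z_def D_def by (simp add: pos_less_divide_eq)
    finally show ?thesis unfolding y using Z assms by (simp add: pos_divide_less_eq)
  qed
  let ?h = "- ((\<delta> - 1) / \<delta> * (1 / \<gamma> - 1))" and ?T = "\<lambda>N. diameter_tail N \<beta> \<gamma> \<delta>"
  obtain c where c: "0 < c" "\<And>(N :: (nat \<Rightarrow> 'a) measure) m. unit_poisson_process N \<Longrightarrow> 1 < m \<Longrightarrow>
      ennreal (c * m powr (1 - \<delta>)) \<le> emeasure (palm_law N) (tail_event m N)"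
    using lower_tail_direct by blast
  note c_le = diameter_tail_geI[OF _ c(2)]
  obtain c' where c': "0 < c'" "\<And>(N :: (nat \<Rightarrow> 'a) measure) m. unit_poisson_process N \<Longrightarrow> 1 < m \<Longrightarrow>
      ennreal (c' * m powr ?h) \<le> emeasure (palm_law N) (tail_event m N)"
  proof (rule lower_tail_hub)
    fix c assume "0 < c" "\<And>(N :: (nat \<Rightarrow> 'a) measure) m. unit_poisson_process N \<Longrightarrow> 1 < m \<Longrightarrow>
      ennreal (c * m powr ?h) \<le> emeasure (palm_law N) (tail_event m N)"
    then show thesis by (rule that)
  qed
  note c'_le = diameter_tail_geI[OF _ c'(2)]
  \<comment> \<open>Outside the regime the implication is empty and the constant 1 serves; in this
    way constants for all three regimes exist at once.\<close>
  obtain C2 where C2: "0 < C2" "\<delta> < 1 / \<gamma> - 1 \<Longrightarrow>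
      \<forall>N :: (nat \<Rightarrow> 'a) measure. unit_poisson_process N \<longrightarrow> (\<forall>m>1. ?T N m \<le> C2 * m powr (1 - \<delta>))"
    using upper_tail_light[OF small] zero_less_one by metis
  obtain C4 where C4: "0 < C4" "\<delta> = 1 / \<gamma> - 1 \<Longrightarrow>
      \<forall>N :: (nat \<Rightarrow> 'a) measure. unit_poisson_process N \<longrightarrow> (\<forall>m\<ge>m0. ?T N m \<le> C4 * ln m * m powr (1 - \<delta>))"
    using upper_tail_critical[OF small _ m0] zero_less_one by metis
  obtain C6 where C6: "0 < C6" "1 / \<gamma> - 1 < \<delta> \<Longrightarrow>
      \<forall>N :: (nat \<Rightarrow> 'a) measure. unit_poisson_process N \<longrightarrow> (\<forall>m>1. ?T N m \<le> C6 * m powr ?h)"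
    using upper_tail_heavy[OF small] zero_less_one by metis
  define a where "a = max 1 (real DIM('a) * (\<delta> - 1))"
  have a: "0 < a" by (simp add: a_def)
  have l0: "0 < ln m0 powr a" using m0 by simp
  \<comment> \<open>The pure power bound is brought into the stated form: for m \<ge> m0 the
    logarithmic factor is at least its value at m0, by which the constant is divided.\<close>
  have C6': "?T N m \<le> C6 / ln m0 powr a * ln m powr a * m powr ?h"
    if "1 / \<gamma> - 1 < \<delta>" "unit_poisson_process N" "m0 \<le> m" for N :: "(nat \<Rightarrow> 'a) measure" and m
  proof -
    have "ln m0 powr a \<le> ln m powr a" using m0 that a by (intro powr_mono2) auto
    then have "C6 * ln m0 powr a \<le> C6 * ln m powr a" using C6(1) by (intro mult_left_mono) auto
    then have "C6 \<le> C6 / ln m0 powr a * ln m powr a" using l0 by (simp add: field_simps)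
    then have "C6 * m powr ?h \<le> C6 / ln m0 powr a * ln m powr a * m powr ?h" by (rule mult_right_mono) simp
    moreover have "?T N m \<le> C6 * m powr ?h" using C6(2)[OF that(1), rule_format, OF that(2), of m] that m0 by simp
    ultimately show ?thesis by (rule order.trans[rotated])
  qed
  have "0 < C6 / ln m0 powr a" using C6(1) l0 by simp
  then show "\<exists>c1>0. \<exists>C2>0. \<exists>c3>0. \<exists>C4>0. \<exists>c5>0. \<exists>C6>0.
      \<forall>N :: (nat \<Rightarrow> 'a) measure. unit_poisson_process N \<longrightarrow> (\<forall>m>1.
        (\<delta> < 1 / \<gamma> - 1 \<longrightarrow> c1 * m powr (1 - \<delta>) \<le> ?T N m \<and> ?T N m \<le> C2 * m powr (1 - \<delta>)) \<and>
        (\<delta> = 1 / \<gamma> - 1 \<longrightarrow> c3 * m powr (1 - \<delta>) \<le> ?T N m \<and> (m \<ge> m0 \<longrightarrow> ?T N m \<le> C4 * ln m * m powr (1 - \<delta>))) \<and>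
        (1 / \<gamma> - 1 < \<delta> \<longrightarrow> c5 * m powr ?h \<le> ?T N m \<and>
           (m \<ge> m0 \<longrightarrow> ?T N m \<le> C6 * ln m powr (max 1 (real DIM('a) * (\<delta> - 1))) * m powr ?h)))"
    unfolding a_def[symmetric]
    by (intro exI[of _ c] exI[of _ C2] exI[of _ C4] exI[of _ c'] exI[of _ "C6 / ln m0 powr a"] conjI allI impI
      c(1) c_le C2(1) C2(2)[rule_format] C4(1) C4(2)[rule_format] c'(1) c'_le C6')
qed

end
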